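(* Let $\epsilon > 0$ be a fixed constant and $\delta \in (0,1)$. There is a randomized algorithm which, given a full-rank matrix $\mathbf{A} \in \mathbb{R}^{n\times d}$ with $n \ge d$, computes $w \in \mathbb{R}^n_{\ge 0}$ such that, with $\mathbf{W} = \mathrm{diag}(w)$, $\kappa(\mathbf{A}^\top \mathbf{W}\mathbf{A}) \le (1+\epsilon)\kappa^\star_i(\mathbf{A})$ with probability at least $1-\delta$, in time \[O\left(\mathcal{T}_{\textup{mv}}(\mathbf{A}) \cdot (\kappa^\star_i(\mathbf{A}))^{1.5} \cdot \log^7\left(\frac{n\kappa^\star_i(\mathbf{A})}{\delta}\right)\right).\]
   Context: For a positive definite matrix $\mathbf{M}$, $\kappa(\mathbf{M}) := \lambda_{\max}(\mathbf{M})/\lambda_{\min}(\mathbf{M})$. For full-rank $\mathbf{A} \in \mathbb{R}^{n\times d}$, $\kappa^\star_i(\mathbf{A}) := \min_{\text{diagonal } \mathbf{W} \succeq \mathbf{0}} \kappa(\mathbf{A}^\top\mathbf{W}\mathbf{A})$ (the optimal inner scaling condition number). $\mathcal{T}_{\textup{mv}}(\mathbf{A})$ is the time to multiply a vector by $\mathbf{A}$ (at most the number of nonzeros of $\mathbf{A}$). Constants hidden in $O(\cdot)$ may depend on $\epsilon$. *)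

theory Defs
  imports
    "HOL-Probability.Probability"
    "Jordan_Normal_Form.DL_Rank"
    "Jordan_Normal_Form.Spectral_Radius"
begin

subsection \<open>Condition numbers and optimal inner scaling\<close>

definition pos_semidef :: "real mat \<Rightarrow> bool" where
  "pos_semidef M \<longleftrightarrow> square_mat M \<and> transpose_mat M = M \<and>
     (\<forall>v \<in> carrier_vec (dim_row M). 0 \<le> v \<bullet> (M *\<^sub>v v))"

definition pos_def :: "real mat \<Rightarrow> bool" where
  "pos_def M \<longleftrightarrow> square_mat M \<and> transpose_mat M = M \<and>
     (\<forall>v \<in> carrier_vec (dim_row M). v \<noteq> 0\<^sub>v (dim_row M) \<longrightarrow> 0 < v \<bullet> (M *\<^sub>v v))"

text \<open>Only meaningful for positive definite matrices, and only applied to them below.\<close>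

definition cond_num :: "real mat \<Rightarrow> real" where
  "cond_num M = Max (spectrum M) / Min (spectrum M)"

definition scaled_gram :: "real mat \<Rightarrow> real mat \<Rightarrow> real mat" where
  "scaled_gram A W = transpose_mat A * W * A"

text \<open>
  The minimum ranges over those scalings for which the condition number is defined, i.e. for
  which the scaled Gram matrix is positive definite. For full-rank matrices with at least as many
  rows as columns this set of values is nonempty, bounded below by 1, and attains its infimum, so
  that the infimum is the minimum.
\<close>

definition opt_inner_cond :: "real mat \<Rightarrow> real" where
  "opt_inner_cond A = Inf {cond_num (scaled_gram A W) | W.
     W \<in> carrier_mat (dim_row A) (dim_row A) \<and> diagonal_mat W \<and> pos_semidef W \<and>
     pos_def (scaled_gram A W)}"


subsection \<open>Randomized real RAM with a matrix-vector multiplication subroutine\<close>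

text \<open>
  The machine has a memory of natural numbers (indices, addresses) and a memory of exact real
  numbers, both with indirect addressing. A program is a finite list of instructions and can only
  contain natural and integer constants, so that no information can be hidden in real constants;
  there is no rounding of reals. The arguments of the instructions are addresses of memory cells,
  except for constants and jump targets.

  The matrix is accessed through its entries, at unit cost per entry, and through
  multiplication of a vector by the matrix or its transpose, at cost \<open>T\<close>, the time
  to multiply a vector by the matrix (the same for the transpose, by the transposition principle).
\<close>

datatype instr =
    NConst nat nat
  | NAdd nat nat nat
  | NSub nat nat nat
  | NLoad nat nat
  | NStore nat nat
  | RConst nat int
  | RAdd nat nat nat
  | RSub nat nat nat
  | RMul nat nat nat
  | RDiv nat nat nat
  | RSqrt nat nat
  | RLoad nat nat
  | RStore nat nat
  | Entry nat nat nat
  | MatVec nat nat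
  | MatTVec nat nat
  | Gauss nat
  | JumpNLess nat nat nat
  | JumpRLess nat nat nat

type_synonym program = "instr list"

record state =
  pc :: nat
  nmem :: "nat \<Rightarrow> nat"
  rmem :: "nat \<Rightarrow> real"
  draws :: nat
  clock :: nat

definition read_vec :: "(nat \<Rightarrow> real) \<Rightarrow> nat \<Rightarrow> nat \<Rightarrow> real vec" where
  "read_vec mem a k = vec k (\<lambda>i. mem (a + i))"

definition write_vec :: "(nat \<Rightarrow> real) \<Rightarrow> nat \<Rightarrow> real vec \<Rightarrow> nat \<Rightarrow> real" where
  "write_vec mem a v = (\<lambda>j. if a \<le> j \<and> j < a + dim_vec v then vec_index v (j - a) else mem j)"

fun cost :: "nat \<Rightarrow> instr \<Rightarrow> nat" where
  "cost T (MatVec a b) = T"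
| "cost T (MatTVec a b) = T"
| "cost T _ = 1"

text \<open>
  \<open>exec\<close> gives the effect of an instruction on memory and control, after the program
  counter has been advanced; \<open>\<omega>\<close> is the tape of random numbers.
\<close>

fun exec :: "real mat \<Rightarrow> (nat \<Rightarrow> real) \<Rightarrow> instr \<Rightarrow> state \<Rightarrow> state" where
  "exec A \<omega> (NConst a k) s = s\<lparr>nmem := (nmem s)(a := k)\<rparr>"
| "exec A \<omega> (NAdd a b c) s = s\<lparr>nmem := (nmem s)(a := nmem s b + nmem s c)\<rparr>"
| "exec A \<omega> (NSub a b c) s = s\<lparr>nmem := (nmem s)(a := nmem s b - nmem s c)\<rparr>"
| "exec A \<omega> (NLoad a b) s = s\<lparr>nmem := (nmem s)(a := nmem s (nmem s b))\<rparr>"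
| "exec A \<omega> (NStore a b) s = s\<lparr>nmem := (nmem s)(nmem s a := nmem s b)\<rparr>"
| "exec A \<omega> (RConst a k) s = s\<lparr>rmem := (rmem s)(a := real_of_int k)\<rparr>"
| "exec A \<omega> (RAdd a b c) s = s\<lparr>rmem := (rmem s)(a := rmem s b + rmem s c)\<rparr>"
| "exec A \<omega> (RSub a b c) s = s\<lparr>rmem := (rmem s)(a := rmem s b - rmem s c)\<rparr>"
| "exec A \<omega> (RMul a b c) s = s\<lparr>rmem := (rmem s)(a := rmem s b * rmem s c)\<rparr>"
| "exec A \<omega> (RDiv a b c) s = s\<lparr>rmem := (rmem s)(a := rmem s b / rmem s c)\<rparr>"
| "exec A \<omega> (RSqrt a b) s = s\<lparr>rmem := (rmem s)(a := sqrt (rmem s b))\<rparr>"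
| "exec A \<omega> (RLoad a b) s = s\<lparr>rmem := (rmem s)(a := rmem s (nmem s b))\<rparr>"
| "exec A \<omega> (RStore a b) s = s\<lparr>rmem := (rmem s)(nmem s a := rmem s b)\<rparr>"
| "exec A \<omega> (Entry a b c) s = s\<lparr>rmem := (rmem s)(a :=
     (if nmem s b < dim_row A \<and> nmem s c < dim_col A then A $$ (nmem s b, nmem s c) else 0))\<rparr>"
| "exec A \<omega> (MatVec a b) s = s\<lparr>rmem :=
     write_vec (rmem s) (nmem s a) (A *\<^sub>v read_vec (rmem s) (nmem s b) (dim_col A))\<rparr>"
| "exec A \<omega> (MatTVec a b) s = s\<lparr>rmem :=
     write_vec (rmem s) (nmem s a) (transpose_mat A *\<^sub>v read_vec (rmem s) (nmem s b) (dim_row A))\<rparr>"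
| "exec A \<omega> (Gauss a) s = s\<lparr>rmem := (rmem s)(a := \<omega> (draws s)), draws := Suc (draws s)\<rparr>"
| "exec A \<omega> (JumpNLess a b l) s = (if nmem s a < nmem s b then s\<lparr>pc := l\<rparr> else s)"
| "exec A \<omega> (JumpRLess a b l) s = (if rmem s a < rmem s b then s\<lparr>pc := l\<rparr> else s)"

definition halted :: "program \<Rightarrow> state \<Rightarrow> bool" where
  "halted P s \<longleftrightarrow> length P \<le> pc s"

definition step :: "program \<Rightarrow> real mat \<Rightarrow> nat \<Rightarrow> (nat \<Rightarrow> real) \<Rightarrow> state \<Rightarrow> state" where
  "step P A T \<omega> s = (if halted P s then s
     else exec A \<omega> (P ! pc s) (s\<lparr>pc := Suc (pc s), clock := clock s + cost T (P ! pc s)\<rparr>))"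

text \<open>The input consists of the dimensions, the failure probability and the matrix.\<close>

definition init :: "real mat \<Rightarrow> real \<Rightarrow> state" where
  "init A \<delta> = \<lparr>pc = 0, nmem = (\<lambda>_. 0)(0 := dim_row A, 1 := dim_col A),
     rmem = (\<lambda>_. 0)(0 := \<delta>), draws = 0, clock = 0\<rparr>"

text \<open>
  The program halts on the given input after time \<open>t\<close> with output \<open>w\<close>, one number for each row of
  the matrix, stored from the address given by cell 0 of the memory of natural numbers.
\<close>

definition computes ::
  "program \<Rightarrow> real mat \<Rightarrow> real \<Rightarrow> nat \<Rightarrow> (nat \<Rightarrow> real) \<Rightarrow> nat \<Rightarrow> real vec \<Rightarrow> bool" where
  "computes P A \<delta> T \<omega> t w \<longleftrightarrow>
     (\<exists>k. let s = (step P A T \<omega> ^^ k) (init A \<delta>) in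
        halted P s \<and> t = clock s \<and> w = read_vec (rmem s) (nmem s 0) (dim_row A))"

text \<open>Independent standard Gaussian random numbers.\<close>

definition random_tape :: "(nat \<Rightarrow> real) measure" where
  "random_tape = Pi\<^sub>M UNIV (\<lambda>_. density lborel (\<lambda>x. ennreal (std_normal_density x)))"


subsection \<open>Correct outputs and the time bound\<close>

definition good_scaling :: "real \<Rightarrow> real mat \<Rightarrow> real vec \<Rightarrow> bool" where
  "good_scaling \<epsilon> A w \<longleftrightarrow> dim_vec w = dim_row A \<and> (\<forall>i < dim_row A. 0 \<le> vec_index w i) \<and>
     (let M = scaled_gram A (mat_diag (dim_row A) (vec_index w)) in
        pos_def M \<and> cond_num M \<le> (1 + \<epsilon>) * opt_inner_cond A)"

text \<open>
  The logarithm is to base 2 and replaced by 1 if it is smaller. This only matters for matrices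
  with a single row: otherwise its argument is at least 2. For a single row, the argument is
  \<open>1/\<delta>\<close>, whose logarithm tends to 0 as \<open>\<delta>\<close> tends to 1.
\<close>

definition time_bound :: "real \<Rightarrow> real mat \<Rightarrow> nat \<Rightarrow> real" where
  "time_bound \<delta> A T = real T * opt_inner_cond A powr (3/2) *
     (max 1 (log 2 (real (dim_row A) * opt_inner_cond A / \<delta>))) ^ 7"

end

theory Submission
 imports Defs
begin

no_notation inner (infix "\<bullet>" 70)
unbundle no vec_syntax

text \<open>
 An outer loop runs through guesses \<open>\<kappa> = (1 + e)\<^sup>g\<close> of the optimal condition number. For each guess the
 scaling \<open>W\<close> grows from \<open>0\<close> by covering steps, controlled by the potential \<open>tr N\<^bsup>-p\<^esup>\<close> of
 \<open>N = I + A\<^sup>T W A\<close>. Each step is a packing problem with one row bound per row of \<open>A\<close>, solved by multiplicative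
 updates under the potential \<open>tr (A\<^sup>T X A)\<^sup>p\<close>. Both potentials are estimated by the Lieb-Thirring
 inequality. A packing phase can fail only if \<open>\<kappa>\<close> is below the optimum, so \<open>\<kappa>\<close> overshoots by at most \<open>1 + e\<close>.
 The quadratic forms come from Gaussian sketches, with a Chebyshev polynomial of degree about
 \<open>\<surd>\<kappa>\<close> in place of \<open>N\<^bsup>-1\<^esup>\<close>. The tape read by a sketch is independent of the state at its start,
 so chi-square tails and a union bound control the failure probability.
\<close>

text \<open>For a covering gradient \<open>P = N^-(p+1)\<close> the row bound is about
  \<open>tr P / (\<kappa> * qf P (row A i))\<close>. In multiples \<open>y\<close> of the row
  bounds, the covering progress of a direction is about \<open>tr P / \<kappa>\<close> times the sum
  of \<open>y\<close>, so a covering step amounts to maximising this sum under one spectral bound. A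
  scaling of condition number at most \<kappa> certifies that the sum can be large; pairing it with
  the packing gradients detects a failed guess. As \<open>(1 + e)^p\<close> is at least
  \<open>n\<close>, the \<open>p\<close>-th root of a potential agrees with an extreme eigenvalue up
  to \<open>1 + e\<close>. Adding \<open>I\<close> to the Gram matrix yields a known interval
  \<open>[1, 4 E \<kappa>]\<close> for the Chebyshev approximation and makes absolute step bounds
  relative; a total step length of \<open>E\<close> makes its share negligible. The gradients have
  odd exponents \<open>p - 1\<close> and \<open>-(p + 1)\<close>: a Gaussian vector whose covariance
  is the matrix itself supplies the odd factor, operators applied on both sides the rest. The power
  1.5 comes from about \<kappa> covering steps times the degree; the seven logarithms from guesses
  (1), covering steps (1), packing rounds (3), samples (1) and products per sample (1).\<close>

type_synonym rseq = "nat \<Rightarrow> real"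

section \<open>Traces of matrix powers and the Lieb-Thirring inequality\<close>

definition tr :: "real mat \<Rightarrow> real" where
 "tr X = (\<Sum>i<dim_row X. X $$ (i, i))"

lemma tr_mult:
 assumes "X \<in> carrier_mat n m" "Y \<in> carrier_mat m n"
 shows "tr (X * Y) = (\<Sum>i<n. \<Sum>j<m. X $$ (i, j) * Y $$ (j, i))"
 using assms by (auto simp: tr_def scalar_prod_def atLeast0LessThan intro!: sum.cong)

lemma tr_comm:
 assumes "X \<in> carrier_mat n m" "Y \<in> carrier_mat m n"
 shows "tr (X * Y) = tr (Y * X)"
 unfolding tr_mult[OF assms] tr_mult[OF assms(2,1)]
 by (subst sum.swap) (simp add: mult.commute)

lemma tr_add:
 assumes "(X :: real mat) \<in> carrier_mat n n" "Y \<in> carrier_mat n n"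
 shows "tr (X + Y) = tr X + tr Y"
 using assms by (simp add: tr_def sum.distrib)

lemma tr_smult: "X \<in> carrier_mat n n \<Longrightarrow> tr (c \<cdot>\<^sub>m X) = c * tr X"
 by (simp add: tr_def sum_distrib_left)

lemma mat_diag_index[simp]: "i < n \<Longrightarrow> j < n \<Longrightarrow> mat_diag n f $$ (i, j) = (if i = j then f j else 0)"
 by (simp add: mat_diag_def)

lemma mat_diag_dims[simp]: "dim_row (mat_diag n f) = n" "dim_col (mat_diag n f) = n"
 by (simp_all add: mat_diag_def)

lemma tr_mat_diag: "tr (mat_diag n f) = (\<Sum>i<n. f i)"
 by (simp add: tr_def mat_diag_def)

lemma transpose_mat_diag[simp]: "transpose_mat (mat_diag n f) = mat_diag n f"
 by (rule eq_matI) (auto simp: mat_diag_def)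

lemma massoc:
 "\<lbrakk>X \<in> carrier_mat n m; Y \<in> carrier_mat m k; Z \<in> carrier_mat k l\<rbrakk> \<Longrightarrow> (X * Y) * Z = X * (Y * (Z :: real mat))"
 by (rule assoc_mult_mat)

lemmas massoc_sq = massoc[of _ n n _ n _ n] for n

lemma scalar_prod_self: "v \<bullet> v = (\<Sum>i<dim_vec v. (v $ i)\<^sup>2)" for v :: "real vec"
 by (simp add: scalar_prod_def atLeast0LessThan power2_eq_square)

lemma scalar_prod_self_nonneg[simp]: "0 \<le> v \<bullet> v" for v :: "real vec"
 by (simp add: scalar_prod_self sum_nonneg)

lemma scalar_prod_self_pos:
 assumes "v \<in> carrier_vec n" "v \<noteq> 0\<^sub>v n"
 shows "0 < v \<bullet> (v :: real vec)"
proof -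
 from assms obtain i where "i < n" "v $ i \<noteq> 0" by (metis carrier_vecD eq_vecI index_zero_vec)
 then show ?thesis using assms unfolding scalar_prod_self by (intro sum_pos2[of _ i]) auto
qed

lemma mult_carrier_sq[simp]:
 "X \<in> carrier_mat n n \<Longrightarrow> Y \<in> carrier_mat n n \<Longrightarrow> X * Y \<in> carrier_mat n (n :: nat)"
 for X Y :: "real mat"
 by (rule mult_carrier_mat)

lemma one_mult_sq[simp]:
 "X \<in> carrier_mat n n \<Longrightarrow> 1\<^sub>m n * X = X" "X \<in> carrier_mat n n \<Longrightarrow> X * 1\<^sub>m n = X"
 for X :: "real mat"
 by auto

lemma mpow_Suc_left:
 assumes "(X :: real mat) \<in> carrier_mat n n"
 shows "X * X ^\<^sub>m k = X ^\<^sub>m Suc k"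
proof (induction k)
 case 0 then show ?case using assms by simp
next
 case (Suc k)
 have "X * X ^\<^sub>m Suc k = (X * X ^\<^sub>m k) * X"
  using assms by (simp add: massoc_sq[of _ n])
 then show ?case using Suc by simp
qed

lemma mpow_add:
 assumes "(X :: real mat) \<in> carrier_mat n n"
 shows "X ^\<^sub>m (k + l) = X ^\<^sub>m k * X ^\<^sub>m l"
 by (induction l) (use assms in \<open>auto simp: massoc_sq[of _ n, symmetric]\<close>)

lemma mpow_mult:
 assumes "(X :: real mat) \<in> carrier_mat n n"
 shows "X ^\<^sub>m (k * l) = (X ^\<^sub>m k) ^\<^sub>m l"
proof (induction l)
 case 0 then show ?case using assms by simp
next
 case (Suc l)
 have "X ^\<^sub>m (k * Suc l) = X ^\<^sub>m (k * l + k)" by (simp add: add.commute)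
 also have "\<dots> = (X ^\<^sub>m k) ^\<^sub>m Suc l" unfolding mpow_add[OF assms] Suc by simp
 finally show ?case .
qed

lemma mpow_swap:
 assumes "(X :: real mat) \<in> carrier_mat n n" "Y \<in> carrier_mat n n"
 shows "(X * Y) ^\<^sub>m Suc k = X * (Y * X) ^\<^sub>m k * Y"
proof (induction k)
 case 0 then show ?case using assms by simp
next
 case (Suc k)
 have "(X * Y) ^\<^sub>m Suc (Suc k) = X * (Y * X) ^\<^sub>m k * Y * (X * Y)" using Suc by simp
 also have "\<dots> = X * (Y * X) ^\<^sub>m Suc k * Y"
  using assms by (simp add: massoc_sq[of _ n])
 finally show ?case .
qed

lemma tr_mpow_comm:
 assumes "(X :: real mat) \<in> carrier_mat n n" "Y \<in> carrier_mat n n"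
 shows "tr ((X * Y) ^\<^sub>m k) = tr ((Y * X) ^\<^sub>m k)"
proof (cases k)
 case 0 then show ?thesis using assms by simp
next
 case (Suc l)
 have "tr ((X * Y) ^\<^sub>m Suc l) = tr ((X * (Y * X) ^\<^sub>m l) * Y)" by (simp only: mpow_swap[OF assms])
 also have "\<dots> = tr (Y * (X * (Y * X) ^\<^sub>m l))"
  by (rule tr_comm[of _ n n]) (use assms in auto)
 also have "Y * (X * (Y * X) ^\<^sub>m l) = (Y * X) ^\<^sub>m Suc l"
  using assms mpow_Suc_left[of "Y * X" n l] by (simp add: massoc_sq[of _ n])
 finally show ?thesis using Suc by simp
qed

lemma transpose_mpow:
 assumes "(X :: real mat) \<in> carrier_mat n n"
 shows "transpose_mat (X ^\<^sub>m k) = (X\<^sup>T) ^\<^sub>m k"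
proof (induction k)
 case (Suc k)
 have "transpose_mat (X ^\<^sub>m Suc k) = X\<^sup>T * (X\<^sup>T) ^\<^sub>m k"
  using assms Suc by (simp add: transpose_mult[of _ n n _ n])
 then show ?case using mpow_Suc_left[of "X\<^sup>T" n k] assms by simp
qed (use assms in simp)

lemma tr_square_le:
 assumes X: "X \<in> carrier_mat n n"
 shows "tr (X * X) \<le> tr (X * X\<^sup>T)"
proof -
 have "2 * tr (X * X) = (\<Sum>i<n. \<Sum>j<n. 2 * X $$ (i, j) * X $$ (j, i))"
  unfolding tr_mult[OF X X] by (simp add: sum_distrib_left mult.assoc)
 also have "\<dots> \<le> (\<Sum>i<n. \<Sum>j<n. (X $$ (i, j))\<^sup>2 + (X $$ (j, i))\<^sup>2)"
  by (intro sum_mono) (simp add: sum_squares_bound)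
 also have "\<dots> = 2 * (\<Sum>i<n. \<Sum>j<n. (X $$ (i, j))\<^sup>2)"
  by (simp add: sum.distrib) (subst sum.swap, simp)
 also have "(\<Sum>i<n. \<Sum>j<n. (X $$ (i, j))\<^sup>2) = tr (X * X\<^sup>T)"
  using X by (subst tr_mult[of _ n n]) (auto simp: power2_eq_square intro!: sum.cong)
 finally show ?thesis by simp
qed

lemma tr_mult_le_half:
 assumes X: "X \<in> carrier_mat n n" "X\<^sup>T = X" and Y: "Y \<in> carrier_mat n n" "Y\<^sup>T = Y"
 shows "2 * tr (X * Y) \<le> tr (X * X) + tr (Y * Y)"
proof -
 have sX: "X $$ (j, i) = X $$ (i, j)" if "i < n" "j < n" for i j
  using X that by (metis carrier_matD index_transpose_mat(1))
 have sY: "Y $$ (j, i) = Y $$ (i, j)" if "i < n" "j < n" for i j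
  using Y that by (metis carrier_matD index_transpose_mat(1))
 have "2 * tr (X * Y) = (\<Sum>i<n. \<Sum>j<n. 2 * X $$ (i, j) * Y $$ (i, j))"
  unfolding tr_mult[OF X(1) Y(1)] by (auto simp: sum_distrib_left mult.assoc sY intro!: sum.cong)
 also have "\<dots> \<le> (\<Sum>i<n. \<Sum>j<n. (X $$ (i, j))\<^sup>2 + (Y $$ (i, j))\<^sup>2)"
  by (intro sum_mono) (simp add: sum_squares_bound)
 also have "\<dots> = tr (X * X) + tr (Y * Y)"
  unfolding tr_mult[OF X(1) X(1)] tr_mult[OF Y(1) Y(1)]
  by (auto simp: sum.distrib power2_eq_square sX sY intro!: sum.cong arg_cong2[of _ _ _ _ "(+)"])
 finally show ?thesis .
qed

text \<open>
 The two inequalities are proved simultaneously: the first one reduces to itself and to the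
 second one with the exponent halved, and so does the second one.
\<close>

lemma tr_pow2_aux:
 "(\<forall>X \<in> carrier_mat n n. tr (X ^\<^sub>m (2 ^ Suc k)) \<le> tr ((X * X\<^sup>T) ^\<^sub>m (2 ^ k))) \<and>
  (\<forall>S \<in> carrier_mat n n. \<forall>Q \<in> carrier_mat n n. S\<^sup>T = S \<longrightarrow> Q\<^sup>T = Q \<longrightarrow>
   tr ((S * Q) ^\<^sub>m (2 ^ k)) \<le> tr (S ^\<^sub>m (2 ^ k) * Q ^\<^sub>m (2 ^ k)))"
proof (induction k)
 case 0
 then show ?case using tr_square_le by (auto simp: numeral_2_eq_2)
next
 case (Suc k)
 note A = Suc[THEN conjunct1, rule_format] and B = Suc[THEN conjunct2, rule_format]
 show ?case
 proof (intro conjI ballI impI)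
  fix X :: "real mat" assume X: "X \<in> carrier_mat n n"
  let ?T = "X\<^sup>T"
  let ?C = "?T * X" and ?D = "X * ?T" and ?m = "2 ^ k :: nat"
  have T: "?T \<in> carrier_mat n n" using X by simp
  have sC: "transpose_mat ?C = ?C" and sD: "transpose_mat ?D = ?D"
   using X by (simp_all add: transpose_mult[of _ n n _ n])
  have "tr (X ^\<^sub>m (2 ^ Suc (Suc k))) = tr ((X * X) ^\<^sub>m (2 ^ Suc k))"
   using mpow_mult[OF X, of 2 "2 ^ Suc k"] X by (simp add: numeral_2_eq_2)
  also have "\<dots> \<le> tr (((X * X) * transpose_mat (X * X)) ^\<^sub>m ?m)"
   by (rule A) (use X in auto)
  also have "(X * X) * transpose_mat (X * X) = (X * ?D) * ?T"
   using X by (simp add: transpose_mult[of _ n n _ n] massoc_sq[of _ n])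
  also have "tr (((X * ?D) * ?T) ^\<^sub>m ?m) = tr ((?T * (X * ?D)) ^\<^sub>m ?m)"
   by (rule tr_mpow_comm[of _ n]) (use X in auto)
  also have "?T * (X * ?D) = ?C * ?D" using X by (simp add: massoc_sq[of _ n])
  also have "tr ((?C * ?D) ^\<^sub>m ?m) \<le> tr (?C ^\<^sub>m ?m * ?D ^\<^sub>m ?m)"
   by (rule B) (use X sC sD in auto)
  \<comment> \<open>The two summands turn out equal, since \<open>X\<^sup>T * X\<close> and
    \<open>X * X\<^sup>T\<close> have the same traces of powers; hence the average is the target
    trace.\<close>
  also have "\<dots> \<le> (tr (?C ^\<^sub>m ?m * ?C ^\<^sub>m ?m) + tr (?D ^\<^sub>m ?m * ?D ^\<^sub>m ?m)) / 2"
   using tr_mult_le_half[of "?C ^\<^sub>m ?m" n "?D ^\<^sub>m ?m"] X sC sD by (simp add: transpose_mpow[of _ n])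
  also have "?C ^\<^sub>m ?m * ?C ^\<^sub>m ?m = ?C ^\<^sub>m (2 ^ Suc k)"
   using X by (simp add: mpow_add[of _ n, symmetric] mult_2)
  also have "?D ^\<^sub>m ?m * ?D ^\<^sub>m ?m = ?D ^\<^sub>m (2 ^ Suc k)"
   using X by (simp add: mpow_add[of _ n, symmetric] mult_2)
  also have "tr (?C ^\<^sub>m (2 ^ Suc k)) = tr (?D ^\<^sub>m (2 ^ Suc k))"
   by (rule tr_mpow_comm[OF T X])
  finally show "tr (X ^\<^sub>m (2 ^ Suc (Suc k))) \<le> tr (?D ^\<^sub>m (2 ^ Suc k))" by simp
 next
  fix S Q :: "real mat" assume S: "S \<in> carrier_mat n n" and Q: "Q \<in> carrier_mat n n"
   and sS: "S\<^sup>T = S" and sQ: "Q\<^sup>T = Q"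
  have "tr ((S * Q) ^\<^sub>m (2 ^ Suc k)) \<le> tr (((S * Q) * transpose_mat (S * Q)) ^\<^sub>m (2 ^ k))"
   by (rule A) (use S Q in auto)
  also have "(S * Q) * transpose_mat (S * Q) = (S * (Q * Q)) * S"
   using S Q sS sQ by (simp add: transpose_mult[of _ n n _ n] massoc_sq[of _ n])
  also have "tr (((S * (Q * Q)) * S) ^\<^sub>m (2 ^ k)) = tr ((S * (S * (Q * Q))) ^\<^sub>m (2 ^ k))"
   by (rule tr_mpow_comm[of _ n]) (use S Q in auto)
  also have "S * (S * (Q * Q)) = (S * S) * (Q * Q)" using S Q by (simp add: massoc_sq[of _ n])
  also have "tr (((S * S) * (Q * Q)) ^\<^sub>m (2 ^ k)) \<le> tr ((S * S) ^\<^sub>m (2 ^ k) * (Q * Q) ^\<^sub>m (2 ^ k))"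
   by (rule B) (use S Q sS sQ in \<open>auto simp: transpose_mult[of _ n n _ n]\<close>)
  also have "(S * S) ^\<^sub>m (2 ^ k) = S ^\<^sub>m (2 ^ Suc k)"
   using mpow_mult[OF S, of 2 "2 ^ k"] S by (simp add: numeral_2_eq_2)
  also have "(Q * Q) ^\<^sub>m (2 ^ k) = Q ^\<^sub>m (2 ^ Suc k)"
   using mpow_mult[OF Q, of 2 "2 ^ k"] Q by (simp add: numeral_2_eq_2)
  finally show "tr ((S * Q) ^\<^sub>m (2 ^ Suc k)) \<le> tr (S ^\<^sub>m (2 ^ Suc k) * Q ^\<^sub>m (2 ^ Suc k))" .
 qed
qed

text \<open>The induction halves the exponent, which restricts it to powers of two; the exponent
  \<open>p\<close> of both potentials is chosen accordingly.\<close>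

lemma lieb_thirring_pow2:
 assumes "S \<in> carrier_mat n n" "Q \<in> carrier_mat n n" "S\<^sup>T = S" "Q\<^sup>T = Q"
 shows "tr ((S * Q) ^\<^sub>m (2 ^ k)) \<le> tr (S ^\<^sub>m (2 ^ k) * Q ^\<^sub>m (2 ^ k))"
 using tr_pow2_aux assms by blast

subsection \<open>Functional calculus of symmetric matrices\<close>

text \<open>Over the complex numbers an eigenvector \<open>x + i y\<close> exists. Comparing
  \<open>y \<bullet> M x\<close> with \<open>x \<bullet> M y\<close> forces the imaginary part of
  the eigenvalue to vanish, so whichever of \<open>x\<close> and \<open>y\<close> is nonzero is a
  real eigenvector.\<close>

lemma symmetric_eigenvector_exists:
 assumes M: "(M :: real mat) \<in> carrier_mat n n" "M\<^sup>T = M" and n: "0 < n"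
 shows "\<exists>v e. v \<in> carrier_vec n \<and> v \<noteq> 0\<^sub>v n \<and> M *\<^sub>v v = e \<cdot>\<^sub>v v"
proof -
 let ?C = "map_mat complex_of_real M"
 have C: "?C \<in> carrier_mat n n" using M by simp
 from spectrum_non_empty[OF C n] obtain k z where z: "z \<in> carrier_vec n" "z \<noteq> 0\<^sub>v n" "?C *\<^sub>v z = k \<cdot>\<^sub>v z"
  using C by (auto simp: spectrum_def eigenvalue_def eigenvector_def)
 define x where "x = map_vec Re z"
 define y where "y = map_vec Im z"
 have xy: "x \<in> carrier_vec n" "y \<in> carrier_vec n" using z by (auto simp: x_def y_def)
 have comp: "(\<Sum>j<n. complex_of_real (M $$ (i, j)) * z $ j) = k * z $ i" if "i < n" for i
 proof -
  have "(?C *\<^sub>v z) $ i = (k \<cdot>\<^sub>v z) $ i" using z(3) by simp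
  then show ?thesis using that M z(1) by (simp add: scalar_prod_def atLeast0LessThan)
 qed
 have Mx: "M *\<^sub>v x = Re k \<cdot>\<^sub>v x - Im k \<cdot>\<^sub>v y"
 proof (rule eq_vecI)
  fix i assume "i < dim_vec (Re k \<cdot>\<^sub>v x - Im k \<cdot>\<^sub>v y)" then have i: "i < n" using xy by simp
  show "(M *\<^sub>v x) $ i = (Re k \<cdot>\<^sub>v x - Im k \<cdot>\<^sub>v y) $ i"
   using arg_cong[OF comp[OF i], of Re] i M z(1) by (simp add: scalar_prod_def atLeast0LessThan x_def y_def)
 qed (use M xy in simp)
 have My: "M *\<^sub>v y = Re k \<cdot>\<^sub>v y + Im k \<cdot>\<^sub>v x"
 proof (rule eq_vecI)
  fix i assume "i < dim_vec (Re k \<cdot>\<^sub>v y + Im k \<cdot>\<^sub>v x)" then have i: "i < n" using xy by simp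
  show "(M *\<^sub>v y) $ i = (Re k \<cdot>\<^sub>v y + Im k \<cdot>\<^sub>v x) $ i"
   using arg_cong[OF comp[OF i], of Im] i M z(1) by (simp add: scalar_prod_def atLeast0LessThan x_def y_def)
 qed (use M xy in simp)
 have "y \<bullet> (M *\<^sub>v x) = x \<bullet> (M *\<^sub>v y)"
  using transpose_vec_mult_scalar[OF M(1) xy(1) xy(2)] M(2) xy M(1)
  by (metis comm_scalar_prod mult_mat_vec_carrier)
 then have "Im k * (x \<bullet> x + y \<bullet> y) = 0"
  unfolding Mx My using xy comm_scalar_prod[OF xy]
  by (simp add: scalar_prod_minus_distrib[of _ n] scalar_prod_add_distrib[of _ n] algebra_simps)
 moreover have "x \<noteq> 0\<^sub>v n \<or> y \<noteq> 0\<^sub>v n"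
 proof (rule ccontr)
  assume "\<not> ?thesis"
  then have *: "x = 0\<^sub>v n" "y = 0\<^sub>v n" by auto
  have "z = 0\<^sub>v n"
  proof (rule eq_vecI)
   fix i assume "i < dim_vec (0\<^sub>v n :: complex vec)" then have i: "i < n" by simp
   have "x $ i = 0" "y $ i = 0" using * i by auto
   then show "z $ i = (0\<^sub>v n) $ i" using i z(1) by (simp add: x_def y_def complex_eq_iff)
  qed (use z in simp)
  with z(2) show False by simp
 qed
 then have "x \<bullet> x + y \<bullet> y \<noteq> 0"
  using scalar_prod_self_pos[OF xy(1)] scalar_prod_self_pos[OF xy(2)] scalar_prod_self_nonneg[of x] scalar_prod_self_nonneg[of y]
  by linarith
 ultimately have k: "Im k = 0" by simp
 have "M *\<^sub>v x = Re k \<cdot>\<^sub>v x" "M *\<^sub>v y = Re k \<cdot>\<^sub>v y" unfolding Mx My k using xy by auto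
 with \<open>x \<noteq> 0\<^sub>v n \<or> y \<noteq> 0\<^sub>v n\<close> xy show ?thesis by blast
qed

text \<open>The reflection in the hyperplane orthogonal to \<open>v - e_0\<close> exchanges the unit
  vectors \<open>v\<close> and \<open>e_0\<close>. For \<open>v = e_0\<close> there is no such
  hyperplane and the identity serves.\<close>

lemma householder_exists:
 assumes v: "v \<in> carrier_vec n" "v \<bullet> v = (1::real)" and n: "0 < n"
 shows "\<exists>H. H \<in> carrier_mat n n \<and> H\<^sup>T = H \<and> H * H = 1\<^sub>m n \<and> H *\<^sub>v unit_vec n 0 = v"
proof (cases "v = unit_vec n 0")
 case True then show ?thesis by (intro exI[of _ "1\<^sub>m n"]) auto
next
 case False
 define w where "w = v - unit_vec n 0"
 have w: "w \<in> carrier_vec n" using v by (simp add: w_def)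
 have ww: "w \<bullet> w = 2 - 2 * v $ 0"
  using v n by (simp add: w_def scalar_prod_minus_distrib[of _ n] minus_scalar_prod_distrib[of _ n])
 have "w \<noteq> 0\<^sub>v n" using False v n unfolding w_def
  by (metis carrier_vecD eq_vecI index_minus_vec(1) index_unit_vec(3) index_zero_vec(1) right_minus_eq)
 then have ww0: "w \<bullet> w \<noteq> 0" using scalar_prod_self_pos[OF w] by simp
 define c where "c = 2 / (w \<bullet> w)"
 have c: "c * (w \<bullet> w) = 2" using ww0 by (simp add: c_def)
 define H where "H = mat n n (\<lambda>(i,j). (if i = j then 1 else 0) - c * w $ i * w $ j)"
 have H: "H \<in> carrier_mat n n" by (simp add: H_def)
 have sw: "(\<Sum>k<n. w $ k * w $ k) = w \<bullet> w"
  using w by (simp add: scalar_prod_def atLeast0LessThan)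
 have "H * H = 1\<^sub>m n"
 proof (rule eq_matI)
  fix i j assume ij: "i < dim_row (1\<^sub>m n :: real mat)" "j < dim_col (1\<^sub>m n :: real mat)"
  then have ij: "i < n" "j < n" by auto
  have "(H * H) $$ (i, j) = (\<Sum>k<n. ((if i = k then 1 else 0) - c * w $ i * w $ k) * ((if k = j then 1 else 0) - c * w $ k * w $ j))"
   using ij by (auto simp: H_def scalar_prod_def atLeast0LessThan intro!: sum.cong)
  also have "\<dots> = (\<Sum>k<n. (if k = i then if i = j then 1 else 0 else 0) - (if k = i then c * w $ i * w $ j else 0) - (if k = j then c * w $ i * w $ j else 0)
    + c * c * w $ i * w $ j * (w $ k * w $ k))"
   by (intro sum.cong) (auto simp: algebra_simps)
  also have "\<dots> = (if i = j then 1 else 0) - 2 * c * w $ i * w $ j + c * w $ i * w $ j * (c * (w \<bullet> w))"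
   using ij by (simp add: sum.distrib sum_subtractf sum_distrib_left[symmetric] sw)
  finally show "(H * H) $$ (i, j) = 1\<^sub>m n $$ (i, j)" using ij c by simp
 qed (auto simp: H_def)
 moreover have "H\<^sup>T = H" by (rule eq_matI) (auto simp: H_def)
 moreover have "H *\<^sub>v unit_vec n 0 = v"
 proof (rule eq_vecI)
  fix i assume "i < dim_vec v" then have i: "i < n" using v by simp
  have w0: "w $ 0 = v $ 0 - 1" using n v by (simp add: w_def)
  then have cw: "c * w $ 0 = -1" using ww c ww0 by (simp add: c_def field_simps)
  have "(H *\<^sub>v unit_vec n 0) $ i = H $$ (i, 0)"
   using i n H by (simp add: scalar_prod_right_unit)
  also have "\<dots> = (if i = 0 then 1 else 0) - (c * w $ 0) * w $ i" using i n by (simp add: H_def algebra_simps)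
  also have "\<dots> = v $ i" unfolding cw using i v by (simp add: w_def)
  finally show "(H *\<^sub>v unit_vec n 0) $ i = v $ i" .
 qed (use v in \<open>simp add: H_def\<close>)
 ultimately show ?thesis using H by blast
qed

text \<open>Deflation: conjugating with a reflection that moves the first unit vector to an
  eigenvector splits off the first row and column, and the induction hypothesis diagonalises the
  remaining block.\<close>

lemma spectral_theorem:
 assumes "(M :: real mat) \<in> carrier_mat n n" "M\<^sup>T = M"
 shows "\<exists>U f. U \<in> carrier_mat n n \<and> U\<^sup>T * U = 1\<^sub>m n \<and> M = U * mat_diag n f * U\<^sup>T"
 using assms
proof (induction n arbitrary: M)
 case 0
 then show ?case by (intro exI[of _ "1\<^sub>m 0"] exI[of _ "\<lambda>_. 0"]) (auto simp: mat_diag_def intro!: eq_matI)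
next
 case (Suc m)
 let ?n = "Suc m"
 obtain v0 e where v0: "v0 \<in> carrier_vec ?n" "v0 \<noteq> 0\<^sub>v ?n" "M *\<^sub>v v0 = e \<cdot>\<^sub>v v0"
  using symmetric_eigenvector_exists[OF Suc.prems] by auto
 have nz: "v0 \<bullet> v0 > 0" using scalar_prod_self_pos[OF v0(1,2)] by simp
 define v where "v = (1 / sqrt (v0 \<bullet> v0)) \<cdot>\<^sub>v v0"
 have v: "v \<in> carrier_vec ?n" "v \<bullet> v = 1" "M *\<^sub>v v = e \<cdot>\<^sub>v v"
  using v0 nz Suc.prems(1) by (auto simp: v_def mult_mat_vec[of _ ?n ?n] smult_smult_assoc mult.commute power2_eq_square[symmetric] power_divide)
 obtain H where H: "H \<in> carrier_mat ?n ?n" "H\<^sup>T = H" "H * H = 1\<^sub>m ?n" "H *\<^sub>v unit_vec ?n 0 = v"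
  using householder_exists[OF v(1,2)] by auto
 define M' where "M' = H * M * H"
 have M': "M' \<in> carrier_mat ?n ?n" "M'\<^sup>T = M'"
  using H Suc.prems by (auto simp: M'_def transpose_mult[of _ ?n ?n _ ?n] massoc_sq[of _ ?n])
 have MH: "M = H * M' * H"
 proof -
  have "H * M' * H = (H * H) * M * (H * H)"
   using H(1) Suc.prems by (simp add: M'_def massoc_sq[of _ ?n])
  then show ?thesis using H Suc.prems by simp
 qed
 have Hv: "H *\<^sub>v v = unit_vec ?n 0"
  using assoc_mult_mat_vec[OF H(1) H(1) unit_vec_carrier, of 0] H(3,4) by simp
 have "M' *\<^sub>v unit_vec ?n 0 = H *\<^sub>v (M *\<^sub>v (H *\<^sub>v unit_vec ?n 0))"
  unfolding M'_def using H(1) Suc.prems(1) by (simp add: assoc_mult_mat_vec[of _ ?n ?n _ ?n])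
 also have "\<dots> = e \<cdot>\<^sub>v unit_vec ?n 0" unfolding H(4) v(3) using mult_mat_vec[OF H(1) v(1)] Hv by simp
 finally have M'e: "M' *\<^sub>v unit_vec ?n 0 = e \<cdot>\<^sub>v unit_vec ?n 0" .
 have c0: "M' $$ (i, 0) = (if i = 0 then e else 0)" if "i < ?n" for i
  using arg_cong[OF M'e, of "\<lambda>x. x $ i"] that M' by (simp add: scalar_prod_right_unit split: if_splits)
 have r0: "M' $$ (0, i) = (if i = 0 then e else 0)" if "i < ?n" for i
  using c0[OF that] M' that by (metis carrier_matD index_transpose_mat(1) zero_less_Suc)
 define B where "B = mat m m (\<lambda>(i,j). M' $$ (Suc i, Suc j))"
 have B: "B \<in> carrier_mat m m" by (simp add: B_def)
 have "B\<^sup>T = B"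
 proof (rule eq_matI)
  fix i j assume "i < dim_row B" "j < dim_col B"
  then have ij: "i < m" "j < m" using B by auto
  have "M' $$ (Suc j, Suc i) = M' $$ (Suc i, Suc j)" using M' ij
   by (metis Suc_less_eq carrier_matD index_transpose_mat(1))
  then show "B\<^sup>T $$ (i, j) = B $$ (i, j)" using ij by (simp add: B_def)
 qed (use B in auto)
 from Suc.IH[OF B this] obtain V f where V: "V \<in> carrier_mat m m" "V\<^sup>T * V = 1\<^sub>m m"
  "B = V * mat_diag m f * V\<^sup>T" by blast
 define D where "D = mat_diag ?n (\<lambda>i. case i of 0 \<Rightarrow> e | Suc j \<Rightarrow> f j)"
 define V1 where "V1 = four_block_mat (1\<^sub>m 1) (0\<^sub>m 1 m) (0\<^sub>m m 1) V"
 have V1: "V1 \<in> carrier_mat ?n ?n" using V by (auto simp: V1_def)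
 have V1t: "V1\<^sup>T = four_block_mat (1\<^sub>m 1) (0\<^sub>m 1 m) (0\<^sub>m m 1) (V\<^sup>T)"
  unfolding V1_def by (subst transpose_four_block_mat[of _ 1 1 _ m _ m]) (use V in auto)
 let ?F = "\<lambda>X. four_block_mat (mat_diag 1 (\<lambda>_. e)) (0\<^sub>m 1 m) (0\<^sub>m m 1) X"
 have D4: "D = ?F (mat_diag m f)"
  by (rule eq_matI) (auto simp: D_def mat_diag_def split: nat.splits)
 have M'4: "M' = ?F B"
 proof (rule eq_matI)
  fix i j assume "i < dim_row (?F B)"
   "j < dim_col (?F B)"
  then have ij: "i < ?n" "j < ?n" using B by (auto simp: mat_diag_def)
  show "M' $$ (i, j) = ?F B $$ (i, j)"
   using ij B c0 r0 by (cases i; cases j) (auto simp: mat_diag_def B_def)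
 qed (use B M' in \<open>auto simp: mat_diag_def\<close>)
 have d1: "mat_diag 1 (\<lambda>_. e) \<in> carrier_mat 1 1" by simp
 have VD: "V1 * D = ?F (V * mat_diag m f)"
  unfolding V1_def D4
  by (subst mult_four_block_mat[OF one_carrier_mat zero_carrier_mat zero_carrier_mat V(1) d1 zero_carrier_mat zero_carrier_mat mat_diag_dim])
   (use V d1 in \<open>simp add: left_mult_one_mat[OF d1] left_mult_zero_mat[OF mat_diag_dim] left_mult_zero_mat[OF d1] del: One_nat_def\<close>)
 have VD': "V * mat_diag m f \<in> carrier_mat m m" using V by simp
 have "V1 * D * V1\<^sup>T = M'"
  unfolding VD V1t M'4 V(3)
  by (subst mult_four_block_mat[OF d1 zero_carrier_mat zero_carrier_mat VD' one_carrier_mat zero_carrier_mat zero_carrier_mat, of "V\<^sup>T" m])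
   (use V VD' d1 in \<open>simp_all add: right_mult_one_mat[OF d1] right_mult_zero_mat[OF d1] right_mult_zero_mat[OF VD'] left_mult_zero_mat[of "V\<^sup>T" m m] del: One_nat_def\<close>)
 moreover have "V1\<^sup>T * V1 = 1\<^sub>m ?n"
  unfolding V1t unfolding V1_def
  by (subst mult_four_block_mat[of _ 1 1 _ m _ m _ _ 1 _ m]) (use V in \<open>auto intro!: eq_matI\<close>)
 ultimately show ?case
 proof (intro exI[of _ "H * V1"] exI conjI)
  assume 1: "V1 * D * V1\<^sup>T = M'" and 2: "V1\<^sup>T * V1 = 1\<^sub>m ?n"
  have t: "transpose_mat (H * V1) = V1\<^sup>T * H" using H V1 by (simp add: transpose_mult[of _ ?n ?n _ ?n])
  show "H * V1 \<in> carrier_mat ?n ?n" using H V1 by simp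
  have "V1\<^sup>T * H * (H * V1) = V1\<^sup>T * ((H * H) * V1)"
   using H(1) V1 by (simp add: massoc_sq[of _ ?n])
  then show "transpose_mat (H * V1) * (H * V1) = 1\<^sub>m ?n" unfolding t using H V1 2 by simp
  have D: "D \<in> carrier_mat ?n ?n" by (simp add: D_def)
  have "H * V1 * D * (V1\<^sup>T * H) = H * (V1 * D * V1\<^sup>T) * H"
   using H(1) V1 D by (simp add: massoc_sq[of _ ?n])
  then show "M = H * V1 * mat_diag ?n (\<lambda>i. case i of 0 \<Rightarrow> e | Suc j \<Rightarrow> f j) * transpose_mat (H * V1)"
   unfolding t D_def[symmetric] 1 using MH by simp
 qed
qed

text \<open>The matrix with eigenvectors the columns of \<open>U\<close> and eigenvalues
  \<open>f\<close>. For fixed \<open>U\<close>, products, powers and polynomials become pointwise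
  operations on \<open>f\<close>.\<close>

definition fc :: "real mat \<Rightarrow> rseq \<Rightarrow> real mat" where
 "fc U f = U * mat_diag (dim_col U) f * U\<^sup>T"

definition orth :: "nat \<Rightarrow> real mat \<Rightarrow> bool" where
 "orth n U \<longleftrightarrow> U \<in> carrier_mat n n \<and> U\<^sup>T * U = 1\<^sub>m n \<and> U * U\<^sup>T = 1\<^sub>m n"

definition qf :: "real mat \<Rightarrow> real vec \<Rightarrow> real" where
 "qf M v = v \<bullet> (M *\<^sub>v v)"

lemma orthD:
 assumes "orth n U"
 shows "U \<in> carrier_mat n n" "U\<^sup>T \<in> carrier_mat n n" "dim_row U = n" "dim_col U = n"
  "U\<^sup>T * U = 1\<^sub>m n" "U * U\<^sup>T = 1\<^sub>m n"
 using assms by (auto simp: orth_def)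

lemma spectral_fc:
 assumes "(M :: real mat) \<in> carrier_mat n n" "M\<^sup>T = M"
 obtains U f where "orth n U" "M = fc U f"
proof -
 from spectral_theorem[OF assms] obtain U f where U: "U \<in> carrier_mat n n" "U\<^sup>T * U = 1\<^sub>m n"
  "M = U * mat_diag n f * U\<^sup>T" by blast
 have "U * U\<^sup>T = 1\<^sub>m n"
  by (rule mat_mult_left_right_inverse[OF _ U(1) U(2)]) (use U in simp)
 then show ?thesis using U by (intro that[of U f]) (auto simp: orth_def fc_def)
qed

lemma fc_carrier[simp]: "orth n U \<Longrightarrow> fc U f \<in> carrier_mat n n"
 by (auto simp: orth_def fc_def)

lemma fc_dim[simp]: "orth n U \<Longrightarrow> dim_row (fc U f) = n" "orth n U \<Longrightarrow> dim_col (fc U f) = n"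
 using fc_carrier by (metis carrier_matD(1), metis carrier_matD(2) fc_carrier)

lemma fc_sym[simp]: "orth n U \<Longrightarrow> transpose_mat (fc U f) = fc U f"
 using orthD[of n U] by (simp add: fc_def transpose_mult[of _ n n _ n] massoc_sq[of _ n])

lemma fc_mult[simp]:
 assumes "orth n U"
 shows "fc U f * fc U g = fc U (\<lambda>i. f i * g i)"
proof -
 note U = orthD[OF assms]
 have "fc U f * fc U g = U * (mat_diag n f * ((U\<^sup>T * U) * (mat_diag n g * U\<^sup>T)))"
  using U(1-4) by (simp add: fc_def massoc_sq[of _ n])
 also have "\<dots> = U * ((mat_diag n f * mat_diag n g) * U\<^sup>T)"
  using U by (simp add: massoc_sq[of _ n] del: mat_diag_diag)
 finally show ?thesis using U by (simp add: fc_def massoc_sq[of _ n])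
qed

lemma fc_one: "orth n U \<Longrightarrow> fc U (\<lambda>_. 1) = 1\<^sub>m n"
 using orthD[of n U] by (simp add: fc_def)

lemma fc_mpow: "orth n U \<Longrightarrow> fc U f ^\<^sub>m k = fc U (\<lambda>i. f i ^ k)"
 by (induction k) (auto simp: fc_one mult.commute)

lemma fc_index:
 assumes "orth n U" "i < n" "j < n"
 shows "fc U f $$ (i, j) = (\<Sum>k<n. f k * U $$ (i, k) * U $$ (j, k))"
 using orthD[OF assms(1)] assms(2,3)
 by (auto simp: fc_def mat_diag_mult_right[of _ n n] scalar_prod_def atLeast0LessThan mult_ac intro!: sum.cong)

lemma fc_add:
 assumes "orth n U" shows "fc U f + fc U g = fc U (\<lambda>i. f i + g i)"
 by (rule eq_matI) (use assms in \<open>auto simp: fc_index sum.distrib algebra_simps\<close>)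

lemma fc_smult:
 assumes "orth n U" shows "c \<cdot>\<^sub>m fc U f = fc U (\<lambda>i. c * f i)"
 by (rule eq_matI) (use assms in \<open>auto simp: fc_index sum_distrib_left algebra_simps\<close>)

lemma fc_cong: "orth n U \<Longrightarrow> (\<And>i. i < n \<Longrightarrow> f i = g i) \<Longrightarrow> fc U f = fc U g"
 by (rule eq_matI) (auto simp: fc_index)

lemma tr_fc_mult:
 assumes "orth n U" and X: "X \<in> carrier_mat n n"
 shows "tr (fc U f * X) = (\<Sum>i<n. f i * qf X (col U i))"
proof -
 note U = orthD[OF assms(1)]
 have "tr (fc U f * X) = tr (mat_diag n f * (U\<^sup>T * X * U))"
  using tr_comm[of U n n "mat_diag n f * (U\<^sup>T * X)"] U X
  by (simp add: fc_def massoc_sq[of _ n])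
 also have "\<dots> = (\<Sum>i<n. f i * (U\<^sup>T * X * U) $$ (i, i))"
  using U X by (simp add: mat_diag_mult_left[of _ n n] tr_def)
 also have "\<dots> = (\<Sum>i<n. f i * qf X (col U i))"
 proof (intro sum.cong refl)
  fix i assume "i \<in> {..<n}" then have i: "i < n" by simp
  have "(U\<^sup>T * X * U) $$ (i, i) = (U\<^sup>T * (X * U)) $$ (i, i)"
   using U X by (simp add: massoc_sq[of _ n])
  also have "\<dots> = qf X (col U i)" using U X i by (simp add: qf_def mult_mat_vec_def)
  finally show "f i * (U\<^sup>T * X * U) $$ (i, i) = f i * qf X (col U i)" by simp
 qed
 finally show ?thesis .
qed

lemma tr_fc: "orth n U \<Longrightarrow> tr (fc U f) = (\<Sum>i<n. f i)"
proof -
 assume U: "orth n U"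
 have "tr (fc U f) = tr (U\<^sup>T * (U * mat_diag n f))"
  unfolding fc_def using orthD[OF U] by (subst tr_comm[of _ n n]) auto
 also have "U\<^sup>T * (U * mat_diag n f) = mat_diag n f"
  using orthD[OF U] by (simp add: massoc_sq[of _ n, symmetric])
 finally show ?thesis by (simp add: tr_mat_diag)
qed

lemma qf_fc:
 assumes "orth n U" "v \<in> carrier_vec n"
 shows "qf (fc U f) v = (\<Sum>i<n. f i * (col U i \<bullet> v)\<^sup>2)"
proof -
 note U = orthD[OF assms(1)]
 let ?w = "U\<^sup>T *\<^sub>v v"
 have w: "?w \<in> carrier_vec n" using U assms by simp
 have "fc U f *\<^sub>v v = U *\<^sub>v (mat_diag n f *\<^sub>v ?w)"
  using U assms(2) by (simp add: fc_def assoc_mult_mat_vec[of _ n n _ n])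
 then have "qf (fc U f) v = ?w \<bullet> (mat_diag n f *\<^sub>v ?w)"
  using transpose_vec_mult_scalar[of U n n "mat_diag n f *\<^sub>v ?w" v] U assms(2)
  by (simp add: qf_def) (metis assms(2) comm_scalar_prod mat_diag_dim mult_mat_vec_carrier w)
 also have "\<dots> = (\<Sum>i<n. f i * (?w $ i)\<^sup>2)"
  using w U by (auto simp: scalar_prod_def atLeast0LessThan mat_diag_def power2_eq_square if_distrib[of "\<lambda>x. x * _"] cong: if_cong intro!: sum.cong)
 also have "\<dots> = (\<Sum>i<n. f i * (col U i \<bullet> v)\<^sup>2)" using U by simp
 finally show ?thesis .
qed

lemma norm_orth:
 assumes "orth n U" "v \<in> carrier_vec n"
 shows "v \<bullet> v = (\<Sum>i<n. (col U i \<bullet> v)\<^sup>2)"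
 using qf_fc[OF assms, of "\<lambda>_. 1"] assms by (simp add: fc_one qf_def)

lemma col_orth:
 assumes "orth n U" "i < n"
 shows "col U i \<in> carrier_vec n" "col U i \<bullet> col U i = 1"
proof -
 note U = orthD[OF assms(1)]
 show "col U i \<in> carrier_vec n" using U by (metis assms(2) col_carrier_vec carrier_matI)
 have "(U\<^sup>T * U) $$ (i, i) = 1" unfolding U(5) using assms by simp
 then show "col U i \<bullet> col U i = 1" using U(1) assms by simp
qed

lemma col_orth':
 assumes "orth n U" "i < n" "j < n"
 shows "col U i \<bullet> col U j = (if i = j then 1 else 0)"
proof -
 note U = orthD[OF assms(1)]
 have "(U\<^sup>T * U) $$ (i, j) = (if i = j then 1 else 0)" unfolding U(5) using assms by simp
 then show ?thesis using U(1) assms by simp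
qed

lemma qf_col:
 assumes "orth n U" "i < n"
 shows "qf (fc U f) (col U i) = f i"
proof -
 have "qf (fc U f) (col U i) = (\<Sum>j<n. if j = i then f j else 0)"
  unfolding qf_fc[OF assms(1) col_orth(1)[OF assms]]
  by (intro sum.cong) (use assms in \<open>auto simp: col_orth'\<close>)
 then show ?thesis using assms by simp
qed

text \<open>In the eigenbasis the trace is a nonnegative combination of values of the quadratic
  form, so an inequality of quadratic forms passes to traces against a positive semidefinite
  factor.\<close>

lemma tr_fc_mono:
 assumes "orth n U" "X \<in> carrier_mat n n" "Y \<in> carrier_mat n n" "\<And>i. i < n \<Longrightarrow> 0 \<le> f i"
  and "\<And>v. v \<in> carrier_vec n \<Longrightarrow> qf X v \<le> qf Y v"
 shows "tr (fc U f * X) \<le> tr (fc U f * Y)"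
 unfolding tr_fc_mult[OF assms(1,2)] tr_fc_mult[OF assms(1,3)]
 by (intro sum_mono mult_left_mono) (use assms col_orth in auto)

lemma qf_fc_mono:
 assumes "orth n U" "v \<in> carrier_vec n" "\<And>i. i < n \<Longrightarrow> f i \<le> g i"
 shows "qf (fc U f) v \<le> qf (fc U g) v"
 unfolding qf_fc[OF assms(1,2)] by (intro sum_mono mult_right_mono) (use assms in auto)

lemma qf_one: "v \<in> carrier_vec n \<Longrightarrow> qf (1\<^sub>m n) v = v \<bullet> v"
 by (simp add: qf_def)

lemma qf_add: "\<lbrakk>X \<in> carrier_mat n n; Y \<in> carrier_mat n n; v \<in> carrier_vec n\<rbrakk> \<Longrightarrow> qf (X + Y) v = qf X v + qf Y v"
 by (simp add: qf_def add_mult_distrib_mat_vec[of _ n n] scalar_prod_add_distrib[of _ n])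

lemma qf_smult: "X \<in> carrier_mat n n \<Longrightarrow> v \<in> carrier_vec n \<Longrightarrow> qf (c \<cdot>\<^sub>m X) v = c * qf X v"
proof -
 assume *: "X \<in> carrier_mat n n" "v \<in> carrier_vec n"
 then have "c \<cdot>\<^sub>m X *\<^sub>v v = c \<cdot>\<^sub>v (X *\<^sub>v v)" by (intro eq_vecI) auto
 then show ?thesis using * by (simp add: qf_def)
qed

lemma qf_congr:
 assumes "K \<in> carrier_mat n n" "K\<^sup>T = K" "X \<in> carrier_mat n n" "v \<in> carrier_vec n"
 shows "qf (K * X * K) v = qf X (K *\<^sub>v v)"
proof -
 have "qf (K * X * K) v = v \<bullet> (K *\<^sub>v (X *\<^sub>v (K *\<^sub>v v)))"
  using assms by (simp add: qf_def assoc_mult_mat_vec[of _ n n _ n])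
 also have "\<dots> = (K *\<^sub>v v) \<bullet> (X *\<^sub>v (K *\<^sub>v v))"
  using transpose_vec_mult_scalar[of K n n "X *\<^sub>v (K *\<^sub>v v)" v] assms
  by (metis comm_scalar_prod mult_mat_vec_carrier)
 finally show ?thesis by (simp add: qf_def)
qed

lemma fc_eigen_ge:
 assumes "orth n U" "\<And>v. v \<in> carrier_vec n \<Longrightarrow> c * (v \<bullet> v) \<le> qf (fc U f) v" "i < n"
 shows "c \<le> f i"
 using assms(2)[OF col_orth(1)[OF assms(1,3)]] col_orth(2)[OF assms(1,3)] qf_col[OF assms(1,3), of f] by simp

lemma fc_eigen_le:
 assumes "orth n U" "\<And>v. v \<in> carrier_vec n \<Longrightarrow> qf (fc U f) v \<le> c * (v \<bullet> v)" "i < n"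
 shows "f i \<le> c"
 using assms(2)[OF col_orth(1)[OF assms(1,3)]] col_orth(2)[OF assms(1,3)] qf_col[OF assms(1,3), of f] by simp

lemma qf_fc_ge:
 assumes "orth n U" "v \<in> carrier_vec n" "\<And>i. i < n \<Longrightarrow> c \<le> f i"
 shows "c * (v \<bullet> v) \<le> qf (fc U f) v"
 unfolding qf_fc[OF assms(1,2)] norm_orth[OF assms(1,2)] sum_distrib_left
 by (intro sum_mono mult_right_mono) (use assms in auto)

lemma qf_fc_le:
 assumes "orth n U" "v \<in> carrier_vec n" "\<And>i. i < n \<Longrightarrow> f i \<le> c"
 shows "qf (fc U f) v \<le> c * (v \<bullet> v)"
 unfolding qf_fc[OF assms(1,2)] norm_orth[OF assms(1,2)] sum_distrib_left
 by (intro sum_mono mult_right_mono) (use assms in auto)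

section \<open>First-order perturbation of the trace potentials\<close>

text \<open>
 Writing \<open>N + \<Delta> = H (1 + X) H\<close> with \<open>H\<close> the square root of \<open>N\<close>, the next lemma provides \<open>X\<close> in
 diagonal form.
\<close>

lemma relative_perturbation:
 assumes U: "orth n U" and f: "\<And>i. i < n \<Longrightarrow> 0 < f i"
  and D: "D \<in> carrier_mat n n" "D\<^sup>T = D"
  and D0: "\<And>v. v \<in> carrier_vec n \<Longrightarrow> 0 \<le> qf D v"
  and Da: "\<And>v. v \<in> carrier_vec n \<Longrightarrow> qf D v \<le> a * qf (fc U f) v"
 obtains V g where "orth n V" "\<And>i. i < n \<Longrightarrow> 0 \<le> g i" "\<And>i. i < n \<Longrightarrow> g i \<le> a"
  "fc U f + D = fc U (\<lambda>i. sqrt (f i)) * fc V (\<lambda>i. 1 + g i) * fc U (\<lambda>i. sqrt (f i))"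
  "fc V g = fc U (\<lambda>i. 1 / sqrt (f i)) * D * fc U (\<lambda>i. 1 / sqrt (f i))"
proof -
 let ?H = "fc U (\<lambda>i. sqrt (f i))" and ?K = "fc U (\<lambda>i. 1 / sqrt (f i))"
 let ?X = "?K * D * ?K"
 have HK: "?H * ?K = 1\<^sub>m n" "?K * ?H = 1\<^sub>m n"
  using fc_cong[OF U, of "\<lambda>i. sqrt (f i) * (1 / sqrt (f i))" "\<lambda>_. 1"] f fc_one[OF U] U
  by (simp_all add: less_imp_neq[symmetric] mult.commute)
 have HH: "?H * ?H = fc U f" using fc_cong[OF U, of "\<lambda>i. sqrt (f i) * sqrt (f i)" f] f U by (simp add: less_imp_le)
 have X: "?X \<in> carrier_mat n n" "transpose_mat ?X = ?X"
  using U D by (simp_all add: transpose_mult[of _ n n _ n] massoc_sq[of _ n])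
 obtain V g where V: "orth n V" "?X = fc V g" using spectral_fc[OF X] by blast
 have qX: "qf ?X v = qf D (?K *\<^sub>v v)" if "v \<in> carrier_vec n" for v
  by (rule qf_congr) (use U D that in auto)
 have Kv: "?K *\<^sub>v v \<in> carrier_vec n" if "v \<in> carrier_vec n" for v using U that by (meson fc_carrier mult_mat_vec_carrier)
 have "qf (fc U f) (?K *\<^sub>v v) = v \<bullet> v" if v: "v \<in> carrier_vec n" for v
 proof -
  have "qf (fc U f) (?K *\<^sub>v v) = qf (?K * (?H * ?H) * ?K) v"
   unfolding HH by (rule qf_congr[symmetric]) (use U v in auto)
  also have "?K * (?H * ?H) * ?K = (?K * ?H) * (?H * ?K)"
   using fc_carrier[OF U] by (simp only: massoc_sq[of _ n] mult_carrier_sq)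
  also have "\<dots> = 1\<^sub>m n" unfolding HK by simp
  finally show ?thesis using v by (simp add: qf_one)
 qed
 then have ga: "g i \<le> a" if "i < n" for i
  using fc_eigen_le[OF V(1), of g a i] Da[OF Kv] that qX V(2) by simp
 have g0: "0 \<le> g i" if "i < n" for i
  using fc_eigen_ge[OF V(1), of 0 g i] D0[OF Kv] that qX V(2) by simp
 have "fc V (\<lambda>i. 1 + g i) = 1\<^sub>m n + ?X" using fc_add[OF V(1), of "\<lambda>_. 1" g] V by (simp add: fc_one[OF V(1)])
 then have "?H * fc V (\<lambda>i. 1 + g i) * ?H = ?H * ?H + (?H * ?K) * D * (?K * ?H)"
  using fc_carrier[OF U] D(1) X(1)
  by (simp only: mult_add_distrib_mat[of _ n n _ n] add_mult_distrib_mat[of _ n n _ _ n] massoc_sq[of _ n] mult_carrier_sq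
    one_mult_sq one_carrier_mat)
 also have "\<dots> = fc U f + D" unfolding HK HH using D by simp
 finally show ?thesis using V g0 ga by (intro that[of V g]) auto
qed

lemma tr_fc_fc:
 assumes "orth n U" "orth n V" "\<And>i. i < n \<Longrightarrow> 0 \<le> f i" "\<And>i. i < n \<Longrightarrow> g i \<le> h i"
 shows "tr (fc U f * fc V g) \<le> tr (fc U f * fc V h)"
 by (rule tr_fc_mono) (use assms qf_fc_mono in auto)

lemma tr_affine:
 assumes U: "orth n U" and V: "orth n V"
 shows "tr (fc U f * fc V (\<lambda>i. 1 + c * g i)) = (\<Sum>i<n. f i) + c * tr (fc U f * fc V g)"
proof -
 have *: "fc V (\<lambda>i. 1 + c * g i) = 1\<^sub>m n + c \<cdot>\<^sub>m fc V g"
  using fc_add[OF V, of "\<lambda>_. 1" "\<lambda>i. c * g i"] V by (simp add: fc_one fc_smult)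
 have "fc U f * fc V (\<lambda>i. 1 + c * g i) = fc U f + c \<cdot>\<^sub>m (fc U f * fc V g)"
  unfolding * using fc_carrier[OF U, of f] fc_carrier[OF V, of g]
  by (simp add: mult_add_distrib_mat[of _ n n _ n] mult_smult_distrib[of _ n n _ n])
 then show ?thesis using U V by (simp add: tr_add[of _ n] tr_smult[of _ n] tr_fc)
qed

lemma tr_conj_eq:
 assumes U: "orth n U" and D: "D \<in> carrier_mat n n"
  and "\<And>i. i < n \<Longrightarrow> k i * f i * k i = h i"
 shows "tr (fc U f * (fc U k * D * fc U k)) = tr (fc U h * D)"
proof -
 have "tr (fc U f * (fc U k * D * fc U k)) = tr ((fc U f * fc U k * D) * fc U k)"
  using fc_carrier[OF U] D by (simp only: massoc_sq[of _ n] mult_carrier_sq)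
 also have "\<dots> = tr (fc U k * (fc U f * fc U k * D))"
  by (rule tr_comm[of _ n n]) (use D U in auto)
 also have "fc U k * (fc U f * fc U k * D) = (fc U k * fc U f * fc U k) * D"
  using fc_carrier[OF U] D by (simp only: massoc_sq[of _ n] mult_carrier_sq)
 also have "fc U k * fc U f * fc U k = fc U h" using U fc_cong[OF U, of "\<lambda>i. k i * f i * k i" h] assms(3) by simp
 finally show ?thesis .
qed

lemma power_1_plus_le:
 assumes "0 \<le> x" "real p * x \<le> e" "e \<le> 1"
 shows "(1 + x) ^ p \<le> 1 + real p * (1 + e) * (x::real)"
proof -
 have "(1 + x) ^ p \<le> exp (real p * x)"
  using assms by (simp add: exp_of_nat_mult power_mono)
 also have "\<dots> \<le> 1 + real p * x + (real p * x)\<^sup>2"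
  by (rule exp_bound) (use assms in auto)
 also have "(real p * x)\<^sup>2 \<le> e * (real p * x)"
  unfolding power2_eq_square by (rule mult_right_mono) (use assms in auto)
 finally show ?thesis by (simp add: algebra_simps)
qed

lemma power_1_plus_inverse_le:
 assumes "0 \<le> x" "real p * x \<le> e"
 shows "(1 / (1 + x)) ^ p \<le> 1 - real p * (1 - e) * (x::real)"
proof -
 have x: "real p * x \<ge> 0" using assms by simp
 have "1 + real p * x \<le> (1 + x) ^ p" by (rule Bernoulli_inequality) (use assms in auto)
 then have "(1 / (1 + x)) ^ p \<le> 1 / (1 + real p * x)"
  using x by (simp add: power_divide frac_le)
 also have "\<dots> \<le> 1 - real p * x + (real p * x)\<^sup>2"
 proof -
  have "1 \<le> (1 - y + y\<^sup>2) * (1 + y)" if "y \<ge> 0" for y :: real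
  proof -
   have "(1 - y + y\<^sup>2) * (1 + y) = 1 + y^3" by (simp add: algebra_simps power2_eq_square power3_eq_cube)
   then show ?thesis using that by simp
  qed
  from this[OF x] show ?thesis using x by (simp add: divide_le_eq)
 qed
 also have "(real p * x)\<^sup>2 \<le> e * (real p * x)"
  unfolding power2_eq_square by (rule mult_right_mono) (use assms in auto)
 finally show ?thesis by (simp add: algebra_simps)
qed

text \<open>The correction term is \<open>1 + e\<close> times the derivative of
  \<open>tr N^p\<close> in direction \<open>D\<close>. By cyclicity
  \<open>tr (N + D)^p = tr (N Q)^p\<close> with \<open>Q = 1 + X\<close>; Lieb-Thirring separates
  the two noncommuting factors, and \<open>Q^p\<close> is then linearised eigenvalue by eigenvalue,
  which is where \<open>p * a \<le> e\<close> enters.\<close>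

lemma tr_power_perturb:
 assumes U: "orth n U" and f: "\<And>i. i < n \<Longrightarrow> 0 < f i"
  and D: "D \<in> carrier_mat n n" "D\<^sup>T = D"
  and D0: "\<And>v. v \<in> carrier_vec n \<Longrightarrow> 0 \<le> qf D v"
  and Da: "\<And>v. v \<in> carrier_vec n \<Longrightarrow> qf D v \<le> a * qf (fc U f) v"
  and a: "2 ^ k * a \<le> e" "e \<le> 1"
  and U': "orth n U'" "fc U f + D = fc U' f'"
 shows "(\<Sum>i<n. f' i ^ 2 ^ k) \<le> (\<Sum>i<n. f i ^ 2 ^ k) + 2 ^ k * (1 + e) * tr (fc U (\<lambda>i. f i ^ (2 ^ k - 1)) * D)"
proof -
 let ?p = "2 ^ k :: nat"
 obtain V g where V: "orth n V" and g: "\<And>i. i < n \<Longrightarrow> 0 \<le> g i" "\<And>i. i < n \<Longrightarrow> g i \<le> a"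
  and ND: "fc U f + D = fc U (\<lambda>i. sqrt (f i)) * fc V (\<lambda>i. 1 + g i) * fc U (\<lambda>i. sqrt (f i))"
  and Vg: "fc V g = fc U (\<lambda>i. 1 / sqrt (f i)) * D * fc U (\<lambda>i. 1 / sqrt (f i))"
  by (rule relative_perturbation[OF U f D D0 Da]) auto
 let ?H = "fc U (\<lambda>i. sqrt (f i))" and ?Q = "fc V (\<lambda>i. 1 + g i)"
 have HH: "?H * ?H = fc U f" using fc_cong[OF U, of "\<lambda>i. sqrt (f i) * sqrt (f i)" f] f U by (simp add: less_imp_le)
 have "(\<Sum>i<n. f' i ^ ?p) = tr ((fc U f + D) ^\<^sub>m ?p)" unfolding U'(2) using U' by (simp add: fc_mpow tr_fc)
 also have "\<dots> = tr ((?H * (?H * ?Q)) ^\<^sub>m ?p)" unfolding ND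
  using tr_mpow_comm[of "?H * ?Q" n ?H ?p] U V by simp
 also have "?H * (?H * ?Q) = fc U f * ?Q"
  unfolding HH[symmetric] using fc_carrier[OF U] fc_carrier[OF V] by (simp only: massoc_sq[of _ n])
 also have "tr ((fc U f * ?Q) ^\<^sub>m ?p) \<le> tr (fc U f ^\<^sub>m ?p * ?Q ^\<^sub>m ?p)"
  by (rule lieb_thirring_pow2[of _ n]) (use U V in auto)
 also have "\<dots> = tr (fc U (\<lambda>i. f i ^ ?p) * fc V (\<lambda>i. (1 + g i) ^ ?p))"
  using U V by (simp add: fc_mpow)
 also have "\<dots> \<le> tr (fc U (\<lambda>i. f i ^ ?p) * fc V (\<lambda>i. 1 + real ?p * (1 + e) * g i))"
 proof (rule tr_fc_fc[OF U V])
  fix i assume i: "i < n"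
  show "0 \<le> f i ^ ?p" using f[OF i] by simp
  have "2 ^ k * g i \<le> 2 ^ k * a" using g[OF i] by (intro mult_left_mono) auto
  then have "2 ^ k * g i \<le> e" using a by linarith
  then show "(1 + g i) ^ ?p \<le> 1 + real ?p * (1 + e) * g i"
   using a g[OF i] by (intro power_1_plus_le) auto
 qed
 also have "\<dots> = (\<Sum>i<n. f i ^ ?p) + real ?p * (1 + e) * tr (fc U (\<lambda>i. f i ^ ?p) * fc V g)"
  by (rule tr_affine[OF U V])
 also have "tr (fc U (\<lambda>i. f i ^ ?p) * fc V g) = tr (fc U (\<lambda>i. f i ^ (?p - 1)) * D)"
  unfolding Vg
 proof (rule tr_conj_eq[OF U D(1)])
  fix i assume i: "i < n"
  have "f i ^ ?p = f i ^ (?p - 1) * (sqrt (f i) * sqrt (f i))"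
   using f[OF i] power_minus_mult[of ?p "f i"] by simp
  then show "1 / sqrt (f i) * f i ^ ?p * (1 / sqrt (f i)) = f i ^ (?p - 1)"
   using f[OF i] by (simp add: field_simps)
 qed
 finally show ?thesis by simp
qed

text \<open>The same argument for \<open>tr N^-p\<close>: the inverse of \<open>N + D\<close> is
  \<open>K Q^-1 K\<close> with \<open>K = N^(-1/2)\<close>, so that Lieb-Thirring applies to
  \<open>N^-1\<close> and \<open>Q^-1\<close>.\<close>

lemma tr_inverse_power_perturb:
 assumes U: "orth n U" and f: "\<And>i. i < n \<Longrightarrow> 0 < f i"
  and D: "D \<in> carrier_mat n n" "D\<^sup>T = D"
  and D0: "\<And>v. v \<in> carrier_vec n \<Longrightarrow> 0 \<le> qf D v"
  and Da: "\<And>v. v \<in> carrier_vec n \<Longrightarrow> qf D v \<le> a * qf (fc U f) v"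
  and a: "2 ^ k * a \<le> e"
  and U': "orth n U'" "fc U f + D = fc U' f'" and f': "\<And>i. i < n \<Longrightarrow> 0 < f' i"
 shows "(\<Sum>i<n. (1 / f' i) ^ 2 ^ k) \<le> (\<Sum>i<n. (1 / f i) ^ 2 ^ k)
   - 2 ^ k * (1 - e) * tr (fc U (\<lambda>i. (1 / f i) ^ (2 ^ k + 1)) * D)"
proof -
 let ?p = "2 ^ k :: nat"
 obtain V g where V: "orth n V" and g: "\<And>i. i < n \<Longrightarrow> 0 \<le> g i" "\<And>i. i < n \<Longrightarrow> g i \<le> a"
  and ND: "fc U f + D = fc U (\<lambda>i. sqrt (f i)) * fc V (\<lambda>i. 1 + g i) * fc U (\<lambda>i. sqrt (f i))"
  and Vg: "fc V g = fc U (\<lambda>i. 1 / sqrt (f i)) * D * fc U (\<lambda>i. 1 / sqrt (f i))"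
  by (rule relative_perturbation[OF U f D D0 Da]) auto
 let ?H = "fc U (\<lambda>i. sqrt (f i))" and ?K = "fc U (\<lambda>i. 1 / sqrt (f i))"
 let ?Q = "fc V (\<lambda>i. 1 + g i)" and ?R = "fc V (\<lambda>i. 1 / (1 + g i))"
 let ?I = "fc U (\<lambda>i. 1 / f i)" and ?N' = "fc U' f'" and ?I' = "fc U' (\<lambda>i. 1 / f' i)"
 have HK: "?H * ?K = 1\<^sub>m n"
  using fc_cong[OF U, of "\<lambda>i. sqrt (f i) * (1 / sqrt (f i))" "\<lambda>_. 1"] f fc_one[OF U] U
  by (simp_all add: less_imp_neq[symmetric] mult.commute)
 have QR: "?Q * ?R = 1\<^sub>m n"
  using fc_cong[OF V, of "\<lambda>i. (1 + g i) * (1 / (1 + g i))" "\<lambda>_. 1"] g fc_one[OF V] V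
  by (simp add: add_pos_nonneg less_imp_neq[symmetric])
 have NI': "?I' * ?N' = 1\<^sub>m n"
  using fc_cong[OF U'(1), of "\<lambda>i. (1 / f' i) * f' i" "\<lambda>_. 1"] f' fc_one[OF U'(1)] U'(1)
  by (simp add: less_imp_neq[symmetric])
 have KK: "?K * ?K = ?I" using fc_cong[OF U, of "\<lambda>i. 1 / sqrt (f i) * (1 / sqrt (f i))" "\<lambda>i. 1 / f i"] f U by (simp add: less_imp_le)
 have "?N' * (?K * ?R * ?K) = ?H * (?Q * ((?H * ?K) * (?R * ?K)))"
  unfolding U'(2)[symmetric] ND using fc_carrier[OF U] fc_carrier[OF V]
  by (simp only: massoc_sq[of _ n] mult_carrier_sq)
 also have "\<dots> = ?H * ((?Q * ?R) * ?K)"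
  unfolding HK using fc_carrier[OF U] fc_carrier[OF V] by (simp only: massoc_sq[of _ n] mult_carrier_sq left_mult_one_mat[of _ n n])
 also have "\<dots> = 1\<^sub>m n" unfolding QR using fc_carrier[OF U] HK by (simp only: left_mult_one_mat[of _ n n])
 finally have inv: "?N' * (?K * ?R * ?K) = 1\<^sub>m n" .
 have "?I' = ?I' * (?N' * (?K * ?R * ?K))" unfolding inv using U' by simp
 also have "\<dots> = (?I' * ?N') * (?K * ?R * ?K)"
  using fc_carrier[OF U] fc_carrier[OF V] fc_carrier[OF U'(1)] by (simp only: massoc_sq[of _ n] mult_carrier_sq)
 also have "\<dots> = ?K * ?R * ?K" unfolding NI' using fc_carrier[OF U] fc_carrier[OF V] by (simp only: left_mult_one_mat[of _ n n] mult_carrier_sq)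
 finally have I': "?I' = ?K * ?R * ?K" .
 have "(\<Sum>i<n. (1 / f' i) ^ ?p) = tr (?I' ^\<^sub>m ?p)" using U' by (simp add: fc_mpow tr_fc)
 also have "\<dots> = tr ((?K * (?K * ?R)) ^\<^sub>m ?p)" unfolding I'
  using tr_mpow_comm[of "?K * ?R" n ?K ?p] U V by simp
 also have "?K * (?K * ?R) = ?I * ?R"
  unfolding KK[symmetric] using fc_carrier[OF U] fc_carrier[OF V] by (simp only: massoc_sq[of _ n])
 also have "tr ((?I * ?R) ^\<^sub>m ?p) \<le> tr (?I ^\<^sub>m ?p * ?R ^\<^sub>m ?p)"
  by (rule lieb_thirring_pow2[of _ n]) (use U V in auto)
 also have "\<dots> = tr (fc U (\<lambda>i. (1 / f i) ^ ?p) * fc V (\<lambda>i. (1 / (1 + g i)) ^ ?p))"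
  using U V by (simp add: fc_mpow)
 also have "\<dots> \<le> tr (fc U (\<lambda>i. (1 / f i) ^ ?p) * fc V (\<lambda>i. 1 + (- (real ?p * (1 - e))) * g i))"
 proof (rule tr_fc_fc[OF U V])
  fix i assume i: "i < n"
  show "0 \<le> (1 / f i) ^ ?p" using f[OF i] by simp
  have "2 ^ k * g i \<le> 2 ^ k * a" using g[OF i] by (intro mult_left_mono) auto
  then have "2 ^ k * g i \<le> e" using a by linarith
  then have "(1 / (1 + g i)) ^ ?p \<le> 1 - real ?p * (1 - e) * g i"
   using a g[OF i] by (intro power_1_plus_inverse_le) auto
  then show "(1 / (1 + g i)) ^ ?p \<le> 1 + (- (real ?p * (1 - e))) * g i" by simp
 qed
 also have "\<dots> = (\<Sum>i<n. (1 / f i) ^ ?p) + (- (real ?p * (1 - e))) * tr (fc U (\<lambda>i. (1 / f i) ^ ?p) * fc V g)"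
  by (rule tr_affine[OF U V])
 also have "tr (fc U (\<lambda>i. (1 / f i) ^ ?p) * fc V g) = tr (fc U (\<lambda>i. (1 / f i) ^ (?p + 1)) * D)"
  unfolding Vg
 proof (rule tr_conj_eq[OF U D(1)])
  fix i assume i: "i < n"
  have "1 / f i = (1 / sqrt (f i)) * (1 / sqrt (f i))" using f[OF i] by simp
  then show "1 / sqrt (f i) * (1 / f i) ^ ?p * (1 / sqrt (f i)) = (1 / f i) ^ (?p + 1)"
   by (metis (no_types, opaque_lifting) Suc_eq_plus1 mult.assoc mult.commute power_Suc)
 qed
 finally show ?thesis by simp
qed

subsection \<open>Packing and covering steps\<close>

definition gram :: "real mat \<Rightarrow> rseq \<Rightarrow> real mat" where
 "gram A w = scaled_gram A (mat_diag (dim_row A) w)"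

lemma gram_carrier[simp]: "A \<in> carrier_mat n d \<Longrightarrow> gram A w \<in> carrier_mat d d"
 by (auto simp: gram_def scaled_gram_def)

lemma gram_dim[simp]: "dim_row (gram A w) = dim_col A" "dim_col (gram A w) = dim_col A"
 by (auto simp: gram_def scaled_gram_def)

lemma gram_index:
 assumes "A \<in> carrier_mat n d" "i < d" "j < d"
 shows "gram A w $$ (i, j) = (\<Sum>k<n. w k * A $$ (k, i) * A $$ (k, j))"
 using assms
 by (auto simp: gram_def scaled_gram_def mat_diag_mult_right[of _ d n] scalar_prod_def atLeast0LessThan mult_ac intro!: sum.cong)

lemma gram_sym[simp]: "A \<in> carrier_mat n d \<Longrightarrow> transpose_mat (gram A w) = gram A w"
 by (rule eq_matI) (auto simp: gram_index mult_ac intro!: sum.cong)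

lemma gram_add:
 assumes "A \<in> carrier_mat n d" shows "gram A (\<lambda>i. u i + w i) = gram A u + gram A w"
 by (rule eq_matI) (use assms in \<open>auto simp: gram_index[OF assms] sum.distrib algebra_simps\<close>)

lemma gram_smult:
 assumes "A \<in> carrier_mat n d" shows "gram A (\<lambda>i. c * w i) = c \<cdot>\<^sub>m gram A w"
 by (rule eq_matI) (use assms in \<open>auto simp: gram_index[OF assms] sum_distrib_left algebra_simps\<close>)

lemma gram_cong:
 assumes "A \<in> carrier_mat n d" "\<And>i. i < n \<Longrightarrow> u i = w i" shows "gram A u = gram A w"
 by (rule eq_matI) (use assms in \<open>auto simp: gram_index[OF assms(1)]\<close>)

lemma qf_sum:
 assumes "X \<in> carrier_mat d d" "v \<in> carrier_vec d"
 shows "qf X v = (\<Sum>i<d. \<Sum>j<d. X $$ (i, j) * v $ i * v $ j)"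
 using assms by (auto simp: qf_def scalar_prod_def atLeast0LessThan sum_distrib_left mult_ac intro!: sum.cong)

lemma qf_gram:
 assumes A: "A \<in> carrier_mat n d" and v: "v \<in> carrier_vec d"
 shows "qf (gram A w) v = (\<Sum>i<n. w i * (row A i \<bullet> v)\<^sup>2)"
proof -
 have "qf (gram A w) v = (\<Sum>i<d. \<Sum>j<d. \<Sum>k<n. w k * (A $$ (k, i) * v $ i) * (A $$ (k, j) * v $ j))"
  unfolding qf_sum[OF gram_carrier[OF A] v]
  by (auto simp: gram_index[OF A] sum_distrib_right sum_distrib_left mult_ac intro!: sum.cong)
 also have "\<dots> = (\<Sum>k<n. \<Sum>i<d. \<Sum>j<d. w k * (A $$ (k, i) * v $ i) * (A $$ (k, j) * v $ j))"
  by (subst (2) sum.swap, subst sum.swap, rule refl)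
 also have "\<dots> = (\<Sum>k<n. w k * (row A k \<bullet> v)\<^sup>2)"
  using A v by (auto simp: scalar_prod_def atLeast0LessThan power2_eq_square sum_product sum_distrib_left mult_ac intro!: sum.cong)
 finally show ?thesis .
qed

lemma tr_mult_gram:
 assumes A: "A \<in> carrier_mat n d" and X: "X \<in> carrier_mat d d"
 shows "tr (X * gram A w) = (\<Sum>i<n. w i * qf X (row A i))"
proof -
 have "tr (X * gram A w) = (\<Sum>i<d. \<Sum>j<d. \<Sum>k<n. w k * (X $$ (i, j) * A $$ (k, i) * A $$ (k, j)))"
  unfolding tr_mult[OF X gram_carrier[OF A]]
  by (auto simp: gram_index[OF A] sum_distrib_left mult_ac intro!: sum.cong)
 also have "\<dots> = (\<Sum>k<n. \<Sum>i<d. \<Sum>j<d. w k * (X $$ (i, j) * A $$ (k, i) * A $$ (k, j)))"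
  by (subst (2) sum.swap, subst sum.swap, rule refl)
 also have "\<dots> = (\<Sum>k<n. w k * qf X (row A k))"
  using A X by (auto simp: qf_sum[OF X] sum_distrib_left mult_ac intro!: sum.cong)
 finally show ?thesis .
qed

lemma pow_tangent:
 assumes "0 \<le> a" "0 \<le> s" "0 < p"
 shows "a ^ p + real p * a ^ (p - 1) * (s - a) \<le> s ^ p"
proof (cases "a = 0")
 case True
 then show ?thesis using assms by (cases "p = 1") (auto simp: power_0_left)
next
 case False
 then have a: "a > 0" using assms by simp
 have "1 + real p * (s / a - 1) \<le> (1 + (s / a - 1)) ^ p"
  by (rule Bernoulli_inequality) (use assms a in auto)
 then have "a ^ p * (1 + real p * (s / a - 1)) \<le> a ^ p * (s / a) ^ p"
  using a by simp
 also have "a ^ p * (s / a) ^ p = s ^ p" using a by (simp add: power_divide)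
 finally have *: "a ^ p * (1 + real p * (s / a - 1)) \<le> s ^ p" .
 have ap: "a ^ p = a * a ^ (p - 1)" using power_minus_mult[of p a] assms by (simp add: mult.commute)
 have "a * b * (1 + real p * (s / a - 1)) = a * b + real p * b * (s - a)" for b
  using a by (simp add: field_simps)
 then show ?thesis using * unfolding ap by simp
qed

lemma young_pow:
 assumes "0 \<le> a" "0 \<le> s" "0 < p"
 shows "real p * (s * a ^ (p - 1)) \<le> (real p - 1) * a ^ p + s ^ p"
proof -
 have "a ^ p + real p * a ^ (p - 1) * (s - a) = real p * (s * a ^ (p - 1)) - real p * (a ^ (p - 1) * a) + a ^ p"
  by (simp add: algebra_simps)
 also have "\<dots> = real p * (s * a ^ (p - 1)) - (real p - 1) * a ^ p"
  unfolding power_minus_mult[OF assms(3)] by (simp add: algebra_simps)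
 finally show ?thesis using pow_tangent[OF assms] by linarith
qed

text \<open>Young's inequality with \<open>s = r / (1 + e)\<close>, chosen such that
  \<open>d\<close> copies of \<open>s^p\<close> sum to at most \<open>r^p\<close>. It makes the
  trace of the packing gradient comparable to the power \<open>r^(p-1)\<close> that a single
  eigenvalue \<open>r\<close> would give.\<close>

lemma sum_pow_pred_le:
 assumes f: "\<And>i. i < d \<Longrightarrow> 0 \<le> f i" and S: "(\<Sum>i<d. f i ^ p) = r ^ p" and r: "0 < r" and p: "0 < p"
  and e: "0 \<le> e" "real d \<le> (1 + e) ^ p"
 shows "(\<Sum>i<d. f i ^ (p - 1)) \<le> (1 + e) * r ^ (p - 1)"
proof -
 define s where "s = r / (1 + e)"
 have s: "s > 0" using r e by (simp add: s_def)
 have rs: "r = s * (1 + e)" using e by (simp add: s_def)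
 have "real p * (s * (\<Sum>i<d. f i ^ (p - 1))) = (\<Sum>i<d. real p * (s * f i ^ (p - 1)))"
  by (simp add: sum_distrib_left mult.assoc)
 also have "\<dots> \<le> (\<Sum>i<d. (real p - 1) * f i ^ p + s ^ p)"
  by (intro sum_mono young_pow) (use f s p in auto)
 also have "\<dots> = (real p - 1) * r ^ p + real d * s ^ p"
  by (simp add: sum.distrib sum_distrib_left[symmetric] S)
 also have "real d * s ^ p \<le> r ^ p"
  using e(2) s unfolding rs power_mult_distrib by (simp add: mult.commute)
 finally have "s * (\<Sum>i<d. f i ^ (p - 1)) \<le> r ^ p"
  using p by (simp add: algebra_simps)
 also have "r ^ p = s * ((1 + e) * r ^ (p - 1))" using power_minus_mult[OF p, of r] rs by (simp add: mult_ac)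
 finally show ?thesis using s by simp
qed

text \<open>Counterpart for the covering gradient, with the same \<open>s\<close> in Young's
  inequality for the exponent \<open>p + 1\<close>.\<close>

lemma sum_pow_Suc_ge:
 assumes f: "\<And>i. i < d \<Longrightarrow> 0 \<le> f i" and S: "(\<Sum>i<d. f i ^ p) = r ^ p" and r: "0 < r" and p: "0 < p"
  and e: "0 \<le> e" "real d \<le> (1 + e) ^ p"
 shows "r ^ (p + 1) / (1 + e) \<le> (\<Sum>i<d. f i ^ (p + 1))"
proof -
 define s where "s = r / (1 + e)"
 have s: "s > 0" using r e by (simp add: s_def)
 have rs: "r = s * (1 + e)" using e by (simp add: s_def)
 have "(\<Sum>i<d. real (p + 1) * (s * f i ^ p)) \<le> (\<Sum>i<d. real p * f i ^ (p + 1) + s ^ (p + 1))"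
  by (intro sum_mono) (use young_pow[of _ s "p + 1"] f s in auto)
 then have "real (p + 1) * (s * r ^ p) \<le> real p * (\<Sum>i<d. f i ^ (p + 1)) + real d * s ^ (p + 1)"
  by (simp only: sum.distrib sum_distrib_left[symmetric] S sum_constant) simp
 moreover have "real d * s ^ p \<le> r ^ p"
  using e(2) s unfolding rs power_mult_distrib by (simp add: mult.commute)
 then have "real d * s ^ (p + 1) \<le> s * r ^ p" using s by (simp add: mult_ac)
 ultimately have "real p * (s * r ^ p) \<le> real p * (\<Sum>i<d. f i ^ (p + 1))"
  by (simp add: algebra_simps)
 then have "s * r ^ p \<le> (\<Sum>i<d. f i ^ (p + 1))"
  using p by simp
 then show ?thesis by (simp add: s_def mult_ac)
qed

text \<open>The program knows \<open>v\<close> only through an estimate of \<open>v^p\<close>, but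
  the threshold uses \<open>v^(p-1)\<close>. If \<open>v\<close> exceeds \<open>r\<close>, one
  factor \<open>v\<close> is traded for the smaller \<open>r\<close>, so the error factor does not
  grow.\<close>

lemma root_pred_le:
 assumes "0 < r" "0 < (v::real)" "v ^ p \<le> (1 + e) * r ^ p" "0 < p" "0 \<le> e"
 shows "v ^ (p - 1) \<le> (1 + e) * r ^ (p - 1)"
proof (cases "v \<le> r")
 case True
 then have "v ^ (p - 1) \<le> 1 * r ^ (p - 1)" using assms by (simp add: power_mono)
 also have "\<dots> \<le> (1 + e) * r ^ (p - 1)" using assms by (intro mult_right_mono) auto
 finally show ?thesis .
next
 case False
 have "r * v ^ (p - 1) \<le> v * v ^ (p - 1)" using False assms by (intro mult_right_mono) auto
 also have "\<dots> = v ^ p" using power_minus_mult[of p v] assms by (simp add: mult.commute)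
 also note assms(3)
 also have "(1 + e) * r ^ p = r * ((1 + e) * r ^ (p - 1))" using power_minus_mult[OF assms(4), of r] by (simp add: mult_ac)
 finally show ?thesis using assms by simp
qed

lemma root_pred_ge:
 assumes "0 < r" "0 < (v::real)" "(1 - e) * r ^ p \<le> v ^ p" "0 < p" "0 \<le> e" "e \<le> 1"
 shows "(1 - e) * r ^ (p - 1) \<le> v ^ (p - 1)"
proof (cases "r \<le> v")
 case True
 have "(1 - e) * r ^ (p - 1) \<le> 1 * r ^ (p - 1)" using assms by (intro mult_right_mono) auto
 also have "\<dots> \<le> v ^ (p - 1)" using True assms by (simp add: power_mono)
 finally show ?thesis .
next
 case False
 have "r * ((1 - e) * r ^ (p - 1)) = (1 - e) * r ^ p" using assms power_minus_mult[of p r] by (simp add: mult_ac)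
 also have "\<dots> \<le> v * v ^ (p - 1)" using power_minus_mult[of p v] assms by (simp add: mult.commute)
 also have "\<dots> \<le> r * v ^ (p - 1)" using False assms by (intro mult_right_mono) auto
 finally show ?thesis using assms by simp
qed

text \<open>Only rows whose gradient times row bound is below the threshold are raised. The root
  \<rho> of the potential then grows by at most \<open>K\<close> times the growth of the sum of
  \<open>y\<close>, which keeps the spectral norm proportional to that sum. A row that is not raised
  has a large gradient and contributes to the dual certificate in \<open>packinv\<close>. The growth
  is stated for any upper bound \<open>R\<close> of \<rho>, so that an invariant need only carry the
  bound.\<close>

lemma packing_step:
 fixes x y r est :: "nat \<Rightarrow> real"
 assumes A: "A \<in> carrier_mat n d" and d: "0 < d"
  and U: "orth d U" "gram A x = fc U f" and f: "\<And>i. i < d \<Longrightarrow> 0 < f i"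
  and U': "orth d U'" "gram A x' = fc U' f'"
  and xy: "\<And>i. i < n \<Longrightarrow> x i = y i * r i" and y: "\<And>i. i < n \<Longrightarrow> 0 \<le> y i" and r: "\<And>i. i < n \<Longrightarrow> 0 \<le> r i"
  and p: "p = 2 ^ k" and e: "0 < e" "e \<le> 1 / 2" and a: "0 < a" "real p * a \<le> e" and th: "0 \<le> th"
  and est: "\<And>i. i < n \<Longrightarrow> (1 - e) * qf (fc U (\<lambda>i. f i ^ (p - 1))) (row A i) \<le> est i"
       "\<And>i. i < n \<Longrightarrow> est i \<le> (1 + e) * qf (fc U (\<lambda>i. f i ^ (p - 1))) (row A i)"
  and v: "0 < v" "v ^ p = (\<Sum>i<n. x i * est i)"
  and D: "\<And>i. i < n \<Longrightarrow> D i \<longleftrightarrow> est i * r i \<le> (1 + th) * v ^ (p - 1)"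
  and x': "\<And>i. i < n \<Longrightarrow> x' i = (if D i then 1 + a else 1) * x i"
 defines "K \<equiv> (1 + e)\<^sup>2 * (1 + th) / (1 - e)"
 defines "\<rho> \<equiv> root p (\<Sum>i<d. f i ^ p)"
 shows "\<rho> > 0" "\<And>R. 0 \<le> R \<Longrightarrow> (\<Sum>i<d. f i ^ p) \<le> R ^ p \<Longrightarrow>
      (\<Sum>i<d. f' i ^ p) \<le> (R + K * (a * (\<Sum>i<n. if D i then y i else 0))) ^ p"
  and "\<And>i. i < n \<Longrightarrow> \<not> D i \<Longrightarrow> (1 + th) * (1 - e) / (1 + e) * \<rho> ^ (p - 1) \<le> qf (fc U (\<lambda>i. f i ^ (p - 1))) (row A i) * r i"
  and "real d \<le> (1 + e) ^ p \<Longrightarrow> tr (fc U (\<lambda>i. f i ^ (p - 1))) \<le> (1 + e) * \<rho> ^ (p - 1)"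
proof -
 let ?P = "fc U (\<lambda>i. f i ^ (p - 1))"
 define q where "q i = qf ?P (row A i)" for i
 have p0: "0 < p" by (simp add: p)
 have rowc: "row A i \<in> carrier_vec d" for i using A by (metis row_carrier carrier_matD(2))
 have q0: "0 \<le> q i" for i unfolding q_def qf_fc[OF U(1) rowc]
  by (intro sum_nonneg mult_nonneg_nonneg) (use f in \<open>auto intro: less_imp_le\<close>)
 have S0: "0 < (\<Sum>i<d. f i ^ p)" using d f by (intro sum_pos) auto
 then show rho: "0 < \<rho>" unfolding \<rho>_def using p0 by simp
 have rhop: "(\<Sum>i<d. f i ^ p) = \<rho> ^ p" unfolding \<rho>_def using p0 S0 by simp
 have sumq: "(\<Sum>i<n. x i * q i) = \<rho> ^ p"
 proof -
  have "(\<Sum>i<n. x i * q i) = tr (?P * gram A x)" unfolding q_def by (subst tr_mult_gram[OF A]) (use U in auto)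
  also have "\<dots> = (\<Sum>i<d. f i ^ p)" unfolding U(2) using U(1) by (simp add: tr_fc power_minus_mult[OF p0, simplified])
  finally show ?thesis using rhop by simp
 qed
 have x0: "0 \<le> x i" if "i < n" for i using xy y r that by simp
 have "v ^ p \<le> (\<Sum>i<n. x i * ((1 + e) * q i))"
  unfolding v(2) q_def by (intro sum_mono mult_left_mono est x0) auto
 also have "\<dots> = (1 + e) * \<rho> ^ p" unfolding sumq[symmetric] by (simp add: sum_distrib_left mult_ac)
 finally have vle: "v ^ (p - 1) \<le> (1 + e) * \<rho> ^ (p - 1)" using rho v p0 e by (intro root_pred_le) auto
 have "(1 - e) * \<rho> ^ p = (\<Sum>i<n. x i * ((1 - e) * q i))" unfolding sumq[symmetric] by (simp add: sum_distrib_left mult_ac)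
 also have "\<dots> \<le> v ^ p"
  unfolding v(2) q_def by (intro sum_mono mult_left_mono est x0) auto
 finally have vge: "(1 - e) * \<rho> ^ (p - 1) \<le> v ^ (p - 1)" using rho v p0 e by (intro root_pred_ge) auto
 show "(1 + th) * (1 - e) / (1 + e) * \<rho> ^ (p - 1) \<le> qf ?P (row A i) * r i" if i: "i < n" "\<not> D i" for i
 proof -
  have "(1 + th) * ((1 - e) * \<rho> ^ (p - 1)) \<le> (1 + th) * v ^ (p - 1)" using vge th by (intro mult_left_mono) auto
  also have "\<dots> \<le> est i * r i" using D[OF i(1)] i(2) by simp
  also have "\<dots> \<le> ((1 + e) * q i) * r i" using est(2)[OF i(1)] r[OF i(1)] unfolding q_def by (intro mult_right_mono)
  finally show ?thesis using e unfolding q_def by (simp add: field_simps)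
 qed
 show "tr ?P \<le> (1 + e) * \<rho> ^ (p - 1)" if "real d \<le> (1 + e) ^ p"
  using sum_pow_pred_le[of d f p \<rho> e] f rhop rho p0 e that by (simp add: tr_fc[OF U(1)] less_imp_le)
 fix R :: real assume R: "0 \<le> R" "(\<Sum>i<d. f i ^ p) \<le> R ^ p"
 have rhoR: "\<rho> \<le> R" using R rho p0 unfolding rhop by (simp add: power_mono_iff)
 define w where "w i = (if D i then a * x i else 0)" for i
 define u where "u = a * (\<Sum>i<n. if D i then y i else 0)"
 have u0: "0 \<le> u" unfolding u_def using a y by (intro mult_nonneg_nonneg sum_nonneg) auto
 have x'w: "gram A x' = fc U f + gram A w"
  unfolding U(2)[symmetric] gram_add[OF A, symmetric]
  by (rule gram_cong[OF A]) (auto simp: x' w_def algebra_simps)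
 have *: "(\<Sum>i<d. f' i ^ 2 ^ k) \<le> (\<Sum>i<d. f i ^ 2 ^ k) + 2 ^ k * (1 + e) * tr (fc U (\<lambda>i. f i ^ (2 ^ k - 1)) * gram A w)"
 proof (rule tr_power_perturb[OF U(1) f, where D = "gram A w" and a = a])
  show "0 \<le> qf (gram A w) v" if "v \<in> carrier_vec d" for v
   unfolding qf_gram[OF A that] by (intro sum_nonneg mult_nonneg_nonneg) (use x0 a in \<open>auto simp: w_def\<close>)
  show "qf (gram A w) v \<le> a * qf (fc U f) v" if "v \<in> carrier_vec d" for v
   unfolding U(2)[symmetric] qf_gram[OF A that] sum_distrib_left mult.assoc[symmetric]
   by (intro sum_mono mult_right_mono) (use x0 a in \<open>auto simp: w_def\<close>)
 qed (use A a e p U' x'w in auto)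
 have "tr (?P * gram A w) = (\<Sum>i<n. w i * q i)" unfolding q_def by (subst tr_mult_gram[OF A]) (use U in auto)
 also have "\<dots> \<le> (\<Sum>i<n. a * (if D i then y i else 0) * ((1 + th) * (1 + e) / (1 - e) * \<rho> ^ (p - 1)))"
 proof (rule sum_mono)
  fix i assume "i \<in> {..<n}" then have i: "i < n" by simp
  show "w i * q i \<le> a * (if D i then y i else 0) * ((1 + th) * (1 + e) / (1 - e) * \<rho> ^ (p - 1))"
  proof (cases "D i")
   case True
   have "(1 - e) * q i * r i \<le> est i * r i" using est(1)[OF i] r[OF i] unfolding q_def by (intro mult_right_mono)
   also have "\<dots> \<le> (1 + th) * v ^ (p - 1)" using D[OF i] True by simp
   also have "\<dots> \<le> (1 + th) * ((1 + e) * \<rho> ^ (p - 1))" using vle th by (intro mult_left_mono) auto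
   finally have "q i * r i \<le> (1 + th) * (1 + e) / (1 - e) * \<rho> ^ (p - 1)"
    using e by (simp add: field_simps)
   then have "a * y i * (q i * r i) \<le> a * y i * ((1 + th) * (1 + e) / (1 - e) * \<rho> ^ (p - 1))"
    using a y[OF i] by (intro mult_left_mono) auto
   then show ?thesis using True xy[OF i] by (simp add: w_def mult_ac)
  qed (simp add: w_def)
 qed
 also have "\<dots> = u * ((1 + th) * (1 + e) / (1 - e) * \<rho> ^ (p - 1))"
  unfolding u_def sum_distrib_left sum_distrib_right ..
 finally have t: "tr (?P * gram A w) \<le> u * ((1 + th) * (1 + e) / (1 - e) * \<rho> ^ (p - 1))" .
 have "(\<Sum>i<d. f' i ^ p) \<le> \<rho> ^ p + real p * (1 + e) * tr (?P * gram A w)"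
  using * rhop unfolding p by simp
 also have "\<dots> \<le> \<rho> ^ p + real p * (1 + e) * (u * ((1 + th) * (1 + e) / (1 - e) * \<rho> ^ (p - 1)))"
  using t e by (intro add_left_mono mult_left_mono) auto
 \<comment> \<open>This is the tangent of \<open>t^p\<close> at \<rho>, evaluated at
   \<open>\<rho> + K * u\<close>; convexity turns additive growth of the potential into additive
   growth of its root.\<close>
 also have "\<dots> = \<rho> ^ p + real p * \<rho> ^ (p - 1) * ((\<rho> + K * u) - \<rho>)"
  unfolding K_def power2_eq_square by (simp add: mult_ac)
 also have "\<dots> \<le> (\<rho> + K * u) ^ p"
  by (rule pow_tangent) (use rho u0 e th p0 in \<open>auto simp: K_def\<close>)
 also have "\<dots> \<le> (R + K * u) ^ p"
  by (rule power_mono) (use rho u0 e th p0 rhoR in \<open>auto simp: K_def\<close>)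
 finally show "(\<Sum>i<d. f' i ^ p) \<le> (R + K * (a * (\<Sum>i<n. if D i then y i else 0))) ^ p"
  unfolding u_def .
qed

text \<open>The reciprocal of the \<open>p\<close>-th root of \<open>tr N^-p\<close> is a soft
  minimum of the spectrum of \<open>N\<close>, with lower bound \<open>l\<close>. A direction whose
  gradient progress matches \<open>h (1 - c)\<close> times the identity raises it almost as much as
  that multiple of the identity would.\<close>

lemma covering_step:
 fixes w :: "nat \<Rightarrow> real"
 assumes A: "A \<in> carrier_mat n d" and d: "0 < d"
  and U: "orth d U" and f: "\<And>i. i < d \<Longrightarrow> 1 \<le> f i"
  and U': "orth d U'" "fc U f + gram A w = fc U' f'"
  and w: "\<And>i. i < n \<Longrightarrow> 0 \<le> w i"
  and p: "p = 2 ^ k" and e: "0 < e" "e < 1" and a: "real p * a \<le> e" and h: "0 < h" and c: "c \<le> 1"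
  and wa: "\<And>v. v \<in> carrier_vec d \<Longrightarrow> qf (gram A w) v \<le> a * (v \<bullet> v)"
  and wt: "h * (1 - c) * tr (fc U (\<lambda>i. (1 / f i) ^ (p + 1))) \<le> tr (fc U (\<lambda>i. (1 / f i) ^ (p + 1)) * gram A w)"
  and de: "real d \<le> (1 + e) ^ p"
  and l: "0 < l" "(\<Sum>i<d. (1 / f i) ^ p) \<le> (1 / l) ^ p"
 shows "(\<Sum>i<d. (1 / f' i) ^ p) \<le> (1 / (l + (1 - e) * (1 - c) / (1 + e) * h)) ^ p"
proof -
 have p0: "0 < p" by (simp add: p)
 have f0: "0 < f i" if "i < d" for i using f[OF that] by simp
 have w0: "0 \<le> qf (gram A w) v" if "v \<in> carrier_vec d" for v
   unfolding qf_gram[OF A that] by (intro sum_nonneg mult_nonneg_nonneg) (use w in auto)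
 have f'0: "0 < f' i" if i: "i < d" for i
 proof -
  have "1 \<le> f' i"
  proof (rule fc_eigen_ge[OF U'(1) _ i])
   fix v :: "real vec" assume v: "v \<in> carrier_vec d"
   have "1 * (v \<bullet> v) \<le> qf (fc U f) v" by (rule qf_fc_ge[OF U v]) (use f in auto)
   then show "1 * (v \<bullet> v) \<le> qf (fc U' f') v" unfolding U'(2)[symmetric]
    using w0[OF v] U A v by (subst qf_add[of _ d]) auto
  qed
  then show ?thesis by simp
 qed
 have a0: "0 \<le> a"
  using w0[OF col_orth(1)[OF U d]] wa[OF col_orth(1)[OF U d]] col_orth(2)[OF U d] by simp
 define Y where "Y = (\<Sum>i<d. (1 / f i) ^ p)"
 have Y0: "0 < Y" unfolding Y_def using d f0 by (intro sum_pos) auto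
 define r where "r = root p Y"
 have r: "0 < r" "Y = r ^ p" using Y0 p0 by (auto simp: r_def)
 define g where "g = (1 - e) * (1 - c) / (1 + e) * h"
 have g0: "0 \<le> g" using e c h by (simp add: g_def)
 have "(\<Sum>i<d. (1 / f' i) ^ 2 ^ k) \<le> (\<Sum>i<d. (1 / f i) ^ 2 ^ k) - 2 ^ k * (1 - e) * tr (fc U (\<lambda>i. (1 / f i) ^ (2 ^ k + 1)) * gram A w)"
 proof (rule tr_inverse_power_perturb[OF U f0 _ _ w0])
  fix v :: "real vec" assume v: "v \<in> carrier_vec d"
  have "1 * (v \<bullet> v) \<le> qf (fc U f) v" by (rule qf_fc_ge[OF U v]) (use f in auto)
  \<comment> \<open>All eigenvalues of \<open>N\<close> are at least 1, so the absolute bound on the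
    step is also a bound relative to \<open>N\<close>.\<close>
  then show "qf (gram A w) v \<le> a * qf (fc U f) v"
   using wa[OF v] mult_left_mono[OF _ a0, of "1 * (v \<bullet> v)" "qf (fc U f) v"] by simp
 qed (use A a p U' f'0 in auto)
 also have "\<dots> \<le> r ^ p - real p * (1 - e) * (h * (1 - c) * (r ^ (p + 1) / (1 + e)))"
 proof -
  have "r ^ (p + 1) / (1 + e) \<le> tr (fc U (\<lambda>i. (1 / f i) ^ (p + 1)))"
   unfolding tr_fc[OF U] by (rule sum_pow_Suc_ge) (use f0 r de p0 e in \<open>auto simp: Y_def less_imp_le\<close>)
  then have "h * (1 - c) * (r ^ (p + 1) / (1 + e)) \<le> h * (1 - c) * tr (fc U (\<lambda>i. (1 / f i) ^ (p + 1)))"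
   using h c by (intro mult_left_mono) auto
  also note wt
  finally have "real p * (1 - e) * (h * (1 - c) * (r ^ (p + 1) / (1 + e))) \<le> real p * (1 - e) * tr (fc U (\<lambda>i. (1 / f i) ^ (p + 1)) * gram A w)"
   using e by (intro mult_left_mono) auto
  then show ?thesis using r(2) unfolding Y_def p by simp
 qed
 also have "\<dots> = r ^ p * (1 - real p * (g * r))" unfolding g_def by (simp add: field_simps)
 finally have 1: "(\<Sum>i<d. (1 / f' i) ^ p) \<le> r ^ p * (1 - real p * (g * r))" unfolding p .
 \<comment> \<open>It rests on \<open>1 - x \<le> exp (- x)\<close> and
   \<open>1 + x \<le> exp x\<close>, and it converts the decrease of \<open>r^p\<close> into the
   increase \<open>g\<close> of \<open>1 / r\<close>.\<close>
 have "(1 - real p * (g * r)) * (1 + g * r) ^ p \<le> 1"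
 proof (cases "1 - real p * (g * r) \<le> 0")
  case True
  then have "(1 - real p * (g * r)) * (1 + g * r) ^ p \<le> 0"
   using g0 r by (intro mult_nonpos_nonneg) auto
  then show ?thesis by simp
 next
  case False
  have "(1 + g * r) ^ p \<le> exp (g * r) ^ p" using g0 r by (intro power_mono) auto
  also have "\<dots> = exp (real p * (g * r))" by (simp add: exp_of_nat_mult)
  finally have "(1 - real p * (g * r)) * (1 + g * r) ^ p \<le> exp (- (real p * (g * r))) * exp (real p * (g * r))"
   using False exp_ge_add_one_self[of "- (real p * (g * r))"] g0 r by (intro mult_mono zero_le_power add_nonneg_nonneg) auto
  then show ?thesis by (simp add: exp_minus)
 qed
 then have 2: "1 - real p * (g * r) \<le> 1 / (1 + g * r) ^ p"
  using g0 r by (simp add: pos_le_divide_eq add_pos_nonneg)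
 have "(\<Sum>i<d. (1 / f' i) ^ p) \<le> r ^ p * (1 / (1 + g * r) ^ p)"
  using 1 mult_left_mono[OF 2, of "r ^ p"] r by simp
 also have "\<dots> = (1 / (1 / r + g)) ^ p" using r by (simp add: power_divide[symmetric] field_simps flip: power_divide)
 also have "\<dots> \<le> (1 / (l + g)) ^ p"
 proof (intro power_mono divide_left_mono add_right_mono)
  have "r \<le> 1 / l" using l r p0 unfolding Y_def[symmetric] by (simp add: power_mono_iff del: power_divide)
  then show "l \<le> 1 / r" using l r by (simp add: field_simps)
 qed (use l g0 r in \<open>auto intro!: mult_pos_pos add_pos_nonneg\<close>)
 finally show ?thesis unfolding g_def .
qed

section \<open>Full rank and condition numbers through quadratic forms\<close>

lemma full_rank_mult_vec_nz:
 assumes A: "(A :: real mat) \<in> carrier_mat n d" and rk: "vec_space.rank n A = d"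
  and v: "v \<in> carrier_vec d" "v \<noteq> 0\<^sub>v d"
 shows "A *\<^sub>v v \<noteq> 0\<^sub>v n"
proof
 assume z: "A *\<^sub>v v = 0\<^sub>v n"
 interpret vec_space "TYPE(real)" n .
 obtain S where S: "maximal S (\<lambda>T. T \<subseteq> set (cols A) \<and> lin_indpt T)"
  using maximal_exists[of "(\<lambda>T. T \<subseteq> set (cols A) \<and> lin_indpt T)" "card (set (cols A))" "{}"]
  by (meson List.finite_set card_mono empty_iff empty_subsetI finite_lin_indpt2 rev_finite_subset)
 have "d = card S" using rank_card_indpt[OF A S] rk by simp
 also have "card S \<le> card (set (cols A))" using S by (intro card_mono) (auto simp: maximal_def)
 \<comment> \<open>Rank and independence refer to the set of columns; distinctness comes first so
   that a kernel vector can be read as a dependence of that set.\<close>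
 finally have dist: "distinct (cols A)" using A
  by (metis card_distinct card_length carrier_matD(2) cols_length le_antisym)
 from lin_depI[OF A v z dist] full_rank_lin_indpt[OF A rk dist] show False by blast
qed

text \<open>Zero rows are exempt from positivity because the algorithm gives them row bound 0 and
  hence weight 0.\<close>

lemma qf_gram_pos:
 assumes A: "(A :: real mat) \<in> carrier_mat n d" and rk: "vec_space.rank n A = d"
  and v: "v \<in> carrier_vec d" "v \<noteq> 0\<^sub>v d"
  and w: "\<And>i. i < n \<Longrightarrow> 0 \<le> w i" "\<And>i. i < n \<Longrightarrow> row A i \<noteq> 0\<^sub>v d \<Longrightarrow> 0 < w i"
 shows "0 < qf (gram A w) v"
proof -
 have "A *\<^sub>v v \<noteq> 0\<^sub>v n" by (rule full_rank_mult_vec_nz[OF A rk v])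
 then obtain i where i: "i < n" "row A i \<bullet> v \<noteq> 0" using A
  by (metis carrier_matD(1) dim_mult_mat_vec eq_vecI index_mult_mat_vec index_zero_vec)
 then have "row A i \<noteq> 0\<^sub>v d" using v by auto
 with i w show ?thesis unfolding qf_gram[OF A v(1)] by (intro sum_pos2[of _ i]) auto
qed

lemma gram_spectral:
 assumes A: "(A :: real mat) \<in> carrier_mat n d" and rk: "vec_space.rank n A = d"
  and w: "\<And>i. i < n \<Longrightarrow> 0 \<le> w i" "\<And>i. i < n \<Longrightarrow> row A i \<noteq> 0\<^sub>v d \<Longrightarrow> 0 < w i"
 obtains U f where "orth d U" "gram A w = fc U f" "\<And>i. i < d \<Longrightarrow> 0 < f i"
proof -
 obtain U f where U: "orth d U" "gram A w = fc U f" using spectral_fc[OF gram_carrier[OF A] gram_sym[OF A]] by blast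
 have "0 < f i" if i: "i < d" for i
 proof -
  have nz: "col U i \<noteq> 0\<^sub>v d" using col_orth[OF U(1) i] by auto
  have "0 < qf (gram A w) (col U i)" by (rule qf_gram_pos[OF A rk col_orth(1)[OF U(1) i] nz w])
  then show ?thesis unfolding U(2) qf_col[OF U(1) i] .
 qed
 with U that show ?thesis by blast
qed

lemma spectrumE:
 assumes "(k :: real) \<in> spectrum M" "M \<in> carrier_mat d d"
 obtains v where "v \<in> carrier_vec d" "0 < v \<bullet> v" "qf M v = k * (v \<bullet> v)"
proof -
 from assms obtain v where v: "v \<in> carrier_vec d" "v \<noteq> 0\<^sub>v d" "M *\<^sub>v v = k \<cdot>\<^sub>v v"
  by (auto simp: spectrum_def eigenvalue_def eigenvector_def)
 then show ?thesis using scalar_prod_self_pos[of v d] by (intro that[of v]) (auto simp: qf_def)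
qed

lemma fc_spectrum:
 assumes "orth d U" "i < d"
 shows "f i \<in> spectrum (fc U f)"
proof -
 note U = orthD[OF assms(1)] and c = col_orth[OF assms]
 have "fc U f *\<^sub>v col U i = U *\<^sub>v (mat_diag d f *\<^sub>v (U\<^sup>T *\<^sub>v col U i))"
  using U c by (simp add: fc_def assoc_mult_mat_vec[of _ d d _ d])
 also have "U\<^sup>T *\<^sub>v col U i = unit_vec d i"
  by (rule eq_vecI) (use U(1) assms col_orth'[OF assms(1)] in auto)
 also have "mat_diag d f *\<^sub>v unit_vec d i = f i \<cdot>\<^sub>v unit_vec d i"
  by (rule eq_vecI) (use assms in \<open>auto simp: scalar_prod_right_unit\<close>)
 also have "U *\<^sub>v (f i \<cdot>\<^sub>v unit_vec d i) = f i \<cdot>\<^sub>v col U i"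
  by (rule eq_vecI) (use U(1) assms in \<open>auto simp: scalar_prod_right_unit\<close>)
 finally have "fc U f *\<^sub>v col U i = f i \<cdot>\<^sub>v col U i" .
 moreover have "col U i \<noteq> 0\<^sub>v d" using c by auto
 ultimately show ?thesis using c assms(1) by (auto simp: spectrum_def eigenvalue_def eigenvector_def)
qed

lemma cond_num_le:
 assumes M: "M \<in> carrier_mat d d" "M\<^sup>T = M" and d: "0 < d" and lo: "0 < lo"
  and q: "\<And>v. v \<in> carrier_vec d \<Longrightarrow> lo * (v \<bullet> v) \<le> qf M v" "\<And>v. v \<in> carrier_vec d \<Longrightarrow> qf M v \<le> hi * (v \<bullet> v)"
 shows "pos_def M" "cond_num M \<le> hi / lo"
proof -
 show "pos_def M" unfolding pos_def_def
 proof (intro conjI ballI impI)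
  fix v :: "real vec" assume "v \<in> carrier_vec (dim_row M)" "v \<noteq> 0\<^sub>v (dim_row M)"
  then have v: "v \<in> carrier_vec d" "v \<noteq> 0\<^sub>v d" using M by auto
  have "0 < lo * (v \<bullet> v)" using scalar_prod_self_pos[OF v] lo by simp
  with q(1)[OF v(1)] show "0 < v \<bullet> (M *\<^sub>v v)" unfolding qf_def by simp
 qed (use M in auto)
 have fin: "finite (spectrum M)" using card_finite_spectrum[OF M(1)] by simp
 obtain U f where U: "orth d U" "M = fc U f" using spectral_fc[OF M] by blast
 have ne: "spectrum M \<noteq> {}" using fc_spectrum[OF U(1) d, of f] U(2) by auto
 have b: "lo \<le> k \<and> k \<le> hi" if k: "k \<in> spectrum M" for k
 proof -
  obtain v where v: "v \<in> carrier_vec d" "0 < v \<bullet> v" "qf M v = k * (v \<bullet> v)" by (rule spectrumE[OF k M(1)])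
  from q(1)[OF v(1)] q(2)[OF v(1)] v(2) show ?thesis unfolding v(3) by simp
 qed
 have "Max (spectrum M) \<in> spectrum M" "Min (spectrum M) \<in> spectrum M" using fin ne by auto
 with b lo have "Max (spectrum M) \<le> hi" "lo \<le> Min (spectrum M)" "lo \<le> Max (spectrum M)" by auto
 then show "cond_num M \<le> hi / lo" unfolding cond_num_def using lo by (intro frac_le) auto
qed

lemma cond_num_witness:
 assumes M: "M \<in> carrier_mat d d" "pos_def M" and d: "0 < d"
 obtains m where "0 < m" "1 \<le> cond_num M"
  "\<And>v. v \<in> carrier_vec d \<Longrightarrow> m * (v \<bullet> v) \<le> qf M v" "\<And>v. v \<in> carrier_vec d \<Longrightarrow> qf M v \<le> m * cond_num M * (v \<bullet> v)"
proof -
 have s: "M\<^sup>T = M" using M by (simp add: pos_def_def)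
 have fin: "finite (spectrum M)" using card_finite_spectrum[OF M(1)] by simp
 obtain U f where U: "orth d U" "M = fc U f" using spectral_fc[OF M(1) s] by blast
 have ne: "spectrum M \<noteq> {}" using fc_spectrum[OF U(1) d, of f] U(2) by auto
 have pos: "0 < k" if k: "k \<in> spectrum M" for k
 proof -
  obtain v where v: "v \<in> carrier_vec d" "0 < v \<bullet> v" "qf M v = k * (v \<bullet> v)" by (rule spectrumE[OF k M(1)])
  have "v \<noteq> 0\<^sub>v d" using v by auto
  then have "0 < qf M v" using M v by (auto simp: pos_def_def qf_def)
  then show ?thesis using v(2) unfolding v(3) by (simp add: zero_less_mult_iff)
 qed
 let ?m = "Min (spectrum M)"
 have m: "?m \<in> spectrum M" "?m \<le> Max (spectrum M)" using fin ne by auto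
 then have m0: "0 < ?m" using pos by simp
 have mc: "?m * cond_num M = Max (spectrum M)" using m0 by (simp add: cond_num_def)
 have f: "?m \<le> f i" "f i \<le> Max (spectrum M)" if "i < d" for i
  using fc_spectrum[OF U(1) that, of f] U(2) fin by auto
 show ?thesis
 proof (rule that[OF m0])
  show "1 \<le> cond_num M" using m0 m by (simp add: cond_num_def)
  show "?m * (v \<bullet> v) \<le> qf M v" if "v \<in> carrier_vec d" for v unfolding U(2) by (rule qf_fc_ge[OF U(1) that]) (use f U(2) in auto)
  show "qf M v \<le> ?m * cond_num M * (v \<bullet> v)" if "v \<in> carrier_vec d" for v
   unfolding mc unfolding U(2) by (rule qf_fc_le[OF U(1) that]) (use f U(2) in auto)
 qed
qed

lemma diagonal_matD: "W \<in> carrier_mat n n \<Longrightarrow> diagonal_mat W \<Longrightarrow> W = mat_diag n (\<lambda>i. W $$ (i, i))"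
 by (rule eq_matI) (auto simp: diagonal_mat_def mat_diag_def)

text \<open>The definition is an infimum, and the analysis works with a scaling within the factor
  \<open>1 + e\<close> of it. Division by the smallest eigenvalue normalises the Gram matrix to lie
  between \<open>I\<close> and \<open>(1 + e) * opt_inner_cond A\<close> times
  \<open>I\<close>.\<close>

lemma opt_inner_cond_witness:
 assumes A: "(A :: real mat) \<in> carrier_mat n d" and rk: "vec_space.rank n A = d" and d: "0 < d" and e: "0 < e"
 shows "1 \<le> opt_inner_cond A"
  and "\<exists>w. (\<forall>i<n. 0 \<le> w i) \<and> (\<forall>v \<in> carrier_vec d. v \<bullet> v \<le> qf (gram A w) v \<and> qf (gram A w) v \<le> (1 + e) * opt_inner_cond A * (v \<bullet> v))"
proof -
 let ?S = "{cond_num (scaled_gram A W) | W. W \<in> carrier_mat (dim_row A) (dim_row A) \<and> diagonal_mat W \<and> pos_semidef W \<and>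
   pos_def (scaled_gram A W)}"
 \<comment> \<open>Unit weights show that the set of admissible condition numbers is nonempty; only
   then does the infimum carry information.\<close>
 have pd: "pos_def (gram A (\<lambda>_. 1))"
  unfolding pos_def_def
 proof (intro conjI ballI impI)
  fix v :: "real vec" assume v: "v \<in> carrier_vec (dim_row (gram A (\<lambda>_. 1)))" "v \<noteq> 0\<^sub>v (dim_row (gram A (\<lambda>_. 1)))"
  show "0 < v \<bullet> (gram A (\<lambda>_. 1) *\<^sub>v v)" using qf_gram_pos[OF A rk, of v "\<lambda>_. 1"] v A by (simp add: qf_def)
 qed (use A in auto)
 have "pos_semidef (mat_diag n (\<lambda>_. 1))"
  unfolding pos_semidef_def by (auto simp: mat_diag_def[symmetric])
 then have "cond_num (gram A (\<lambda>_. 1)) \<in> ?S"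
  using A pd by (intro CollectI exI[of _ "mat_diag n (\<lambda>_. 1)"]) (auto simp: gram_def diagonal_mat_def mat_diag_def)
 then have ne: "?S \<noteq> {}" by blast
 have ge1: "1 \<le> k" if "k \<in> ?S" for k
 proof -
  from that obtain W where W: "k = cond_num (scaled_gram A W)" "W \<in> carrier_mat n n" "pos_def (scaled_gram A W)" using A by auto
  have "scaled_gram A W \<in> carrier_mat d d" using W A by (auto simp: scaled_gram_def)
  from cond_num_witness[OF this W(3) d] W(1) show ?thesis by metis
 qed
 show opt1: "1 \<le> opt_inner_cond A" unfolding opt_inner_cond_def by (rule cInf_greatest[OF ne]) (use ge1 in auto)
 have "opt_inner_cond A < (1 + e) * opt_inner_cond A" using opt1 e by simp
 then obtain k where k: "k \<in> ?S" "k < (1 + e) * opt_inner_cond A"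
  using cInf_lessD[OF ne] unfolding opt_inner_cond_def by blast
 then obtain W where W: "k = cond_num (scaled_gram A W)" "W \<in> carrier_mat n n" "diagonal_mat W" "pos_semidef W" "pos_def (scaled_gram A W)"
  using A by auto
 define u where "u i = W $$ (i, i)" for i
 have Wu: "W = mat_diag n u" unfolding u_def by (rule diagonal_matD[OF W(2,3)])
 have gW: "scaled_gram A W = gram A u" using A by (simp add: gram_def Wu)
 have u0: "0 \<le> u i" if "i < n" for i
 proof -
  have "0 \<le> unit_vec n i \<bullet> (W *\<^sub>v unit_vec n i)" using W by (auto simp: pos_semidef_def)
  then show ?thesis using that W by (simp add: u_def scalar_prod_left_unit scalar_prod_right_unit)
 qed
 have pg: "pos_def (gram A u)" "k = cond_num (gram A u)" using W gW by auto
 obtain m where m: "0 < m" "1 \<le> cond_num (gram A u)"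
  "\<And>v. v \<in> carrier_vec d \<Longrightarrow> m * (v \<bullet> v) \<le> qf (gram A u) v" "\<And>v. v \<in> carrier_vec d \<Longrightarrow> qf (gram A u) v \<le> m * cond_num (gram A u) * (v \<bullet> v)"
  by (rule cond_num_witness[OF gram_carrier[OF A] pg(1) d]) auto
 show "\<exists>w. (\<forall>i<n. 0 \<le> w i) \<and> (\<forall>v \<in> carrier_vec d. v \<bullet> v \<le> qf (gram A w) v \<and> qf (gram A w) v \<le> (1 + e) * opt_inner_cond A * (v \<bullet> v))"
 proof (intro exI[of _ "\<lambda>i. (1 / m) * u i"] conjI allI impI ballI)
  fix v :: "real vec" assume v: "v \<in> carrier_vec d"
  have q: "qf (gram A (\<lambda>i. (1 / m) * u i)) v = (1 / m) * qf (gram A u) v"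
   unfolding gram_smult[OF A] using A v by (simp add: qf_smult[of _ d])
  show "v \<bullet> v \<le> qf (gram A (\<lambda>i. (1 / m) * u i)) v" unfolding q using m(1) m(3)[OF v] by (simp add: field_simps)
  have "(1 / m) * qf (gram A u) v \<le> k * (v \<bullet> v)" using m(1) m(4)[OF v] pg by (simp add: field_simps)
  also have "\<dots> \<le> (1 + e) * opt_inner_cond A * (v \<bullet> v)" using k(2) by (intro mult_right_mono) auto
  finally show "qf (gram A (\<lambda>i. (1 / m) * u i)) v \<le> (1 + e) * opt_inner_cond A * (v \<bullet> v)" unfolding q .
 qed (use u0 m in auto)
qed

section \<open>Chebyshev polynomials\<close>

fun cheb :: "real \<Rightarrow> nat \<Rightarrow> real" where
 "cheb s 0 = 1"
| "cheb s (Suc 0) = s"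
| "cheb s (Suc (Suc k)) = 2 * s * cheb s (Suc k) - cheb s k"

text \<open>The quotient of \<open>T\<^sub>k(a) - T\<^sub>k(a - b x)\<close> by \<open>x\<close>.\<close>

fun chebq :: "real \<Rightarrow> real \<Rightarrow> nat \<Rightarrow> real \<Rightarrow> real" where
 "chebq a b 0 x = 0"
| "chebq a b (Suc 0) x = b"
| "chebq a b (Suc (Suc k)) x = 2 * (a - b * x) * chebq a b (Suc k) x - chebq a b k x + 2 * b * cheb a (Suc k)"

lemma chebq_mult: "x * chebq a b k x = cheb a k - cheb (a - b * x) k"
proof (induction a b k x rule: chebq.induct)
 case (3 a b k x)
 have "x * chebq a b (Suc (Suc k)) x = 2 * (a - b * x) * (x * chebq a b (Suc k) x) - x * chebq a b k x + 2 * b * x * cheb a (Suc k)"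
  by (simp add: algebra_simps)
 then show ?case unfolding 3 by (simp add: algebra_simps)
qed auto

lemma cheb_cos: "cheb (cos t) k = cos (real k * t)"
proof (induction k rule: induct_nat_012)
 case (ge2 k)
 have "real (Suc (Suc k)) * t = real (Suc k) * t + t" "real k * t = real (Suc k) * t - t" by (simp_all add: algebra_simps)
 then have "cos (real (Suc (Suc k)) * t) + cos (real k * t) = 2 * cos t * cos (real (Suc k) * t)"
  by (simp only: cos_add cos_diff) simp
 then show ?case using ge2 by simp
qed auto

lemma abs_cheb_le_1: "\<bar>x\<bar> \<le> 1 \<Longrightarrow> \<bar>cheb x k\<bar> \<le> 1"
 using cheb_cos[of "arccos x" k] by (simp add: cos_arccos_abs)

lemma cheb_closed: "r \<noteq> 0 \<Longrightarrow> cheb ((r + 1 / r) / 2) k = (r ^ k + 1 / r ^ k) / 2"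
proof (induction k rule: induct_nat_012)
 case (ge2 k)
 have "cheb ((r + 1 / r) / 2) (Suc (Suc k)) = (r + 1 / r) * ((r ^ Suc k + 1 / r ^ Suc k) / 2) - (r ^ k + 1 / r ^ k) / 2"
  unfolding ge2.IH(2)[OF ge2.prems, symmetric] ge2.IH(1)[OF ge2.prems, symmetric] by (simp add: field_simps)
 also have "\<dots> = (r ^ Suc (Suc k) + 1 / r ^ Suc (Suc k)) / 2"
  using ge2.prems by (simp add: field_simps)
 finally show ?case .
qed (auto simp: field_simps)

text \<open>With \<open>1 + \<delta> = (r + 1 / r) / 2\<close> the value is
  \<open>(r^k + 1 / r^k) / 2\<close>, and \<open>r\<close> exceeds 1 by at least
  \<open>sqrt (2 * \<delta>)\<close>. This square root is why the degree grows only like the root of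
  the condition number.\<close>

lemma cheb_growth:
 assumes "0 \<le> \<delta>"
 shows "(1 + sqrt (2 * \<delta>)) ^ k / 2 \<le> cheb (1 + \<delta>) k"
proof -
 define r where "r = 1 + \<delta> + sqrt (\<delta>\<^sup>2 + 2 * \<delta>)"
 have sq: "(sqrt (\<delta>\<^sup>2 + 2 * \<delta>))\<^sup>2 = \<delta>\<^sup>2 + 2 * \<delta>" using assms by simp
 have r: "0 < r" using assms by (simp add: r_def add_pos_nonneg)
 have "r * (1 + \<delta> - sqrt (\<delta>\<^sup>2 + 2 * \<delta>)) = 1"
  using sq unfolding r_def by (simp add: algebra_simps power2_eq_square)
 then have "1 / r = 1 + \<delta> - sqrt (\<delta>\<^sup>2 + 2 * \<delta>)" using r by (simp add: field_simps)
 then have s: "1 + \<delta> = (r + 1 / r) / 2" by (simp add: r_def)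
 have c: "cheb (1 + \<delta>) k = (r ^ k + 1 / r ^ k) / 2" unfolding s by (rule cheb_closed) (use r in simp)
 have "sqrt (2 * \<delta>) \<le> sqrt (\<delta>\<^sup>2 + 2 * \<delta>)" by simp
 then have "1 + sqrt (2 * \<delta>) \<le> r" unfolding r_def using assms by linarith
 then have le: "(1 + sqrt (2 * \<delta>)) ^ k \<le> r ^ k" using assms by (intro power_mono) auto
 have "(1 + sqrt (2 * \<delta>)) ^ k / 2 \<le> (r ^ k + 1 / r ^ k) / 2"
  using le r by (intro divide_right_mono add_increasing2) auto
 then show ?thesis unfolding c .
qed

text \<open>The map \<open>a - b * x\<close> takes \<open>[1, hi]\<close> onto
  \<open>[-1, 1]\<close>, where Chebyshev polynomials are bounded by 1. Hence
  \<open>chebq a b k x / cheb a k\<close> approximates \<open>1 / x\<close> with relative error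
  \<open>1 / cheb a k\<close>.\<close>

lemma chebq_approx:
 assumes lh: "1 < hi" "1 \<le> x" "x \<le> hi"
 defines "a \<equiv> (hi + 1) / (hi - 1)" and "b \<equiv> 2 / (hi - 1)"
 shows "cheb a k - 1 \<le> x * chebq a b k x" "x * chebq a b k x \<le> cheb a k + 1"
proof -
 have "a - b * x = (hi + 1 - 2 * x) / (hi - 1)" unfolding a_def b_def by (simp add: diff_divide_distrib add_divide_distrib)
 moreover have "\<bar>(hi + 1 - 2 * x) / (hi - 1)\<bar> \<le> 1"
  using lh by (simp add: abs_le_iff divide_le_eq)
 ultimately have "\<bar>a - b * x\<bar> \<le> 1" by simp
 from abs_cheb_le_1[OF this, of k] show "cheb a k - 1 \<le> x * chebq a b k x" "x * chebq a b k x \<le> cheb a k + 1"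
  unfolding chebq_mult by auto
qed

subsection \<open>A structured language on the machine\<close>

text \<open>\<open>sc\<close> are scalar registers, \<open>vc\<close> arrays with one cell per row
  of \<open>A\<close>, \<open>ix\<close> the loop index, \<open>dr\<close> the position on the tape
  and \<open>ct\<close> the time. Counters other than \<open>ix\<close> are kept as reals, so that
  one kind of arithmetic suffices.\<close>

record hst =
 sc :: "nat \<Rightarrow> real"
 vc :: "nat \<Rightarrow> nat \<Rightarrow> real"
 ix :: nat
 dr :: nat
 ct :: nat

datatype bop = Add | Sub | Mul | Div
datatype test = TR nat nat | TN bool
datatype com =
  Cst nat int | Bin bop nat nat nat | Rt nat nat | Gau nat | Ld nat nat | St nat nat
 | MV nat nat | MTV nat nat | IxZ | IxS
 | Seq com com (infixr ";;" 60) | If test com com | Wh test com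

fun bsem :: "bop \<Rightarrow> real \<Rightarrow> real \<Rightarrow> real" where
 "bsem Add x y = x + y"
| "bsem Sub x y = x - y"
| "bsem Mul x y = x * y"
| "bsem Div x y = x / y"

definition dm :: "real mat \<Rightarrow> bool \<Rightarrow> nat" where
 "dm A b = (if b then dim_row A else dim_col A)"

fun tst :: "real mat \<Rightarrow> test \<Rightarrow> hst \<Rightarrow> bool" where
 "tst A (TR a b) h = (sc h a < sc h b)"
| "tst A (TN b) h = (ix h < dm A b)"

definition Af :: "real mat \<Rightarrow> rseq \<Rightarrow> nat \<Rightarrow> real" where
 "Af A v i = (\<Sum>j<dim_col A. A $$ (i, j) * v j)"

definition Atf :: "real mat \<Rightarrow> rseq \<Rightarrow> nat \<Rightarrow> real" where
 "Atf A v j = (\<Sum>i<dim_row A. A $$ (i, j) * v i)"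

definition upd_upto :: "nat \<Rightarrow> rseq \<Rightarrow> rseq \<Rightarrow> nat \<Rightarrow> real" where
 "upd_upto k f g = (\<lambda>i. if i < k then f i else g i)"

text \<open>The last component of the state counts execution time; \<open>T\<close> is the cost of a matrix-vector product.\<close>

inductive big :: "real mat \<Rightarrow> nat \<Rightarrow> rseq \<Rightarrow> com \<Rightarrow> hst \<Rightarrow> hst \<Rightarrow> bool" for A T rnd where
 Cst: "big A T rnd (Cst r k) h (h\<lparr>sc := (sc h)(r := real_of_int k), ct := ct h + 1\<rparr>)"
| Bin: "big A T rnd (Bin b r x y) h (h\<lparr>sc := (sc h)(r := bsem b (sc h x) (sc h y)), ct := ct h + 1\<rparr>)"
| Rt: "big A T rnd (Rt r x) h (h\<lparr>sc := (sc h)(r := sqrt (sc h x)), ct := ct h + 1\<rparr>)"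
| Gau: "big A T rnd (Gau r) h (h\<lparr>sc := (sc h)(r := rnd (dr h)), dr := Suc (dr h), ct := ct h + 1\<rparr>)"
| Ld: "ix h < dim_row A \<Longrightarrow> big A T rnd (Ld r a) h (h\<lparr>sc := (sc h)(r := vc h a (ix h)), ct := ct h + 2\<rparr>)"
| St: "ix h < dim_row A \<Longrightarrow> big A T rnd (St a r) h (h\<lparr>vc := (vc h)(a := (vc h a)(ix h := sc h r)), ct := ct h + 2\<rparr>)"
| MV: "big A T rnd (MV a b) h (h\<lparr>vc := (vc h)(a := upd_upto (dim_row A) (Af A (vc h b)) (vc h a)), ct := ct h + T\<rparr>)"
| MTV: "big A T rnd (MTV a b) h (h\<lparr>vc := (vc h)(a := upd_upto (dim_col A) (Atf A (vc h b)) (vc h a)), ct := ct h + T\<rparr>)"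
| IxZ: "big A T rnd IxZ h (h\<lparr>ix := 0, ct := ct h + 1\<rparr>)"
| IxS: "big A T rnd IxS h (h\<lparr>ix := Suc (ix h), ct := ct h + 1\<rparr>)"
| Seq: "big A T rnd c1 h h1 \<Longrightarrow> big A T rnd c2 h1 h2 \<Longrightarrow> big A T rnd (c1 ;; c2) h h2"
| IfT: "tst A t h \<Longrightarrow> big A T rnd c1 (h\<lparr>ct := ct h + 2\<rparr>) h' \<Longrightarrow> big A T rnd (If t c1 c2) h h'"
| IfF: "\<not> tst A t h \<Longrightarrow> big A T rnd c2 (h\<lparr>ct := ct h + 2\<rparr>) h' \<Longrightarrow> big A T rnd (If t c1 c2) h h'"
| WhF: "\<not> tst A t h \<Longrightarrow> big A T rnd (Wh t c) h (h\<lparr>ct := ct h + 2\<rparr>)"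
| WhT: "\<lbrakk>tst A t h; big A T rnd c (h\<lparr>ct := ct h + 2\<rparr>) h1; big A T rnd (Wh t c) h1 h2\<rbrakk> \<Longrightarrow> big A T rnd (Wh t c) h h2"

definition nregs :: nat where "nregs = 50"
definition narrs :: nat where "narrs = 20"

fun wf :: "com \<Rightarrow> bool" where
 "wf (Cst r k) = (r < nregs)"
| "wf (Bin b r x y) = (r < nregs \<and> x < nregs \<and> y < nregs)"
| "wf (Rt r x) = (r < nregs \<and> x < nregs)"
| "wf (Gau r) = (r < nregs)"
| "wf (Ld r a) = (r < nregs \<and> a < narrs)"
| "wf (St a r) = (r < nregs \<and> a < narrs)"
| "wf (MV a b) = (a < narrs \<and> b < narrs)"
| "wf (MTV a b) = (a < narrs \<and> b < narrs)"
| "wf IxZ = True"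
| "wf IxS = True"
| "wf (c1 ;; c2) = (wf c1 \<and> wf c2)"
| "wf (If t c1 c2) = ((case t of TR a b \<Rightarrow> a < nregs \<and> b < nregs | TN b \<Rightarrow> True) \<and> wf c1 \<and> wf c2)"
| "wf (Wh t c) = ((case t of TR a b \<Rightarrow> a < nregs \<and> b < nregs | TN b \<Rightarrow> True) \<and> wf c)"

section \<open>Compilation to the machine\<close>

text \<open>
 Cells 2 and 3 of the memory of natural numbers hold the constants 0 and 1, cell 4 the loop index,
 cell 5 is scratch space, and the cells from 6 hold the addresses of the arrays.
\<close>

fun jmp :: "test \<Rightarrow> nat \<Rightarrow> instr" where
 "jmp (TR a b) l = JumpRLess a b l"
| "jmp (TN b) l = JumpNLess 4 (if b then 0 else 1) l"

fun bin :: "bop \<Rightarrow> nat \<Rightarrow> nat \<Rightarrow> nat \<Rightarrow> instr" where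
 "bin Add = RAdd" | "bin Sub = RSub" | "bin Mul = RMul" | "bin Div = RDiv"

fun csize :: "com \<Rightarrow> nat" where
 "csize (Ld r a) = 2"
| "csize (St a r) = 2"
| "csize (c1 ;; c2) = csize c1 + csize c2"
| "csize (If t c1 c2) = csize c1 + csize c2 + 2"
| "csize (Wh t c) = csize c + 3"
| "csize _ = 1"

text \<open>\<open>JumpNLess 2 3\<close> always jumps because these cells hold 0 and 1. A true test
  jumps, so the else branch is placed first. The address \<open>p\<close> of the code is a parameter
  since jump targets are absolute.\<close>

fun comp :: "nat \<Rightarrow> com \<Rightarrow> instr list" where
 "comp p (Cst r k) = [RConst r k]"
| "comp p (Bin b r x y) = [bin b r x y]"
| "comp p (Rt r x) = [RSqrt r x]"
| "comp p (Gau r) = [Gauss r]"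
| "comp p (Ld r a) = [NAdd 5 (6 + a) 4, RLoad r 5]"
| "comp p (St a r) = [NAdd 5 (6 + a) 4, RStore 5 r]"
| "comp p (MV a b) = [MatVec (6 + a) (6 + b)]"
| "comp p (MTV a b) = [MatTVec (6 + a) (6 + b)]"
| "comp p IxZ = [NConst 4 0]"
| "comp p IxS = [NAdd 4 4 3]"
| "comp p (c1 ;; c2) = comp p c1 @ comp (p + csize c1) c2"
| "comp p (If t c1 c2) = jmp t (p + csize c2 + 2) # comp (p + 1) c2 @ [JumpNLess 2 3 (p + csize c1 + csize c2 + 2)]
   @ comp (p + csize c2 + 2) c1"
| "comp p (Wh t c) = jmp t (p + 2) # JumpNLess 2 3 (p + csize c + 3) # comp (p + 2) c @ [JumpNLess 2 3 p]"

lemma length_comp[simp]: "length (comp p c) = csize c"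
 by (induction c arbitrary: p) auto

definition code_at :: "program \<Rightarrow> nat \<Rightarrow> instr list \<Rightarrow> bool" where
 "code_at P p is \<longleftrightarrow> (\<exists>xs ys. P = xs @ is @ ys \<and> length xs = p)"

lemma code_at_append: "code_at P p (is1 @ is2) \<longleftrightarrow> code_at P p is1 \<and> code_at P (p + length is1) is2"
proof
 assume "code_at P p (is1 @ is2)"
 then obtain xs ys where "P = xs @ (is1 @ is2) @ ys" "length xs = p" by (auto simp: code_at_def)
 then show "code_at P p is1 \<and> code_at P (p + length is1) is2"
  unfolding code_at_def by (metis append.assoc length_append)
next
 assume "code_at P p is1 \<and> code_at P (p + length is1) is2"
 then obtain xs ys xs' ys' where *: "P = xs @ is1 @ ys" "length xs = p" "P = xs' @ is2 @ ys'" "length xs' = p + length is1"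
  unfolding code_at_def by blast
 then have "(xs @ is1) @ ys = xs' @ (is2 @ ys')" "length (xs @ is1) = length xs'" by auto
 then have "xs @ is1 = xs'" "ys = is2 @ ys'" using append_eq_append_conv by blast+
 with * show "code_at P p (is1 @ is2)" unfolding code_at_def by (metis append.assoc)
qed

lemma code_at_single: "code_at P p [i] \<Longrightarrow> p < length P \<and> P ! p = i"
 by (auto simp: code_at_def)

definition sim :: "real mat \<Rightarrow> state \<Rightarrow> hst \<Rightarrow> bool" where
 "sim A s h \<longleftrightarrow> nmem s 0 = dim_row A \<and> nmem s 1 = dim_col A \<and> nmem s 2 = 0 \<and> nmem s 3 = 1 \<and> nmem s 4 = ix h
   \<and> (\<forall>j<narrs. nmem s (6 + j) = nregs + j * dim_row A)
   \<and> (\<forall>r<nregs. rmem s r = sc h r) \<and> (\<forall>j<narrs. \<forall>i<dim_row A. rmem s (nregs + j * dim_row A + i) = vc h j i)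
   \<and> draws s = dr h"

lemma sim_ct[simp]: "sim A s (h\<lparr>ct := k\<rparr>) = sim A s h"
 by (simp add: sim_def)

text \<open>The bounds on the program counter record that the run stays inside the compiled
  fragment. Later they show that the head of the main loop is not passed in between, so that its
  visits can be counted.\<close>

definition reach :: "program \<Rightarrow> real mat \<Rightarrow> nat \<Rightarrow> rseq \<Rightarrow> nat \<Rightarrow> nat \<Rightarrow> state \<Rightarrow> state \<Rightarrow> bool" where
 "reach P A T rnd lo hi s s' \<longleftrightarrow> (\<exists>k. (step P A T rnd ^^ k) s = s' \<and> (\<forall>i<k. lo \<le> pc ((step P A T rnd ^^ i) s) \<and> pc ((step P A T rnd ^^ i) s) < hi))"

lemma reach_trans:
 assumes "reach P A T rnd lo hi s s'" "reach P A T rnd lo hi s' s''"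
 shows "reach P A T rnd lo hi s s''"
proof -
 let ?f = "step P A T rnd"
 from assms obtain k l where k: "(?f ^^ k) s = s'" "\<forall>i<k. lo \<le> pc ((?f ^^ i) s) \<and> pc ((?f ^^ i) s) < hi"
  and l: "(?f ^^ l) s' = s''" "\<forall>i<l. lo \<le> pc ((?f ^^ i) s') \<and> pc ((?f ^^ i) s') < hi"
  unfolding reach_def by blast
 have *: "(?f ^^ (i + k)) s = (?f ^^ i) s'" for i using k(1) by (simp add: funpow_add)
 have "lo \<le> pc ((?f ^^ i) s) \<and> pc ((?f ^^ i) s) < hi" if "i < l + k" for i
 proof (cases "i < k")
  case True then show ?thesis using k by auto
 next
  case False
  then have "i = (i - k) + k" "i - k < l" using that by auto
  then show ?thesis using * l by metis
 qed
 then show ?thesis unfolding reach_def using *[of l] l(1) by blast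
qed

lemma reach_mono: "\<lbrakk>reach P A T rnd lo hi s s'; lo' \<le> lo; hi \<le> hi'\<rbrakk> \<Longrightarrow> reach P A T rnd lo' hi' s s'"
proof -
 assume a: "reach P A T rnd lo hi s s'" "lo' \<le> lo" "hi \<le> hi'"
 let ?f = "step P A T rnd"
 from a(1) obtain k where k: "(?f ^^ k) s = s'" "\<forall>i<k. lo \<le> pc ((?f ^^ i) s) \<and> pc ((?f ^^ i) s) < hi"
  unfolding reach_def by blast
 have "lo' \<le> pc ((?f ^^ i) s) \<and> pc ((?f ^^ i) s) < hi'" if "i < k" for i
 proof -
  have "lo \<le> pc ((?f ^^ i) s)" "pc ((?f ^^ i) s) < hi" using k(2) that by auto
  with a(2,3) show ?thesis by linarith
 qed
 with k(1) show ?thesis unfolding reach_def by blast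
qed

lemma reach_step:
 assumes "pc s = p" "code_at P p [i]" "lo \<le> p" "p < hi"
 shows "reach P A T rnd lo hi s (exec A rnd i (s\<lparr>pc := Suc p, clock := clock s + cost T i\<rparr>))"
 unfolding reach_def using code_at_single[OF assms(2)] assms by (intro exI[of _ 1]) (auto simp: step_def halted_def)

lemma arr_addr_inj:
 assumes "nregs + j * (n::nat) + i = nregs + j' * n + i'" "i < n" "i' < n"
 shows "j = j' \<and> i = i'"
proof -
 have eq: "j * n + i = j' * n + i'" using assms by simp
 have "(j * n + i) div n = j" "(j' * n + i') div n = j'" "(j * n + i) mod n = i" "(j' * n + i') mod n = i'"
  using assms(2,3) by auto
 with eq show ?thesis by metis
qed

lemma sim_jmp:
 assumes "pc s = p" "code_at P p [jmp t l]" "sim A s h" "lo \<le> p" "p < hi"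
  and "case t of TR a b \<Rightarrow> a < nregs \<and> b < nregs | TN b \<Rightarrow> True"
 shows "\<exists>s'. reach P A T rnd lo hi s s' \<and> pc s' = (if tst A t h then l else Suc p) \<and> sim A s' h \<and> clock s' = clock s + 1"
proof (intro exI conjI)
 show "reach P A T rnd lo hi s (exec A rnd (jmp t l) (s\<lparr>pc := Suc p, clock := clock s + cost T (jmp t l)\<rparr>))"
  by (rule reach_step[OF assms(1,2,4,5)])
qed (use assms in \<open>cases t; auto simp: sim_def dm_def\<close>)+

lemma sim_goto:
 assumes "pc s = p" "code_at P p [JumpNLess 2 3 l]" "sim A s h" "lo \<le> p" "p < hi"
 shows "\<exists>s'. reach P A T rnd lo hi s s' \<and> pc s' = l \<and> sim A s' h \<and> clock s' = clock s + 1"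
proof (intro exI conjI)
 show "reach P A T rnd lo hi s (exec A rnd (JumpNLess 2 3 l) (s\<lparr>pc := Suc p, clock := clock s + cost T (JumpNLess 2 3 l)\<rparr>))"
  by (rule reach_step[OF assms(1,2,4,5)])
qed (use assms in \<open>auto simp: sim_def\<close>)

lemma mat_vec_read:
 assumes "\<forall>i<dim_row A. mem (b + i) = v i" "dim_col A \<le> dim_row A" "i < dim_row A"
 shows "(A *\<^sub>v read_vec mem b (dim_col A)) $ i = Af A v i"
 using assms by (auto simp: read_vec_def Af_def scalar_prod_def atLeast0LessThan intro!: sum.cong)

lemma mat_tvec_read:
 assumes "\<forall>i<dim_row A. mem (b + i) = v i" "i < dim_col A"
 shows "(A\<^sup>T *\<^sub>v read_vec mem b (dim_row A)) $ i = Atf A v i"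
 using assms by (auto simp: read_vec_def Atf_def scalar_prod_def atLeast0LessThan intro!: sum.cong)

lemma array_write:
 assumes "\<forall>j<narrs. \<forall>i<n. mem (nregs + j * n + i) = V j i" "dim_vec w = k" "k \<le> n" "\<And>i. i < k \<Longrightarrow> w $ i = f i" "a < narrs"
 shows "\<forall>j<narrs. \<forall>i<n. write_vec mem (nregs + a * n) w (nregs + j * n + i) = (V(a := upd_upto k f (V a))) j i"
proof (intro allI impI)
 fix j i assume ji: "j < narrs" "i < n"
 show "write_vec mem (nregs + a * n) w (nregs + j * n + i) = (V(a := upd_upto k f (V a))) j i"
 proof (cases "nregs + a * n \<le> nregs + j * n + i \<and> nregs + j * n + i < nregs + a * n + k")
  case True
  define l where "l = nregs + j * n + i - (nregs + a * n)"
  have "nregs + j * n + i = nregs + a * n + l" "l < k" using True by (auto simp: l_def)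
  then have "j = a" "i = l" using arr_addr_inj[of j n i a l] ji assms(3) by auto
  then show ?thesis using True assms \<open>l < k\<close> by (simp add: write_vec_def upd_upto_def)
 next
  case False
  then have "\<not> (j = a \<and> i < k)" by auto
  then show ?thesis using False assms ji by (auto simp: write_vec_def upd_upto_def)
 qed
qed

lemma comp_single:
 assumes "pc s = p" "code_at P p [i]"
  and "sim A (exec A rnd i (s\<lparr>pc := Suc p, clock := clock s + cost T i\<rparr>)) h'"
  and "pc (exec A rnd i (s\<lparr>pc := Suc p, clock := clock s + cost T i\<rparr>)) = Suc p"
  and "clock (exec A rnd i (s\<lparr>pc := Suc p, clock := clock s + cost T i\<rparr>)) + ct h \<le> clock s + ct h'"
  and "csize c = 1"
 shows "\<exists>s'. reach P A T rnd p (p + csize c) s s' \<and> sim A s' h' \<and> pc s' = p + csize c \<and> clock s' + ct h \<le> clock s + ct h'"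
 using reach_step[OF assms(1,2), of p "p + 1" A T rnd] assms(3-) by auto

text \<open>The source cost is an upper bound: every test is charged 2, although a true conditional
  executes only one jump. \<open>dim_col A \<le> dim_row A\<close> makes arrays of one common length
  large enough for both kinds of vectors.\<close>

theorem comp_correct:
 assumes "big A T rnd c h h'" "wf c" "code_at P p (comp p c)" "sim A s h" "pc s = p" "dim_col A \<le> dim_row A"
 shows "\<exists>s'. reach P A T rnd p (p + csize c) s s' \<and> sim A s' h' \<and> pc s' = p + csize c \<and> clock s' + ct h \<le> clock s + ct h'"
 using assms
proof (induction arbitrary: p s rule: big.induct)
 case (Cst r k h)
 show ?case by (rule comp_single[OF Cst(4), where i = "RConst r k"]) (use Cst in \<open>auto simp: sim_def nregs_def\<close>)
next
 case (Bin b r x y h)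
 have *: "exec A rnd (bin b r x y) s' = s'\<lparr>rmem := (rmem s')(r := bsem b (rmem s' x) (rmem s' y))\<rparr>"
  "cost T (bin b r x y) = 1" for s' by (cases b; simp)+
 show ?case by (rule comp_single[OF Bin(4), where i = "bin b r x y"]) (use Bin in \<open>auto simp: sim_def *\<close>)
next
 case (Rt r x h)
 show ?case by (rule comp_single[OF Rt(4), where i = "RSqrt r x"]) (use Rt in \<open>auto simp: sim_def\<close>)
next
 case (Gau r h)
 show ?case by (rule comp_single[OF Gau(4), where i = "Gauss r"]) (use Gau in \<open>auto simp: sim_def\<close>)
next
 case (Ld h r a)
 have c: "code_at P p [NAdd 5 (6 + a) 4]" "code_at P (p + 1) [RLoad r 5]"
  using code_at_append[of P p "[NAdd 5 (6 + a) 4]" "[RLoad r 5]"] Ld(3) by auto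
 let ?s1 = "exec A rnd (NAdd 5 (6 + a) 4) (s\<lparr>pc := Suc p, clock := clock s + cost T (NAdd 5 (6 + a) 4)\<rparr>)"
 have r1: "reach P A T rnd p (p + csize (Ld r a)) s ?s1" by (rule reach_step[OF Ld(5) c(1)]) auto
 have p1: "pc ?s1 = p + 1" by simp
 let ?s2 = "exec A rnd (RLoad r 5) (?s1\<lparr>pc := Suc (p + 1), clock := clock ?s1 + cost T (RLoad r 5)\<rparr>)"
 have r2: "reach P A T rnd p (p + csize (Ld r a)) ?s1 ?s2" by (rule reach_step[OF p1 c(2)]) auto
 show ?case
  by (rule exI, rule conjI, rule reach_trans[OF r1 r2]) (use Ld in \<open>auto simp: sim_def\<close>)
next
 case (St h a r)
 have c: "code_at P p [NAdd 5 (6 + a) 4]" "code_at P (p + 1) [RStore 5 r]"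
  using code_at_append[of P p "[NAdd 5 (6 + a) 4]" "[RStore 5 r]"] St(3) by auto
 let ?s1 = "exec A rnd (NAdd 5 (6 + a) 4) (s\<lparr>pc := Suc p, clock := clock s + cost T (NAdd 5 (6 + a) 4)\<rparr>)"
 have r1: "reach P A T rnd p (p + csize (St a r)) s ?s1" by (rule reach_step[OF St(5) c(1)]) auto
 have p1: "pc ?s1 = p + 1" by simp
 let ?s2 = "exec A rnd (RStore 5 r) (?s1\<lparr>pc := Suc (p + 1), clock := clock ?s1 + cost T (RStore 5 r)\<rparr>)"
 have r2: "reach P A T rnd p (p + csize (St a r)) ?s1 ?s2" by (rule reach_step[OF p1 c(2)]) auto
 have ne: "nregs + j * dim_row A + i \<noteq> nregs + a * dim_row A + ix h" if "i < dim_row A" "j \<noteq> a \<or> i \<noteq> ix h" for i j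
  using arr_addr_inj[of j "dim_row A" i a "ix h"] that St by auto
 show ?case
  by (rule exI, rule conjI, rule reach_trans[OF r1 r2]) (use St ne in \<open>auto simp: sim_def\<close>)
next
 case (MV a b h)
 have *: "\<forall>i<dim_row A. rmem s (nregs + b * dim_row A + i) = vc h b i" using MV by (auto simp: sim_def)
 have **: "\<forall>j<narrs. \<forall>i<dim_row A. write_vec (rmem s) (nregs + a * dim_row A) (A *\<^sub>v read_vec (rmem s) (nregs + b * dim_row A) (dim_col A)) (nregs + j * dim_row A + i)
   = ((vc h)(a := upd_upto (dim_row A) (Af A (vc h b)) (vc h a))) j i"
  by (rule array_write) (use MV * in \<open>auto simp: sim_def simp del: index_mult_mat_vec intro!: mat_vec_read\<close>)
 show ?case by (rule comp_single[OF MV(4), where i = "MatVec (6 + a) (6 + b)"]) (use MV ** in \<open>auto simp: sim_def write_vec_def\<close>)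
next
 case (MTV a b h)
 have *: "\<forall>i<dim_row A. rmem s (nregs + b * dim_row A + i) = vc h b i" using MTV by (auto simp: sim_def)
 have **: "\<forall>j<narrs. \<forall>i<dim_row A. write_vec (rmem s) (nregs + a * dim_row A) (A\<^sup>T *\<^sub>v read_vec (rmem s) (nregs + b * dim_row A) (dim_row A)) (nregs + j * dim_row A + i)
   = ((vc h)(a := upd_upto (dim_col A) (Atf A (vc h b)) (vc h a))) j i"
  by (rule array_write) (use MTV * in \<open>auto simp: sim_def simp del: index_mult_mat_vec intro!: mat_tvec_read\<close>)
 show ?case by (rule comp_single[OF MTV(4), where i = "MatTVec (6 + a) (6 + b)"]) (use MTV ** in \<open>auto simp: sim_def write_vec_def\<close>)
next
 case (IxZ h)
 show ?case by (rule comp_single[OF IxZ(4), where i = "NConst 4 0"]) (use IxZ in \<open>auto simp: sim_def\<close>)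
next
 case (IxS h)
 show ?case by (rule comp_single[OF IxS(4), where i = "NAdd 4 4 3"]) (use IxS in \<open>auto simp: sim_def\<close>)
next
 case (Seq c1 h h1 c2 h2)
 have c: "code_at P p (comp p c1)" "code_at P (p + csize c1) (comp (p + csize c1) c2)"
  using Seq.prems(2) by (auto simp: code_at_append)
 from Seq.IH(1)[OF _ c(1) Seq.prems(3,4,5)] Seq.prems(1) obtain s1 where
  s1: "reach P A T rnd p (p + csize c1) s s1" "sim A s1 h1" "pc s1 = p + csize c1" "clock s1 + ct h \<le> clock s + ct h1" by auto
 from Seq.IH(2)[OF _ c(2) s1(2,3) Seq.prems(5)] Seq.prems(1) obtain s2 where
  s2: "reach P A T rnd (p + csize c1) (p + csize c1 + csize c2) s1 s2" "sim A s2 h2" "pc s2 = p + csize c1 + csize c2"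
   "clock s2 + ct h1 \<le> clock s1 + ct h2" by auto
 have "reach P A T rnd p (p + csize (c1 ;; c2)) s s2"
  by (rule reach_trans[OF reach_mono[OF s1(1)] reach_mono[OF s2(1)]]) auto
 then show ?case using s1 s2 by (auto simp: add.assoc)
next
 case (IfT t h c1 h' c2)
 let ?c = "If t c1 c2"
 have c: "code_at P p [jmp t (p + csize c2 + 2)]" "code_at P (p + csize c2 + 2) (comp (p + csize c2 + 2) c1)"
  using IfT.prems(2) code_at_append[of P p "[jmp t (p + csize c2 + 2)]" "comp (p + 1) c2 @ [JumpNLess 2 3 (p + csize c1 + csize c2 + 2)]
   @ comp (p + csize c2 + 2) c1"]
   code_at_append[of P "p + 1 + csize c2" "[JumpNLess 2 3 (p + csize c1 + csize c2 + 2)]" "comp (p + csize c2 + 2) c1"]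
   code_at_append[of P "p + 1" "comp (p + 1) c2" "[JumpNLess 2 3 (p + csize c1 + csize c2 + 2)] @ comp (p + csize c2 + 2) c1"]
  by simp_all
 obtain s1 where s1: "reach P A T rnd p (p + csize ?c) s s1" "pc s1 = p + csize c2 + 2" "sim A s1 (h\<lparr>ct := ct h + 2\<rparr>)" "clock s1 = clock s + 1"
  using sim_jmp[OF IfT.prems(4) c(1) IfT.prems(3), where lo = p and hi = "p + csize ?c" and T = T and rnd = rnd] IfT.prems(1) IfT.hyps(1) by auto
 from IfT.IH[OF _ c(2) s1(3,2) IfT.prems(5)] IfT.prems(1) obtain s2 where
  s2: "reach P A T rnd (p + csize c2 + 2) (p + csize c2 + 2 + csize c1) s1 s2" "sim A s2 h'" "pc s2 = p + csize c2 + 2 + csize c1"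
   "clock s2 + (ct h + 2) \<le> clock s1 + ct h'" by auto
 have "reach P A T rnd p (p + csize ?c) s s2"
  by (rule reach_trans[OF s1(1) reach_mono[OF s2(1)]]) auto
 then show ?case using s1 s2 by (auto simp: algebra_simps)
next
 case (IfF t h c2 h' c1)
 let ?c = "If t c1 c2" let ?e = "p + csize c1 + csize c2 + 2"
 have c: "code_at P p [jmp t (p + csize c2 + 2)]" "code_at P (p + 1) (comp (p + 1) c2)"
  "code_at P (p + 1 + csize c2) [JumpNLess 2 3 ?e]"
  using IfF.prems(2) code_at_append[of P p "[jmp t (p + csize c2 + 2)]" "comp (p + 1) c2 @ [JumpNLess 2 3 (p + csize c1 + csize c2 + 2)]
   @ comp (p + csize c2 + 2) c1"]
   code_at_append[of P "p + 1 + csize c2" "[JumpNLess 2 3 (p + csize c1 + csize c2 + 2)]" "comp (p + csize c2 + 2) c1"]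
   code_at_append[of P "p + 1" "comp (p + 1) c2" "[JumpNLess 2 3 (p + csize c1 + csize c2 + 2)] @ comp (p + csize c2 + 2) c1"]
  by simp_all
 obtain s1 where s1: "reach P A T rnd p (p + csize ?c) s s1" "pc s1 = p + 1" "sim A s1 (h\<lparr>ct := ct h + 2\<rparr>)" "clock s1 = clock s + 1"
  using sim_jmp[OF IfF.prems(4) c(1) IfF.prems(3), where lo = p and hi = "p + csize ?c" and T = T and rnd = rnd] IfF.prems(1) IfF.hyps(1) by auto
 from IfF.IH[OF _ c(2) s1(3,2) IfF.prems(5)] IfF.prems(1) obtain s2 where
  s2: "reach P A T rnd (p + 1) (p + 1 + csize c2) s1 s2" "sim A s2 h'" "pc s2 = p + 1 + csize c2"
   "clock s2 + (ct h + 2) \<le> clock s1 + ct h'" by auto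
 obtain s3 where s3: "reach P A T rnd p (p + csize ?c) s2 s3" "pc s3 = ?e" "sim A s3 h'" "clock s3 = clock s2 + 1"
  using sim_goto[OF s2(3) c(3) s2(2), where lo = p and hi = "p + csize ?c" and T = T and rnd = rnd] by auto
 have "reach P A T rnd p (p + csize ?c) s s3"
  by (rule reach_trans[OF reach_trans[OF s1(1) reach_mono[OF s2(1)]] s3(1)]) auto
 then show ?case using s1 s2 s3 by (auto simp: algebra_simps)
next
 case (WhF t h c)
 let ?c = "Wh t c" let ?e = "p + csize c + 3"
 have c: "code_at P p [jmp t (p + 2)]" "code_at P (p + 1) [JumpNLess 2 3 ?e]"
  using WhF.prems(2) code_at_append[of P p "[jmp t (p + 2)]" "[JumpNLess 2 3 ?e] @ comp (p + 2) c @ [JumpNLess 2 3 p]"]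
   code_at_append[of P "p + 1" "[JumpNLess 2 3 ?e]" "comp (p + 2) c @ [JumpNLess 2 3 p]"]
  by simp_all
 obtain s1 where s1: "reach P A T rnd p (p + csize ?c) s s1" "pc s1 = p + 1" "sim A s1 h" "clock s1 = clock s + 1"
  using sim_jmp[OF WhF.prems(4) c(1) WhF.prems(3), where lo = p and hi = "p + csize ?c" and T = T and rnd = rnd] WhF.prems(1) WhF.hyps(1) by auto
 obtain s3 where s3: "reach P A T rnd p (p + csize ?c) s1 s3" "pc s3 = ?e" "sim A s3 h" "clock s3 = clock s1 + 1"
  using sim_goto[OF s1(2) c(2) s1(3), where lo = p and hi = "p + csize ?c" and T = T and rnd = rnd] by auto
 from reach_trans[OF s1(1) s3(1)] show ?case using s1 s3 by (auto simp: algebra_simps)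
next
 case (WhT t h c h1 h2)
 let ?c = "Wh t c"
 have c: "code_at P p [jmp t (p + 2)]" "code_at P (p + 2) (comp (p + 2) c)" "code_at P (p + 2 + csize c) [JumpNLess 2 3 p]"
  using WhT.prems(2) code_at_append[of P p "[jmp t (p + 2)]" "[JumpNLess 2 3 (p + csize c + 3)] @ comp (p + 2) c @ [JumpNLess 2 3 p]"]
   code_at_append[of P "p + 1" "[JumpNLess 2 3 (p + csize c + 3)]" "comp (p + 2) c @ [JumpNLess 2 3 p]"]
   code_at_append[of P "p + 2" "comp (p + 2) c" "[JumpNLess 2 3 p]"]
  by simp_all
 obtain s1 where s1: "reach P A T rnd p (p + csize ?c) s s1" "pc s1 = p + 2" "sim A s1 (h\<lparr>ct := ct h + 2\<rparr>)" "clock s1 = clock s + 1"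
  using sim_jmp[OF WhT.prems(4) c(1) WhT.prems(3), where lo = p and hi = "p + csize ?c" and T = T and rnd = rnd] WhT.prems(1) WhT.hyps(1) by auto
 from WhT.IH(1)[OF _ c(2) s1(3,2) WhT.prems(5)] WhT.prems(1) obtain s2 where
  s2: "reach P A T rnd (p + 2) (p + 2 + csize c) s1 s2" "sim A s2 h1" "pc s2 = p + 2 + csize c"
   "clock s2 + (ct h + 2) \<le> clock s1 + ct h1" by auto
 obtain s3 where s3: "reach P A T rnd p (p + csize ?c) s2 s3" "pc s3 = p" "sim A s3 h1" "clock s3 = clock s2 + 1"
  using sim_goto[OF s2(3) c(3) s2(2), where lo = p and hi = "p + csize ?c" and T = T and rnd = rnd] by auto
 from WhT.IH(2)[OF WhT.prems(1,2) s3(3,2) WhT.prems(5)] obtain s4 where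
  s4: "reach P A T rnd p (p + csize ?c) s3 s4" "sim A s4 h2" "pc s4 = p + csize ?c" "clock s4 + ct h1 \<le> clock s3 + ct h2" by blast
 have "reach P A T rnd p (p + csize ?c) s s4"
  by (rule reach_trans[OF reach_trans[OF reach_trans[OF s1(1) reach_mono[OF s2(1)]] s3(1)] s4(1)]) auto
 then show ?case using s1 s2 s3 s4 by auto
qed

section \<open>Total correctness and loop rules\<close>

definition wp :: "real mat \<Rightarrow> nat \<Rightarrow> rseq \<Rightarrow> com \<Rightarrow> (hst \<Rightarrow> bool) \<Rightarrow> hst \<Rightarrow> bool" where
 "wp A T rnd c Q h \<longleftrightarrow> (\<exists>h'. big A T rnd c h h' \<and> Q h')"

lemma wp_mono: "wp A T rnd c Q h \<Longrightarrow> (\<And>h'. Q h' \<Longrightarrow> Q' h') \<Longrightarrow> wp A T rnd c Q' h"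
 by (auto simp: wp_def)

inductive_cases big_CstE: "big A T rnd (Cst r k) h h'"
inductive_cases big_BinE: "big A T rnd (Bin b r x y) h h'"
inductive_cases big_RtE: "big A T rnd (Rt r x) h h'"
inductive_cases big_GauE: "big A T rnd (Gau r) h h'"
inductive_cases big_LdE: "big A T rnd (Ld r a) h h'"
inductive_cases big_StE: "big A T rnd (St a r) h h'"
inductive_cases big_MVE: "big A T rnd (MV a b) h h'"
inductive_cases big_MTVE: "big A T rnd (MTV a b) h h'"
inductive_cases big_IxZE: "big A T rnd IxZ h h'"
inductive_cases big_IxSE: "big A T rnd IxS h h'"
inductive_cases big_SeqE: "big A T rnd (c1 ;; c2) h h'"
inductive_cases big_IfE: "big A T rnd (If t c1 c2) h h'"

text \<open>
 The equations are stated for the simplifier, which normalises the state after each step; the state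
 would grow exponentially otherwise.
\<close>

lemma wp_simps:
 "wp A T rnd (Cst r k) Q h = Q (h\<lparr>sc := (sc h)(r := real_of_int k), ct := ct h + 1\<rparr>)"
 "wp A T rnd (Bin b r x y) Q h = Q (h\<lparr>sc := (sc h)(r := bsem b (sc h x) (sc h y)), ct := ct h + 1\<rparr>)"
 "wp A T rnd (Rt r x) Q h = Q (h\<lparr>sc := (sc h)(r := sqrt (sc h x)), ct := ct h + 1\<rparr>)"
 "wp A T rnd (Gau r) Q h = Q (h\<lparr>sc := (sc h)(r := rnd (dr h)), dr := Suc (dr h), ct := ct h + 1\<rparr>)"
 "ix h < dim_row A \<Longrightarrow> wp A T rnd (Ld r a) Q h = Q (h\<lparr>sc := (sc h)(r := vc h a (ix h)), ct := ct h + 2\<rparr>)"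
 "ix h < dim_row A \<Longrightarrow> wp A T rnd (St a r) Q h = Q (h\<lparr>vc := (vc h)(a := (vc h a)(ix h := sc h r)), ct := ct h + 2\<rparr>)"
 "wp A T rnd (MV a a') Q h = Q (h\<lparr>vc := (vc h)(a := upd_upto (dim_row A) (Af A (vc h a')) (vc h a)), ct := ct h + T\<rparr>)"
 "wp A T rnd (MTV a a') Q h = Q (h\<lparr>vc := (vc h)(a := upd_upto (dim_col A) (Atf A (vc h a')) (vc h a)), ct := ct h + T\<rparr>)"
 "wp A T rnd IxZ Q h = Q (h\<lparr>ix := 0, ct := ct h + 1\<rparr>)"
 "wp A T rnd IxS Q h = Q (h\<lparr>ix := Suc (ix h), ct := ct h + 1\<rparr>)"
 unfolding wp_def
 by (rule iffI, (elim exE conjE; elim big_CstE big_BinE big_RtE big_GauE big_LdE big_StE big_MVE big_MTVE big_IxZE big_IxSE; simp),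
   (rule exI, rule conjI, (rule big.intros; simp), simp))+

lemma wp_Seq: "wp A T rnd (c1 ;; c2) Q h = wp A T rnd c1 (wp A T rnd c2 Q) h"
 unfolding wp_def[abs_def] by (blast intro: big.intros elim: big_SeqE)

lemmas wpq = wp_Seq wp_simps

lemma wp_If: "wp A T rnd (If t c1 c2) Q h = (if tst A t h then wp A T rnd c1 Q (h\<lparr>ct := ct h + 2\<rparr>) else wp A T rnd c2 Q (h\<lparr>ct := ct h + 2\<rparr>))"
 unfolding wp_def
 by (cases "tst A t h") (auto intro: big.IfT[simplified] big.IfF[simplified] elim: big_IfE)

text \<open>The number of rounds of each inner loop is known to the analysis, so the invariant is
  indexed by the round and no separate termination argument arises. The main loop is not treated
  this way: its rounds depend on the tape and are followed on the machine itself.\<close>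

lemma wp_iter:
 assumes "I 0 h"
  and "\<And>k h. k < N \<Longrightarrow> I k h \<Longrightarrow> tst A t h"
  and "\<And>k h. k < N \<Longrightarrow> I k h \<Longrightarrow> wp A T rnd c (I (Suc k)) (h\<lparr>ct := ct h + 2\<rparr>)"
  and "\<And>h. I N h \<Longrightarrow> \<not> tst A t h"
  and "\<And>h. I N h \<Longrightarrow> Q (h\<lparr>ct := ct h + 2\<rparr>)"
 shows "wp A T rnd (Wh t c) Q h"
proof -
 have "wp A T rnd (Wh t c) Q h'" if "I k h'" "k + l = N" for k l h'
  using that
 proof (induction l arbitrary: k h')
  case 0
  then show ?case using assms(4,5)[of h'] big.WhF[of A t h'] unfolding wp_def by auto
 next
  case (Suc l)
  then have k: "k < N" "tst A t h'" using assms(2)[of k h'] by auto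
  from assms(3)[OF k(1) Suc.prems(1)] obtain h1 where h1: "big A T rnd c (h'\<lparr>ct := ct h' + 2\<rparr>) h1" "I (Suc k) h1"
   unfolding wp_def by blast
  have "wp A T rnd (Wh t c) Q h1" by (rule Suc.IH[OF h1(2)]) (use Suc.prems in auto)
  then show ?case using big.WhT[OF k(2) h1(1)] unfolding wp_def by blast
 qed
 from this[of 0 h N] assms(1) show ?thesis by simp
qed

section \<open>Loops over vectors\<close>

definition "For b c = IxZ ;; Wh (TN b) (c ;; IxS)"

text \<open>Registers 45 to 49 are overwritten by the vector operations.\<close>

definition tmp :: "rseq \<Rightarrow> rseq \<Rightarrow> nat \<Rightarrow> real" where
 "tmp t f = (\<lambda>r. if 45 \<le> r \<and> r \<le> 49 then t r else f r)"

lemma tmp_low[simp]: "r < 45 \<Longrightarrow> tmp t f r = f r"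
 by (simp add: tmp_def)

lemma tmp_high[simp]: "tmp t f 45 = t 45" "tmp t f 46 = t 46" "tmp t f 47 = t 47" "tmp t f 48 = t 48" "tmp t f 49 = t 49"
 by (simp_all add: tmp_def)

lemma tmp_upd[simp]: "(tmp t f)(45 := x) = tmp (t(45 := x)) f" "(tmp t f)(46 := x) = tmp (t(46 := x)) f"
 "(tmp t f)(47 := x) = tmp (t(47 := x)) f" "(tmp t f)(48 := x) = tmp (t(48 := x)) f"
 "(tmp t f)(49 := x) = tmp (t(49 := x)) f"
 by (auto simp: tmp_def)

lemma tmp_self[simp]: "tmp f f = f"
 by (auto simp: tmp_def)

lemma upd_upto_0[simp]: "upd_upto 0 f g = g"
 by (auto simp: upd_upto_def)

lemma upd_upto_Suc: "(upd_upto i f g)(i := f i) = upd_upto (Suc i) f g"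
 by (auto simp: upd_upto_def less_Suc_eq)

lemma upd_upto_same: "upd_upto i f g i = g i"
 by (auto simp: upd_upto_def)

lemma upd_upto_lt[simp]: "i < n \<Longrightarrow> upd_upto n f g i = f i"
 by (auto simp: upd_upto_def)

lemma sum_upd_upto[simp]: "(\<Sum>i<n. upd_upto n f g i) = (\<Sum>i<n. f i)"
 by simp

lemma Af_upd_upto[simp]: "Af A (upd_upto (dim_col A) f g) = Af A f"
 by (simp add: Af_def fun_eq_iff)

lemma Atf_upd_upto[simp]: "Atf A (upd_upto (dim_row A) f g) = Atf A f"
 by (simp add: Atf_def fun_eq_iff)

lemma dm_simps[simp]: "dm A True = dim_row A" "dm A False = dim_col A"
 by (simp_all add: dm_def)

text \<open>\<open>w\<close> counts the tape entries and \<open>k\<close> the time per vector entry.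
  The other 5 units are the loop test, the store and the increment; the constant 3 is the reset of
  the index and the last test.\<close>

lemma wp_emap:
 assumes dim: "dim_col A \<le> dim_row A"
  and body: "\<And>i t k' h'. i < dm A b \<Longrightarrow> h' = h\<lparr>sc := tmp t (sc h), vc := (vc h)(a := upd_upto i f (vc h a)), ix := i, dr := dr h + w * i, ct := k'\<rparr>
   \<Longrightarrow> wp A T rnd body (\<lambda>h2. \<exists>t'. h2 = h'\<lparr>sc := tmp t' (sc h), dr := dr h + w * Suc i, ct := k' + k\<rparr> \<and> t' 49 = f i) h'"
  and Q: "\<And>t. Q (h\<lparr>sc := tmp t (sc h), vc := (vc h)(a := upd_upto (dm A b) f (vc h a)), ix := dm A b, dr := dr h + w * dm A b, ct := ct h + 3 + (k + 5) * dm A b\<rparr>)"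
 shows "wp A T rnd (For b (body ;; St a 49)) Q h"
proof -
 let ?S = "\<lambda>i t. h\<lparr>sc := tmp t (sc h), vc := (vc h)(a := upd_upto i f (vc h a)), ix := i, dr := dr h + w * i, ct := ct h + 1 + (k + 5) * i\<rparr>"
 show ?thesis unfolding For_def wpq
 proof (rule wp_iter[where N = "dm A b" and
    I = "\<lambda>i h'. \<exists>t. h' = ?S i t"])
  show "\<exists>t. h\<lparr>ix := 0, ct := ct h + 1\<rparr> = ?S 0 t"
   by (intro exI[of _ "sc h"]) simp
 next
  fix i h1 assume i: "i < dm A b" "\<exists>t. h1 = ?S i t"
  then obtain t where h1: "h1 = ?S i t" by blast
  show "tst A (TN b) h1" using i h1 by simp
  have ir: "i < dim_row A" using i dim by (auto simp: dm_def split: if_splits)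
  show "wp A T rnd ((body ;; St a 49) ;; IxS) (\<lambda>h'. \<exists>t. h' = ?S (Suc i) t)
       (h1\<lparr>ct := ct h1 + 2\<rparr>)"
   unfolding wp_Seq
   apply (rule wp_mono[OF body[OF i(1), where t = t and k' = "ct h + 1 + (k + 5) * i + 2"]])
    apply (simp add: h1)
   apply (erule exE)
   subgoal for h2 t'
    using ir by (elim conjE) (simp add: wp_simps h1, intro exI[of _ t'], simp add: upd_upto_Suc)
   done
 next
  fix h1 assume "\<exists>t. h1 = ?S (dm A b) t"
  then obtain t where h1: "h1 = ?S (dm A b) t" by blast
  show "\<not> tst A (TN b) h1" by (simp add: h1)
  show "Q (h1\<lparr>ct := ct h1 + 2\<rparr>)" using Q[of t] by (simp add: h1 numeral_3_eq_3)
 qed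
qed

abbreviation arr_upd :: "nat \<Rightarrow> nat \<Rightarrow> rseq \<Rightarrow> nat \<Rightarrow> rseq \<Rightarrow> hst \<Rightarrow> hst" where
 "arr_upd m a f k t h \<equiv> h\<lparr>sc := tmp t (sc h), vc := (vc h)(a := upd_upto m f (vc h a)), ix := m, ct := ct h + 3 + k * m\<rparr>"

definition "VBin bo b a x y = For b ((Ld 47 x ;; Ld 48 y ;; Bin bo 49 47 48) ;; St a 49)"

definition "VSc bo b a x r = For b ((Ld 47 x ;; Bin bo 49 47 r) ;; St a 49)"

definition "VRt b a x = For b ((Ld 47 x ;; Rt 49 47) ;; St a 49)"

definition "VFill b a k = For b (Cst 49 k ;; St a 49)"

definition "VGau b a = For b (Gau 49 ;; St a 49)"

definition "VSum b r a = Cst r 0 ;; For b (Ld 47 a ;; Bin Add r r 47)"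

text \<open>The update of the packing vector. \<open>Cst 45 0\<close> pads the first branch so that
  both branches take equal time and the loop has an exact cost.\<close>

definition "VThr y x r v f = For True ((Ld 47 x ;; Ld 48 r ;; Bin Mul 46 47 48 ;; If (TR v 46) (Cst 45 0 ;; Ld 49 y) (Ld 45 y ;; Bin Mul 49 45 f)) ;; St y 49)"

context
 fixes A :: "real mat"
 assumes dim: "dim_col A \<le> dim_row A"
begin

lemma ix_lt: "i < dm A b \<Longrightarrow> i < dim_row A"
 using dim by (auto simp: dm_def split: if_splits)

lemma wp_VBin:
 assumes "\<And>t. Q (arr_upd (dm A b) a (\<lambda>i. bsem bo (vc h x i) (vc h y i)) 10 t h)"
 shows "wp A T rnd (VBin bo b a x y) Q h"
 unfolding VBin_def
proof (rule wp_emap[OF dim, where f = "\<lambda>i. bsem bo (vc h x i) (vc h y i)" and w = 0 and k = "Suc (Suc (Suc (Suc (Suc 0))))"], goal_cases)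
 case (1 i t k' h')
 then show ?case using ix_lt[OF 1(1)] by (auto simp: wpq upd_upto_same)
qed (use assms in simp)

lemma wp_VSc:
 assumes "\<And>t. Q (arr_upd (dm A b) a (\<lambda>i. bsem bo (vc h x i) (sc h r)) 8 t h)"
  and "r < 45"
 shows "wp A T rnd (VSc bo b a x r) Q h"
 unfolding VSc_def
proof (rule wp_emap[OF dim, where f = "\<lambda>i. bsem bo (vc h x i) (sc h r)" and w = 0 and k = "Suc (Suc (Suc 0))"], goal_cases)
 case (1 i t k' h')
 then show ?case using ix_lt[OF 1(1)] assms(2)
  by (auto simp: wpq upd_upto_same)
qed (use assms in simp)

lemma wp_VRt:
 assumes "\<And>t. Q (arr_upd (dm A b) a (\<lambda>i. sqrt (vc h x i)) 8 t h)"
 shows "wp A T rnd (VRt b a x) Q h"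
 unfolding VRt_def
proof (rule wp_emap[OF dim, where f = "\<lambda>i. sqrt (vc h x i)" and w = 0 and k = "Suc (Suc (Suc 0))"], goal_cases)
 case (1 i t k' h')
 then show ?case using ix_lt[OF 1(1)] by (auto simp: wpq upd_upto_same)
qed (use assms in simp)

lemma wp_VFill:
 assumes "\<And>t. Q (arr_upd (dm A b) a (\<lambda>i. real_of_int k) 6 t h)"
 shows "wp A T rnd (VFill b a k) Q h"
 unfolding VFill_def
proof (rule wp_emap[OF dim, where f = "\<lambda>i. real_of_int k" and w = 0 and k = "Suc 0"], goal_cases)
 case (1 i t k' h')
 then show ?case using ix_lt[OF 1(1)] by (auto simp: wpq upd_upto_same)
qed (use assms in simp)

lemma wp_VGau:
 assumes "\<And>t. Q (h\<lparr>sc := tmp t (sc h), vc := (vc h)(a := upd_upto (dm A b) (\<lambda>i. rnd (dr h + i)) (vc h a)), ix := dm A b, dr := dr h + dm A b, ct := ct h + 3 + 6 * dm A b\<rparr>)"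
 shows "wp A T rnd (VGau b a) Q h"
 unfolding VGau_def
proof (rule wp_emap[OF dim, where f = "\<lambda>i. rnd (dr h + i)" and w = 1 and k = "Suc 0"], goal_cases)
 case (1 i t k' h')
 then show ?case using ix_lt[OF 1(1)] by (auto simp: wpq upd_upto_same)
qed (use assms in simp)

lemma wp_VThr:
 assumes "\<And>t. Q (arr_upd (dim_row A) y (\<lambda>i. if sc h v < vc h x i * vc h r i then vc h y i else vc h y i * sc h f) 15 t h)"
  and "v < 45" "f < 45" "x \<noteq> y" "r \<noteq> y"
 shows "wp A T rnd (VThr y x r v f) Q h"
proof -
 define F where "F = (\<lambda>i. if sc h v < vc h x i * vc h r i then vc h y i else vc h y i * sc h f)"
 note Q = assms(1)[folded F_def]
 show ?thesis unfolding VThr_def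
 proof (rule wp_emap[OF dim, where f = F and w = 0 and k = "Suc (Suc (Suc (Suc (Suc (Suc (Suc (Suc (Suc (Suc 0)))))))))"], goal_cases)
  case (1 i t k' h')
  have ir: "i < dim_row A" using ix_lt[OF 1(1)] .
  show ?case
   using 1(2) ir assms(2-5) by (auto simp: wpq wp_If upd_upto_same F_def)
 qed (use Q in simp)
qed

lemma wp_VSum:
 assumes "\<And>t. Q (h\<lparr>sc := tmp t ((sc h)(r := \<Sum>i<dm A b. vc h a i)), ix := dm A b, ct := ct h + 4 + 6 * dm A b\<rparr>)"
  and "r < 45"
 shows "wp A T rnd (VSum b r a) Q h"
 unfolding VSum_def For_def wpq
proof (rule wp_iter[where N = "dm A b" and
   I = "\<lambda>i h'. \<exists>t. h' = h\<lparr>sc := tmp t ((sc h)(r := \<Sum>l<i. vc h a l)), ix := i, ct := ct h + 2 + 6 * i\<rparr>"], goal_cases)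
 case 1
 show ?case by (intro exI[of _ "(sc h)(r := 0)"]) simp
next
 case (3 i h1)
 then obtain t where h1: "h1 = h\<lparr>sc := tmp t ((sc h)(r := \<Sum>l<i. vc h a l)), ix := i, ct := ct h + 2 + 6 * i\<rparr>" by blast
 have u: "(tmp t' f)(r := x) = tmp t' (f(r := x))" for t' f x using assms(2) by (auto simp: tmp_def)
 show ?case using ix_lt[OF 3(1)] assms(2)
  by (simp add: wpq h1 u, intro exI[of _ "t(47 := vc h a i)"], simp)
next
 case (5 h1)
 then obtain t where h1: "h1 = h\<lparr>sc := tmp t ((sc h)(r := \<Sum>l<dm A b. vc h a l)), ix := dm A b, ct := ct h + 2 + 6 * dm A b\<rparr>" by blast
 show ?case using assms(1)[of t] by (simp add: h1 eval_nat_numeral)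
qed auto

end

subsection \<open>The program\<close>

text \<open>
 Registers: 3 accuracy \<open>E\<close>, 5 \<open>n\<close>, 6 \<open>p\<close>, 7 \<open>\<kappa>\<close>, 8 phase (0 covering, 1 packing), 9 weight of
 \<open>I\<close> in the covariance, 10 and 11 Chebyshev coefficients, 12 degree, 13 power, 14 number of samples,
 15 exit flag, 16 sketches so far, 17 total step length, 18 packing scale, 20 step length, 21 initial scale.
 Arrays: 0 \<open>W\<close>, 1 weights of the sketched matrix, 2 packing vector, 3 its multiples \<open>y\<close> of the row
 bounds, 4 row bounds, 5 row estimates. Division by zero yields zero, so that \<open>postC\<close> starts \<open>y\<close> at
 zero in the rows without a bound.
\<close>

definition "VAcc b a x = For b ((Ld 47 x ;; Bin Mul 47 47 47 ;; Ld 48 a ;; Bin Add 49 48 47) ;; St a 49)"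

text \<open>
 Arrays 12 and 13 hold the last two Chebyshev iterates, 14 the image of the last one under the Gram
 matrix, and 8 the right-hand side.
\<close>

definition "VCheb = For False ((Ld 45 13 ;; Ld 46 14 ;; Bin Add 46 45 46 ;; Bin Mul 46 11 46 ;; Bin Mul 47 10 45 ;; Bin Sub 47 47 46 ;;
   Bin Add 47 47 47 ;; Ld 48 12 ;; Bin Sub 47 47 48 ;; Ld 48 8 ;; Bin Mul 48 36 48 ;; Bin Add 49 47 48) ;; St 15 49)"

definition "opP = MV 11 8 ;; VBin Mul True 11 11 1 ;; MTV 8 11"

text \<open>The iteration starts from degrees 0 and 1 and therefore makes one round less than the
  degree. Registers 33 and 34 carry the scalar Chebyshev values, which enter the inhomogeneous term
  of the recurrence.\<close>

definition "opC = VFill False 12 0 ;; VSc Mul False 13 8 11 ;; Cst 33 1 ;; Bin Add 34 10 19 ;; Cst 32 1 ;;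
   Wh (TR 32 12) (MV 11 13 ;; VBin Mul True 11 11 1 ;; MTV 14 11 ;; Bin Mul 36 11 34 ;; Bin Add 36 36 36 ;; VCheb ;;
    VSc Add False 12 13 19 ;; VSc Add False 13 15 19 ;;
    Bin Mul 35 10 34 ;; Bin Add 35 35 35 ;; Bin Sub 35 35 33 ;; Bin Add 33 34 19 ;; Bin Add 34 35 19 ;; Bin Add 32 32 1) ;;
   VSc Add False 8 13 19"

text \<open>One sample: a Gaussian vector with covariance \<open>b^2 I + gram A u\<close> is
  multiplied by a power of the phase operator. Its squared products with the rows go to array 5, its
  squared coordinates to array 6; the latter add up to an estimate of a trace.\<close>

definition "sk1 = VGau False 9 ;; VGau True 10 ;; VBin Mul True 10 10 7 ;; MTV 8 10 ;; VSc Mul False 9 9 9 ;; VBin Add False 8 8 9 ;;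
   Cst 31 0 ;; Wh (TR 31 13) (If (TR 8 2) opC opP ;; Bin Add 31 31 1) ;;
   MV 11 8 ;; VAcc True 5 11 ;; VAcc False 6 8"

definition "sketch = VRt True 7 1 ;; VFill True 5 0 ;; VFill False 6 0 ;; Cst 30 0 ;; Wh (TR 30 14) (sk1 ;; Bin Add 30 30 1) ;;
   VSc Div True 5 5 14 ;; VSum False 28 6 ;; Bin Div 28 28 14"

text \<open>Register 30 holds \<open>hi = 4 E \<kappa>\<close>. The first loop computes
  \<open>hi^(p+1)\<close> for the initial scale, the second finds the least degree at which the
  Chebyshev value reaches \<open>4 (p + 2) E\<close>. A new guess discards the scaling, so covering
  starts anew.\<close>

definition "setk = Bin Mul 30 7 3 ;; Bin Add 30 30 30 ;; Bin Add 30 30 30 ;;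
   Bin Sub 31 30 1 ;; Bin Add 32 30 1 ;; Bin Div 10 32 31 ;; Bin Add 32 1 1 ;; Bin Div 11 32 31 ;;
   Bin Mul 31 3 6 ;; Bin Mul 31 31 7 ;; Bin Add 31 31 31 ;; Bin Div 20 1 31 ;;
   Bin Add 32 30 19 ;; Cst 31 0 ;; Wh (TR 31 6) (Bin Mul 32 32 30 ;; Bin Add 31 31 1) ;;
   Bin Mul 32 32 5 ;; Bin Mul 32 32 5 ;; Bin Add 32 32 32 ;; Bin Add 32 32 32 ;; Bin Div 21 1 32 ;;
   Bin Add 31 6 1 ;; Bin Add 31 31 1 ;; Bin Mul 31 31 3 ;; Bin Add 31 31 31 ;; Bin Add 31 31 31 ;;
   Cst 33 1 ;; Bin Add 34 10 19 ;; Cst 12 1 ;;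
   Wh (TR 34 31) (Bin Mul 35 10 34 ;; Bin Add 35 35 35 ;; Bin Sub 35 35 33 ;; Bin Add 33 34 19 ;; Bin Add 34 35 19 ;; Bin Add 12 12 1) ;;
   VFill True 0 0 ;; VFill True 1 0 ;; Cst 9 1 ;; Cst 8 0 ;; Cst 17 0 ;; Bin Mul 13 6 2 ;; Bin Add 13 13 1"

text \<open>Repeated halving replaces a logarithm, which the machine does not offer. Aiming at
  failure probability \<open>\<delta> / ((c + 1) (c + 2))\<close> for sketch number \<open>c\<close>
  makes the total at most \<delta> without knowing in advance how many sketches there will
  be.\<close>

definition "setm = Bin Add 30 16 1 ;; Bin Add 31 30 1 ;; Bin Mul 30 30 31 ;; Bin Mul 30 30 5 ;; Bin Add 30 30 30 ;; Bin Add 30 30 30 ;;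
   Bin Div 30 30 0 ;; Bin Add 14 27 19 ;;
   Wh (TR 1 30) (Bin Mul 30 30 2 ;; Bin Add 14 14 27)"

text \<open>\<open>p\<close> results from repeated squaring of \<open>(1 + e)^2\<close>; it is a
  power of two, at least 2, and less than twice the least admissible exponent unless it is
  2.\<close>

definition "init0 E = Cst 1 1 ;; Cst 19 0 ;; Bin Add 30 1 1 ;; Bin Div 2 1 30 ;; Cst 3 (int E) ;; Bin Div 4 1 3 ;; Cst 27 (8 * int E * int E) ;;
   Cst 24 20 ;; Bin Mul 24 24 4 ;; Bin Add 24 24 1 ;; Bin Add 25 1 4 ;;
   VFill True 10 1 ;; VSum True 5 10 ;;
   Cst 6 2 ;; Bin Mul 30 25 25 ;; Wh (TR 30 5) (Bin Mul 30 30 30 ;; Bin Add 6 6 6) ;;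
   Bin Div 22 4 6 ;; Bin Mul 23 22 4 ;; Bin Add 22 22 1 ;; Bin Add 23 23 1 ;;
   Cst 7 1 ;; setk ;; Cst 16 0 ;; setm ;; Cst 15 0"

definition "postC = VSc Mul True 4 5 7 ;; VFill True 2 0 ;; VSc Add True 2 2 28 ;; VBin Div True 4 2 4 ;;
   VBin Div True 3 4 4 ;; VSc Mul True 3 3 21 ;; VBin Mul True 2 3 4 ;; VSc Add True 1 2 19 ;;
   Bin Add 18 21 19 ;; Cst 9 0 ;; Cst 8 1 ;; Bin Mul 13 6 2 ;; Bin Sub 13 13 1"

text \<open>Register 18 is multiplied by \<open>1 + e^2 / p\<close> in every round. If it reaches
  \<open>E\<close> before the sum of \<open>y\<close> does, the guess is given up; by
  \<open>packinv_fail\<close> this cannot happen when \<kappa> is at least the optimum. A finished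
  packing solution is rescaled so that its \<open>y\<close> sum to step length times
  \<kappa>.\<close>

definition "postT = Bin Mul 33 24 30 ;; Bin Div 33 33 31 ;; VThr 3 5 4 33 22 ;; VBin Mul True 2 3 4 ;; VSum True 34 3 ;; Bin Mul 18 18 23 ;;
   If (TR 34 3) (If (TR 18 3) (VSc Add True 1 2 19) (Bin Mul 7 7 25 ;; setk))
    (Bin Mul 35 20 7 ;; Bin Div 35 35 34 ;; VSc Mul True 11 2 35 ;; VBin Add True 0 0 11 ;; Bin Add 17 17 20 ;; VSc Add True 1 0 19 ;;
    Cst 9 1 ;; Cst 8 0 ;; Bin Mul 13 6 2 ;; Bin Add 13 13 1 ;; If (TR 17 3) (Cst 30 0) (Cst 15 1))"

text \<open>As \<open>p\<close> is a power of two, iterated square roots yield the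
  \<open>p\<close>-th root \<open>v\<close> of the estimated potential \<open>t\<close>; then
  \<open>t / v\<close> is the power \<open>v^(p-1)\<close> in the threshold.\<close>

definition "postP = VBin Mul True 11 2 5 ;; VSum True 30 11 ;; Bin Add 31 30 19 ;; Cst 32 1 ;;
   Wh (TR 32 6) (Rt 31 31 ;; Bin Add 32 32 32) ;; postT"

definition "body = sketch ;; If (TR 8 2) postC postP ;; Bin Add 16 16 1 ;; setm"

section \<open>Vectors and operators computed by a sketch\<close>

fun chebM :: "real \<Rightarrow> real \<Rightarrow> real mat \<Rightarrow> nat \<Rightarrow> real mat" where
 "chebM a b N 0 = 0\<^sub>m (dim_row N) (dim_row N)"
| "chebM a b N (Suc 0) = b \<cdot>\<^sub>m 1\<^sub>m (dim_row N)"
| "chebM a b N (Suc (Suc k)) = 2 \<cdot>\<^sub>m ((a \<cdot>\<^sub>m 1\<^sub>m (dim_row N) - b \<cdot>\<^sub>m N) * chebM a b N (Suc k)) - chebM a b N k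
   + (2 * b * cheb a (Suc k)) \<cdot>\<^sub>m 1\<^sub>m (dim_row N)"

lemma chebM_carrier[simp]: "N \<in> carrier_mat d d \<Longrightarrow> chebM a b N k \<in> carrier_mat d d"
 by (induction a b N k rule: chebM.induct) auto

lemma fc_zero: "orth n U \<Longrightarrow> fc U (\<lambda>_. 0) = 0\<^sub>m n n"
 by (rule eq_matI) (auto simp: fc_index)

lemma fc_diff:
 assumes "orth n U" shows "fc U f - fc U g = fc U (\<lambda>i. f i - g i)"
 by (rule eq_matI) (use assms in \<open>auto simp: fc_index sum_subtractf algebra_simps\<close>)

lemma chebM_fc:
 assumes "orth d U"
 shows "chebM a b (fc U f) k = fc U (\<lambda>i. chebq a b k (f i))"
proof (induction k rule: induct_nat_012)
 case 0 then show ?case using assms by (simp add: fc_zero)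
next
 case 1 then show ?case using assms fc_smult[OF assms, of b "\<lambda>_. 1"] by (simp add: fc_one)
next
 case (ge2 k)
 have 1: "1\<^sub>m d = fc U (\<lambda>_. 1)" using assms by (simp add: fc_one)
 show ?case using assms ge2 by (simp add: 1 fc_smult fc_add fc_diff, intro fc_cong[OF assms]) (simp add: algebra_simps)
qed

lemma chebM_mult_vec:
 fixes a b :: real and k :: nat
 assumes N: "N \<in> carrier_mat d d" and x: "x \<in> carrier_vec d" and i: "i < d"
 defines "y \<equiv> chebM a b N (Suc k) *\<^sub>v x"
 shows "(chebM a b N (Suc (Suc k)) *\<^sub>v x) $ i =
  2 * (a * y $ i - b * (N *\<^sub>v y) $ i) - (chebM a b N k *\<^sub>v x) $ i + 2 * b * cheb a (Suc k) * x $ i"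
proof -
 let ?M = "a \<cdot>\<^sub>m 1\<^sub>m d - b \<cdot>\<^sub>m N" and ?C1 = "chebM a b N (Suc k)" and ?C0 = "chebM a b N k"
 have C: "?C1 \<in> carrier_mat d d" "?C0 \<in> carrier_mat d d" using N by simp_all
 have y: "y \<in> carrier_vec d" unfolding y_def using C x by (meson mult_mat_vec_carrier)
 have M: "?M \<in> carrier_mat d d" using N by (intro minus_carrier_mat) auto
 have PC: "2 \<cdot>\<^sub>m (?M * ?C1) - ?C0 \<in> carrier_mat d d" using C(2) by (rule minus_carrier_mat)
 have sm: "(c \<cdot>\<^sub>m X) *\<^sub>v v = c \<cdot>\<^sub>v (X *\<^sub>v v)" if "X \<in> carrier_mat d d" "v \<in> carrier_vec d" for c :: real and X v
  using that by (intro eq_vecI) auto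
 have "chebM a b N (Suc (Suc k)) *\<^sub>v x = (2 \<cdot>\<^sub>m (?M * ?C1)) *\<^sub>v x - ?C0 *\<^sub>v x + ((2 * b * cheb a (Suc k)) \<cdot>\<^sub>m 1\<^sub>m d) *\<^sub>v x"
  using N x C M PC by (simp add: add_mult_distrib_mat_vec[of _ d d] minus_mult_distrib_mat_vec[of _ d d])
 also have "(2 \<cdot>\<^sub>m (?M * ?C1)) *\<^sub>v x = 2 \<cdot>\<^sub>v (?M *\<^sub>v y)"
  using N x C M by (simp add: sm y_def assoc_mult_mat_vec[of _ d d _ d])
 also have "?M *\<^sub>v y = a \<cdot>\<^sub>v y - b \<cdot>\<^sub>v (N *\<^sub>v y)"
  using N y by (simp add: minus_mult_distrib_mat_vec[of _ d d] sm)
 also have "((2 * b * cheb a (Suc k)) \<cdot>\<^sub>m 1\<^sub>m d) *\<^sub>v x = (2 * b * cheb a (Suc k)) \<cdot>\<^sub>v x"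
  using x by (simp add: sm)
 finally have "chebM a b N (Suc (Suc k)) *\<^sub>v x = 2 \<cdot>\<^sub>v (a \<cdot>\<^sub>v y - b \<cdot>\<^sub>v (N *\<^sub>v y)) - ?C0 *\<^sub>v x + 2 * b * cheb a (Suc k) \<cdot>\<^sub>v x" .
 moreover have "?C0 *\<^sub>v x \<in> carrier_vec d" "N *\<^sub>v y \<in> carrier_vec d" using C N x y by (meson mult_mat_vec_carrier)+
 ultimately show ?thesis using x y i by (simp del: index_mult_mat_vec chebM.simps dim_mult_mat_vec)
qed

lemma vec_upd_upto[simp]: "vec d (upd_upto d f g) = vec d f"
 by (rule eq_vecI) auto

lemma Af_vec: "A \<in> carrier_mat n d \<Longrightarrow> i < n \<Longrightarrow> Af A v i = row A i \<bullet> vec d v"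
 by (auto simp: Af_def scalar_prod_def atLeast0LessThan intro!: sum.cong)

lemma gram_mult_vec:
 assumes A: "A \<in> carrier_mat n d" and g: "\<And>i. i < n \<Longrightarrow> g i = Af A v i * u i"
 shows "vec d (Atf A g) = gram A u *\<^sub>v vec d v"
proof (rule eq_vecI)
 fix j assume "j < dim_vec (gram A u *\<^sub>v vec d v)" then have j: "j < d" using A by simp
 have "(gram A u *\<^sub>v vec d v) $ j = (\<Sum>l<d. (\<Sum>k<n. u k * A $$ (k, j) * A $$ (k, l)) * v l)"
  using j A by (auto simp: scalar_prod_def atLeast0LessThan gram_index[OF A] intro!: sum.cong)
 also have "\<dots> = (\<Sum>k<n. \<Sum>l<d. u k * A $$ (k, j) * A $$ (k, l) * v l)"
  unfolding sum_distrib_right by (rule sum.swap)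
 also have "\<dots> = vec d (Atf A g) $ j"
  using j A by (auto simp: Atf_def g Af_def sum_distrib_left sum_distrib_right mult_ac intro!: sum.cong)
 finally show "vec d (Atf A g) $ j = (gram A u *\<^sub>v vec d v) $ j" by simp
qed (use A in simp)

definition frame :: "nat \<Rightarrow> nat \<Rightarrow> hst \<Rightarrow> hst \<Rightarrow> bool" where
 "frame r a h h' \<longleftrightarrow> (\<forall>i<r. sc h' i = sc h i) \<and> (\<forall>i<a. vc h' i = vc h i)"

lemma frame_refl[simp]: "frame r a h h"
 by (simp add: frame_def)

lemma frame_trans: "\<lbrakk>frame r a h h1; frame r' a' h1 h2; r'' \<le> r; r'' \<le> r'; a'' \<le> a; a'' \<le> a'\<rbrakk> \<Longrightarrow> frame r'' a'' h h2"
 by (auto simp: frame_def)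

lemma frameD: "frame r a h h' \<Longrightarrow> i < r \<Longrightarrow> sc h' i = sc h i" "frame r a h h' \<Longrightarrow> j < a \<Longrightarrow> vc h' j = vc h j"
 by (auto simp: frame_def)

locale prog_context =
 fixes A :: "real mat" and n d T :: nat and rnd :: "nat \<Rightarrow> real"
 assumes A: "A \<in> carrier_mat n d" and d0: "1 \<le> d" and dn: "d \<le> n" and nT: "n \<le> T"
begin

lemma dim: "dim_col A \<le> dim_row A" "dim_row A = n" "dim_col A = d"
 using A dn by auto

abbreviation "WP \<equiv> wp A T rnd"

lemmas wps = wp_VBin[OF dim(1)] wp_VSc[OF dim(1)] wp_VRt[OF dim(1)] wp_VFill[OF dim(1)] wp_VGau[OF dim(1)] wp_VThr[OF dim(1)] wp_VSum[OF dim(1)]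
lemmas wpr = wps[rotated]
lemmas wpd = wpq dim

lemma wp_VAcc:
 assumes "\<And>t. Q (arr_upd (dm A b) a (\<lambda>i. vc h a i + vc h x i * vc h x i) 11 t h)"
  and "x \<noteq> a"
 shows "WP (VAcc b a x) Q h"
 unfolding VAcc_def
proof (rule wp_emap[OF dim(1), where f = "\<lambda>i. vc h a i + vc h x i * vc h x i" and w = 0 and k = "Suc (Suc (Suc (Suc (Suc (Suc 0)))))"], goal_cases)
 case (1 i t k' h')
 then show ?case using ix_lt[OF dim(1) 1(1)] assms(2)
  by (auto simp: wpq upd_upto_same)
qed (use assms in simp)

lemma wp_VCheb:
 assumes "\<And>t. Q (arr_upd d 15 (\<lambda>i.
   (sc h 10 * vc h 13 i - sc h 11 * (vc h 13 i + vc h 14 i)) + (sc h 10 * vc h 13 i - sc h 11 * (vc h 13 i + vc h 14 i))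
    - vc h 12 i + sc h 36 * vc h 8 i) 21 t h)"
 shows "WP VCheb Q h"
 unfolding VCheb_def
proof (rule wp_emap[OF dim(1), where f = "\<lambda>i. (sc h 10 * vc h 13 i - sc h 11 * (vc h 13 i + vc h 14 i)) + (sc h 10 * vc h 13 i - sc h 11 * (vc h 13 i + vc h 14 i))
    - vc h 12 i + sc h 36 * vc h 8 i" and w = 0 and k = "Suc (Suc (Suc (Suc (Suc (Suc (Suc (Suc (Suc (Suc (Suc (Suc (Suc (Suc (Suc (Suc 0)))))))))))))))"], goal_cases)
 case (1 i t k' h')
 then show ?case using ix_lt[OF dim(1) 1(1)] by (auto simp: wpq upd_upto_same)
qed (use assms dim in simp)

lemma wp_opP:
 assumes "\<And>h'. \<lbrakk>frame 45 8 h h'; vec d (vc h' 8) = gram A (vc h 1) *\<^sub>v vec d (vc h 8); dr h' = dr h; ct h' \<le> ct h + 20 * T\<rbrakk> \<Longrightarrow> Q h'"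
 shows "WP opP Q h"
 unfolding opP_def
 apply (simp add: wpq)
 apply (rule wps)
 apply (simp add: wpd)
 apply (rule assms)
   apply (simp add: frame_def)
 subgoal by (simp add: dim, rule gram_mult_vec[OF A], simp)
  apply simp
 using nT d0 dn apply simp
 done

lemma vec_index_vec_eq: "vec d v = w \<Longrightarrow> i < d \<Longrightarrow> v i = w $ i"
 by auto

lemma gram_idx: "(\<And>i. i < n \<Longrightarrow> g i = Af A v i * u i) \<Longrightarrow> j < d \<Longrightarrow> Atf A g j = (gram A u *\<^sub>v vec d v) $ j"
 using gram_mult_vec[OF A] by (metis index_vec)

lemma wp_opC:
 assumes r: "sc h 19 = 0" "sc h 1 = 1" "sc h 12 = real kc" "1 \<le> kc"
  and Q: "\<And>h'. \<lbrakk>frame 32 8 h h';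
   vec d (vc h' 8) = chebM (sc h 10) (sc h 11) (1\<^sub>m d + gram A (vc h 1)) kc *\<^sub>v vec d (vc h 8); dr h' = dr h; ct h' \<le> ct h + 150 * T * kc\<rbrakk> \<Longrightarrow> Q h'"
 shows "WP opC Q h"
proof -
 let ?a = "sc h 10" and ?b = "sc h 11" and ?N = "1\<^sub>m d + gram A (vc h 1)" and ?x = "vec d (vc h 8)"
 let ?C = "\<lambda>k. chebM ?a ?b ?N k *\<^sub>v ?x"
 have N: "?N \<in> carrier_mat d d" using A by simp
 have C: "?C k \<in> carrier_vec d" for k using N by (meson chebM_carrier mult_mat_vec_carrier vec_carrier)
 define I where "I k h' \<longleftrightarrow> frame 32 8 h h' \<and> vc h' 8 = vc h 8 \<and> vec d (vc h' 12) = ?C k \<and> vec d (vc h' 13) = ?C (Suc k)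
  \<and> sc h' 33 = cheb ?a k \<and> sc h' 34 = cheb ?a (Suc k) \<and> sc h' 32 = real (Suc k) \<and> dr h' = dr h \<and> ct h' \<le> ct h + 30 * T + 100 * T * k" for k h'
 have regs: "sc h' 19 = 0" "sc h' 1 = 1" "sc h' 12 = real kc" "sc h' 10 = ?a" "sc h' 11 = ?b" "vc h' 1 = vc h 1" "vc h' 8 = vc h 8" if "I k h'" for k h'
  using that r by (auto simp: I_def frame_def)
 have step: "I (Suc k) h2" if I: "I k h'" and k: "k < kc - 1"
  and h2: "frame 32 8 h' h2" "vc h2 8 = vc h' 8" "vec d (vc h2 12) = vec d (vc h' 13)"
   "\<And>i. i < d \<Longrightarrow> vc h2 13 i = (?a * vc h' 13 i - ?b * (vc h' 13 i + (gram A (vc h' 1) *\<^sub>v vec d (vc h' 13)) $ i))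
     + (?a * vc h' 13 i - ?b * (vc h' 13 i + (gram A (vc h' 1) *\<^sub>v vec d (vc h' 13)) $ i)) - vc h' 12 i + 2 * ?b * sc h' 34 * vc h 8 i"
   "sc h2 33 = sc h' 34" "sc h2 34 = 2 * (?a * sc h' 34) - sc h' 33" "sc h2 32 = sc h' 32 + 1" "dr h2 = dr h'" "ct h2 \<le> ct h' + 100 * T" for k h' h2
 proof -
  note I' = I[unfolded I_def]
  have "vec d (vc h2 13) = ?C (Suc (Suc k))"
  proof (rule eq_vecI)
   fix i assume "i < dim_vec (?C (Suc (Suc k)))" then have i: "i < d" using C[of "Suc (Suc k)"] by (metis carrier_vecD)
   have x: "?x \<in> carrier_vec d" by simp
   have v: "vc h' 13 i = (?C (Suc k)) $ i" "vc h' 12 i = (?C k) $ i"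
    using I' i by (metis vec_index_vec_eq)+
   have Ny: "(?N *\<^sub>v ?C (Suc k)) $ i = (?C (Suc k)) $ i + (gram A (vc h 1) *\<^sub>v ?C (Suc k)) $ i"
    using C[of "Suc k"] A i by (simp add: add_mult_distrib_mat_vec[of _ d d])
   have V: "vec d (vc h' 13) = ?C (Suc k)" "vc h' 1 = vc h 1" "sc h' 34 = cheb ?a (Suc k)" using I' regs[OF I] by auto
   show "(vec d (vc h2 13)) $ i = (?C (Suc (Suc k))) $ i"
    unfolding chebM_mult_vec[OF N x i] Ny using h2(4)[OF i, unfolded V v] i by (simp add: algebra_simps)
  qed (simp only: dim_vec carrier_vecD[OF C])
  then show ?thesis using I' h2 unfolding I_def by (auto simp: algebra_simps frame_def)
 qed
 have cst: "x + (5 + 8 * d) \<le> ct h + 150 * T * kc" if "x \<le> ct h + 30 * T + 100 * T * (kc - 1)" for x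
 proof -
  obtain k where k: "kc = Suc k" using r(4) by (cases kc) auto
  show ?thesis using that nT d0 dn unfolding k by (simp add: algebra_simps)
 qed
 show ?thesis unfolding opC_def
  apply (simp add: wpq)
  apply (rule wps)
  apply (simp add: wpq)
  apply (rule wpr, simp)
  apply (simp add: wpd)
  apply (rule wp_iter[where N = "kc - 1" and I = I])
  subgoal for t t'
   using N nT d0 dn r C[of 1] unfolding I_def
   by (auto simp: frame_def intro!: eq_vecI)
  subgoal for t t' k h' using r(4) regs[of k h'] by (auto simp: I_def)
  subgoal premises p for t t' k h'
   using regs[OF p(2)]
   apply (simp add: wpq)
   apply (rule wps)
   apply (simp add: wpd)
   apply (rule wp_VCheb)
   apply (simp add: wpd)
   apply (rule wpr, simp)
   apply (simp add: wpd)
   apply (rule wpr, simp)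
   apply (simp add: wpd)
   apply (rule step[OF p(2,1)])
       apply (simp add: frame_def)
       apply simp
      apply (simp)
   subgoal for t1 t2 t3 t4 i
    by (simp, subst gram_idx[where v = "vc h' 13" and u = "vc h (Suc 0)"]) (auto simp: algebra_simps)
   using nT d0 dn by simp_all
  subgoal for t t' h' using r(4) regs[of "kc - 1" h'] by (auto simp: I_def)
  subgoal premises p for t t' h'
   using regs[OF p]
   apply (simp add: wpq)
   apply (rule wpr, simp)
   apply (simp add: wpd)
   apply (rule Q)
   using p r(4) cst[of "ct h'"] unfolding I_def by (auto simp: frame_def)
  done
qed

end

text \<open>\<open>md\<close> is the phase register, 0 for covering and 1 for packing; comparison
  with 1/2 is available on the machine, a test for equality of reals is not.\<close>

definition opM :: "real mat \<Rightarrow> real \<Rightarrow> real \<Rightarrow> nat \<Rightarrow> real \<Rightarrow> rseq \<Rightarrow> real mat" where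
 "opM A s0 s1 kc md u = (if md < 1 / 2 then chebM s0 s1 (1\<^sub>m (dim_col A) + gram A u) kc else gram A u)"

text \<open>For a standard Gaussian \<xi> and nonnegative \<open>u\<close> this is a Gaussian vector
  with covariance \<open>b^2 I + gram A u\<close>: the first \<open>d\<close> entries supply the
  identity part, the next \<open>n\<close> the Gram part.\<close>

definition start_vec :: "real mat \<Rightarrow> real \<Rightarrow> rseq \<Rightarrow> rseq \<Rightarrow> real vec" where
 "start_vec A b u \<xi> = vec (dim_col A) (\<lambda>j. Atf A (\<lambda>i. \<xi> (dim_col A + i) * sqrt (u i)) j + \<xi> j * b)"

definition samp :: "real mat \<Rightarrow> real mat \<Rightarrow> real \<Rightarrow> rseq \<Rightarrow> rseq \<Rightarrow> real vec \<Rightarrow> real" where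
 "samp A Z b u \<xi> a = a \<bullet> (Z *\<^sub>v start_vec A b u \<xi>)"

text \<open>Each sample reads its own block of \<open>n + d\<close> tape entries, which makes the
  samples independent.\<close>

definition estim :: "real mat \<Rightarrow> real mat \<Rightarrow> real \<Rightarrow> rseq \<Rightarrow> nat \<Rightarrow> rseq \<Rightarrow> real vec \<Rightarrow> real" where
 "estim A Z b u m \<xi> a = (\<Sum>k<m. (samp A Z b u (\<lambda>l. \<xi> (k * (dim_row A + dim_col A) + l)) a)\<^sup>2) / real m"

context prog_context
begin

lemma opM_carrier[simp]: "opM A s0 s1 kc md u \<in> carrier_mat d d"
 using A by (simp add: opM_def dim)

lemma opM_dim[simp]: "dim_row (opM A s0 s1 kc md u) = d" "dim_col (opM A s0 s1 kc md u) = d"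
 by (rule carrier_matD[OF opM_carrier])+

definition opcost :: "real \<Rightarrow> nat \<Rightarrow> nat" where
 "opcost md kc = (if md < 1 / 2 then 150 * kc else 20)"

lemma wp_sk1:
 assumes r: "sc h 19 = 0" "sc h 1 = 1" "sc h 2 = 1 / 2" "sc h 12 = real kc" "1 \<le> kc" "sc h 13 = real pw"
  and sq: "\<And>i. i < n \<Longrightarrow> vc h 7 i = sqrt (vc h 1 i)"
 defines "Z \<equiv> opM A (sc h 10) (sc h 11) kc (sc h 8) (vc h 1) ^\<^sub>m pw"
 defines "\<xi> \<equiv> \<lambda>l. rnd (dr h + l)"
 assumes Q: "\<And>h'. \<lbrakk>frame 31 5 h h'; vc h' 7 = vc h 7;
   \<And>i. i < n \<Longrightarrow> vc h' 5 i = vc h 5 i + (samp A Z (sc h 9) (vc h 1) \<xi> (row A i))\<^sup>2;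
   \<And>j. j < d \<Longrightarrow> vc h' 6 j = vc h 6 j + (samp A Z (sc h 9) (vc h 1) \<xi> (unit_vec d j))\<^sup>2;
   dr h' = dr h + (n + d); ct h' \<le> ct h + T * (pw * (opcost (sc h 8) kc + 10) + 150)\<rbrakk> \<Longrightarrow> Q h'"
 shows "WP sk1 Q h"
proof -
 let ?M = "opM A (sc h 10) (sc h 11) kc (sc h 8) (vc h 1)" and ?x = "start_vec A (sc h 9) (vc h 1) \<xi>"
 have M: "?M \<in> carrier_mat d d" by simp
 have x: "?x \<in> carrier_vec d" by (simp add: start_vec_def dim)
 have M0: "(?M ^\<^sub>m 0) *\<^sub>v ?x = ?x" using x by simp
 define I where "I k h' \<longleftrightarrow> frame 31 8 h h' \<and> vec d (vc h' 8) = (?M ^\<^sub>m k) *\<^sub>v ?x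
  \<and> sc h' 31 = real k \<and> dr h' = dr h + (n + d) \<and> ct h' \<le> ct h + T * (70 + k * (opcost (sc h 8) kc + 10))" for k h'
 have regs: "sc h' 19 = 0" "sc h' 1 = 1" "sc h' 12 = real kc" "sc h' 13 = real pw" "sc h' 2 = 1 / 2" if "I k h'" for k h'
  using that r by (auto simp: I_def frame_def)
 have step: "I (Suc k) h2" if I: "I k h'" and fr: "frame 31 8 h' h2" "sc h2 31 = real k + 1"
   "vec d (vc h2 8) = ?M *\<^sub>v vec d (vc h' 8)" "dr h2 = dr h'" "ct h2 \<le> ct h' + T * (opcost (sc h 8) kc + 10)" for k h' h2
 proof -
  have "vec d (vc h2 8) = (?M * ?M ^\<^sub>m k) *\<^sub>v ?x"
   using I fr(3) x M unfolding I_def by (simp add: assoc_mult_mat_vec[of _ d d _ d])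
  then show ?thesis using I fr x M frame_trans[of 31 8 h h' 31 8 h2 31 8] mpow_Suc_left[OF M]
   unfolding I_def by (simp add: algebra_simps)
 qed
 have body: "WP (If (TR 8 2) opC opP ;; Bin Add 31 31 1) (I (Suc k)) (h'\<lparr>ct := ct h' + 2\<rparr>)" if I: "I k h'" for k h'
 proof -
  have e: "sc h' 10 = sc h 10" "sc h' 11 = sc h 11" "sc h' 8 = sc h 8" "vc h' 1 = vc h 1" using I by (auto simp: I_def frame_def)
  show ?thesis
  proof (cases "sc h 8 < 1 / 2")
   case True
   then have T2: "sc h 8 * 2 < 1" by simp
   show ?thesis
    apply (simp add: wp_Seq wp_If regs(1-4)[OF I, simplified] regs(5)[OF I] e T2)
    apply (rule wp_opC[where kc = kc])
    using regs[OF I] apply simp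
    using regs[OF I] apply simp
    using regs[OF I] apply simp
     apply (rule r)
    apply (simp add: wp_simps)
    apply (rule step[OF I])
    using I regs[OF I] e True mult_le_mono2[of 1 T] nT dn d0
    by (auto simp: frame_def opM_def dim opcost_def I_def algebra_simps)
  next
   case False
   then have T2: "\<not> sc h 8 * 2 < 1" by simp
   show ?thesis
    apply (simp add: wp_Seq wp_If regs(1-4)[OF I, simplified] regs(5)[OF I] e T2)
    apply (rule wp_opP)
    apply (simp add: wp_simps)
    apply (rule step[OF I])
    using I regs[OF I] e False nT dn d0
    by (auto simp: frame_def opM_def dim opcost_def I_def algebra_simps)
  qed
 qed
 have Zx: "Z *\<^sub>v ?x \<in> carrier_vec d" unfolding Z_def using M x by (meson mult_mat_vec_carrier pow_carrier_mat)
 have fin: "Q h2" if I: "I pw h'" and fr: "frame 31 5 h' h2" "vc h2 7 = vc h' 7"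
  "\<And>i. i < n \<Longrightarrow> vc h2 5 i = vc h' 5 i + Af A (vc h' 8) i * Af A (vc h' 8) i"
  "\<And>j. j < d \<Longrightarrow> vc h2 6 j = vc h' 6 j + vc h' 8 j * vc h' 8 j"
  "dr h2 = dr h'" "ct h2 \<le> ct h' + 80 * T" for h' h2
 proof (rule Q)
  have v8: "vec d (vc h' 8) = Z *\<^sub>v ?x" using I unfolding I_def Z_def by simp
  have f: "frame 31 8 h h'" using I by (simp add: I_def)
  show "frame 31 5 h h2" using frame_trans[OF f fr(1)] by simp
  show "vc h2 7 = vc h 7" using fr(2) frameD(2)[OF f] by simp
  show "vc h2 5 i = vc h 5 i + (samp A Z (sc h 9) (vc h 1) \<xi> (row A i))\<^sup>2" if "i < n" for i
   using fr(3)[OF that] frameD(2)[OF f, of 5] Af_vec[OF A that, of "vc h' 8"] v8 by (simp add: samp_def power2_eq_square)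
  show "vc h2 6 j = vc h 6 j + (samp A Z (sc h 9) (vc h 1) \<xi> (unit_vec d j))\<^sup>2" if "j < d" for j
   using fr(4)[OF that] frameD(2)[OF f, of 6] vec_index_vec_eq[OF v8 that] Zx that
   by (simp add: samp_def power2_eq_square scalar_prod_left_unit del: index_mult_mat_vec)
  show "dr h2 = dr h + (n + d)" using fr(5) I by (simp add: I_def)
  show "ct h2 \<le> ct h + T * (pw * (opcost (sc h 8) kc + 10) + 150)" using fr(6) I by (simp add: I_def algebra_simps)
 qed
 show ?thesis unfolding sk1_def
  apply (simp add: wp_Seq)
  apply (rule wps, simp add: wpd)
  apply (rule wps, simp add: wpd)
  apply (rule wps, simp add: wpd)
  apply (rule wpr, simp, simp add: wpd)
  apply (rule wps, simp add: wpd)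
  apply (rule wp_iter[where N = pw and I = I])
  subgoal
   using nT d0 dn unfolding I_def M0
   by (auto simp: frame_def start_vec_def dim \<xi>_def Atf_def sq add.assoc intro!: eq_vecI sum.cong)
  subgoal for t1 t2 t3 t4 t5 k h' using regs[of k h'] by (auto simp: I_def)
  subgoal using body by simp
  subgoal for t1 t2 t3 t4 t5 h' using regs[of pw h'] by (auto simp: I_def)
  subgoal premises p for t1 t2 t3 t4 t5 h'
   apply (simp add: wpd)
   apply (rule wp_VAcc[rotated], simp, simp add: wpd)
   apply (rule wp_VAcc[rotated], simp, simp add: wpd)
   apply (rule fin[OF p])
   using nT d0 dn by (auto simp: frame_def)
  done
qed

lemma wp_sketch:
 assumes r: "sc h 19 = 0" "sc h 1 = 1" "sc h 2 = 1 / 2" "sc h 12 = real kc" "1 \<le> kc" "sc h 13 = real pw" "sc h 14 = real m"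
 defines "Z \<equiv> opM A (sc h 10) (sc h 11) kc (sc h 8) (vc h 1) ^\<^sub>m pw"
 defines "\<xi> \<equiv> \<lambda>l. rnd (dr h + l)"
 assumes Q: "\<And>h'. \<lbrakk>frame 28 5 h h'; sc h' 29 = sc h 29;
   \<And>i. i < n \<Longrightarrow> vc h' 5 i = estim A Z (sc h 9) (vc h 1) m \<xi> (row A i);
   sc h' 28 = (\<Sum>j<d. estim A Z (sc h 9) (vc h 1) m \<xi> (unit_vec d j));
   ct h' \<le> ct h + T * (m * (pw * (opcost (sc h 8) kc + 10) + 160) + 80)\<rbrakk> \<Longrightarrow> Q h'"
 shows "WP sketch Q h"
proof -
 let ?s = "\<lambda>k a. (samp A Z (sc h 9) (vc h 1) (\<lambda>l. \<xi> (k * (n + d) + l)) a)\<^sup>2"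
 define I where "I k h' \<longleftrightarrow> frame 30 5 h h' \<and> (\<forall>i<n. vc h' 7 i = sqrt (vc h 1 i)) \<and> (\<forall>i<n. vc h' 5 i = (\<Sum>l<k. ?s l (row A i)))
   \<and> (\<forall>j<d. vc h' 6 j = (\<Sum>l<k. ?s l (unit_vec d j))) \<and> sc h' 30 = real k \<and> dr h' = dr h + k * (n + d)
   \<and> ct h' \<le> ct h + T * (40 + k * (pw * (opcost (sc h 8) kc + 10) + 160))" for k h'
 have regs: "sc h' 19 = 0" "sc h' 1 = 1" "sc h' 12 = real kc" "sc h' 13 = real pw" "sc h' 2 = 1 / 2" "sc h' 14 = real m" if "I k h'" for k h'
  using that r by (auto simp: I_def frame_def)
 have body: "WP (sk1 ;; Bin Add 30 30 1) (I (Suc k)) (h'\<lparr>ct := ct h' + 2\<rparr>)" if I: "I k h'" for k h'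
 proof -
  have e: "sc h' 10 = sc h 10" "sc h' 11 = sc h 11" "sc h' 8 = sc h 8" "sc h' 9 = sc h 9" "vc h' 1 = vc h 1" using I by (auto simp: I_def frame_def)
  have xi: "(\<lambda>l. rnd (dr h' + l)) = (\<lambda>l. \<xi> (k * (n + d) + l))" using I by (simp add: I_def \<xi>_def add.assoc)
  show ?thesis
   apply (simp add: wp_Seq)
   apply (rule wp_sk1[where kc = kc and pw = pw])
   using regs[OF I] r I e apply (simp_all add: I_def)[7]
   apply (simp add: wp_simps xi e regs(1-4)[OF I, simplified])
   unfolding I_def
   apply (intro conjI)
   apply (use I r in \<open>auto simp: frame_def I_def Z_def\<close>)[6]
   subgoal using I mult_le_mono2[of 1 T 10] nT d0 dn by (auto simp: I_def algebra_simps)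
   done
 qed
 show ?thesis unfolding sketch_def
  apply (simp add: wp_Seq)
  apply (rule wps, simp add: wpd)
  apply (rule wps, simp add: wpd)
  apply (rule wps, simp add: wpd)
  apply (rule wp_iter[where N = m and I = I])
  subgoal using nT d0 dn unfolding I_def by (auto simp: frame_def)
  subgoal for t1 t2 t3 k h' using regs[of k h'] by (auto simp: I_def)
  subgoal using body by simp
  subgoal for t1 t2 t3 h' using regs[of m h'] by (auto simp: I_def)
  subgoal premises p for t1 t2 t3 h'
   apply (simp add: wpd)
   apply (rule wpr, simp, simp add: wpd)
   apply (rule wpr, simp, simp add: wpd)
   apply (rule Q)
   apply (use p in \<open>auto simp: frame_def I_def\<close>)[2]
   subgoal using p regs[OF p] by (auto simp: estim_def I_def dim)
   subgoal using p regs[OF p] by (auto simp: estim_def I_def dim sum_divide_distrib)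
   subgoal using p nT d0 dn by (auto simp: I_def algebra_simps)
   done
  done
qed

end

section \<open>Parameters of the algorithm\<close>

abbreviation tol :: "nat \<Rightarrow> nat \<Rightarrow> real" where
 "tol E p \<equiv> 4 * ((real p + 2) * real E)"

abbreviation cs0 :: "nat \<Rightarrow> real \<Rightarrow> real" where
 "cs0 E x \<equiv> (4 * (x * real E) + 1) / (4 * (x * real E) - 1)"

definition cregs :: "nat \<Rightarrow> nat \<Rightarrow> nat \<Rightarrow> real \<Rightarrow> hst \<Rightarrow> bool" where
 "cregs n E p \<delta> h \<longleftrightarrow> sc h 0 = \<delta> \<and> sc h 1 = 1 \<and> sc h 2 = 1 / 2 \<and> sc h 3 = real E \<and> sc h 5 = real n \<and> sc h 6 = real p \<and> sc h 19 = 0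
   \<and> sc h 22 = 1 / real E / real p + 1 \<and> sc h 23 = 1 / real E / real p * (1 / real E) + 1 \<and> sc h 24 = 20 * (1 / real E) + 1
   \<and> sc h 25 = 1 + 1 / real E \<and> sc h 27 = 8 * real E * real E"

text \<open>\<open>hi\<close> bounds the spectrum of \<open>N\<close> while the total step length is
  below \<open>E\<close>. Register 20 keeps a covering step within relative size
  \<open>e / p\<close>, and register 21 makes the first packing potential at most 1. The lower bound
  on the Chebyshev value gives accuracy, minimality of the degree bounds the running time.\<close>

definition kpar :: "nat \<Rightarrow> nat \<Rightarrow> nat \<Rightarrow> nat \<Rightarrow> hst \<Rightarrow> bool" where
 "kpar n E p kc h \<longleftrightarrow> (let hi = 4 * (sc h 7 * real E); s0 = (hi + 1) / (hi - 1) in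
   sc h 10 = s0 \<and> sc h 11 = 2 / (hi - 1) \<and> sc h 12 = real kc \<and> 1 \<le> kc \<and> sc h 20 = 1 / (2 * (real E * real p * sc h 7))
   \<and> sc h 21 = 1 / (4 * (hi ^ Suc p * real n * real n)) \<and> tol E p \<le> cheb s0 kc
   \<and> (\<forall>l. 1 \<le> l \<and> l < kc \<longrightarrow> cheb s0 l < tol E p))"

text \<open>With \<open>m = 8 E^2 (mk + 1)\<close> samples the exponent \<open>m e^2 / 8\<close> of
  the chi-square tail equals \<open>mk + 1\<close>; the condition on \<open>mk\<close> then beats
  the union bound over rows and unit vectors.\<close>

definition mpar :: "nat \<Rightarrow> nat \<Rightarrow> real \<Rightarrow> nat \<Rightarrow> hst \<Rightarrow> bool" where
 "mpar n E \<delta> mk h \<longleftrightarrow> (let x = 4 * ((sc h 16 + 1) * (sc h 16 + 2) * real n) / \<delta> in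
   sc h 14 = 8 * real E * real E * real (Suc mk) \<and> x \<le> 2 ^ mk \<and> (\<forall>l<mk. 2 ^ l < x))"

text \<open>Registers from 30 on are scratch space and are left unconstrained.\<close>

definition chg :: "nat set \<Rightarrow> hst \<Rightarrow> hst \<Rightarrow> bool" where
 "chg S h h' \<longleftrightarrow> (\<forall>r<30. r \<notin> S \<longrightarrow> sc h' r = sc h r)"

lemma chgD: "\<lbrakk>chg S h h'; r < 30; r \<notin> S\<rbrakk> \<Longrightarrow> sc h' r = sc h r"
 by (simp add: chg_def)

lemma ex_least_ge:
 fixes f :: "nat \<Rightarrow> real"
 assumes "\<exists>k. x \<le> f k"
 obtains k where "x \<le> f k" "\<And>l. l < k \<Longrightarrow> f l < x"
proof -
 let ?k = "LEAST k. x \<le> f k"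
 have "x \<le> f ?k" using assms by (rule LeastI_ex)
 moreover have "f l < x" if "l < ?k" for l using not_less_Least[OF that] by simp
 ultimately show ?thesis by (rule that)
qed

lemma ex_pow_ge: "1 < (a::real) \<Longrightarrow> \<exists>k. x \<le> a ^ k"
 using real_arch_pow[of a x] by (meson less_imp_le)

lemma ex_double_exponent:
 assumes a: "1 < (a::real)"
 obtains j where "x \<le> a ^ 2 ^ Suc j" "\<And>l. l < j \<Longrightarrow> a ^ 2 ^ Suc l < x" "0 < j \<Longrightarrow> a ^ 2 ^ j < x"
proof -
 obtain k where k: "x \<le> a ^ k" using ex_pow_ge[OF a] by blast
 have "k < 2 ^ k" by (rule less_exp)
 then have "k \<le> 2 ^ Suc k" unfolding power_Suc by linarith
 then have "a ^ k \<le> a ^ 2 ^ Suc k" using a by (intro power_increasing) auto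
 then obtain j where j: "x \<le> a ^ 2 ^ Suc j" "\<And>l. l < j \<Longrightarrow> a ^ 2 ^ Suc l < x"
  using ex_least_ge[of x "\<lambda>k. a ^ 2 ^ Suc k"] order_trans[OF k] by blast
 have "a ^ 2 ^ j < x" if "0 < j" using j(2)[of "j - 1"] that by simp
 then show ?thesis using that[OF j] by blast
qed

lemma ex_cheb_ge:
 assumes "1 < s" shows "\<exists>k. x \<le> cheb s (Suc k)"
proof -
 define \<delta> where "\<delta> = s - 1"
 have d: "0 < \<delta>" using assms by (simp add: \<delta>_def)
 obtain k where k: "2 * x \<le> (1 + sqrt (2 * \<delta>)) ^ k" using ex_pow_ge[of "1 + sqrt (2 * \<delta>)" "2 * x"] d by auto
 also have "\<dots> \<le> (1 + sqrt (2 * \<delta>)) ^ Suc k" using d by (intro power_increasing) auto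
 also have "\<dots> \<le> 2 * cheb s (Suc k)" using cheb_growth[of \<delta> "Suc k"] d by (simp add: \<delta>_def)
 finally show ?thesis by auto
qed

subsection \<open>Correctness of the program\<close>

context prog_context
begin

lemma wp_setm:
 assumes r: "sc h 1 = 1" "sc h 2 = 1 / 2" "sc h 19 = 0"
 defines "x \<equiv> 4 * ((sc h 16 + 1) * (sc h 16 + 2) * sc h 5) / sc h 0"
 assumes Q: "\<And>h' k. \<lbrakk>chg {14} h h'; vc h' = vc h; dr h' = dr h; sc h' 14 = sc h 27 * real (Suc k); x \<le> 2 ^ k;
   \<And>l. l < k \<Longrightarrow> 2 ^ l < x; ct h' \<le> ct h + 20 + 10 * k\<rbrakk> \<Longrightarrow> Q h'"
 shows "WP setm Q h"
proof -
 obtain k where k: "x \<le> 2 ^ k" "\<And>l. l < k \<Longrightarrow> 2 ^ l < x"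
  using ex_least_ge[OF ex_pow_ge[of 2 x]] by auto
 define I where "I i h' \<longleftrightarrow> chg {14} h h' \<and> vc h' = vc h \<and> dr h' = dr h \<and> sc h' 14 = sc h 27 * real (Suc i) \<and> sc h' 30 = x / 2 ^ i
   \<and> ct h' \<le> ct h + 10 + 10 * i" for i h'
 show ?thesis unfolding setm_def
  apply (simp add: wpq)
  apply (rule wp_iter[where N = k and I = I])
  subgoal using r unfolding I_def chg_def x_def by (simp add: algebra_simps)
  subgoal for i h' using k(2)[of i] r by (simp add: I_def chg_def less_divide_eq)
  subgoal for i h' using r(1,3) by (auto simp: r(2) I_def chg_def wpq algebra_simps)
  subgoal for h' using k(1) r by (simp add: I_def chg_def less_divide_eq)
  subgoal for h' by (rule Q[of _ k]) (use k in \<open>auto simp: I_def chg_def\<close>)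
  done
qed

lemma wp_setk:
 assumes r: "sc h 1 = 1" "sc h 2 = 1 / 2" "sc h 19 = 0" "sc h 3 = real E" "1 \<le> E" "sc h 6 = real p" "1 \<le> sc h 7" "sc h 5 = real n"
 assumes Q: "\<And>h' kc. \<lbrakk>chg {8,9,10,11,12,13,17,20,21} h h'; \<And>a. 2 \<le> a \<Longrightarrow> vc h' a = vc h a; dr h' = dr h;
   \<And>i. i < n \<Longrightarrow> vc h' 0 i = 0; \<And>i. i < n \<Longrightarrow> vc h' 1 i = 0;
   sc h' 8 = 0; sc h' 9 = 1; kpar n E p kc h'; sc h' 13 = real p / 2 + 1; sc h' 17 = 0;
   ct h' \<le> ct h + 70 + 10 * p + 15 * kc + 20 * n\<rbrakk> \<Longrightarrow> Q h'"
 shows "WP setk Q h"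
proof -
 define hi where "hi = 4 * (sc h 7 * real E)"
 define s0 where "s0 = (hi + 1) / (hi - 1)"
 have "1 * 1 \<le> sc h 7 * real E" using r by (intro mult_mono) auto
 then have hi: "4 \<le> hi" unfolding hi_def by simp
 then have s0: "1 < s0" unfolding s0_def by simp
 obtain k where k: "tol E p \<le> cheb s0 (Suc k)" "\<And>l. l < k \<Longrightarrow> cheb s0 (Suc l) < tol E p"
  by (rule ex_least_ge[OF ex_cheb_ge[OF s0]]) auto
 have kp: "kpar n E p (Suc k) g" if "sc g 7 = sc h 7" "sc g 10 = s0" "sc g 11 = 2 / (hi - 1)" "sc g 12 = real (Suc k)"
   "sc g 20 = 1 / (2 * (real E * real p * sc h 7))" "sc g 21 = 1 / (4 * (hi ^ Suc p * real n * real n))" for g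
 proof -
  have "cheb s0 l < tol E p" if "1 \<le> l" "l < Suc k" for l using k(2)[of "l - 1"] that by simp
  then show ?thesis unfolding kpar_def Let_def that hi_def[symmetric] s0_def[symmetric] using k(1) by simp
 qed
 define I1 where "I1 i h' \<longleftrightarrow> chg {10,11,20} h h' \<and> vc h' = vc h \<and> dr h' = dr h \<and> sc h' 10 = s0 \<and> sc h' 11 = 2 / (hi - 1)
  \<and> sc h' 20 = 1 / (2 * (real E * real p * sc h 7)) \<and> sc h' 30 = hi \<and> sc h' 31 = real i \<and> sc h' 32 = hi ^ Suc i \<and> ct h' \<le> ct h + 20 + 10 * i" for i h'
 define I2 where "I2 i h' \<longleftrightarrow> chg {10,11,12,20,21} h h' \<and> vc h' = vc h \<and> dr h' = dr h \<and> sc h' 10 = s0 \<and> sc h' 11 = 2 / (hi - 1)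
  \<and> sc h' 20 = 1 / (2 * (real E * real p * sc h 7)) \<and> sc h' 21 = 1 / (4 * (hi ^ Suc p * real n * real n))
  \<and> sc h' 31 = tol E p \<and> sc h' 33 = cheb s0 i \<and> sc h' 34 = cheb s0 (Suc i) \<and> sc h' 12 = real (Suc i) \<and> ct h' \<le> ct h + 50 + 10 * p + 10 * i" for i h'
 show ?thesis unfolding setk_def
  apply (simp add: wpq)
  apply (rule wp_iter[where N = p and I = I1])
  subgoal using r unfolding I1_def chg_def s0_def hi_def by (simp add: algebra_simps)
  subgoal for i h' using r by (simp add: I1_def chg_def)
  subgoal for i h' using r by (auto simp: I1_def chg_def wpq algebra_simps)
  subgoal for h' using r by (simp add: I1_def chg_def)
  subgoal premises p1 for h1
   using p1 apply (simp add: wpq)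
   apply (rule wp_iter[where N = k and I = I2])
   subgoal using r unfolding I2_def I1_def chg_def by (simp add: algebra_simps)
   subgoal for i h' using k(2)[of i] r by (simp add: I2_def chg_def)
   subgoal for i h' using r by (auto simp: I2_def chg_def wpq algebra_simps)
   subgoal for h' using k(1) by (simp add: I2_def chg_def)
   subgoal premises p2 for h2
    using p2 apply (simp add: wpq)
    apply (rule wps, simp add: wpd)
    apply (rule wps, simp add: wpd)
    apply (rule Q[of _ "Suc k"])
    subgoal by (auto simp: I2_def chg_def)
    apply (auto simp: I2_def)[6]
    subgoal by (rule kp) (auto simp: I2_def chg_def)
    subgoal using r by (auto simp: I2_def chg_def)
    apply (auto simp: I2_def)[2]
    done
   done
  done
qed

lemma wp_postC:
 assumes r: "sc h 1 = 1" "sc h 2 = 1 / 2" "sc h 19 = 0"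
 assumes Q: "\<And>h'. \<lbrakk>chg {8,9,13,18} h h'; vc h' 0 = vc h 0; dr h' = dr h;
   \<And>i. i < n \<Longrightarrow> vc h' 4 i = sc h 28 / (vc h 5 i * sc h 7);
   \<And>i. i < n \<Longrightarrow> vc h' 3 i = vc h' 4 i / vc h' 4 i * sc h 21;
   \<And>i. i < n \<Longrightarrow> vc h' 2 i = vc h' 3 i * vc h' 4 i; \<And>i. i < n \<Longrightarrow> vc h' 1 i = vc h' 2 i;
   sc h' 18 = sc h 21; sc h' 8 = 1; sc h' 9 = 0; sc h' 13 = sc h 6 / 2 - 1; ct h' \<le> ct h + 50 + 80 * n\<rbrakk> \<Longrightarrow> Q h'"
 shows "WP postC Q h"
 unfolding postC_def
 apply (simp add: wp_Seq)
 apply (rule wpr, simp, simp add: wpd)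
 apply (rule wps, simp add: wpd)
 apply (rule wpr, simp, simp add: wpd)
 apply (rule wps, simp add: wpd)
 apply (rule wps, simp add: wpd)
 apply (rule wpr, simp, simp add: wpd)
 apply (rule wps, simp add: wpd)
 apply (rule wpr, simp, simp add: wpd)
 apply (rule Q)
 using r by (auto simp: chg_def)

end

context prog_context begin

text \<open>
 The three outcomes are: another round of the packing phase, a failed guess, and the end of a
 packing phase.
\<close>

lemma wp_postP:
 assumes r: "sc h 1 = 1" "sc h 2 = 1 / 2" "sc h 19 = 0" "sc h 3 = real E" "1 \<le> E" "sc h 6 = real p" "p = 2 ^ lp" "1 \<le> sc h 7" "sc h 5 = real n"
 assumes t0: "0 \<le> (\<Sum>i<n. vc h 2 i * vc h 5 i)"
 defines "v \<equiv> root p (\<Sum>i<n. vc h 2 i * vc h 5 i)"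
 defines "Y \<equiv> \<lambda>i. if sc h 24 * (\<Sum>i<n. vc h 2 i * vc h 5 i) / v < vc h 5 i * vc h 4 i then vc h 3 i else vc h 3 i * sc h 22"
 assumes k1: "1 \<le> sc h 25"
 assumes Q1: "\<And>h'. \<lbrakk>(\<Sum>i<n. Y i) < real E; sc h 18 * sc h 23 < real E; chg {18} h h'; vc h' 0 = vc h 0; vc h' 4 = vc h 4;
   \<And>i. i < n \<Longrightarrow> vc h' 3 i = Y i; \<And>i. i < n \<Longrightarrow> vc h' 2 i = Y i * vc h 4 i; \<And>i. i < n \<Longrightarrow> vc h' 1 i = Y i * vc h 4 i;
   sc h' 18 = sc h 18 * sc h 23; ct h' \<le> ct h + 80 + 10 * p + 100 * n\<rbrakk> \<Longrightarrow> Q h'"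
 assumes Q2: "\<And>h' kc. \<lbrakk>(\<Sum>i<n. Y i) < real E; real E \<le> sc h 18 * sc h 23; chg {7,8,9,10,11,12,13,17,18,20,21} h h';
   sc h' 7 = sc h 7 * sc h 25; \<And>i. i < n \<Longrightarrow> vc h' 0 i = 0; \<And>i. i < n \<Longrightarrow> vc h' 1 i = 0;
   sc h' 8 = 0; sc h' 9 = 1; kpar n E p kc h'; sc h' 13 = real p / 2 + 1; sc h' 17 = 0;
   ct h' \<le> ct h + 180 + 20 * p + 15 * kc + 120 * n\<rbrakk> \<Longrightarrow> Q h'"
 assumes Q3: "\<And>h'. \<lbrakk>real E \<le> (\<Sum>i<n. Y i); chg {8,9,13,15,17,18} h h';
   \<And>i. i < n \<Longrightarrow> vc h' 0 i = vc h 0 i + Y i * vc h 4 i * (sc h 20 * sc h 7 / (\<Sum>i<n. Y i));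
   \<And>i. i < n \<Longrightarrow> vc h' 1 i = vc h' 0 i;
   sc h' 17 = sc h 17 + sc h 20; sc h' 8 = 0; sc h' 9 = 1; sc h' 13 = real p / 2 + 1;
   sc h' 15 = (if sc h' 17 < real E then sc h 15 else 1); ct h' \<le> ct h + 90 + 10 * p + 120 * n\<rbrakk> \<Longrightarrow> Q h'"
 shows "WP postP Q h"
proof -
 let ?t = "\<Sum>i<n. vc h 2 i * vc h 5 i"
 have mid: "WP (If (TR 34 3) (If (TR 18 3) (VSc Add True 1 2 19) (Bin Mul 7 7 25 ;; setk))
    (Bin Mul 35 20 7 ;; Bin Div 35 35 34 ;; VSc Mul True 11 2 35 ;; VBin Add True 0 0 11 ;; Bin Add 17 17 20 ;; VSc Add True 1 0 19 ;;
    Cst 9 1 ;; Cst 8 0 ;; Bin Mul 13 6 2 ;; Bin Add 13 13 1 ;; If (TR 17 3) (Cst 30 0) (Cst 15 1))) Q h1"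
  if a: "chg {18} h h1" "vc h1 0 = vc h 0" "vc h1 4 = vc h 4" "\<And>i. i < n \<Longrightarrow> vc h1 3 i = Y i" "\<And>i. i < n \<Longrightarrow> vc h1 2 i = Y i * vc h 4 i"
   "sc h1 34 = (\<Sum>i<n. Y i)" "sc h1 18 = sc h 18 * sc h 23" "ct h1 \<le> ct h + 42 + 10 * p + 60 * n" for h1
 proof -
  have r1: "sc h1 1 = 1" "sc h1 2 = 1 / 2" "sc h1 19 = 0" "sc h1 3 = real E" "sc h1 6 = real p" "sc h1 7 = sc h 7" "sc h1 25 = sc h 25"
   "sc h1 5 = sc h 5" "sc h1 20 = sc h 20" "sc h1 17 = sc h 17" "sc h1 15 = sc h 15" "sc h1 0 = sc h 0"
   using a(1) r by (simp_all add: chg_def)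
  note r1' = r1(2) r1(1,3-)[simplified]
  consider "(\<Sum>i<n. Y i) < real E" "sc h 18 * sc h 23 < real E" | "(\<Sum>i<n. Y i) < real E" "real E \<le> sc h 18 * sc h 23" | "real E \<le> (\<Sum>i<n. Y i)"
   by linarith
  then show ?thesis
  proof cases
   case 1
   show ?thesis
    apply (simp add: wp_If r1' a(6,7) 1)
    apply (rule wpr, simp, simp add: wpd)
    apply (rule Q1[OF 1])
    using a r1 by (auto simp: chg_def)
  next
   case 2
   have k7: "1 \<le> sc h 7 * sc h 25" using mult_mono[of 1 "sc h 7" 1 "sc h 25"] r(8) k1 by simp
   show ?thesis
    apply (simp add: wp_If r1' a(6,7) 2(1) leD[OF 2(2)] wpq)
    apply (rule wp_setk[where E = E and p = p])
    apply (simp_all add: r1' r(9) r(5)[simplified] k7)[8]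
    subgoal premises q for h' kc
     apply (rule Q2[OF 2, of h' kc])
     subgoal using q(1) a(1) by (simp add: chg_def)
     subgoal using q(1) by (simp add: chg_def)
     using a(8) q(4-) r1' by simp_all
    done
  next
   case 3
   show ?thesis
    apply (simp add: wp_If r1' a(6,7) leD[OF 3] wpq)
    apply (rule wpr, simp, simp add: wpd)
    apply (rule wps, simp add: wpd)
    apply (rule wpr, simp, simp add: wpd)
    apply (simp add: wp_If r1' wp_simps)
    apply (intro conjI impI)
    subgoal
     apply (rule Q3[OF 3])
     subgoal using a(1) by (simp add: chg_def)
     using a(8) by (simp_all add: a(2-6)[simplified] r1')
    subgoal
     apply (rule Q3[OF 3])
     subgoal using a(1) by (simp add: chg_def)
     using a(8) by (simp_all add: a(2-6)[simplified] r1')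
    done
  qed
 qed
 have lpp: "lp \<le> p" using r(7) by (simp add: less_imp_le)
 define I where "I i h' \<longleftrightarrow> chg {} h h' \<and> (\<forall>a. a \<noteq> 11 \<longrightarrow> vc h' a = vc h a) \<and> dr h' = dr h \<and> sc h' 30 = ?t \<and> sc h' 31 = root (2 ^ i) ?t
  \<and> sc h' 32 = 2 ^ i \<and> ct h' \<le> ct h + 20 + 10 * i + 20 * n" for i h'
 have regs: "sc h' 6 = 2 ^ lp" if "I k h'" for k h'
  using that r by (auto simp: I_def chg_def)
 have fin: "WP postT Q h1" if I: "I lp h0" and h1: "h1 = h0\<lparr>ct := ct h0 + 2\<rparr>" for h0 h1
 proof -
  note I' = I[unfolded I_def]
  have e: "sc h1 a = sc h a" if "a < 30" for a using I' that by (simp add: h1 chg_def)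
  have f: "vc h1 a = vc h a" if "a \<noteq> 11" for a using I' that by (simp add: h1)
  have v: "sc h1 31 = v" "sc h1 30 = ?t" using I' r(7) by (simp_all add: h1 v_def)
  have ct1: "ct h1 \<le> ct h + 22 + 10 * p + 20 * n" using I' lpp by (simp add: h1)
  show ?thesis unfolding postT_def
   apply (simp add: wpq)
   apply (rule wp_VThr[OF dim(1), rotated], simp, simp, simp, simp, simp add: wpd cong: if_cong)
   apply (rule wps, simp add: wpd cong: if_cong)
   apply (rule wpr, simp, simp add: wpd cong: if_cong)
   apply (unfold One_nat_def[symmetric])
   apply (rule mid)
   using ct1 by (auto simp: chg_def Y_def e f v cong: if_cong)
 qed
 show ?thesis unfolding postP_def
  apply (simp add: wp_Seq)
  apply (rule wps, simp add: wpd)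
  apply (rule wpr, simp, simp add: wpd)
  apply (rule wp_iter[where N = lp and I = I])
  subgoal using r unfolding I_def chg_def by simp
  subgoal for t t' k h' using regs[of k h'] by (simp add: I_def)
  subgoal for t t' i h' using t0 by (auto simp: I_def chg_def wpq sqrt_def real_root_mult_exp[symmetric])
  subgoal for t t' h' using regs[of lp h'] by (simp add: I_def)
  subgoal for t t' h' by (rule fin) auto
  done
qed

end

context prog_context
begin

lemma wp_init0:
 assumes E: "1 \<le> E" and r: "sc h 0 = \<delta>"
 assumes Q: "\<And>h' p j kc mk. \<lbrakk>cregs n E p \<delta> h'; p = 2 ^ Suc j; real n \<le> (1 + 1 / real E) ^ p; (0 < j \<Longrightarrow> (1 + 1 / real E) ^ 2 ^ j < real n);
   sc h' 7 = 1; kpar n E p kc h'; sc h' 8 = 0; sc h' 9 = 1; sc h' 13 = real p / 2 + 1; sc h' 15 = 0; sc h' 16 = 0; sc h' 17 = 0;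
   mpar n E \<delta> mk h'; \<And>i. i < n \<Longrightarrow> vc h' 0 i = 0; \<And>i. i < n \<Longrightarrow> vc h' 1 i = 0; dr h' = dr h;
   ct h' \<le> ct h + 200 + 20 * p + 15 * kc + 40 * n + 10 * mk\<rbrakk> \<Longrightarrow> Q h'"
 shows "WP (init0 E) Q h"
proof -
 let ?a = "1 + 1 / real E"
 have a: "1 < ?a" using E by simp
 obtain j where j: "real n \<le> ?a ^ 2 ^ Suc j" "\<And>l. l < j \<Longrightarrow> ?a ^ 2 ^ Suc l < real n" and jj: "0 < j \<Longrightarrow> ?a ^ 2 ^ j < real n"
  using ex_double_exponent[OF a] by blast
 define p :: nat where "p = 2 ^ Suc j"
 have "Suc j < p" unfolding p_def by (rule less_exp)
 then have jp: "j \<le> p" by simp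
 define I where "I i h' \<longleftrightarrow> sc h' 0 = \<delta> \<and> sc h' 1 = 1 \<and> sc h' 2 = 1 / 2 \<and> sc h' 3 = real E \<and> sc h' 4 = 1 / real E \<and> sc h' 5 = real n \<and> sc h' 19 = 0
   \<and> sc h' 24 = 20 * (1 / real E) + 1 \<and> sc h' 25 = ?a \<and> sc h' 27 = 8 * real E * real E \<and> sc h' 6 = 2 ^ Suc i \<and> sc h' 30 = ?a ^ 2 ^ Suc i
   \<and> dr h' = dr h \<and> ct h' \<le> ct h + 40 + 20 * n + 10 * i" for i :: nat and h' :: hst
 {
  fix h1 h' h2 :: hst and kc mk :: nat
  assume c: "cregs n E p \<delta> h1" "dr h1 = dr h" "ct h1 \<le> ct h + 60 + 20 * n + 10 * p"
  assume k: "chg {8,9,10,11,12,13,17,20,21} h1 h'" "sc h' 7 = 1" "kpar n E p kc h'" "dr h' = dr h1"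
   "\<And>i. i < n \<Longrightarrow> vc h' 0 i = 0" "\<And>i. i < n \<Longrightarrow> vc h' 1 i = 0" "sc h' 8 = 0" "sc h' 9 = 1" "sc h' 13 = real p / 2 + 1" "sc h' 17 = 0"
   "ct h' \<le> ct h1 + 72 + 10 * p + 15 * kc + 20 * n"
  assume m: "chg {14,16,15} h' h2" "vc h2 = vc h'" "dr h2 = dr h'" "sc h2 16 = 0" "sc h2 15 = 0" "mpar n E \<delta> mk h2" "ct h2 \<le> ct h' + 30 + 10 * mk"
  have "Q h2"
 proof (rule Q[of p h2 j kc mk])
  have e: "sc h2 r = sc h1 r" if "r \<in> {0,1,2,3,5,6,19,22,23,24,25,27}" for r
   using k(1) m(1) that by (elim insertE emptyE) (simp_all add: chg_def)
  have f: "sc h2 r = sc h' r" if "r \<in> {7,8,9,10,11,12,13,17,20,21}" for r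
   using m(1) that by (elim insertE emptyE) (simp_all add: chg_def)
  show "cregs n E p \<delta> h2" using c(1) e unfolding cregs_def by simp
  show "kpar n E p kc h2" using k(3) f unfolding kpar_def by simp
  show "sc h2 7 = 1" "sc h2 8 = 0" "sc h2 9 = 1" "sc h2 13 = real p / 2 + 1" "sc h2 17 = 0" using k f by simp_all
 qed (use c k m j jj in \<open>auto simp: p_def\<close>)
 }
 note fin = this
 show ?thesis unfolding init0_def
  apply (simp add: wpq)
  apply (rule wps, simp add: wpd)
  apply (rule wpr, simp, simp add: wpd)
  apply (rule wp_iter[where N = j and I = I])
  subgoal using r E by (simp add: I_def power2_eq_square)
  subgoal premises p0 for t t' k h' using p0(2) j(2)[OF p0(1)] by (simp add: I_def)
  subgoal premises p0 for t t' i h' using p0(2) by (simp add: I_def wpq power_mult[symmetric] power_add[symmetric] mult_2[symmetric])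
  subgoal premises p0 for t t' h' using p0 j(1) by (simp add: I_def)
  subgoal premises p0 for t t' h'
  proof -
   note I' = p0[unfolded I_def]
   show ?thesis
    apply (simp add: wpq)
    apply (rule wp_setk[where E = E and p = p])
    using I' E apply (simp_all add: p_def)[8]
    subgoal premises q for h1 kc
     apply (simp add: wpq)
     apply (rule wp_setm)
     apply (use chgD[OF q(1)] I' in simp_all)[3]
     subgoal premises m for h2 mk
      apply (simp add: wpq)
      apply (rule fin[OF _ _ _ q(1), where ?kc2 = kc and ?mk2 = mk])
      subgoal using I' E by (simp add: cregs_def p_def mult.commute)
      subgoal using I' by simp
      subgoal using I' jp by simp
      subgoal using chgD[OF q(1), of 7] by simp
      apply (use q in \<open>simp_all add: p_def\<close>)[9]
      subgoal using m(1) by (simp add: chg_def)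
      subgoal using m(2) by simp
      subgoal using m(3) by simp
      subgoal using chgD[OF m(1), of 16] by simp
      subgoal by simp
      subgoal using m(4-) chgD[OF m(1)] chgD[OF q(1)] I' by (simp add: mpar_def mult_ac)
      subgoal using m by simp
      done
     done
    done
  qed
  done
qed

end

section \<open>Quadratic forms estimated by the sketches\<close>

lemma cheb_power_bounds:
 fixes x :: real and p E :: nat
 assumes lh: "1 < hi" "1 \<le> x" "x \<le> hi" and E: "1 \<le> E"
 defines "a \<equiv> (hi + 1) / (hi - 1)" and "b \<equiv> 2 / (hi - 1)"
 assumes tau: "tol E p \<le> cheb a k"
 defines "S \<equiv> cheb a k ^ (p + 2)"
 shows "0 < S" "(1 - 1 / real E) * S * (1 / x) ^ (p + 1) \<le> chebq a b k x ^ (p + 2) * x"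
  "chebq a b k x ^ (p + 2) * x \<le> (1 + 1 / real E) * S * (1 / x) ^ (p + 1)"
proof -
 let ?t = "cheb a k" and ?y = "x * chebq a b k x"
 have "4 * ((0 + 2) * 1) \<le> tol E p" using E by (intro mult_left_mono mult_mono) auto
 also note tau
 finally have t: "8 \<le> ?t" by simp
 then show "0 < S" unfolding S_def by simp
 have u: "real (p + 2) * (1 / ?t) \<le> 1 / (4 * real E)" using tau t E by (simp add: field_simps)
 have u1: "1 / (4 * real E) \<le> 1" using E by simp
 have u2: "1 / (4 * real E) = 1 / real E / 4" by simp
 have "1 / (4 * real E) \<le> 1 / real E" using E by (simp add: field_simps)
 with u have u3: "real (p + 2) * (1 / ?t) \<le> 1 / real E" by simp
 have y: "?t - 1 \<le> ?y" "?y \<le> ?t + 1" unfolding a_def b_def by (rule chebq_approx[OF lh])+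
 \<comment> \<open>Each factor \<open>x * chebq a b k x\<close> equals \<open>cheb a k\<close> up to
   1, so the power is \<open>S\<close> up to a relative error of about
   \<open>(p + 2) / cheb a k\<close>, which \<open>tol\<close> keeps below \<open>e\<close>. The
   scale \<open>S\<close> itself drops out later, because only quotients of estimates enter the row
   bounds.\<close>
 have eq: "chebq a b k x ^ (p + 2) * x = ?y ^ (p + 2) * (1 / x) ^ (p + 1)"
  using lh by (simp add: power_mult_distrib field_simps power_divide)
 have x: "0 \<le> (1 / x) ^ (p + 1)" using lh by simp
 have "1 - 1 / real E \<le> 1 + real (p + 2) * (- (1 / ?t))" using u3 by simp
 also have "\<dots> \<le> (1 + - (1 / ?t)) ^ (p + 2)" by (rule Bernoulli_inequality) (use t in simp)
 finally have "(1 - 1 / real E) * S \<le> (1 + - (1 / ?t)) ^ (p + 2) * S" using \<open>0 < S\<close> by (intro mult_right_mono) auto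
 also have "\<dots> = (?t - 1) ^ (p + 2)" unfolding S_def power_mult_distrib[symmetric] using t by (simp add: algebra_simps)
 also have "\<dots> \<le> ?y ^ (p + 2)" using y t by (intro power_mono) auto
 finally show "(1 - 1 / real E) * S * (1 / x) ^ (p + 1) \<le> chebq a b k x ^ (p + 2) * x"
  unfolding eq by (rule mult_right_mono) (rule x)
 have "?y ^ (p + 2) \<le> (?t + 1) ^ (p + 2)" using y t by (intro power_mono) auto
 also have "\<dots> = (1 + 1 / ?t) ^ (p + 2) * S" unfolding S_def power_mult_distrib[symmetric] using t by (simp add: algebra_simps)
 also have "(1 + 1 / ?t) ^ (p + 2) \<le> 1 + real (p + 2) * (1 + 1 / (4 * real E)) * (1 / ?t)"
  by (rule power_1_plus_le) (use t u u1 in auto)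
 also have "real (p + 2) * (1 + 1 / (4 * real E)) * (1 / ?t) = (1 + 1 / (4 * real E)) * (real (p + 2) * (1 / ?t))" by simp
 also have "\<dots> \<le> 2 * (1 / (4 * real E))" using u u1 t by (intro mult_mono) auto
 also have "1 + 2 * (1 / (4 * real E)) \<le> 1 + 1 / real E" using E by (simp add: field_simps)
 finally have "?y ^ (p + 2) \<le> (1 + 1 / real E) * S" using \<open>0 < S\<close> by simp
 then show "chebq a b k x ^ (p + 2) * x \<le> (1 + 1 / real E) * S * (1 / x) ^ (p + 1)"
  unfolding eq by (rule mult_right_mono) (rule x)
qed

definition covm :: "real mat \<Rightarrow> real \<Rightarrow> rseq \<Rightarrow> real mat" where
 "covm A b u = b\<^sup>2 \<cdot>\<^sub>m 1\<^sub>m (dim_col A) + gram A u"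

text \<open>For nonnegative \<open>u\<close> this is the expectation of the squared sample
  \<open>samp A Z b u \<xi> a\<close> over a Gaussian tape.\<close>

definition Qv :: "real mat \<Rightarrow> real mat \<Rightarrow> real \<Rightarrow> rseq \<Rightarrow> real vec \<Rightarrow> real" where
 "Qv A Z b u a = qf (Z * covm A b u * Z\<^sup>T) a"

text \<open>The rows yield the row estimates; the unit vectors are included because their values add
  up to the trace.\<close>

definition accurate :: "real mat \<Rightarrow> real \<Rightarrow> real mat \<Rightarrow> real \<Rightarrow> rseq \<Rightarrow> nat \<Rightarrow> rseq \<Rightarrow> bool" where
 "accurate A e Z b u m \<xi> \<longleftrightarrow> (\<forall>a \<in> row A ` {..<dim_row A} \<union> unit_vec (dim_col A) ` {..<dim_col A}.
   (1 - e) * Qv A Z b u a \<le> estim A Z b u m \<xi> a \<and> estim A Z b u m \<xi> a \<le> (1 + e) * Qv A Z b u a)"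

lemma smult01[simp]: "(1::real) \<cdot>\<^sub>m M = M" "M \<in> carrier_mat d d \<Longrightarrow> (0::real) \<cdot>\<^sub>m 1\<^sub>m d + M = M"
 by (auto intro!: eq_matI)

lemma qf_fc_scale:
 assumes U: "orth d U" and v: "v \<in> carrier_vec d" and fg: "\<And>i. i < d \<Longrightarrow> c * f i \<le> g i"
 shows "c * qf (fc U f) v \<le> qf (fc U g) v"
 unfolding qf_fc[OF U v] sum_distrib_left
proof (rule sum_mono)
 fix i assume "i \<in> {..<d}"
 then have "(c * f i) * (col U i \<bullet> v)\<^sup>2 \<le> g i * (col U i \<bullet> v)\<^sup>2" using fg by (intro mult_right_mono) auto
 then show "c * (f i * (col U i \<bullet> v)\<^sup>2) \<le> g i * (col U i \<bullet> v)\<^sup>2" by (simp add: mult_ac)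
qed

context
 fixes A :: "real mat" and n d E p :: nat and e :: real
 assumes A: "A \<in> carrier_mat n d" and E: "1 \<le> E" and e: "e = 1 / real E" and p: "even p"
begin

text \<open>With \<open>Z\<close> the power \<open>p/2 + 1\<close> of the approximate inverse and
  covariance \<open>N\<close>, the form is that of \<open>Z N Z\<close>, which is about
  \<open>S N^-(p+1)\<close>. Evenness of \<open>p\<close> makes the halved exponent an
  integer.\<close>

lemma cover_sketch:
 assumes U: "orth d U" and N: "1\<^sub>m d + gram A u = fc U f" and f: "\<And>i. i < d \<Longrightarrow> 1 \<le> f i" "\<And>i. i < d \<Longrightarrow> f i \<le> hi" and hi: "1 < hi"
 defines "a \<equiv> (hi + 1) / (hi - 1)" and "b \<equiv> 2 / (hi - 1)"
 assumes tau: "tol E p \<le> cheb a k"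
 defines "S \<equiv> cheb a k ^ (p + 2)"
 defines "P \<equiv> fc U (\<lambda>i. (1 / f i) ^ (p + 1))"
 assumes v: "v \<in> carrier_vec d"
 shows "(1 - e) * S * qf P v \<le> Qv A (opM A a b k 0 u ^\<^sub>m (p div 2 + 1)) 1 u v"
  "Qv A (opM A a b k 0 u ^\<^sub>m (p div 2 + 1)) 1 u v \<le> (1 + e) * S * qf P v"
proof -
 have c1: "covm A 1 u = fc U f" using A N by (simp add: covm_def)
 have Z: "opM A a b k 0 u ^\<^sub>m (p div 2 + 1) = fc U (\<lambda>i. chebq a b k (f i) ^ (p div 2 + 1))"
  using A N by (simp add: opM_def chebM_fc[OF U] fc_mpow[OF U] del: pow_mat.simps)
 have pp: "chebq a b k (f i) ^ (p div 2 + 1) * f i * chebq a b k (f i) ^ (p div 2 + 1) = chebq a b k (f i) ^ (p + 2) * f i" for i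
 proof -
  obtain q where "p = 2 * q" using p by (elim evenE)
  then have "p + 2 = (p div 2 + 1) + (p div 2 + 1)" by simp
  then show ?thesis by (simp only: power_add mult_ac)
 qed
 have Q: "Qv A (opM A a b k 0 u ^\<^sub>m (p div 2 + 1)) 1 u v = qf (fc U (\<lambda>i. chebq a b k (f i) ^ (p + 2) * f i)) v"
  unfolding Qv_def Z c1 fc_sym[OF U] fc_mult[OF U] pp ..
 note cb = cheb_power_bounds[OF hi _ _ E tau[unfolded a_def], folded a_def b_def S_def e]
 show "(1 - e) * S * qf P v \<le> Qv A (opM A a b k 0 u ^\<^sub>m (p div 2 + 1)) 1 u v"
  unfolding Q P_def by (rule qf_fc_scale[OF U v]) (rule cb(2)[OF f])
 have "0 \<le> e" using e by simp
 moreover have "(1 / ((1 + e) * S)) * qf (fc U (\<lambda>i. chebq a b k (f i) ^ (p + 2) * f i)) v \<le> qf P v"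
  unfolding P_def
 proof (rule qf_fc_scale[OF U v])
  fix i assume i: "i < d"
  show "1 / ((1 + e) * S) * (chebq a b k (f i) ^ (p + 2) * f i) \<le> (1 / f i) ^ (p + 1)"
   using cb(1,3)[OF f(1)[OF i] f(2)[OF i]] e by (simp add: divide_le_eq add_pos_nonneg mult_ac)
 qed
 ultimately have *: "qf (fc U (\<lambda>i. chebq a b k (f i) ^ (p + 2) * f i)) v / ((1 + e) * S) \<le> qf P v" by simp
 show "Qv A (opM A a b k 0 u ^\<^sub>m (p div 2 + 1)) 1 u v \<le> (1 + e) * S * qf P v"
 proof (cases "d = 0")
  case True
  then show ?thesis unfolding Q P_def qf_fc[OF U v] by simp
 next
  case False
  then have "0 < S" using cb(1)[OF f(1)[of 0] f(2)[of 0]] by simp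
  then have "0 < (1 + e) * S" using e by (intro mult_pos_pos) (auto simp: add_pos_nonneg)
  then show ?thesis unfolding Q using * by (simp only: pos_divide_le_eq mult_ac)
 qed
qed

text \<open>Here the matrix itself can be applied, so the identity is exact: half of
  \<open>p - 2\<close> factors on each side of the covariance give the exponent
  \<open>p - 1\<close>.\<close>

lemma pack_sketch:
 assumes U: "orth d U" and N: "gram A u = fc U f" and p2: "2 \<le> p"
 assumes v: "v \<in> carrier_vec d"
 shows "Qv A (opM A a b k 1 u ^\<^sub>m (p div 2 - 1)) 0 u v = qf (fc U (\<lambda>i. f i ^ (p - 1))) v"
proof -
 have c1: "covm A 0 u = fc U f" using A N U by (simp add: covm_def)
 have Z: "opM A a b k 1 u ^\<^sub>m (p div 2 - 1) = fc U (\<lambda>i. f i ^ (p div 2 - 1))"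
  using A N by (simp add: opM_def fc_mpow[OF U])
 have pp: "f i ^ (p div 2 - 1) * f i * f i ^ (p div 2 - 1) = f i ^ (p - 1)" for i
 proof -
  obtain r where r: "p = 2 * r" using p by (elim evenE)
  then obtain q where "r = Suc q" using p2 by (cases r) auto
  with r have q: "p = 2 * Suc q" by simp
  then have "p - 1 = q + 1 + q" by simp
  then show ?thesis using q by (simp add: power_add mult_2)
 qed
 show ?thesis unfolding Qv_def Z c1 fc_sym[OF U] fc_mult[OF U] pp ..
qed

end

section \<open>Analysis of the packing and covering phases\<close>

locale scaling_analysis =
 fixes A :: "real mat" and n d E p k :: nat and e :: real
 assumes A: "A \<in> carrier_mat n d" and d0: "1 \<le> d" and dn: "d \<le> n" and rk: "vec_space.rank n A = d"
  and E: "100 \<le> E" and e_def: "e = 1 / real E" and p: "p = 2 ^ Suc k" and np: "real n \<le> (1 + e) ^ p"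
begin

lemma e: "0 < e" "e \<le> 1 / 100"
proof -
 have "100 \<le> real E" using E by simp
 then show "0 < e" "e \<le> 1 / 100" by (simp_all add: e_def field_simps)
qed

lemma p0: "0 < p" "2 \<le> p" "even p"
 using power_increasing[of 1 "Suc k" "2::nat"] by (simp_all add: p)

lemma dp: "real d \<le> (1 + e) ^ p"
 using np dn by simp

text \<open>An estimate carries two errors \<open>1 + e\<close> or \<open>1 - e\<close>, one from
  sampling and one from the polynomial; \<open>Cr\<close> is the worst quotient of two estimates.
  \<open>K\<close> is the growth factor of \<open>packing_step\<close> with slack
  \<open>20 e\<close> in the threshold. \<open>gam\<close> is the factor
  \<open>(1 - e) / (1 + e)\<close> of \<open>covering_step\<close> divided by
  \<open>Cr\<close>.\<close>

definition "Cr = ((1 + e) / (1 - e))\<^sup>2"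
definition "K = (1 + e)\<^sup>2 * (1 + 20 * e) / (1 - e)"
definition "gam = ((1 - e) / (1 + e)) ^ 3"

lemma Cr: "1 \<le> Cr" "Cr \<le> 4"
proof -
 have "1 \<le> (1 + e) / (1 - e)" "(1 + e) / (1 - e) \<le> 2" using e by (simp_all add: field_simps)
 then have "1\<^sup>2 \<le> Cr" "Cr \<le> 2\<^sup>2" unfolding Cr_def by (intro power_mono; simp)+
 then show "1 \<le> Cr" "Cr \<le> 4" by simp_all
qed

lemma rowc[simp]: "row A i \<in> carrier_vec d"
 using A by (metis row_carrier carrier_matD(2))

text \<open>Ideally \<open>\<kappa> * RR i * qf P (row A i) = tr P\<close>, so that in the direction
  with weights \<open>y i * RR i\<close> every row makes covering progress
  \<open>tr P / \<kappa>\<close> per unit of \<open>y\<close>. \<open>RRok\<close> is this equality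
  up to the factor \<open>Cr\<close> on both sides.\<close>

definition RRok :: "real \<Rightarrow> real mat \<Rightarrow> rseq \<Rightarrow> bool" where
 "RRok \<kappa> P RR \<longleftrightarrow> (\<forall>i<n. (row A i = 0\<^sub>v d \<longrightarrow> RR i = 0) \<and> (row A i \<noteq> 0\<^sub>v d \<longrightarrow> 0 < RR i \<and>
   tr P \<le> Cr * (\<kappa> * RR i * qf P (row A i)) \<and> \<kappa> * RR i * qf P (row A i) \<le> Cr * tr P))"

definition Pm :: "real mat \<Rightarrow> rseq \<Rightarrow> real mat" where
 "Pm U f = fc U (\<lambda>i. (1 / f i) ^ (p + 1))"

lemma qf_one: "v \<in> carrier_vec m \<Longrightarrow> qf (1\<^sub>m m) v = v \<bullet> v"
 by (simp add: qf_def)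

context
 fixes U :: "real mat" and f :: "nat \<Rightarrow> real" and hi :: real
 assumes U: "orth d U" and f: "\<And>i. i < d \<Longrightarrow> 1 \<le> f i" "\<And>i. i < d \<Longrightarrow> f i \<le> hi"
begin

lemma Pm_lower: "v \<in> carrier_vec d \<Longrightarrow> (1 / hi) ^ (p + 1) * (v \<bullet> v) \<le> qf (Pm U f) v"
 unfolding Pm_def
proof (rule qf_fc_ge[OF U])
 fix i assume i: "i < d"
 show "(1 / hi) ^ (p + 1) \<le> (1 / f i) ^ (p + 1)" using f[OF i] by (intro power_mono) (auto simp: frac_le)
qed

lemma hi1: "1 \<le> hi"
 using f[of 0] d0 by simp

lemma Pm_pos: "v \<in> carrier_vec d \<Longrightarrow> v \<noteq> 0\<^sub>v d \<Longrightarrow> 0 < qf (Pm U f) v"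
 by (rule less_le_trans[OF mult_pos_pos Pm_lower]) (use scalar_prod_self_pos[of v d] hi1 in auto)

lemma tr_Pm: "0 < tr (Pm U f)" "tr (Pm U f) \<le> real d"
proof -
 show "0 < tr (Pm U f)" unfolding Pm_def tr_fc[OF U]
 proof (rule sum_pos)
  fix i assume "i \<in> {..<d}"
  then have "1 \<le> f i" using f by simp
  then show "0 < (1 / f i) ^ (p + 1)" by simp
 qed (use d0 in \<open>auto simp: lessThan_empty_iff\<close>)
 have "(\<Sum>i<d. (1 / f i) ^ (p + 1)) \<le> (\<Sum>i<d. 1)"
 proof (rule sum_mono)
  fix i assume "i \<in> {..<d}"
  then have "1 \<le> f i" using f by simp
  then show "(1 / f i) ^ (p + 1) \<le> 1" by (intro power_le_one) auto
 qed
 then show "tr (Pm U f) \<le> real d" unfolding Pm_def tr_fc[OF U] by simp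
qed

text \<open>\<open>S\<close> occurs in the numerator and in the denominator of \<open>RR i\<close>
  and cancels; what remains is \<open>Cr\<close>, the quotient of the upper and the lower error
  factor.\<close>

lemma RRok_sketch:
 assumes \<kappa>: "0 < \<kappa>" and S: "0 < S"
  and Q: "\<And>v. v \<in> carrier_vec d \<Longrightarrow> (1 - e) * S * qf (Pm U f) v \<le> Q v" "\<And>v. v \<in> carrier_vec d \<Longrightarrow> Q v \<le> (1 + e) * S * qf (Pm U f) v"
  and c: "\<And>i. i < n \<Longrightarrow> (1 - e) * Q (row A i) \<le> c i" "\<And>i. i < n \<Longrightarrow> c i \<le> (1 + e) * Q (row A i)"
  and u: "\<And>j. j < d \<Longrightarrow> (1 - e) * Q (unit_vec d j) \<le> u j" "\<And>j. j < d \<Longrightarrow> u j \<le> (1 + e) * Q (unit_vec d j)"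
  and RR: "\<And>i. i < n \<Longrightarrow> RR i = (\<Sum>j<d. u j) / (c i * \<kappa>)"
 shows "RRok \<kappa> (Pm U f) RR"
proof -
 let ?P = "Pm U f" and ?lo = "(1 - e)\<^sup>2 * S" and ?up = "(1 + e)\<^sup>2 * S"
 have e1: "0 < 1 - e" "0 < 1 + e" using e by auto
 have lu: "0 < ?lo" "0 < ?up" using e1 S by simp_all
 have Q': "?lo * qf ?P v \<le> (1 - e) * Q v" "(1 + e) * Q v \<le> ?up * qf ?P v" if "v \<in> carrier_vec d" for v
  using mult_left_mono[OF Q(1)[OF that], of "1 - e"] mult_left_mono[OF Q(2)[OF that], of "1 + e"] e1
  by (simp_all add: power2_eq_square mult_ac)
 have c': "?lo * qf ?P (row A i) \<le> c i" "c i \<le> ?up * qf ?P (row A i)" if i: "i < n" for i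
  using Q'[OF rowc, of i] c[OF i] by simp_all
 have u': "?lo * qf ?P (unit_vec d j) \<le> u j" "u j \<le> ?up * qf ?P (unit_vec d j)" if j: "j < d" for j
  using Q'[of "unit_vec d j"] u[OF j] by simp_all
 have PC: "?P \<in> carrier_mat d d" unfolding Pm_def using U by simp
 have trP: "tr ?P = (\<Sum>j<d. qf ?P (unit_vec d j))"
  unfolding tr_def using PC by (intro sum.cong) (auto simp: qf_def)
 define t where "t = (\<Sum>j<d. u j)"
 have t: "?lo * tr ?P \<le> t" "t \<le> ?up * tr ?P" unfolding t_def trP sum_distrib_left using u' by (auto intro: sum_mono)
 have t0: "0 < t" using t(1) lu(1) tr_Pm(1) mult_pos_pos[of ?lo "tr ?P"] by linarith
 have cr: "?up = Cr * ?lo" using e1 by (simp add: Cr_def power_divide)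
 show ?thesis unfolding RRok_def
 proof (intro allI impI conjI)
  fix i assume i: "i < n" and r: "row A i = 0\<^sub>v d"
  have "qf ?P (row A i) = 0" unfolding r using PC by (simp add: qf_def)
  then have "c i = 0" using c'[OF i] by simp
  then show "RR i = 0" using RR[OF i] by simp
 next
  fix i assume i: "i < n" and r: "row A i \<noteq> 0\<^sub>v d"
  define q where "q = qf ?P (row A i)"
  have q: "0 < q" unfolding q_def by (rule Pm_pos[OF rowc r])
  note ci = c'[OF i, folded q_def]
  have c0: "0 < c i" using ci(1) lu(1) q mult_pos_pos[of ?lo q] by linarith
  show "0 < RR i" unfolding RR[OF i, folded t_def] using t0 c0 \<kappa> by simp
  have eq: "\<kappa> * RR i * q = t * q / c i" unfolding RR[OF i, folded t_def] using \<kappa> by simp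
  have "tr ?P * c i \<le> tr ?P * (?up * q)" using ci tr_Pm(1) by (intro mult_left_mono) auto
  also have "\<dots> = Cr * (?lo * tr ?P) * q" unfolding cr by (simp add: mult_ac)
  also have "\<dots> \<le> Cr * t * q" using t Cr q by (intro mult_right_mono mult_left_mono) auto
  finally show "tr ?P \<le> Cr * (\<kappa> * RR i * qf ?P (row A i))" unfolding q_def[symmetric] eq using c0 by (simp add: field_simps)
  have "t * q \<le> ?up * tr ?P * q" using t q by (intro mult_right_mono) auto
  also have "\<dots> = Cr * tr ?P * (?lo * q)" unfolding cr by (simp add: mult_ac)
  also have "\<dots> \<le> Cr * tr ?P * c i" using ci Cr tr_Pm(1) by (intro mult_left_mono) auto
  finally show "\<kappa> * RR i * qf ?P (row A i) \<le> Cr * tr ?P" unfolding q_def[symmetric] eq using c0 by (simp add: field_simps)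
 qed
qed

text \<open>The initial scale is so small that each row adds at most \<open>1 / n\<close> to the
  trace of the Gram matrix: \<open>P\<close> has eigenvalues at least \<open>hi^-(p+1)\<close>, its
  trace is at most \<open>n\<close>, and \<open>Cr\<close> is at most 4. All eigenvalues then lie in
  \<open>[0, 1]\<close>, where \<open>p\<close>-th powers only decrease.\<close>

lemma pack_init:
 assumes RR: "RRok \<kappa> (Pm U f) RR" and \<kappa>: "1 \<le> \<kappa>" and U': "orth d U'"
  and Y: "\<And>i. i < n \<Longrightarrow> Y i = (if RR i = 0 then 0 else 1 / (4 * (hi ^ Suc p * real n * real n)))"
  and g: "gram A (\<lambda>i. Y i * RR i) = fc U' f'"
 shows "(\<Sum>i<d. f' i ^ p) \<le> 1"
proof -
 let ?P = "Pm U f" and ?z = "1 / (4 * (hi ^ Suc p * real n * real n))"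
 have n0: "0 < n" using d0 dn by simp
 have hi0: "0 < hi" using hi1 by simp
 have RR0: "0 \<le> RR i" if "i < n" for i using RR that unfolding RRok_def by (metis less_imp_le order_refl)
 have Y0: "0 \<le> Y i" if "i < n" for i using Y[OF that] hi0 by simp
 have f0: "0 \<le> f' i" if i: "i < d" for i
 proof (rule fc_eigen_ge[OF U' _ i])
  fix v :: "real vec" assume v: "v \<in> carrier_vec d"
  show "0 * (v \<bullet> v) \<le> qf (fc U' f') v" unfolding g[symmetric] qf_gram[OF A v]
   using RR0 Y0 by (auto intro!: sum_nonneg mult_nonneg_nonneg)
 qed
 have tm: "Y i * RR i * (row A i \<bullet> row A i) \<le> 1 / real n" if i: "i < n" for i
 proof (cases "row A i = 0\<^sub>v d")
  case True then show ?thesis using RR i unfolding RRok_def by simp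
 next
  case False
  then have r: "0 < RR i" "\<kappa> * RR i * qf ?P (row A i) \<le> Cr * tr ?P" using RR i unfolding RRok_def by auto
  have "row A i \<bullet> row A i = hi ^ Suc p * ((1 / hi) ^ (p + 1) * (row A i \<bullet> row A i))" using hi0 by (simp add: power_divide)
  also have "\<dots> \<le> hi ^ Suc p * qf ?P (row A i)" using Pm_lower[OF rowc] hi0 by (intro mult_left_mono) auto
  finally have "RR i * (row A i \<bullet> row A i) \<le> RR i * (hi ^ Suc p * qf ?P (row A i))" using r by (intro mult_left_mono) auto
  also have "\<dots> = hi ^ Suc p * (1 * (RR i * qf ?P (row A i)))" by (simp add: mult_ac)
  also have "\<dots> \<le> hi ^ Suc p * (\<kappa> * (RR i * qf ?P (row A i)))"
   using Pm_pos[OF rowc False] r \<kappa> hi0 by (intro mult_left_mono mult_right_mono) auto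
  also have "\<dots> \<le> hi ^ Suc p * (Cr * tr ?P)" using r hi0 by (intro mult_left_mono) (auto simp: mult_ac)
  also have "\<dots> \<le> hi ^ Suc p * (4 * real n)" using Cr tr_Pm dn hi0 by (intro mult_left_mono mult_mono) auto
  finally have "?z * (RR i * (row A i \<bullet> row A i)) \<le> ?z * (hi ^ Suc p * (4 * real n))" using hi0 by (intro mult_left_mono) auto
  also have "\<dots> = 1 / real n" using hi0 n0 by (simp add: field_simps)
  finally show ?thesis using Y[OF i] r by (simp add: mult_ac)
 qed
 have "(\<Sum>i<d. f' i) = tr (1\<^sub>m d * gram A (\<lambda>i. Y i * RR i))" unfolding g using U' by (simp add: tr_fc)
 also have "\<dots> = (\<Sum>i<n. Y i * RR i * (row A i \<bullet> row A i))" by (subst tr_mult_gram[OF A]) (auto simp: qf_one)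
 also have "\<dots> \<le> (\<Sum>i<n. 1 / real n)" by (rule sum_mono) (use tm in auto)
 also have "\<dots> = 1" using n0 by simp
 finally have s: "(\<Sum>i<d. f' i) \<le> 1" .
 have "f' i ^ p \<le> f' i" if i: "i < d" for i
 proof -
  have "f' i \<le> (\<Sum>i<d. f' i)" by (rule member_le_sum) (use f0 i in auto)
  then have "f' i ^ p \<le> f' i ^ 1" using f0[OF i] s p0 by (intro power_decreasing) auto
  then show ?thesis by simp
 qed
 then have "(\<Sum>i<d. f' i ^ p) \<le> (\<Sum>i<d. f' i)" by (intro sum_mono) auto
 then show ?thesis using s by simp
qed

end

text \<open>\<open>cnt i\<close> counts the rounds that raised row \<open>i\<close>;
  \<open>G\<close> sums the packing gradients of all rounds, each divided by
  \<open>\<rho>^(p-1)\<close>. Every round that leaves row \<open>i\<close> alone adds at least the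
  constant of the second conjunct to \<open>RR i * G i\<close>. The third conjunct pairs
  \<open>G\<close> with an arbitrary scaling, to which each round contributes at most
  \<open>c * (1 + e)\<close>. The last one bounds the potential by the sum of
  \<open>Y\<close>.\<close>

definition packinv :: "rseq \<Rightarrow> real \<Rightarrow> nat \<Rightarrow> rseq \<Rightarrow> bool" where
 "packinv RR \<zeta> R Y \<longleftrightarrow> (\<exists>cnt :: nat \<Rightarrow> nat. \<exists>G :: nat \<Rightarrow> real.
   (\<forall>i<n. Y i = (if RR i = 0 then 0 else \<zeta> * (1 + e / real p) ^ cnt i)) \<and>
   (\<forall>i<n. (1 + 20 * e) * (1 - e) / (1 + e) * (real R - real (cnt i)) \<le> RR i * G i \<or> RR i = 0) \<and>
   (\<forall>w c. (\<forall>i<n. 0 \<le> w i) \<longrightarrow> (\<forall>v \<in> carrier_vec d. qf (gram A w) v \<le> c * (v \<bullet> v)) \<longrightarrow> (\<Sum>i<n. w i * G i) \<le> real R * c * (1 + e)) \<and>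
   (\<forall>U f. orth d U \<longrightarrow> gram A (\<lambda>i. Y i * RR i) = fc U f \<longrightarrow> (\<Sum>i<d. f i ^ p) \<le> (1 + K * (\<Sum>i<n. Y i)) ^ p))"

definition "RRrow RR \<longleftrightarrow> (\<forall>i<n. 0 \<le> RR i \<and> (RR i = 0 \<longleftrightarrow> row A i = 0\<^sub>v d))"

lemma RRok_row: "RRok \<kappa> P RR \<Longrightarrow> RRrow RR"
 unfolding RRok_def RRrow_def by (metis less_imp_le less_irrefl order_refl)

lemma K0: "1 \<le> K" "K \<le> 1 + 28 * e"
proof -
 have e2: "e * e \<le> e / 100" "0 \<le> e * e" using mult_left_mono[OF e(2), of e] e by simp_all
 have e3: "e * (e * e) \<le> e / 100" "0 \<le> e * (e * e)"
 proof -
  have "e * (e * e) \<le> e * (e / 100)" using e2 e by (intro mult_left_mono) auto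
  moreover have "e * (e / 100) = e * e / 100" by simp
  ultimately show "e * (e * e) \<le> e / 100" using e2 e by linarith
 qed (use e in simp)
 have "1 * 1 \<le> (1 + e)\<^sup>2 * (1 + 20 * e)" using e by (intro mult_mono one_le_power) auto
 then have "1 - e \<le> (1 + e)\<^sup>2 * (1 + 20 * e)" using e by linarith
 then show "1 \<le> K" unfolding K_def using e by (subst le_divide_eq) auto
 have "(1 + e)\<^sup>2 * (1 + 20 * e) = 1 + 22 * e + 41 * (e * e) + 20 * (e * (e * e))" "(1 + 28 * e) * (1 - e) = 1 + 27 * e - 28 * (e * e)"
  by (simp_all add: power2_eq_square algebra_simps)
 then have "(1 + e)\<^sup>2 * (1 + 20 * e) \<le> (1 + 28 * e) * (1 - e)" using e2 e3 e by linarith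
 then show "K \<le> 1 + 28 * e" unfolding K_def using e by (simp add: divide_le_eq)
qed

lemma packinv_init:
 assumes "orth d U" "\<And>i. i < d \<Longrightarrow> 1 \<le> f i" "\<And>i. i < d \<Longrightarrow> f i \<le> hi" "RRok \<kappa> (Pm U f) RR" "1 \<le> \<kappa>"
  and "\<zeta> = 1 / (4 * (hi ^ Suc p * real n * real n))" "\<And>i. i < n \<Longrightarrow> Y i = (if RR i = 0 then 0 else \<zeta>)"
 shows "packinv RR \<zeta> 0 Y"
 unfolding packinv_def
proof (intro exI conjI allI impI)
 fix U' f' assume U': "orth d U'" "gram A (\<lambda>i. Y i * RR i) = fc U' f'"
 have "1 \<le> hi" using assms(2,3)[of 0] d0 by simp
 then have "0 \<le> \<zeta>" unfolding assms(6) by (intro divide_nonneg_nonneg mult_nonneg_nonneg zero_le_power) auto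
 then have "0 \<le> (\<Sum>i<n. Y i)" using assms(7) by (intro sum_nonneg) auto
 have "(\<Sum>i<d. f' i ^ p) \<le> 1" using pack_init[OF assms(1-5) U'(1) _ U'(2)] assms(6,7) by simp
 also have "1 \<le> (1 + K * (\<Sum>i<n. Y i)) ^ p" using \<open>0 \<le> (\<Sum>i<n. Y i)\<close> K0 by (intro one_le_power) auto
 finally show "(\<Sum>i<d. f' i ^ p) \<le> (1 + K * (\<Sum>i<n. Y i)) ^ p" .
next
 fix i assume "i < n"
 show "Y i = (if RR i = 0 then 0 else \<zeta> * (1 + e / real p) ^ (\<lambda>_. 0) i)" using assms(7)[OF \<open>i < n\<close>] by simp
 show "(1 + 20 * e) * (1 - e) / (1 + e) * (real 0 - real ((\<lambda>_. 0) i)) \<le> RR i * (\<lambda>_. 0) i \<or> RR i = 0" by simp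
qed simp

end

context scaling_analysis
begin

text \<open>The estimate is assumed for every diagonalisation of the Gram matrix, so that the caller
  need not know the one chosen in the proof.\<close>

lemma packinv_round:
 assumes inv: "packinv RR \<zeta> R Y" and row: "RRrow RR" and \<zeta>: "0 < \<zeta>"
  and est: "\<And>U f i. \<lbrakk>orth d U; gram A (\<lambda>i. Y i * RR i) = fc U f; i < n\<rbrakk> \<Longrightarrow>
    (1 - e) * qf (fc U (\<lambda>i. f i ^ (p - 1))) (row A i) \<le> est i \<and> est i \<le> (1 + e) * qf (fc U (\<lambda>i. f i ^ (p - 1))) (row A i)"
  and t: "t = (\<Sum>i<n. Y i * RR i * est i)" and v: "v = root p t"
  and Y': "\<And>i. i < n \<Longrightarrow> Y' i = (if (1 + 20 * e) * t / v < est i * RR i then Y i else Y i * (1 + e / real p))"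
 shows "packinv RR \<zeta> (Suc R) Y'"
proof -
 obtain cnt G where H: "\<forall>i<n. Y i = (if RR i = 0 then 0 else \<zeta> * (1 + e / real p) ^ cnt i)"
  "\<forall>i<n. (1 + 20 * e) * (1 - e) / (1 + e) * (real R - real (cnt i)) \<le> RR i * G i \<or> RR i = 0"
  "\<forall>w c. (\<forall>i<n. 0 \<le> w i) \<longrightarrow> (\<forall>v \<in> carrier_vec d. qf (gram A w) v \<le> c * (v \<bullet> v)) \<longrightarrow> (\<Sum>i<n. w i * G i) \<le> real R * c * (1 + e)"
  "\<forall>U f. orth d U \<longrightarrow> gram A (\<lambda>i. Y i * RR i) = fc U f \<longrightarrow> (\<Sum>i<d. f i ^ p) \<le> (1 + K * (\<Sum>i<n. Y i)) ^ p"
  using inv unfolding packinv_def by (elim exE conjE) (rule that)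
 note Y = H(1)[rule_format] and G = H(2)[rule_format] and pot = H(4)[rule_format]
 have a: "0 < e / real p" "real p * (e / real p) \<le> e" using e p0 by auto
 have RR0: "0 \<le> RR i" if "i < n" for i using row that unfolding RRrow_def by simp
 have Y0: "0 \<le> Y i" if "i < n" for i using Y[OF that] \<zeta> a by simp
 have Yp: "0 < Y i * RR i" if "i < n" "row A i \<noteq> 0\<^sub>v d" for i
 proof -
  have "RR i \<noteq> 0" "0 \<le> RR i" using row that unfolding RRrow_def by auto
  then have "0 < RR i" by simp
  moreover have "0 < Y i" using Y[OF that(1)] \<zeta> a \<open>RR i \<noteq> 0\<close> by (simp add: add_pos_pos)
  ultimately show ?thesis by simp
 qed
 define X where "X i = Y i * RR i" for i
 obtain U f where U: "orth d U" "gram A X = fc U f" and f: "\<And>i. i < d \<Longrightarrow> 0 < f i"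
 proof (rule gram_spectral[OF A rk, of X])
  show "0 \<le> X i" if "i < n" for i unfolding X_def using Y0 RR0 that by simp
  show "0 < X i" if "i < n" "row A i \<noteq> 0\<^sub>v d" for i unfolding X_def using Yp that by simp
 qed (rule that)
 define P where "P = fc U (\<lambda>i. f i ^ (p - 1))"
 define \<rho> where "\<rho> = root p (\<Sum>i<d. f i ^ p)"
 have est': "(1 - e) * qf P (row A i) \<le> est i" "est i \<le> (1 + e) * qf P (row A i)" if "i < n" for i
  using est[OF U(1) U(2)[unfolded X_def] that] unfolding P_def by auto
 have S: "(\<Sum>i<n. X i * qf P (row A i)) = (\<Sum>i<d. f i ^ p)"
 proof -
  have "(\<Sum>i<n. X i * qf P (row A i)) = tr (P * gram A X)" unfolding P_def using U by (subst tr_mult_gram[OF A]) auto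
  also have "\<dots> = (\<Sum>i<d. f i ^ p)" unfolding U(2) P_def using U(1) by (simp add: tr_fc power_minus_mult[OF p0(1), simplified])
  finally show ?thesis .
 qed
 have Sp: "0 < (\<Sum>i<d. f i ^ p)" using d0 f by (intro sum_pos) (auto simp: lessThan_empty_iff)
 have X0: "0 \<le> X i" if "i < n" for i unfolding X_def using Y0 RR0 that by simp
 have "(1 - e) * (\<Sum>i<d. f i ^ p) = (\<Sum>i<n. X i * ((1 - e) * qf P (row A i)))" unfolding S[symmetric] by (simp add: sum_distrib_left mult_ac)
 also have "\<dots> \<le> t" unfolding t X_def[symmetric] by (intro sum_mono mult_left_mono est' X0) auto
 finally have t0: "0 < t" using Sp e mult_pos_pos[of "1 - e" "\<Sum>i<d. f i ^ p"] by linarith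
 have v0: "0 < v" "v ^ p = t" unfolding v using t0 p0 by simp_all
 have tv: "t / v = v ^ (p - 1)" using v0 p0 by (metis less_irrefl nonzero_mult_div_cancel_right power_minus_mult)
 define D where "D i \<longleftrightarrow> est i * RR i \<le> (1 + 20 * e) * v ^ (p - 1)" for i
 have Y'D: "Y' i = (if D i then 1 + e / real p else 1) * Y i" if "i < n" for i
  using Y'[OF that] tv unfolding D_def by (simp add: times_divide_eq_right[symmetric] not_less del: times_divide_eq_right)
 define X' where "X' i = Y' i * RR i" for i
 obtain U' f' where U': "orth d U'" "gram A X' = fc U' f'" using spectral_fc[OF gram_carrier[OF A] gram_sym[OF A]] by blast
 have X: "X i = Y i * RR i" for i by (rule X_def)
 have X': "X' i = (if D i then 1 + e / real p else 1) * X i" if "i < n" for i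
  using Y'D[OF that] by (simp add: X'_def X_def)
 have vt: "v ^ p = (\<Sum>i<n. X i * est i)" using v0 t by (simp add: X_def)
 have e2: "e \<le> 1 / 2" "0 \<le> 20 * e" using e by auto
 have ps': "\<rho> > 0" "\<And>U' f' R. \<lbrakk>orth d U'; gram A X' = fc U' f'; 0 \<le> R; (\<Sum>i<d. f i ^ p) \<le> R ^ p\<rbrakk> \<Longrightarrow>
      (\<Sum>i<d. f' i ^ p) \<le> (R + K * (e / real p * (\<Sum>i<n. if D i then Y i else 0))) ^ p"
  "\<And>i. i < n \<Longrightarrow> \<not> D i \<Longrightarrow> (1 + 20 * e) * (1 - e) / (1 + e) * \<rho> ^ (p - 1) \<le> qf P (row A i) * RR i"
  "tr P \<le> (1 + e) * \<rho> ^ (p - 1)"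
 proof -
  show "\<rho> > 0" using packing_step(1)[OF A _ U f U' X Y0 RR0 p e(1) e2(1) a e2(2) est'[unfolded P_def] v0(1) vt D_def X'] d0 unfolding \<rho>_def by simp
  show "(1 + 20 * e) * (1 - e) / (1 + e) * \<rho> ^ (p - 1) \<le> qf P (row A i) * RR i" if "i < n" "\<not> D i" for i
   using packing_step(3)[OF A _ U f U' X Y0 RR0 p e(1) e2(1) a e2(2) est'[unfolded P_def] v0(1) vt D_def X' that] d0 unfolding \<rho>_def P_def by simp
  show "tr P \<le> (1 + e) * \<rho> ^ (p - 1)" using packing_step(4)[OF A _ U f U' X Y0 RR0 p e(1) e2(1) a e2(2) est'[unfolded P_def] v0(1) vt D_def X' dp] d0 unfolding \<rho>_def P_def by simp
  show "(\<Sum>i<d. f' i ^ p) \<le> (R + K * (e / real p * (\<Sum>i<n. if D i then Y i else 0))) ^ p"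
   if "orth d U'" "gram A X' = fc U' f'" "0 \<le> R" "(\<Sum>i<d. f i ^ p) \<le> R ^ p" for U' f' R
   using packing_step(2)[OF A _ U f that(1,2) X Y0 RR0 p e(1) e2(1) a e2(2) est'[unfolded P_def] v0(1) vt D_def X' that(3,4)] d0
   unfolding K_def by simp
 qed
 have gamma0: "0 < (1 + 20 * e) * (1 - e) / (1 + e)" using e by simp
 define G' where "G' i = G i + qf P (row A i) / \<rho> ^ (p - 1)" for i
 define cnt' where "cnt' i = cnt i + (if D i then 1 else 0)" for i
 have rp: "0 < \<rho> ^ (p - 1)" using ps'(1) by simp
 have P0: "0 \<le> qf P v" if "v \<in> carrier_vec d" for v
  using qf_fc_ge[OF U(1) that, of 0] f unfolding P_def by (simp add: less_imp_le)
 show ?thesis unfolding packinv_def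
 proof (intro exI[of _ cnt'] exI[of _ G'] conjI allI impI)
  fix i assume i: "i < n"
  show "Y' i = (if RR i = 0 then 0 else \<zeta> * (1 + e / real p) ^ cnt' i)"
   using Y'D[OF i] Y[OF i] by (simp add: cnt'_def)
  show "(1 + 20 * e) * (1 - e) / (1 + e) * (real (Suc R) - real (cnt' i)) \<le> RR i * G' i \<or> RR i = 0"
  proof (cases "RR i = 0")
   case False
   define c0 where "c0 = (1 + 20 * e) * (1 - e) / (1 + e)"
   have g: "c0 * (real R - real (cnt i)) \<le> RR i * G i" using G[OF i] False unfolding c0_def by blast
   define y where "y = RR i * (qf P (row A i) / \<rho> ^ (p - 1))"
   have y0: "0 \<le> y" using P0[OF rowc] RR0[OF i] rp unfolding y_def by simp
   have y1: "c0 \<le> y" if "\<not> D i"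
    using ps'(3)[OF i that] rp unfolding c0_def[symmetric] y_def by (simp add: le_divide_eq mult.commute)
   have y2: "RR i * G' i = RR i * G i + y" by (simp only: G'_def distrib_left y_def)
   have "c0 * (real (Suc R) - real (cnt' i)) \<le> RR i * G' i"
   proof (cases "D i")
    case True
    then have eq: "real (Suc R) - real (cnt' i) = real R - real (cnt i)" by (simp add: cnt'_def)
    show ?thesis unfolding eq y2 using g y0 by linarith
   next
    case False
    then have eq: "c0 * (real (Suc R) - real (cnt' i)) = c0 * (real R - real (cnt i)) + c0" by (simp add: cnt'_def algebra_simps)
    show ?thesis unfolding eq y2 using g y1[OF False] by linarith
   qed
   then show ?thesis unfolding c0_def by blast
  qed simp
 next
  fix u :: "nat \<Rightarrow> real" and c assume u: "\<forall>i<n. 0 \<le> u i" "\<forall>v \<in> carrier_vec d. qf (gram A u) v \<le> c * (v \<bullet> v)"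
  have "tr (P * gram A u) = (\<Sum>i<d. f i ^ (p - 1) * qf (gram A u) (col U i))" unfolding P_def by (rule tr_fc_mult[OF U(1)]) (use A in simp)
  also have "\<dots> \<le> (\<Sum>i<d. f i ^ (p - 1) * c)"
  proof (intro sum_mono mult_left_mono)
   fix i assume "i \<in> {..<d}"
   then show "qf (gram A u) (col U i) \<le> c" using bspec[OF u(2) col_orth(1)[OF U(1)], of i] col_orth(2)[OF U(1), of i] by simp
   show "0 \<le> f i ^ (p - 1)" using f[of i] \<open>i \<in> {..<d}\<close> by simp
  qed
  also have "\<dots> = c * tr P" unfolding P_def tr_fc[OF U(1)] by (simp add: sum_distrib_left mult.commute)
  also have "\<dots> \<le> c * ((1 + e) * \<rho> ^ (p - 1))"
  proof (rule mult_left_mono[OF ps'(4)])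
   have c: "col U 0 \<in> carrier_vec d" "col U 0 \<bullet> col U 0 = 1" using col_orth[OF U(1), of 0] d0 by auto
   have "0 \<le> qf (gram A u) (col U 0)" unfolding qf_gram[OF A c(1)] using u(1) by (intro sum_nonneg) auto
   then show "0 \<le> c" using bspec[OF u(2) c(1)] c(2) by simp
  qed
  finally have "(\<Sum>i<n. u i * qf P (row A i)) / \<rho> ^ (p - 1) \<le> c * (1 + e)"
   using U rp by (subst (asm) tr_mult_gram[OF A]) (auto simp: P_def divide_le_eq mult_ac)
  moreover have "(\<Sum>i<n. u i * G i) \<le> real R * c * (1 + e)" using H(3) u by blast
  moreover have "(\<Sum>i<n. u i * G' i) = (\<Sum>i<n. u i * G i) + (\<Sum>i<n. u i * qf P (row A i)) / \<rho> ^ (p - 1)"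
   unfolding G'_def by (simp add: distrib_left sum.distrib sum_divide_distrib)
  ultimately show "(\<Sum>i<n. u i * G' i) \<le> real (Suc R) * c * (1 + e)" by (simp add: algebra_simps)
 next
  fix V g assume V: "orth d V" "gram A (\<lambda>i. Y' i * RR i) = fc V g"
  have "(\<Sum>i<n. Y' i) = (\<Sum>i<n. Y i + e / real p * (if D i then Y i else 0))"
   by (intro sum.cong) (auto simp: Y'D algebra_simps)
  also have "\<dots> = (\<Sum>i<n. Y i) + e / real p * (\<Sum>i<n. if D i then Y i else 0)"
   by (simp only: sum.distrib sum_distrib_left)
  finally have s: "(\<Sum>i<n. Y' i) = (\<Sum>i<n. Y i) + e / real p * (\<Sum>i<n. if D i then Y i else 0)" .
  have "0 \<le> 1 + K * (\<Sum>i<n. Y i)" using K0 Y0 by (intro add_nonneg_nonneg mult_nonneg_nonneg sum_nonneg) auto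
  then show "(\<Sum>i<d. g i ^ p) \<le> (1 + K * (\<Sum>i<n. Y' i)) ^ p"
   using ps'(2)[OF V(1) V(2)[folded X'_def] _ pot[OF U(1) U(2)[unfolded X_def]]]
   unfolding s by (simp add: algebra_simps)
 qed
qed

text \<open>This fixes the slack in the threshold: to first order the estimates cost
  \<open>8 e\<close> and the counter \<open>2 e\<close>, and \<open>1 + 20 e\<close> exceeds their
  sum with room for the higher terms.\<close>

lemma frac_bound: "(1 + e) ^ 5 / ((1 - e) ^ 3 * (1 + 20 * e)) \<le> 1 - 2 * e"
proof -
 have "0 \<le> e * e * (10 * (1 - e))" using e by simp
 have b: "1 - 3 * e \<le> (1 - e) ^ 3" using Bernoulli_inequality[of "- e" 3] e by simp
 have "(1 + e) ^ 5 \<le> 1 + real 5 * (1 + 1 / 10) * e" by (rule power_1_plus_le) (use e in auto)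
 also have "\<dots> \<le> (1 - 2 * e) * ((1 - 3 * e) * (1 + 20 * e))"
 proof -
  have e2: "e * e \<le> e / 100" "0 \<le> e * e" "0 \<le> e * (e * e)" using mult_left_mono[OF e(2), of e] e by simp_all
  have "(1 - 2 * e) * ((1 - 3 * e) * (1 + 20 * e)) = 1 + 15 * e - 94 * (e * e) + 120 * (e * (e * e))"
   by (simp add: algebra_simps)
  moreover have "1 + real 5 * (1 + 1 / 10) * e = 1 + 11 / 2 * e" by simp
  ultimately show ?thesis using e2 e by linarith
 qed
 also have "\<dots> \<le> (1 - 2 * e) * ((1 - e) ^ 3 * (1 + 20 * e))" using b e by (intro mult_left_mono mult_right_mono) auto
 finally show ?thesis using e by (subst pos_divide_le_eq) auto
qed

text \<open>Weak duality. A nearly optimal scaling, written as \<open>s i * RR i\<close>, has sum of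
  \<open>s\<close> at least \<open>\<kappa> / Cr\<close>, while its pairing with \<open>G\<close> is
  at most about \<open>R\<close> times the optimum. So for \<kappa> at least the optimum the rows
  cannot all have been left alone almost always: some row was raised in a fraction
  \<open>2 e\<close> of the rounds, and its \<open>Y i\<close> alone is large.\<close>

lemma packinv_fail:
 assumes inv: "packinv RR \<zeta> R Y" and RR: "RRok \<kappa> P RR" and P: "P = Pm U f" "orth d U" and f: "\<And>i. i < d \<Longrightarrow> 1 \<le> f i"
  and \<zeta>: "0 < \<zeta>" and \<kappa>: "opt_inner_cond A \<le> \<kappa>" and R: "0 < R"
 shows "\<zeta> * (1 + e / real p * e) ^ R \<le> (\<Sum>i<n. Y i)"
proof -
 let ?k = "opt_inner_cond A" and ?c = "(1 + 20 * e) * (1 - e) / (1 + e)"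
 have PC: "P \<in> carrier_mat d d" using P by (simp add: Pm_def)
 have trP: "0 < tr P" unfolding P(1) Pm_def tr_fc[OF P(2)]
 proof (rule sum_pos)
  fix i assume "i \<in> {..<d}"
  then have "1 \<le> f i" using f by simp
  then show "0 < (1 / f i) ^ (p + 1)" by simp
 qed (use d0 in \<open>auto simp: lessThan_empty_iff\<close>)
 obtain cnt G where H: "\<forall>i<n. Y i = (if RR i = 0 then 0 else \<zeta> * (1 + e / real p) ^ cnt i)"
  "\<forall>i<n. ?c * (real R - real (cnt i)) \<le> RR i * G i \<or> RR i = 0"
  "\<forall>w c. (\<forall>i<n. 0 \<le> w i) \<longrightarrow> (\<forall>v \<in> carrier_vec d. qf (gram A w) v \<le> c * (v \<bullet> v)) \<longrightarrow> (\<Sum>i<n. w i * G i) \<le> real R * c * (1 + e)"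
  using inv unfolding packinv_def by (elim exE conjE) (rule that)
 have k1: "1 \<le> ?k" using opt_inner_cond_witness(1)[OF A rk _ e(1)] d0 by simp
 obtain w where w0: "\<And>i. i < n \<Longrightarrow> 0 \<le> w i" and w: "\<And>v. v \<in> carrier_vec d \<Longrightarrow> v \<bullet> v \<le> qf (gram A w) v"
  "\<And>v. v \<in> carrier_vec d \<Longrightarrow> qf (gram A w) v \<le> (1 + e) * ?k * (v \<bullet> v)"
  using opt_inner_cond_witness(2)[OF A rk _ e(1)] d0 by auto
 define s where "s i = (if RR i = 0 then 0 else w i / RR i)" for i
 have RRp: "0 < RR i" if "i < n" "RR i \<noteq> 0" for i using RR that unfolding RRok_def by metis
 have s0: "0 \<le> s i" if "i < n" for i using w0[OF that] RRp[OF that] by (simp add: s_def less_imp_le)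
 have "tr P \<le> tr (P * gram A w)"
 proof -
  have "0 \<le> (1 / f i) ^ (p + 1)" if "i < d" for i using f[OF that] by simp
  then have "tr (P * 1\<^sub>m d) \<le> tr (P * gram A w)" unfolding P Pm_def
   using tr_fc_mono[OF P(2) one_carrier_mat gram_carrier[OF A]] w(1) by (simp add: qf_one del: power_Suc)
  then show ?thesis using PC by simp
 qed
 also have "\<dots> = (\<Sum>i<n. w i * qf P (row A i))" by (rule tr_mult_gram[OF A PC])
 also have "\<dots> \<le> (\<Sum>i<n. s i * (Cr * tr P / \<kappa>))"
 proof (rule sum_mono)
  fix i assume "i \<in> {..<n}" then have i: "i < n" by simp
  show "w i * qf P (row A i) \<le> s i * (Cr * tr P / \<kappa>)"
  proof (cases "row A i = 0\<^sub>v d")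
   case True
   have "qf P (row A i) = 0" unfolding True using PC by (simp add: qf_def)
   moreover have "RR i = 0" using RR i True unfolding RRok_def by blast
   ultimately show ?thesis by (simp add: s_def)
  next
   case False
   then have r: "0 < RR i" "\<kappa> * RR i * qf P (row A i) \<le> Cr * tr P" using RR i unfolding RRok_def by auto
   have "w i * qf P (row A i) = s i * (RR i * qf P (row A i))" using r by (simp add: s_def)
   also have "\<dots> \<le> s i * (Cr * tr P / \<kappa>)" using r k1 \<kappa> s0[OF i] by (intro mult_left_mono) (simp_all add: le_divide_eq mult_ac)
   finally show ?thesis .
  qed
 qed
 also have "\<dots> = (\<Sum>i<n. s i) * (Cr * tr P / \<kappa>)" by (rule sum_distrib_right[symmetric])
 finally have "\<kappa> \<le> (\<Sum>i<n. s i) * Cr" using trP k1 \<kappa> by (simp add: field_simps)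
 then have sk: "?k \<le> (\<Sum>i<n. s i) * Cr" using \<kappa> by simp
 have sG: "(\<Sum>i<n. s i * (?c * (real R - real (cnt i)))) \<le> real R * ((1 + e) * ?k) * (1 + e)"
 proof -
  have "(\<Sum>i<n. s i * (?c * (real R - real (cnt i)))) \<le> (\<Sum>i<n. (if RR i = 0 then 0 else w i) * G i)"
  proof (rule sum_mono)
   fix i assume "i \<in> {..<n}" then have i: "i < n" by simp
   show "s i * (?c * (real R - real (cnt i))) \<le> (if RR i = 0 then 0 else w i) * G i"
   proof (cases "RR i = 0")
    case False
    then have "?c * (real R - real (cnt i)) \<le> RR i * G i" using H(2) i by blast
    then have "s i * (?c * (real R - real (cnt i))) \<le> s i * (RR i * G i)" by (rule mult_left_mono) (rule s0[OF i])
    then show ?thesis using False by (simp add: s_def)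
   qed (simp add: s_def)
  qed
  also have "\<dots> \<le> real R * ((1 + e) * ?k) * (1 + e)"
  proof (rule H(3)[rule_format])
   fix v :: "real vec" assume v: "v \<in> carrier_vec d"
   have "qf (gram A (\<lambda>i. if RR i = 0 then 0 else w i)) v \<le> qf (gram A w) v"
    unfolding qf_gram[OF A v] by (intro sum_mono mult_right_mono) (use w0 in auto)
   also note w(2)[OF v]
   finally show "qf (gram A (\<lambda>i. if RR i = 0 then 0 else w i)) v \<le> (1 + e) * ?k * (v \<bullet> v)" .
  qed (use w0 in auto)
  finally show ?thesis .
 qed
 have "\<exists>i<n. RR i \<noteq> 0 \<and> 2 * e * real R \<le> real (cnt i)"
 proof (rule ccontr)
  assume "\<not> ?thesis"
  then have c: "real (cnt i) < 2 * e * real R" if "i < n" "RR i \<noteq> 0" for i using that by (meson not_less)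
  have c0: "0 < ?c" using e by simp
  have S0: "0 < (\<Sum>i<n. s i)"
  proof (rule ccontr)
   assume "\<not> ?thesis"
   then have "(\<Sum>i<n. s i) * Cr \<le> 0" using Cr by (intro mult_nonpos_nonneg) auto
   then show False using sk k1 by simp
  qed
  have st: "s i * (?c * ((1 - 2 * e) * real R)) \<le> s i * (?c * (real R - real (cnt i)))" if i: "i < n" for i
  proof (cases "RR i = 0")
   case False
   have "(1 - 2 * e) * real R \<le> real R - real (cnt i)" using c[OF i False] by (simp add: algebra_simps)
   then show ?thesis using c0 s0[OF i] by (intro mult_left_mono) auto
  qed (simp add: s_def)
  have "\<exists>i<n. s i \<noteq> 0"
  proof (rule ccontr)
   assume "\<not> ?thesis"
   then have "(\<Sum>i<n. s i) = 0" by (intro sum.neutral) auto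
   then show False using S0 by simp
  qed
  then obtain i where i: "i < n" "s i \<noteq> 0" by blast
  then have i': "RR i \<noteq> 0" "0 < s i" using s0[OF i(1)] by (fastforce simp: s_def, linarith)
  have "(1 - 2 * e) * real R < real R - real (cnt i)" using c[OF i(1) i'(1)] by (simp add: algebra_simps)
  then have "s i * (?c * ((1 - 2 * e) * real R)) < s i * (?c * (real R - real (cnt i)))" using c0 i' by (intro mult_strict_left_mono) auto
  then have "(\<Sum>i<n. s i * (?c * ((1 - 2 * e) * real R))) < (\<Sum>i<n. s i * (?c * (real R - real (cnt i))))"
   using i st by (intro sum_strict_mono_ex1) auto
  also note sG
  also have "real R * ((1 + e) * ?k) * (1 + e) \<le> real R * ((1 + e) * ((\<Sum>i<n. s i) * Cr)) * (1 + e)"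
   using sk e by (intro mult_left_mono mult_right_mono) auto
  finally have lt: "(\<Sum>i<n. s i * (?c * ((1 - 2 * e) * real R))) < real R * ((1 + e) * ((\<Sum>i<n. s i) * Cr)) * (1 + e)" .
  have "(\<Sum>i<n. s i * (?c * ((1 - 2 * e) * real R))) = (\<Sum>i<n. s i) * (real R * (?c * (1 - 2 * e)))"
   unfolding sum_distrib_right[symmetric] by (simp only: mult_ac)
  moreover have "real R * ((1 + e) * ((\<Sum>i<n. s i) * Cr)) * (1 + e) = (\<Sum>i<n. s i) * (real R * ((1 + e)\<^sup>2 * Cr))"
   by (simp only: mult_ac power2_eq_square)
  ultimately have "(\<Sum>i<n. s i) * (real R * (?c * (1 - 2 * e))) < (\<Sum>i<n. s i) * (real R * ((1 + e)\<^sup>2 * Cr))"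
   using lt by (simp only:)
  then have lt: "?c * (1 - 2 * e) < (1 + e)\<^sup>2 * Cr" using S0 R by (simp only: mult_less_cancel_left_pos of_nat_0_less_iff)
  have "(1 + e)\<^sup>2 * Cr = ?c * ((1 + e) ^ 5 / ((1 - e) ^ 3 * (1 + 20 * e)))"
  proof -
   have "a\<^sup>2 * (a / b)\<^sup>2 = t * b / a * (a ^ 5 / (b ^ 3 * t))" if "a \<noteq> 0" "b \<noteq> 0" "t \<noteq> 0" for a b t :: real
    using that by (simp add: field_simps eval_nat_numeral)
   then show ?thesis unfolding Cr_def by this (use e in auto)
  qed
  also have "\<dots> \<le> ?c * (1 - 2 * e)" using frac_bound c0 by (intro mult_left_mono) auto
  finally show False using lt by simp
 qed
 then obtain i where i: "i < n" "RR i \<noteq> 0" "2 * e * real R \<le> real (cnt i)" by blast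
 have a: "0 < e / real p" "e / real p \<le> 1" using e p0 by (auto simp: divide_le_eq)
 \<comment> \<open>Half of the exponent pays for replacing \<open>1 + e / p\<close> by an
   exponential, so \<open>2 * e * R\<close> raises of the row guarantee the rate
   \<open>e^2 / p\<close> per round.\<close>
 have "(1 + e / real p * e) ^ R \<le> exp (e / real p * e) ^ R" using a e by (intro power_mono exp_ge_add_one_self) auto
 also have "\<dots> = exp (e / real p * (e * real R))" by (simp add: exp_of_nat_mult[symmetric] mult_ac)
 also have "\<dots> \<le> exp (e / real p * (real (cnt i) / 2))" by (subst exp_le_cancel_iff, rule mult_left_mono) (use i(3) a(1) in auto)
 also have "\<dots> = exp (e / real p / 2) ^ cnt i" by (simp add: exp_of_nat_mult[symmetric] mult_ac)
 also have "\<dots> \<le> (1 + e / real p) ^ cnt i"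
 proof (intro power_mono)
  have "exp (e / real p / 2) \<le> 1 + e / real p / 2 + (e / real p / 2)\<^sup>2" by (rule exp_bound) (use a in auto)
  moreover have "(e / real p / 2) * (e / real p / 2) \<le> 1 * (e / real p / 2)" using a by (intro mult_right_mono) auto
  ultimately show "exp (e / real p / 2) \<le> 1 + e / real p" by (simp add: power2_eq_square)
 qed simp
 finally have "\<zeta> * (1 + e / real p * e) ^ R \<le> Y i" using H(1) i \<zeta> by simp
 also have "\<dots> \<le> (\<Sum>i<n. Y i)"
 proof (rule member_le_sum)
  fix j assume "j \<in> {..<n} - {i}"
  then have "Y j = (if RR j = 0 then 0 else \<zeta> * (1 + e / real p) ^ cnt j)" using H(1) by auto
  then show "0 \<le> Y j" using \<zeta> a by simp
 qed (use i in auto)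
 finally show ?thesis .
qed

end

context scaling_analysis
begin

text \<open>\<open>Lam\<close> is the total step length. The largest eigenvalue of the Gram matrix
  grows at rate \<open>\<kappa> * (K + e)\<close>, the soft minimum of \<open>N\<close> at rate
  \<open>gam\<close>, and their quotient governs the final condition number. The start value
  \<open>1 / (1 + e)\<close> belongs to \<open>N = I\<close>, where
  \<open>tr N^-p = d \<le> (1 + e)^p\<close>.\<close>

definition coverinv :: "real \<Rightarrow> rseq \<Rightarrow> real \<Rightarrow> bool" where
 "coverinv \<kappa> W Lam \<longleftrightarrow> (\<forall>i<n. 0 \<le> W i) \<and> (\<forall>v \<in> carrier_vec d. qf (gram A W) v \<le> \<kappa> * (K + e) * Lam * (v \<bullet> v)) \<and>
   (\<forall>U f. orth d U \<longrightarrow> 1\<^sub>m d + gram A W = fc U f \<longrightarrow> (\<Sum>i<d. (1 / f i) ^ p) \<le> (1 / (1 / (1 + e) + gam * Lam)) ^ p)"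

lemma coverinv_init:
 assumes "\<And>i. i < n \<Longrightarrow> W i = 0"
 shows "coverinv \<kappa> W 0"
proof -
 have q: "qf (gram A W) v = 0" if "v \<in> carrier_vec d" for v
  unfolding qf_gram[OF A that] using assms by simp
 have "(\<Sum>i<d. (1 / f i) ^ p) \<le> (1 + e) ^ p" if U: "orth d U" "1\<^sub>m d + gram A W = fc U f" for U f
 proof -
  have "f i = 1" if i: "i < d" for i
  proof (rule antisym)
   have *: "qf (fc U f) v = v \<bullet> v" if "v \<in> carrier_vec d" for v
    unfolding U(2)[symmetric] using qf_add[of "1\<^sub>m d" d "gram A W" v] A that q by (simp add: qf_one)
   show "f i \<le> 1" by (rule fc_eigen_le[OF U(1) _ i]) (use * in simp)
   show "1 \<le> f i" by (rule fc_eigen_ge[OF U(1) _ i]) (use * in simp)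
  qed
  then have "(\<Sum>i<d. (1 / f i) ^ p) = real d" by simp
  then show ?thesis using dp by simp
 qed
 then show ?thesis unfolding coverinv_def using assms q by simp
qed

lemma coverinv_spectrum:
 assumes inv: "coverinv \<kappa> W Lam" and U: "orth d U" "1\<^sub>m d + gram A W = fc U f" and i: "i < d"
 shows "1 \<le> f i" "f i \<le> 1 + \<kappa> * (K + e) * Lam"
proof -
 have *: "qf (fc U f) v = v \<bullet> v + qf (gram A W) v" if "v \<in> carrier_vec d" for v
  unfolding U(2)[symmetric] using qf_add[of "1\<^sub>m d" d "gram A W" v] A that by (simp add: qf_one)
 show "1 \<le> f i"
 proof (rule fc_eigen_ge[OF U(1) _ i])
  fix v :: "real vec" assume v: "v \<in> carrier_vec d"
  have "0 \<le> qf (gram A W) v" unfolding qf_gram[OF A v] using inv unfolding coverinv_def by (intro sum_nonneg) auto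
  then show "1 * (v \<bullet> v) \<le> qf (fc U f) v" using *[OF v] by simp
 qed
 show "f i \<le> 1 + \<kappa> * (K + e) * Lam"
 proof (rule fc_eigen_le[OF U(1) _ i])
  fix v :: "real vec" assume v: "v \<in> carrier_vec d"
  have "qf (gram A W) v \<le> \<kappa> * (K + e) * Lam * (v \<bullet> v)" using inv v unfolding coverinv_def by blast
  then show "qf (fc U f) v \<le> (1 + \<kappa> * (K + e) * Lam) * (v \<bullet> v)" using *[OF v] by (simp add: algebra_simps)
 qed
qed

lemma Ke: "K + e \<le> 1 + 30 * e" "K + e \<le> 2"
 using K0 e by auto

lemma gam: "0 < gam" "gam \<le> 1" "1 - 6 * e \<le> gam"
proof -
 have q: "0 < (1 - e) / (1 + e)" "(1 - e) / (1 + e) \<le> 1" "1 + - (2 * e) \<le> (1 - e) / (1 + e)"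
  using e by (simp_all add: field_simps)
 show "0 < gam" "gam \<le> 1" unfolding gam_def using q by (simp_all add: power_le_one)
 have "1 + real 3 * (- (2 * e)) \<le> (1 + - (2 * e)) ^ 3" by (rule Bernoulli_inequality) (use e in simp)
 also have "\<dots> \<le> gam" unfolding gam_def by (intro power_mono) (use q e in auto)
 finally show "1 - 6 * e \<le> gam" by simp
qed

lemma coverinv_step:
 assumes inv: "coverinv \<kappa> W Lam" and Lam: "0 \<le> Lam" and \<kappa>: "1 \<le> \<kappa>"
  and U: "orth d U" "1\<^sub>m d + gram A W = fc U f" and RR: "RRok \<kappa> (Pm U f) RR"
  and pack: "packinv RR \<zeta> R Y" and \<zeta>: "0 < \<zeta>" and Y: "real E \<le> (\<Sum>i<n. Y i)"
  and eta: "eta = 1 / (2 * (real E * real p * \<kappa>))"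
  and W': "\<And>i. i < n \<Longrightarrow> W' i = W i + Y i * RR i * (eta * \<kappa> / (\<Sum>i<n. Y i))"
 shows "coverinv \<kappa> W' (Lam + eta)"
proof -
 define s where "s = (\<Sum>i<n. Y i)"
 define X where "X i = Y i * RR i" for i
 define w where "w i = (eta * \<kappa> / s) * X i" for i
 have s: "real E \<le> s" "0 < s" using Y E by (auto simp: s_def)
 \<comment> \<open>Packing runs until the sum of \<open>Y\<close> reaches \<open>E = 1 / e\<close>,
   so that the additive 1 in the spectral bound \<open>1 + K * s\<close> is absorbed into
   \<open>(K + e) * s\<close>.\<close>
 have "1 \<le> e * s" using s e E unfolding e_def by (simp add: field_simps)
 have eta0: "0 < eta" unfolding eta using E p0 \<kappa> by simp
 \<comment> \<open>Together with \<open>K + e \<le> 2\<close> this keeps the step at most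
   \<open>e / p\<close> in spectral norm, as \<open>covering_step\<close> demands.\<close>
 have etak: "eta * \<kappa> = e / (2 * real p)" unfolding eta e_def using \<kappa> by simp
 obtain cnt :: "nat \<Rightarrow> nat" where H: "\<forall>i<n. Y i = (if RR i = 0 then 0 else \<zeta> * (1 + e / real p) ^ cnt i)"
  "\<forall>U f. orth d U \<longrightarrow> gram A (\<lambda>i. Y i * RR i) = fc U f \<longrightarrow> (\<Sum>i<d. f i ^ p) \<le> (1 + K * (\<Sum>i<n. Y i)) ^ p"
  using pack unfolding packinv_def by (elim exE conjE) (rule that)
 have Y0: "0 \<le> Y i" if "i < n" for i using H(1) that \<zeta> e by simp
 have RR0: "0 \<le> RR i" if "i < n" for i using RRok_row[OF RR] that unfolding RRrow_def by simp
 have X0: "0 \<le> X i" if "i < n" for i unfolding X_def using Y0 RR0 that by simp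
 have w0: "0 \<le> w i" if "i < n" for i unfolding w_def using X0[OF that] eta0 \<kappa> s by simp
 have W0: "0 \<le> W i" if "i < n" for i using inv that unfolding coverinv_def by blast
 have gW': "gram A W' = gram A W + gram A w"
  unfolding gram_add[OF A, symmetric] by (rule gram_cong[OF A]) (simp add: W' w_def X_def s_def mult_ac)
 have gX: "qf (gram A X) v \<le> (1 + K * s) * (v \<bullet> v)" if v: "v \<in> carrier_vec d" for v
 proof -
  obtain V g where V: "orth d V" "gram A X = fc V g" using spectral_fc[OF gram_carrier[OF A] gram_sym[OF A]] by blast
  have g0: "0 \<le> g i" if i: "i < d" for i
  proof (rule fc_eigen_ge[OF V(1) _ i])
   fix v :: "real vec" assume v: "v \<in> carrier_vec d"
   show "0 * (v \<bullet> v) \<le> qf (fc V g) v" unfolding V(2)[symmetric] qf_gram[OF A v] using X0 by (auto intro!: sum_nonneg)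
  qed
  have pot: "(\<Sum>i<d. g i ^ p) \<le> (1 + K * s) ^ p" using H(2) V unfolding X_def[abs_def] s_def by blast
  have "g i \<le> 1 + K * s" if i: "i < d" for i
  proof -
   have "g i ^ p \<le> (\<Sum>i<d. g i ^ p)" by (rule member_le_sum) (use g0 i in auto)
   then have "g i ^ p \<le> (1 + K * s) ^ p" using pot by simp
   then show ?thesis using power_mono_iff[OF g0[OF i] _ p0(1), of "1 + K * s"] K0 s by simp
  qed
  then show ?thesis unfolding V(2) by (intro qf_fc_le[OF V(1) v])
 qed
 have gw: "qf (gram A w) v \<le> eta * \<kappa> * (K + e) * (v \<bullet> v)" if v: "v \<in> carrier_vec d" for v
 proof -
  have "qf (gram A w) v = eta * \<kappa> / s * qf (gram A X) v"
   unfolding qf_gram[OF A v] w_def by (simp add: sum_distrib_left mult_ac)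
  also have "\<dots> \<le> eta * \<kappa> / s * ((1 + K * s) * (v \<bullet> v))" using gX[OF v] eta0 \<kappa> s by (intro mult_left_mono) auto
  also have "\<dots> \<le> eta * \<kappa> / s * (((K + e) * s) * (v \<bullet> v))"
   using \<open>1 \<le> e * s\<close> eta0 \<kappa> s scalar_prod_self_nonneg[of v] by (intro mult_left_mono mult_right_mono) (auto simp: algebra_simps)
  also have "\<dots> = eta * \<kappa> * (K + e) * (v \<bullet> v)" using s by simp
  finally show ?thesis .
 qed
 show ?thesis unfolding coverinv_def
 proof (intro conjI allI ballI impI)
  fix i assume i: "i < n"
  then have "0 \<le> W i + w i" using W0 w0 by simp
  then show "0 \<le> W' i" using W'[OF i] by (simp add: w_def X_def s_def mult_ac)
 next
  fix v :: "real vec" assume v: "v \<in> carrier_vec d"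
  have "qf (gram A W') v = qf (gram A W) v + qf (gram A w) v" unfolding gW' by (rule qf_add) (use A v in auto)
  also have "\<dots> \<le> \<kappa> * (K + e) * Lam * (v \<bullet> v) + eta * \<kappa> * (K + e) * (v \<bullet> v)"
   using gw[OF v] inv v unfolding coverinv_def by (intro add_mono) auto
  finally show "qf (gram A W') v \<le> \<kappa> * (K + e) * (Lam + eta) * (v \<bullet> v)" by (simp add: algebra_simps)
 next
  fix V g assume V: "orth d V" "1\<^sub>m d + gram A W' = fc V g"
  have l: "0 < 1 / (1 + e) + gam * Lam" using e gam Lam by (simp add: add_pos_nonneg)
  have cr: "1 - (1 - 1 / Cr) = ((1 - e) / (1 + e))\<^sup>2" unfolding Cr_def by (simp add: power_divide)
  have V': "fc U f + gram A w = fc V g" unfolding U(2)[symmetric] V(2)[symmetric] gW' using A by (simp add: assoc_add_mat[of _ d d])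
  have pa: "real p * (eta * \<kappa> * (K + e)) \<le> e" unfolding etak using Ke e p0 by simp
  \<comment> \<open>By the lower half of \<open>RRok\<close> each unit of rescaled \<open>Y\<close>
    is worth at least \<open>tr P / (Cr * \<kappa>)\<close>, and the rescaled sum is
    \<open>eta * \<kappa>\<close>.\<close>
  have wt: "eta * (1 - (1 - 1 / Cr)) * tr (Pm U f) \<le> tr (Pm U f * gram A w)"
  proof -
   have "eta * (1 / Cr) * tr (Pm U f) = (\<Sum>i<n. Y i * (eta / s / Cr * tr (Pm U f)))"
    unfolding sum_distrib_right[symmetric] s_def[symmetric] using s by simp
   also have "\<dots> \<le> (\<Sum>i<n. w i * qf (Pm U f) (row A i))"
   proof (rule sum_mono)
    fix i assume "i \<in> {..<n}" then have i: "i < n" by simp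
    show "Y i * (eta / s / Cr * tr (Pm U f)) \<le> w i * qf (Pm U f) (row A i)"
    proof (cases "RR i = 0")
     case True
     then show ?thesis using H(1) i by (simp add: w_def X_def)
    next
     case False
     then have "row A i \<noteq> 0\<^sub>v d" using RR i unfolding RRok_def by blast
     then have "tr (Pm U f) \<le> Cr * (\<kappa> * RR i * qf (Pm U f) (row A i))" using RR i unfolding RRok_def by blast
     then have "Y i * eta / s / Cr * tr (Pm U f) \<le> Y i * eta / s / Cr * (Cr * (\<kappa> * RR i * qf (Pm U f) (row A i)))"
      using Y0[OF i] eta0 s Cr by (intro mult_left_mono divide_nonneg_nonneg mult_nonneg_nonneg) auto
     then show ?thesis using Cr by (simp add: w_def X_def mult_ac)
    qed
   qed
   also have "\<dots> = tr (Pm U f * gram A w)" by (rule tr_mult_gram[OF A, symmetric]) (simp add: Pm_def U)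
   finally show ?thesis by simp
  qed
  have "(\<Sum>i<d. (1 / g i) ^ p) \<le> (1 / ((1 / (1 + e) + gam * Lam) + (1 - e) * (1 - (1 - 1 / Cr)) / (1 + e) * eta)) ^ p"
  proof (rule covering_step[OF A _ U(1) _ V(1) V' w0 p e(1) _ pa eta0 _ gw wt[unfolded Pm_def] dp l])
   show "(\<Sum>i<d. (1 / f i) ^ p) \<le> (1 / (1 / (1 + e) + gam * Lam)) ^ p" using inv U unfolding coverinv_def by blast
  qed (use d0 e Cr coverinv_spectrum(1)[OF inv U] in auto)
  also have "(1 / (1 + e) + gam * Lam) + (1 - e) * (1 - (1 - 1 / Cr)) / (1 + e) * eta = 1 / (1 + e) + gam * (Lam + eta)"
  proof -
   have "(1 - e) * ((1 - e) / (1 + e))\<^sup>2 / (1 + e) = gam" unfolding gam_def by (simp add: power3_eq_cube power2_eq_square)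
   then show ?thesis unfolding cr by (simp add: distrib_left)
  qed
  finally show "(\<Sum>i<d. (1 / g i) ^ p) \<le> (1 / (1 / (1 + e) + gam * (Lam + eta))) ^ p" .
 qed
qed

text \<open>Removing the identity from \<open>N\<close> costs at most
  \<open>1 - 1 / (1 + e) \<le> e * Lam\<close> in the smallest eigenvalue. The factors
  \<open>1 + e\<close> of the guess, \<open>K + e\<close> and \<open>1 / (gam - e)\<close> multiply
  to at most \<open>1 + 50 e\<close>.\<close>

lemma coverinv_final:
 assumes inv: "coverinv \<kappa> W Lam" and Lam: "real E \<le> Lam" and \<kappa>: "1 \<le> \<kappa>" "\<kappa> \<le> (1 + e) * opt_inner_cond A"
  and eps: "50 * e \<le> \<epsilon>"
 shows "good_scaling \<epsilon> A (vec n W)"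
proof -
 have W0: "0 \<le> W i" if "i < n" for i using inv that unfolding coverinv_def by blast
 have L1: "1 \<le> Lam" using Lam E by simp
 have l0: "0 < 1 / (1 + e) + gam * Lam" using e gam L1 by (intro add_pos_pos) auto
 have lo: "(gam - e) * Lam * (v \<bullet> v) \<le> qf (gram A W) v" if v: "v \<in> carrier_vec d" for v
 proof -
  obtain U f where U: "orth d U" "1\<^sub>m d + gram A W = fc U f"
   using spectral_fc[of "1\<^sub>m d + gram A W" d] A by (auto simp: transpose_add[of _ d d])
  have f: "1 / (1 + e) + gam * Lam \<le> f i" if i: "i < d" for i
  proof -
   have f1: "1 \<le> f i" if "i < d" for i by (rule coverinv_spectrum(1)[OF inv U that])
   have "(1 / f i) ^ p \<le> (\<Sum>i<d. (1 / f i) ^ p)" by (rule member_le_sum) (use i f1 in \<open>auto intro!: zero_le_power order_trans[OF zero_le_one f1]\<close>)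
   also have "\<dots> \<le> (1 / (1 / (1 + e) + gam * Lam)) ^ p" using inv U unfolding coverinv_def by blast
   finally have "1 / f i \<le> 1 / (1 / (1 + e) + gam * Lam)"
    using power_mono_iff[of "1 / f i" "1 / (1 / (1 + e) + gam * Lam)" p] f1[OF i] l0 p0 by simp
   then show ?thesis using inverse_le_iff_le[of "f i" "1 / (1 + e) + gam * Lam"] f1[OF i] l0 unfolding inverse_eq_divide by linarith
  qed
  have "(1 / (1 + e) + gam * Lam) * (v \<bullet> v) \<le> qf (fc U f) v" by (rule qf_fc_ge[OF U(1) v f])
  also have "\<dots> = v \<bullet> v + qf (gram A W) v"
   unfolding U(2)[symmetric] using qf_add[of "1\<^sub>m d" d "gram A W" v] A v by (simp add: qf_one)
  finally have "(1 / (1 + e) + gam * Lam - 1) * (v \<bullet> v) \<le> qf (gram A W) v" by (simp add: algebra_simps)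
  moreover have "(gam - e) * Lam \<le> 1 / (1 + e) + gam * Lam - 1"
  proof -
   have "1 - e \<le> 1 / (1 + e)" using e by (simp add: le_divide_eq algebra_simps)
   moreover have "e * 1 \<le> e * Lam" using L1 e by (intro mult_left_mono) auto
   ultimately show ?thesis by (simp add: algebra_simps)
  qed
  ultimately show ?thesis using scalar_prod_self_nonneg[of v] by (meson mult_right_mono order_trans)
 qed
 have ge: "0 < gam - e" "1 - 7 * e \<le> gam - e" using gam e by auto
 have lo0: "0 < (gam - e) * Lam" using ge L1 by simp
 have up: "qf (gram A W) v \<le> \<kappa> * (K + e) * Lam * (v \<bullet> v)" if "v \<in> carrier_vec d" for v
  using inv that unfolding coverinv_def by blast
 note cn = cond_num_le[OF gram_carrier[OF A] gram_sym[OF A] _ lo0 lo up]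
 have "\<kappa> * (K + e) * Lam / ((gam - e) * Lam) = \<kappa> * ((K + e) / (gam - e))" using L1 by simp
 also have "\<dots> \<le> (1 + e) * opt_inner_cond A * ((K + e) / (gam - e))"
  using \<kappa> ge K0 e by (intro mult_right_mono) auto
 also have "\<dots> = ((1 + e) * (K + e) / (gam - e)) * opt_inner_cond A" by simp
 also have "(1 + e) * (K + e) / (gam - e) \<le> 1 + \<epsilon>"
 proof -
  have e2: "e * e \<le> e / 100" using mult_left_mono[OF e(2), of e] e by simp
  have "(1 + e) * (K + e) \<le> (1 + e) * (1 + 30 * e)" using Ke e by (intro mult_left_mono) auto
  also have "\<dots> = 1 + 31 * e + 30 * (e * e)" by (simp add: algebra_simps)
  also have "\<dots> \<le> 1 + 43 * e - 350 * (e * e)" using e2 e by linarith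
  also have "\<dots> = (1 + 50 * e) * (1 - 7 * e)" by (simp add: algebra_simps)
  also have "\<dots> \<le> (1 + \<epsilon>) * (gam - e)" using eps ge e by (intro mult_mono) auto
  finally show ?thesis using ge by (simp add: divide_le_eq)
 qed
 then have "((1 + e) * (K + e) / (gam - e)) * opt_inner_cond A \<le> (1 + \<epsilon>) * opt_inner_cond A"
  using opt_inner_cond_witness(1)[OF A rk _ e(1)] d0 by (intro mult_right_mono) auto
 finally have "cond_num (gram A W) \<le> (1 + \<epsilon>) * opt_inner_cond A" using cn(2) d0 by simp
 moreover have "gram A W = scaled_gram A (mat_diag n (vec_index (vec n W)))"
  using A gram_cong[OF A, of W "vec_index (vec n W)"] by (simp add: gram_def)
 ultimately show ?thesis using A W0 cn(1) d0 unfolding good_scaling_def by simp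
qed

end

section \<open>Invariant of the main loop\<close>

context prog_context
begin

lemma wp_tail:
 assumes c: "cregs n E p \<delta> h"
  and Q: "\<And>h' mk. \<lbrakk>chg {14, 16} h h'; vc h' = vc h; sc h' 16 = sc h 16 + 1; mpar n E \<delta> mk h'; ct h' \<le> ct h + 30 + 10 * mk\<rbrakk> \<Longrightarrow> Q h'"
 shows "WP (Bin Add 16 16 1 ;; setm) Q h"
proof -
 note r = c[unfolded cregs_def]
 show ?thesis
  apply (simp add: wpq)
  apply (rule wp_setm)
  apply (use r in simp_all)[3]
  subgoal premises m for h' mk
   apply (rule Q[of h' mk])
   using m chgD[OF m(1)] r by (simp_all add: chg_def mpar_def mult_ac)
  done
qed

end

locale scaling_program = prog_context A n d T rnd + scaling_analysis A n d E p k e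
 for A n d T rnd E p k e +
 fixes \<delta> \<epsilon> :: real
 assumes eps: "50 * e \<le> \<epsilon>"
begin

abbreviation "kmax \<equiv> (1 + e) * opt_inner_cond A"
abbreviation "zfac \<equiv> 1 + e / real p * e"
abbreviation "succs g s R \<equiv> {(g, s, Some (Suc R)), (g, Suc s, None), (Suc g, 0, None)}"

text \<open>\<open>g\<close> numbers the guess and \<open>s\<close> the covering step. The bound by
  \<open>kmax\<close> persists because a guess is raised only after it has proved to be below the
  optimum.\<close>

definition ghead :: "nat \<Rightarrow> nat \<Rightarrow> hst \<Rightarrow> bool" where
 "ghead g s h \<longleftrightarrow> cregs n E p \<delta> h \<and> (\<exists>kc. kpar n E p kc h) \<and> sc h 15 = 0 \<and> sc h 7 = (1 + e) ^ g \<and> sc h 7 \<le> kmax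
   \<and> sc h 17 = real s * sc h 20 \<and> sc h 17 < real E \<and> coverinv (sc h 7) (vc h 0) (sc h 17)"

definition mode0 :: "hst \<Rightarrow> bool" where
 "mode0 h \<longleftrightarrow> sc h 8 = 0 \<and> sc h 9 = 1 \<and> sc h 13 = real (p div 2 + 1) \<and> (\<forall>i<n. vc h 1 i = vc h 0 i)"

text \<open>The row bounds belong to the matrix \<open>N\<close> of the preceding covering sketch;
  array 0 does not change during a packing phase, so this can be stated for the current
  state.\<close>

definition mode1 :: "nat \<Rightarrow> hst \<Rightarrow> bool" where
 "mode1 R h \<longleftrightarrow> sc h 8 = 1 \<and> sc h 9 = 0 \<and> sc h 13 = real (p div 2 - 1) \<and> sc h 18 = sc h 21 * zfac ^ R \<and> sc h 18 < real E
   \<and> (\<Sum>i<n. vc h 3 i) < real E \<and> packinv (vc h 4) (sc h 21) R (vc h 3)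
   \<and> (\<exists>U f. orth d U \<and> 1\<^sub>m d + gram A (vc h 0) = fc U f \<and> RRok (sc h 7) (Pm U f) (vc h 4))
   \<and> (\<forall>i<n. vc h 1 i = vc h 3 i * vc h 4 i) \<and> (\<forall>i<n. vc h 2 i = vc h 3 i * vc h 4 i)"

fun Inv :: "nat \<Rightarrow> nat \<Rightarrow> nat option \<Rightarrow> hst \<Rightarrow> bool" where
 "Inv g s None h \<longleftrightarrow> ghead g s h \<and> mode0 h"
| "Inv g s (Some R) h \<longleftrightarrow> ghead g s h \<and> mode1 R h"

text \<open>The event that the sketch about to run is accurate. The registers hold reals, hence the
  quantification over the natural numbers that they represent.\<close>

definition acc :: "hst \<Rightarrow> bool" where
 "acc h \<longleftrightarrow> (\<forall>kc pw m. sc h 12 = real kc \<longrightarrow> sc h 13 = real pw \<longrightarrow> sc h 14 = real m \<longrightarrow>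
   accurate A e (opM A (sc h 10) (sc h 11) kc (sc h 8) (vc h 1) ^\<^sub>m pw) (sc h 9) (vc h 1) m (\<lambda>l. rnd (dr h + l)))"

lemma accD:
 assumes "acc h" "sc h 12 = real kc" "sc h 13 = real pw" "sc h 14 = real m"
 defines "Z \<equiv> opM A (sc h 10) (sc h 11) kc (sc h 8) (vc h 1) ^\<^sub>m pw" and "\<xi> \<equiv> \<lambda>l. rnd (dr h + l)"
 shows "i < n \<Longrightarrow> (1 - e) * Qv A Z (sc h 9) (vc h 1) (row A i) \<le> estim A Z (sc h 9) (vc h 1) m \<xi> (row A i)"
  "i < n \<Longrightarrow> estim A Z (sc h 9) (vc h 1) m \<xi> (row A i) \<le> (1 + e) * Qv A Z (sc h 9) (vc h 1) (row A i)"
  "j < d \<Longrightarrow> (1 - e) * Qv A Z (sc h 9) (vc h 1) (unit_vec d j) \<le> estim A Z (sc h 9) (vc h 1) m \<xi> (unit_vec d j)"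
  "j < d \<Longrightarrow> estim A Z (sc h 9) (vc h 1) m \<xi> (unit_vec d j) \<le> (1 + e) * Qv A Z (sc h 9) (vc h 1) (unit_vec d j)"
 using assms(1)[unfolded acc_def, rule_format, OF assms(2-4), folded Z_def \<xi>_def] dim unfolding accurate_def by auto

lemma kap1: "ghead g s h \<Longrightarrow> 1 \<le> sc h 7"
 unfolding ghead_def using e by (simp add: one_le_power)

lemma inv_mono_tail:
 assumes c: "chg {14, 16} h h'" "vc h' = vc h" and I: "Inv g s ro h"
 shows "Inv g s ro h'"
proof -
 have r: "sc h' i = sc h i" if "i < 30" "i \<noteq> 14" "i \<noteq> 16" for i using chgD[OF c(1), of i] that by simp
 have "cregs n E p \<delta> h' = cregs n E p \<delta> h" unfolding cregs_def by (simp add: r)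
 moreover have "kpar n E p kc h' = kpar n E p kc h" for kc unfolding kpar_def by (simp add: r)
 ultimately have "ghead g s h' = ghead g s h" unfolding ghead_def by (simp add: r c(2))
 moreover have "mode0 h' = mode0 h" unfolding mode0_def by (simp add: r c(2))
 moreover have "mode1 R h' = mode1 R h" for R unfolding mode1_def by (simp add: r c(2))
 ultimately show ?thesis using I by (cases ro) auto
qed

end

abbreviation cost_cover :: "nat \<Rightarrow> nat \<Rightarrow> nat \<Rightarrow> nat \<Rightarrow> nat" where
 "cost_cover E p mk kc \<equiv> 8 * E * E * Suc mk * ((p div 2 + 1) * (150 * kc + 10) + 160) + 80"

abbreviation cost_pack :: "nat \<Rightarrow> nat \<Rightarrow> nat \<Rightarrow> nat" where
 "cost_pack E p mk \<equiv> 8 * E * E * Suc mk * ((p div 2 - 1) * 30 + 160) + 80"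

context scaling_program
begin

lemma ghead_cong:
 assumes r: "\<And>r. r < 28 \<Longrightarrow> r \<notin> {8,9,13,14,16,18} \<Longrightarrow> sc h' r = sc h r" and v: "vc h' 0 = vc h 0"
 shows "ghead g s h' = ghead g s h"
proof -
 have "cregs n E p \<delta> h' = cregs n E p \<delta> h" unfolding cregs_def by (simp add: r)
 moreover have "kpar n E p kc h' = kpar n E p kc h" for kc unfolding kpar_def by (simp add: r)
 ultimately show ?thesis unfolding ghead_def by (simp add: r v)
qed

lemma kparD:
 assumes "kpar n E p kc h"
 shows "sc h 10 = cs0 E (sc h 7)" "sc h 11 = 2 / (4 * (sc h 7 * real E) - 1)"
  "sc h 12 = real kc" "1 \<le> kc" "sc h 20 = 1 / (2 * (real E * real p * sc h 7))"
  "sc h 21 = 1 / (4 * ((4 * (sc h 7 * real E)) ^ Suc p * real n * real n))"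
  "tol E p \<le> cheb (cs0 E (sc h 7)) kc"
 using assms unfolding kpar_def Let_def by simp_all

lemma phalf: "real p / 2 + 1 = real (p div 2 + 1)" "real p / 2 - 1 = real (p div 2 - 1)"
proof -
 have "2 * (p div 2) = p" "1 \<le> p div 2" using p0 by auto
 then show "real p / 2 + 1 = real (p div 2 + 1)" "real p / 2 - 1 = real (p div 2 - 1)" by (simp_all add: of_nat_diff real_of_nat_div)
qed

lemma wp_body0:
 assumes I: "ghead g s h" "mode0 h" and kc: "kpar n E p kc h" and mk: "mpar n E \<delta> mk h" and a: "acc h"
  and Q: "\<And>h' mk'. \<lbrakk>Inv g s (Some 0) h'; sc h' 16 = sc h 16 + 1; mpar n E \<delta> mk' h';
   ct h' \<le> ct h + T * cost_cover E p mk kc + 90 + 80 * n + 10 * mk'\<rbrakk> \<Longrightarrow> Q h'"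
 shows "WP body Q h"
proof -
 note c = I(1)[unfolded ghead_def, THEN conjunct1]
 note cr = c[unfolded cregs_def]
 note kp = kparD[OF kc]
 note m0 = I(2)[unfolded mode0_def]
 let ?k = "sc h 7" and ?m = "8 * E * E * Suc mk" and ?u = "vc h 1"
 let ?hi = "4 * (?k * real E)"
 let ?Z = "opM A (sc h 10) (sc h 11) kc (sc h 8) ?u ^\<^sub>m (p div 2 + 1)" and ?\<xi> = "\<lambda>l. rnd (dr h + l)"
 let ?est = "estim A ?Z (sc h 9) ?u ?m ?\<xi>"
 have m: "sc h 14 = real ?m" using mk unfolding mpar_def Let_def by (simp add: algebra_simps)
 have k1: "1 \<le> ?k" using kap1[OF I(1)] .
 have E100: "100 \<le> real E" using E by simp
 have hi: "1 < ?hi" "4 \<le> ?hi" using mult_mono[OF k1 E100] E100 k1 by auto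
 have cov: "coverinv ?k (vc h 0) (sc h 17)" and Lam: "sc h 17 < real E" using I(1) unfolding ghead_def by auto
 have gW: "gram A ?u = gram A (vc h 0)" by (rule gram_cong[OF A]) (use m0 in simp)
 obtain U f where U: "orth d U" "1\<^sub>m d + gram A (vc h 0) = fc U f"
  using spectral_fc[of "1\<^sub>m d + gram A (vc h 0)" d] A by (auto simp: transpose_add[of _ d d])
 \<comment> \<open>With total step length below \<open>E\<close> the spectrum is at most
   \<open>1 + 2 \<kappa> E \<le> 3 \<kappa> E\<close>, hence inside the Chebyshev interval.\<close>
 have f: "1 \<le> f i" "f i \<le> ?hi" if i: "i < d" for i
 proof -
  show "1 \<le> f i" by (rule coverinv_spectrum(1)[OF cov U i])
  have "f i \<le> 1 + ?k * (K + e) * sc h 17" by (rule coverinv_spectrum(2)[OF cov U i])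
  also have "\<dots> \<le> 1 + ?k * (K + e) * real E" using Lam k1 K0 e by (intro add_left_mono mult_left_mono) auto
  also have "\<dots> \<le> ?k * real E + ?k * 2 * real E"
   using mult_mono[OF k1 E100] Ke k1 by (intro add_mono mult_right_mono mult_left_mono) auto
  also have "\<dots> \<le> ?hi" using k1 by (simp add: mult_ac)
  finally show "f i \<le> ?hi" .
 qed
 define S where "S = cheb ((?hi + 1) / (?hi - 1)) kc ^ (p + 2)"
 have S: "0 < S" unfolding S_def using cheb_power_bounds(1)[OF hi(1) _ _ _ kp(7), of 1] hi E by simp
 define QQ where "QQ = Qv A ?Z (sc h 9) ?u"
 have QQ: "(1 - e) * S * qf (Pm U f) v \<le> QQ v" "QQ v \<le> (1 + e) * S * qf (Pm U f) v" if "v \<in> carrier_vec d" for v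
  using cover_sketch[OF A _ e_def p0(3) U(1) U(2)[folded gW] f hi(1) kp(7) that] m0 E
  unfolding QQ_def S_def Pm_def kp(1,2) by simp_all
 note ac = accD[OF a kp(3) _ m, of "p div 2 + 1", folded QQ_def]
 have a13: "sc h 13 = real (p div 2 + 1)" using m0 by blast
 have ok: "RRok ?k (Pm U f) RR" if "\<And>i. i < n \<Longrightarrow> RR i = (\<Sum>j<d. ?est (unit_vec d j)) / (?est (row A i) * ?k)" for RR
  by (rule RRok_sketch[OF U(1) f _ S QQ ac(1)[OF a13] ac(2)[OF a13] ac(3)[OF a13] ac(4)[OF a13] that]) (use k1 in simp_all)
 have oc: "opcost (sc h 8) kc = 150 * kc" using m0 by (simp add: opcost_def)
 \<comment> \<open>At the initial scale neither the sum of \<open>y\<close> nor register 18 has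
   reached \<open>E\<close>, so the packing phase starts undecided.\<close>
 have z: "sc h 21 \<le> 1" "real n * sc h 21 \<le> 1" "0 < sc h 21"
 proof -
  have n1: "1 \<le> real n" using d0 dn by simp
  define H where "H = ?hi ^ Suc p"
  have "1 \<le> H" unfolding H_def using hi by (intro one_le_power) auto
  then have b: "1 * real n \<le> H * real n" by (rule mult_right_mono) simp
  then have "real n * 1 \<le> real n * (H * real n)" using n1 b by (intro mult_left_mono) linarith+
  moreover have "0 < H * real n * real n" using b n1 by (intro mult_pos_pos) auto
  ultimately show z1: "real n * sc h 21 \<le> 1" "0 < sc h 21" unfolding kp(6) H_def[symmetric] using n1
   by (simp_all add: divide_le_eq mult_ac)
  have "1 * sc h 21 \<le> real n * sc h 21" using n1 z1 by (intro mult_right_mono) auto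
  then show "sc h 21 \<le> 1" using z1 by linarith
 qed
 show ?thesis unfolding body_def
  apply (subst wp_Seq)
  apply (rule wp_sketch[OF _ _ _ kp(3,4) a13 m])
  apply (use cr in simp_all)[3]
  subgoal premises q for h1
  proof -
   have r: "sc h1 i = sc h i" if "i < 28" for i using frameD(1)[OF q(1) that] .
   have v: "vc h1 i = vc h i" if "i < 5" for i using frameD(2)[OF q(1) that] .
   have br: "wp A T rnd (If (TR 8 2) postC postP) Q' h1 = WP postC Q' (h1\<lparr>ct := ct h1 + 2\<rparr>)" for Q'
    using cr m0 by (simp add: wp_If r)
   show ?thesis
    apply (subst wp_Seq)
    apply (subst br)
    apply (rule wp_postC)
    apply (use cr in \<open>simp_all add: r r[of 1, simplified]\<close>)[3]
    subgoal premises w for h2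
    proof -
     have w1: "sc h2 i = sc h i" if "i < 28" "i \<notin> {8,9,13,18}" for i using chgD[OF w(1), of i] r[of i] that by simp
     have c2: "cregs n E p \<delta> h2" using c unfolding cregs_def by (simp add: w1)
     have RR: "vc h2 4 i = (\<Sum>j<d. ?est (unit_vec d j)) / (?est (row A i) * ?k)" if "i < n" for i
      using w(4)[OF that] q(3)[OF that] q(4) by (simp add: r)
     note okr = ok[of "vc h2 4", OF RR]
     have Y: "vc h2 3 i = (if vc h2 4 i = 0 then 0 else sc h 21)" if "i < n" for i using w(5)[OF that] r[of 21] by simp
     have gh: "ghead g s h2" using I(1) ghead_cong[of h2 h g s] w1 v[of 0] w(2) by simp
     have "Inv g s (Some 0) h2" unfolding Inv.simps mode1_def
     proof (intro conjI)
      show "ghead g s h2" by (rule gh)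
      show "sc h2 8 = 1" "sc h2 9 = 0" by (rule w(9), rule w(10))
      show "sc h2 13 = real (p div 2 - 1)" using w(11) cr phalf(2) by (simp add: r)
      show "sc h2 18 = sc h2 21 * zfac ^ 0" using w(8) by (simp add: r w1)
      show "sc h2 18 < real E" using w(8) z(1) E100 by (simp add: r)
      have "(\<Sum>i<n. vc h2 3 i) \<le> (\<Sum>i<n. sc h 21)" by (rule sum_mono) (use Y z in simp)
      also have "\<dots> \<le> 1" using z(2) by simp
      finally show "(\<Sum>i<n. vc h2 3 i) < real E" using E100 by simp
      show "packinv (vc h2 4) (sc h2 21) 0 (vc h2 3)"
       by (rule packinv_init[OF U(1) f okr k1]) (use kp(6) Y w1[of 21] in simp_all)
      show "\<exists>U f. orth d U \<and> 1\<^sub>m d + gram A (vc h2 0) = fc U f \<and> RRok (sc h2 7) (Pm U f) (vc h2 4)"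
       using U okr w(2) v[of 0] w1[of 7] by (intro exI[of _ U] exI[of _ f]) simp
      show "\<forall>i<n. vc h2 1 i = vc h2 3 i * vc h2 4 i" "\<forall>i<n. vc h2 2 i = vc h2 3 i * vc h2 4 i" using w(6,7) by auto
     qed
     then have inv: "Inv g s (Some 0) h3" if "chg {14, 16} h2 h3" "vc h3 = vc h2" for h3 using inv_mono_tail that by blast
     show ?thesis
      apply (rule wp_tail[OF c2])
      subgoal premises t for h3 mk'
      proof (rule Q[of h3 mk'])
       show "Inv g s (Some 0) h3" by (rule inv[OF t(1,2)])
       show "sc h3 16 = sc h 16 + 1" using t(3) w1[of 16] by simp
       show "mpar n E \<delta> mk' h3" by (rule t(4))
       show "ct h3 \<le> ct h + T * cost_cover E p mk kc + 90 + 80 * n + 10 * mk'"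
        using t(5) w(12) q(5)[unfolded oc] by simp
      qed
      done
    qed
    done
  qed
  done
qed

end

context scaling_program
begin

lemma wp_body1:
 assumes I: "ghead g s h" "mode1 R h" and kc: "kpar n E p kc h" and mk: "mpar n E \<delta> mk h" and a: "acc h"
  and Q: "\<And>h' g' s' ro' kc' mk'. \<lbrakk>Inv g' s' ro' h'; (g', s', ro') \<in> succs g s R;
    kpar n E p kc' h'; sc h' 16 = sc h 16 + 1; mpar n E \<delta> mk' h';
   ct h' \<le> ct h + T * cost_pack E p mk + 220 + 20 * p + 15 * kc' + 120 * n + 10 * mk'\<rbrakk> \<Longrightarrow> Q h'"
  and Q': "\<And>h' mk'. \<lbrakk>cregs n E p \<delta> h'; sc h' 15 = 1; good_scaling \<epsilon> A (vec n (vc h' 0)); sc h' 16 = sc h 16 + 1; mpar n E \<delta> mk' h';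
   ct h' \<le> ct h + T * cost_pack E p mk + 220 + 20 * p + 120 * n + 10 * mk'\<rbrakk> \<Longrightarrow> Q h'"
 shows "WP body Q h"
proof -
 note gh = I(1)[unfolded ghead_def] note c = gh[THEN conjunct1]
 note cr = c[unfolded cregs_def]
 note kp = kparD[OF kc]
 note m1 = I(2)[unfolded mode1_def]
 let ?k = "sc h 7" and ?m = "8 * E * E * Suc mk" and ?u = "vc h 1" and ?z = "sc h 21"
 let ?Z = "opM A (sc h 10) (sc h 11) kc (sc h 8) ?u ^\<^sub>m (p div 2 - 1)" and ?\<xi> = "\<lambda>l. rnd (dr h + l)"
 let ?est = "estim A ?Z (sc h 9) ?u ?m ?\<xi>"
 have m: "sc h 14 = real ?m" using mk unfolding mpar_def Let_def by (simp add: algebra_simps)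
 have k1: "1 \<le> ?k" using kap1[OF I(1)] .
 have E100: "100 \<le> real E" using E by simp
 have E1: "1 \<le> E" using E by simp
 have cov: "coverinv ?k (vc h 0) (sc h 17)" and Lam: "sc h 17 < real E" "sc h 17 = real s * sc h 20" and kk: "?k \<le> kmax"
  and kg: "?k = (1 + e) ^ g"
  using gh by auto
 have eta: "0 < sc h 20" unfolding kp(5) using k1 E100 p0 by simp
 have \<zeta>: "0 < ?z" unfolding kp(6) using k1 E100 d0 dn by simp
 have pack: "packinv (vc h 4) ?z R (vc h 3)" using m1 by blast
 obtain U f where U: "orth d U" "1\<^sub>m d + gram A (vc h 0) = fc U f" "RRok ?k (Pm U f) (vc h 4)" using m1 by blast
 have f1: "1 \<le> f i" if "i < d" for i by (rule coverinv_spectrum(1)[OF cov U(1,2) that])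
 have a13: "sc h 13 = real (p div 2 - 1)" using m1 by blast
 note ac = accD[OF a kp(3) a13 m]
 have gu: "gram A ?u = gram A (\<lambda>i. vc h 3 i * vc h 4 i)" by (rule gram_cong[OF A]) (use m1 in simp)
 have est: "(1 - e) * qf (fc V (\<lambda>i. g i ^ (p - 1))) (row A i) \<le> ?est (row A i) \<and> ?est (row A i) \<le> (1 + e) * qf (fc V (\<lambda>i. g i ^ (p - 1))) (row A i)"
  if V: "orth d V" "gram A (\<lambda>i. vc h 3 i * vc h 4 i) = fc V g" "i < n" for V g i
 proof -
  have "Qv A ?Z (sc h 9) ?u (row A i) = qf (fc V (\<lambda>i. g i ^ (p - 1))) (row A i)"
   using pack_sketch[OF A E1 e_def p0(3) V(1) V(2)[folded gu] p0(2) rowc[of i]] m1 by simp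
  then show ?thesis using ac(1,2)[OF V(3)] by simp
 qed
 define t where "t = (\<Sum>i<n. vc h 3 i * vc h 4 i * ?est (row A i))"
 define Y where "Y i = (if (1 + 20 * e) * t / root p t < ?est (row A i) * vc h 4 i then vc h 3 i else vc h 3 i * (1 + e / real p))" for i
 have pack': "packinv (vc h 4) ?z (Suc R) Y"
  by (rule packinv_round[OF pack RRok_row[OF U(3)] \<zeta> est t_def refl]) (simp_all add: Y_def)
 have t0: "0 \<le> t"
 proof -
  have "0 \<le> vc h 3 i" if "i < n" for i
  proof -
   obtain cnt :: "nat \<Rightarrow> nat" where "\<forall>i<n. vc h 3 i = (if vc h 4 i = 0 then 0 else ?z * (1 + e / real p) ^ cnt i)"
    using pack unfolding packinv_def by (elim exE conjE) (rule that)
   then show ?thesis using that \<zeta> e by simp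
  qed
  moreover have "0 \<le> vc h 4 i" if "i < n" for i using RRok_row[OF U(3)] that unfolding RRrow_def by simp
  moreover have "0 \<le> ?est v" for v unfolding estim_def by (intro divide_nonneg_nonneg sum_nonneg) auto
  ultimately show ?thesis unfolding t_def by (intro sum_nonneg mult_nonneg_nonneg) auto
 qed
 have oc: "opcost (sc h 8) kc = 20" using m1 by (simp add: opcost_def)
 let ?cs = "T * cost_pack E p mk"
 show ?thesis unfolding body_def
  apply (subst wp_Seq)
  apply (rule wp_sketch[OF _ _ _ kp(3,4) a13 m])
  apply (use cr in simp_all)[3]
  subgoal premises q for h1
  proof -
   have r: "sc h1 i = sc h i" if "i < 28" for i using frameD(1)[OF q(1) that] .
   have v: "vc h1 i = vc h i" if "i < 5" for i using frameD(2)[OF q(1) that] .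
   have br: "wp A T rnd (If (TR 8 2) postC postP) Q' h1 = WP postP Q' (h1\<lparr>ct := ct h1 + 2\<rparr>)" for Q'
    using cr m1 by (simp add: wp_If r)
   have t1: "(\<Sum>i<n. vc h1 2 i * vc h1 5 i) = t"
    unfolding t_def using q(3) m1 v[of 2] by (intro sum.cong) auto
   have Y1: "(if sc h1 24 * t / root p t < vc h1 5 i * vc h1 4 i then vc h1 3 i else vc h1 3 i * sc h1 22) = Y i" if "i < n" for i
    unfolding Y_def using cr q(3)[OF that] v[of 3] v[of 4] by (simp add: r e_def add.commute)
   have SY: "(\<Sum>i<n. if sc h1 24 * t / root p t < vc h1 5 i * vc h1 4 i then vc h1 3 i else vc h1 3 i * sc h1 22) = (\<Sum>i<n. Y i)"
    by (intro sum.cong) (use Y1 in auto)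
   have e23: "sc h 23 = 1 + e / real p * e" "sc h 25 = 1 + e" using cr by (simp_all add: e_def)
   have z': "sc h 18 * sc h 23 = ?z * zfac ^ Suc R" using m1 e23 by (simp add: mult_ac)
   have fin: "WP (Bin Add 16 16 1 ;; setm) Q h2" if h2: "cregs n E p \<delta> h2" "sc h2 16 = sc h 16"
     "Inv g' s' ro' h2" "(g', s', ro') \<in> succs g s R" "kpar n E p kc' h2"
     "ct h2 \<le> ct h + ?cs + 190 + 20 * p + 15 * kc' + 120 * n" for h2 :: hst and g' s' ro' kc'
    apply (rule wp_tail[OF h2(1)])
    subgoal premises w for h3 mk'
    proof (rule Q[OF inv_mono_tail[OF w(1,2) h2(3)] h2(4), of kc' mk'])
     have "sc h3 i = sc h2 i" if "i \<in> {7,10,11,12,20,21}" for i using chgD[OF w(1), of i] that by auto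
     then show "kpar n E p kc' h3" using h2(5) unfolding kpar_def by simp
    qed (use w h2 in simp_all)
    done
   have fin': "WP (Bin Add 16 16 1 ;; setm) Q h2" if h2: "cregs n E p \<delta> h2" "sc h2 16 = sc h 16" "sc h2 15 = 1" "good_scaling \<epsilon> A (vec n (vc h2 0))"
     "ct h2 \<le> ct h + ?cs + 190 + 20 * p + 120 * n" for h2 :: hst
    apply (rule wp_tail[OF h2(1)])
    subgoal premises w for h3 mk'
    proof (rule Q'[of h3 mk'])
     show "cregs n E p \<delta> h3" using h2(1) chgD[OF w(1)] unfolding cregs_def by simp
    qed (use w h2 chgD[OF w(1), of 15] in simp_all)
    done
   show ?thesis
    apply (subst wp_Seq)
    apply (subst br)
    apply (rule wp_postP[where E = E and p = p and lp = "Suc k"])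
    apply (use cr E1 p k1 t1 t0 e in \<open>simp_all add: r r[of 1, simplified]\<close>)[11]
    subgoal premises w for h2
    proof -
     have w1: "sc h2 i = sc h i" if "i < 28" "i \<noteq> 18" for i using chgD[OF w(3), of i] r[of i] that by simp
     have s1: "(\<Sum>i<n. Y i) < real E" using w(1) by (simp add: t1 SY cong: if_cong)
     have Y2: "vc h2 3 i = Y i" if "i < n" for i using w(6)[OF that] Y1[OF that] by (simp add: t1 cong: if_cong)
     have v2: "vc h2 0 = vc h 0" "vc h2 4 = vc h 4" using w(4,5) v by simp_all
     have X2: "vc h2 1 i = Y i * vc h 4 i" "vc h2 2 i = Y i * vc h 4 i" if "i < n" for i
      using w(7,8)[OF that] Y1[OF that] v[of 4] by (simp_all add: t1 cong: if_cong)
     have z2: "sc h2 18 = ?z * zfac ^ Suc R" using w(9) z' by (simp add: r)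
     have gh2: "ghead g s h2" using I(1) ghead_cong[of h2 h g s] w1 v2 by simp
     have S2: "(\<Sum>i<n. vc h2 3 i) = (\<Sum>i<n. Y i)" by (intro sum.cong) (use Y2 in auto)
     have pk: "packinv (vc h2 4) (sc h2 21) (Suc R) (vc h2 3)"
      unfolding v2 w1[of 21, simplified]
      by (rule packinv_round[OF pack RRok_row[OF U(3)] \<zeta> est t_def refl]) (simp_all add: Y2 Y_def)
     have "Inv g s (Some (Suc R)) h2" unfolding Inv.simps mode1_def
     proof (intro conjI)
      show "sc h2 18 < real E" using w(2) z' z2 by (simp add: r)
      show "sc h2 18 = sc h2 21 * zfac ^ Suc R" using z2 w1 by simp
      show "\<exists>U f. orth d U \<and> 1\<^sub>m d + gram A (vc h2 0) = fc U f \<and> RRok (sc h2 7) (Pm U f) (vc h2 4)"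
       using U w1[of 7] v2 by (intro exI[of _ U] exI[of _ f]) simp
     qed (use gh2 m1 S2 s1 pk X2 Y2 v2 in \<open>simp_all add: w1\<close>)
     moreover have "cregs n E p \<delta> h2" using c unfolding cregs_def by (simp add: w1)
     moreover have "kpar n E p kc h2" using kc unfolding kpar_def by (simp add: w1)
     moreover have "ct h2 \<le> ct h + ?cs + 190 + 20 * p + 15 * kc + 120 * n" using w(10) q(5)[unfolded oc] by simp
     moreover have "sc h2 16 = sc h 16" using w1[of 16] by simp
     ultimately show ?thesis by (intro fin[of h2 g s "Some (Suc R)" kc]) simp_all
    qed
    subgoal premises w for h2 kc'
    proof -
     have w1: "sc h2 i = sc h i" if "i < 28" "i \<notin> {7,8,9,10,11,12,13,17,18,20,21}" for i using chgD[OF w(3), of i] r[of i] that by simp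
     have s1: "(\<Sum>i<n. Y i) < real E" using w(1) by (simp add: t1 SY cong: if_cong)
     have "real E \<le> ?z * zfac ^ Suc R" using w(2) z' by (simp add: r)
     \<comment> \<open>Otherwise \<open>packinv_fail\<close> would push the sum of \<open>Y\<close>
       up to the value of register 18 and hence to \<open>E\<close>. So the guess was below the
       optimum, and the next one stays below \<open>kmax\<close>.\<close>
     then have "\<not> opt_inner_cond A \<le> ?k" using packinv_fail[OF pack' U(3) refl U(1) f1 \<zeta>] s1 by force
     then have "(1 + e) * ?k \<le> kmax" using e by (intro mult_left_mono) auto
     have k2: "sc h2 7 = ?k * (1 + e)" using w(4) e23 by (simp add: r)
     have cr2: "cregs n E p \<delta> h2" using c unfolding cregs_def by (simp add: w1)
     note kp2 = w(9)
     have "ghead (Suc g) 0 h2" unfolding ghead_def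
     proof (intro conjI)
      show "\<exists>kc. kpar n E p kc h2" using kp2 by blast
      show "sc h2 7 = (1 + e) ^ Suc g" using k2 kg by simp
      show "sc h2 7 \<le> kmax" using \<open>(1 + e) * ?k \<le> kmax\<close> k2 by (simp add: mult.commute)
      have l: "sc h2 17 = 0" by (rule w(11))
      show "sc h2 17 = real 0 * sc h2 20" "sc h2 17 < real E" using l E100 by simp_all
      show "coverinv (sc h2 7) (vc h2 0) (sc h2 17)" unfolding l by (rule coverinv_init) (use w(5) in simp)
      show "sc h2 15 = 0" using w1[of 15] gh by simp
     qed (rule cr2)
     moreover have "mode0 h2" unfolding mode0_def using w(5-10) phalf(1) by simp
     ultimately have "Inv (Suc g) 0 None h2" by simp
     moreover have "ct h2 \<le> ct h + ?cs + 190 + 20 * p + 15 * kc' + 120 * n" using w(12) q(5)[unfolded oc] by simp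
     moreover have "sc h2 16 = sc h 16" using w1[of 16] by simp
     ultimately show ?thesis using cr2 kp2 by (intro fin[of h2 "Suc g" 0 None kc']) simp_all
    qed
    subgoal premises w for h2
    proof -
     have w1: "sc h2 i = sc h i" if "i < 28" "i \<notin> {8,9,13,15,17,18}" for i using chgD[OF w(2), of i] r[of i] that by simp
     have s1: "real E \<le> (\<Sum>i<n. Y i)" using w(1) by (simp add: t1 SY cong: if_cong)
     have W: "vc h2 0 i = vc h 0 i + Y i * vc h 4 i * (sc h 20 * ?k / (\<Sum>i<n. Y i))" if "i < n" for i
     proof -
      have "vc h2 0 i = vc h1 0 i + Y i * vc h1 4 i * (sc h1 20 * sc h1 7 / (\<Sum>i<n. Y i))"
       using w(3)[OF that] Y1[OF that] by (simp add: t1 SY cong: if_cong)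
      then show ?thesis using v[of 0] v[of 4] by (simp add: r)
     qed
     have l: "sc h2 17 = sc h 17 + sc h 20" using w(5) by (simp add: r)
     have cr2: "cregs n E p \<delta> h2" using c unfolding cregs_def by (simp add: w1)
     have kp2: "kpar n E p kc h2" using kc unfolding kpar_def by (simp add: w1)
     have "0 \<le> sc h 17" using Lam eta by simp
     have cov2: "coverinv ?k (vc h2 0) (sc h2 17)" unfolding l
      by (rule coverinv_step[OF cov \<open>0 \<le> sc h 17\<close> k1 U pack' \<zeta> s1 kp(5) W])
     have ctb: "ct h2 \<le> ct h + ?cs + 190 + 20 * p + 120 * n" using w(10) q(5)[unfolded oc] by simp
     show ?thesis
     proof (cases "sc h2 17 < real E")
      case True
      have "ghead g (Suc s) h2" unfolding ghead_def
      proof (intro conjI)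
       show "\<exists>kc. kpar n E p kc h2" using kp2 by blast
       show "sc h2 17 = real (Suc s) * sc h2 20" using l Lam(2) w1[of 20] by (simp add: algebra_simps)
       show "sc h2 15 = 0" using w(9) True gh by (simp add: r)
       show "coverinv (sc h2 7) (vc h2 0) (sc h2 17)" using cov2 w1[of 7] by simp
      qed (use cr2 True kg kk w1[of 7] in simp_all)
      moreover have "mode0 h2" unfolding mode0_def using w(4-8) phalf(1) by simp
      ultimately have "Inv g (Suc s) None h2" by simp
      moreover have "sc h2 16 = sc h 16" using w1[of 16] by simp
      ultimately show ?thesis using cr2 kp2 ctb by (intro fin[of h2 g "Suc s" None kc]) simp_all
     next
      case False
      then have "sc h2 15 = 1" using w(9) by simp
      moreover have "good_scaling \<epsilon> A (vec n (vc h2 0))"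
       by (rule coverinv_final[OF cov2 _ k1 kk eps]) (use False in simp)
      ultimately show ?thesis using fin'[OF cr2 _ _ _ ctb] w1[of 16] by simp
     qed
    qed
    done
  qed
  done
qed

end

section \<open>Round and cost bounds for the main loop\<close>

locale scaling_counters = scaling_program A n d T rnd E p k e \<delta> \<epsilon>
 for A n d T rnd E p k e \<delta> \<epsilon> +
 fixes Gm S Rm kcM mkM :: nat
 assumes Gm: "\<And>g. (1 + e) ^ g \<le> kmax \<Longrightarrow> g \<le> Gm"
  and S: "2 * real E * real E * real p * kmax \<le> real S"
  and Rm: "real E \<le> 1 / (4 * ((4 * (kmax * real E)) ^ Suc p * real n * real n)) * zfac ^ Rm"
  and kcM: "1 \<le> kcM" "\<And>\<kappa>. 1 \<le> \<kappa> \<Longrightarrow> \<kappa> \<le> kmax \<Longrightarrow>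
    tol E p \<le> cheb (cs0 E \<kappa>) kcM"
  and mkM: "4 * ((real ((Gm + 1) * (S + 1) * (Rm + 1)) + 1) * (real ((Gm + 1) * (S + 1) * (Rm + 1)) + 2) * real n) / \<delta> \<le> 2 ^ mkM"
  and \<delta>: "0 < \<delta>"
begin

text \<open>Bounds for a covering and for a packing round, with 2 units for the test of the main
  loop. \<open>X2\<close> includes a search for the degree, because a packing round may move on to
  the next guess.\<close>

definition "X1 = T * cost_cover E p mkM kcM + 92 + 80 * n + 10 * mkM"
definition "X2 = T * cost_pack E p mkM + 222 + 20 * p + 15 * kcM + 120 * n + 10 * mkM"
definition "Nmax = (Gm + 1) * (S + 1) * (Rm + 1)"
definition "Cmax = (Gm + 1) * (S + 1) * (X1 + Rm * X2)"

text \<open>Positions are visited in lexicographic order, each pair \<open>(g, s)\<close> having one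
  covering round and at most \<open>Rm\<close> packing rounds. \<open>bound\<close> and
  \<open>cbound\<close> charge every earlier position in full, so leaving a phase early only widens
  the slack.\<close>

fun bound :: "nat \<Rightarrow> nat \<Rightarrow> nat option \<Rightarrow> nat" where
 "bound g s None = (g * (S + 1) + s) * (Rm + 1)"
| "bound g s (Some R) = (g * (S + 1) + s) * (Rm + 1) + Suc R"

fun cbound :: "nat \<Rightarrow> nat \<Rightarrow> nat option \<Rightarrow> nat" where
 "cbound g s None = (g * (S + 1) + s) * (X1 + Rm * X2)"
| "cbound g s (Some R) = (g * (S + 1) + s) * (X1 + Rm * X2) + (X1 + R * X2)"

definition InvC :: "nat \<Rightarrow> nat \<Rightarrow> nat option \<Rightarrow> hst \<Rightarrow> bool" where
 "InvC g s ro h \<longleftrightarrow> Inv g s ro h \<and> (\<exists>c mk. sc h 16 = real c \<and> c \<le> bound g s ro \<and> mpar n E \<delta> mk h)"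

lemma kc_le:
 assumes "kpar n E p kc h" "1 \<le> sc h 7" "sc h 7 \<le> kmax"
 shows "kc \<le> kcM"
proof (rule ccontr)
 assume "\<not> kc \<le> kcM"
 then have "cheb (cs0 E (sc h 7)) kcM < tol E p"
  using assms(1) kcM(1) unfolding kpar_def Let_def by auto
 then show False using kcM(2)[OF assms(2,3)] by simp
qed

lemma mk_le:
 assumes "mpar n E \<delta> mk h" "sc h 16 = real c" "c \<le> Nmax"
 shows "mk \<le> mkM"
proof (rule ccontr)
 assume "\<not> mk \<le> mkM"
 then have "2 ^ mkM < 4 * ((real c + 1) * (real c + 2) * real n) / \<delta>"
  using assms(1,2) unfolding mpar_def Let_def by simp
 also have "\<dots> \<le> 4 * ((real Nmax + 1) * (real Nmax + 2) * real n) / \<delta>"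
  using assms(3) \<delta> by (intro divide_right_mono mult_left_mono mult_right_mono mult_mono) auto
 also have "\<dots> \<le> 2 ^ mkM" using mkM by (simp add: Nmax_def)
 finally show False by simp
qed

lemma ghead_bounds:
 assumes "ghead g s h"
 shows "g \<le> Gm" "s \<le> S" "kpar n E p kc h \<Longrightarrow> kc \<le> kcM"
proof -
 note gh = assms[unfolded ghead_def]
 have k1: "1 \<le> sc h 7" by (rule kap1[OF assms])
 have k2: "sc h 7 \<le> kmax" using gh by blast
 show "g \<le> Gm" using gh by (intro Gm) simp
 obtain kc' where kc': "kpar n E p kc' h" using gh by blast
 have "sc h 17 = real s * sc h 20" "sc h 17 < real E" using gh by blast+
 then have "real s * (1 / (2 * (real E * real p * sc h 7))) < real E" using kparD(5)[OF kc'] by simp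
 then have "real s < real E * (2 * (real E * real p * sc h 7))" using k1 E p0 by (simp add: divide_less_eq mult_ac)
 also have "\<dots> \<le> real E * (2 * (real E * real p * kmax))" using k2 by (intro mult_left_mono) auto
 also have "\<dots> \<le> real S" using S by (simp add: mult_ac)
 finally show "s \<le> S" by simp
 show "kpar n E p kc h \<Longrightarrow> kc \<le> kcM" using kc_le k1 k2 by blast
qed

text \<open>Register 18 grows geometrically and is below \<open>E\<close> at the loop head. Its
  start value decreases with the guess, so the number of rounds computed for \<open>kmax\<close>
  covers all guesses.\<close>

lemma mode1_bound:
 assumes "ghead g s h" "mode1 R h"
 shows "R < Rm"
proof (rule ccontr)
 assume "\<not> R < Rm"
 then have R: "Rm \<le> R" by simp
 note gh = assms(1)[unfolded ghead_def]
 obtain kc' where kc': "kpar n E p kc' h" using gh by blast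
 note m1 = assms(2)[unfolded mode1_def]
 have k1: "1 \<le> sc h 7" by (rule kap1[OF assms(1)])
 define q where "q = kmax"
 have k2: "sc h 7 \<le> q" using gh unfolding q_def by blast
 have n0: "0 < real n" and E0: "0 < real E" using d0 dn E by simp_all
 let ?H = "\<lambda>\<kappa>. 1 / (4 * ((4 * (\<kappa> * real E)) ^ Suc p * real n * real n))"
 have "?H (q) \<le> ?H (sc h 7)"
 proof (rule divide_left_mono)
  show "4 * ((4 * (sc h 7 * real E)) ^ Suc p * real n * real n) \<le> 4 * ((4 * (q * real E)) ^ Suc p * real n * real n)"
   using k1 k2 by (intro mult_left_mono mult_right_mono power_mono) auto
  show "0 < 4 * ((4 * (q * real E)) ^ Suc p * real n * real n) * (4 * ((4 * (sc h 7 * real E)) ^ Suc p * real n * real n))"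
   using k1 k2 n0 E0 by (intro mult_pos_pos zero_less_power) auto
 qed simp
 have "0 \<le> ?H (sc h 7)" using k1 by (intro divide_nonneg_nonneg mult_nonneg_nonneg zero_le_power) auto
 have a: "1 \<le> 1 + e / real p * e" using e by simp
 have "real E \<le> ?H (q) * zfac ^ Rm" using Rm unfolding q_def by simp
 also have "\<dots> \<le> ?H (sc h 7) * zfac ^ R"
 proof (rule mult_mono)
  show "zfac ^ Rm \<le> zfac ^ R" by (rule power_increasing[OF R a])
 qed (use \<open>0 \<le> ?H (sc h 7)\<close> \<open>?H (q) \<le> ?H (sc h 7)\<close> a in auto)
 also have "\<dots> = sc h 18" using m1 kparD(6)[OF kc'] by simp
 finally show False using m1 by simp
qed

lemma bound_lt:
 assumes "Inv g s ro h" shows "bound g s ro < Nmax" "cbound g s ro + (case ro of None \<Rightarrow> X1 | Some R \<Rightarrow> X2) \<le> Cmax"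
proof -
 have gh: "ghead g s h" and R: "\<And>R. ro = Some R \<Longrightarrow> R < Rm" using assms mode1_bound by (cases ro; auto)+
 have "g * (S + 1) + s + 1 \<le> Gm * (S + 1) + S + 1" using ghead_bounds(1,2)[OF gh] by (intro add_mono mult_right_mono) auto
 then have q: "g * (S + 1) + s + 1 \<le> (Gm + 1) * (S + 1)" by (simp add: algebra_simps)
 have "bound g s ro < (g * (S + 1) + s + 1) * (Rm + 1)" using R by (cases ro) (auto simp: algebra_simps)
 also have "\<dots> \<le> Nmax" unfolding Nmax_def by (rule mult_right_mono[OF q]) simp
 finally show "bound g s ro < Nmax" .
 have "cbound g s ro + (case ro of None \<Rightarrow> X1 | Some R \<Rightarrow> X2) \<le> (g * (S + 1) + s + 1) * (X1 + Rm * X2)"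
 proof (cases ro)
  case (Some r)
  then have "Suc r * X2 \<le> Rm * X2" using R by (intro mult_right_mono) auto
  then show ?thesis using Some by (simp add: algebra_simps)
 qed (simp add: algebra_simps)
 also have "\<dots> \<le> Cmax" unfolding Cmax_def by (rule mult_right_mono[OF q]) simp
 finally show "cbound g s ro + (case ro of None \<Rightarrow> X1 | Some R \<Rightarrow> X2) \<le> Cmax" .
qed

lemma bound_next:
 assumes "Inv g s (Some R) h" "Inv g' s' ro' h'" "(g', s', ro') \<in> succs g s R"
 shows "bound g s (Some R) + 1 \<le> bound g' s' ro'" "cbound g s (Some R) + X2 \<le> cbound g' s' ro'"
proof -
 have R: "Suc R \<le> Rm" using assms(1) mode1_bound by (auto simp: Suc_le_eq)
 have s: "s \<le> S" using assms(1) ghead_bounds by auto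
 have RX: "Suc R * X2 \<le> Rm * X2" using R by (rule mult_right_mono) simp
 consider "g' = g" "s' = s" "ro' = Some (Suc R)" | "g' = g" "s' = Suc s" "ro' = None" | "g' = Suc g" "s' = 0" "ro' = None"
  using assms(3) by auto
 then have "bound g s (Some R) + 1 \<le> bound g' s' ro' \<and> cbound g s (Some R) + X2 \<le> cbound g' s' ro'"
 proof cases
  case 3
  have a: "(s + 1) * Z \<le> (S + 1) * Z" for Z using s by (intro mult_right_mono) auto
  show ?thesis using 3 a[of "Rm + 1"] R a[of "X1 + Rm * X2"] RX by (simp add: algebra_simps)
 qed (use R RX in \<open>auto simp: algebra_simps\<close>)
 then show "bound g s (Some R) + 1 \<le> bound g' s' ro'" "cbound g s (Some R) + X2 \<le> cbound g' s' ro'" by blast+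
qed

lemma wp_body:
 assumes I: "InvC g s ro h" and a: "acc h"
  and Q: "\<And>h' g' s' ro'. \<lbrakk>InvC g' s' ro' h'; sc h' 16 = sc h 16 + 1; ct h' + 2 + cbound g s ro \<le> ct h + cbound g' s' ro'\<rbrakk> \<Longrightarrow> Q h'"
  and Q': "\<And>h'. \<lbrakk>cregs n E p \<delta> h'; sc h' 15 = 1; good_scaling \<epsilon> A (vec n (vc h' 0)); sc h' 16 = sc h 16 + 1; ct h' + 2 + cbound g s ro \<le> ct h + Cmax\<rbrakk> \<Longrightarrow> Q h'"
 shows "WP body Q h"
proof -
 obtain c mk where c: "sc h 16 = real c" "c \<le> bound g s ro" and mk: "mpar n E \<delta> mk h" using I unfolding InvC_def by blast
 have Inv: "Inv g s ro h" using I unfolding InvC_def by blast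
 have gh: "ghead g s h" using Inv by (cases ro) auto
 obtain kc where kc: "kpar n E p kc h" using gh unfolding ghead_def by blast
 have kcl: "kc \<le> kcM" by (rule ghead_bounds(3)[OF gh kc])
 have cN: "Suc c \<le> Nmax" using c(2) bound_lt(1)[OF Inv] by simp
 have mkl: "mk \<le> mkM" using mk_le[OF mk c(1)] cN by simp
 have mkl': "mk' \<le> mkM" if "mpar n E \<delta> mk' h'" "sc h' 16 = sc h 16 + 1" for h' mk'
  using mk_le[OF that(1), of "Suc c"] that(2) c(1) cN by simp
 have mk8: "8 * E * E * Suc mk \<le> 8 * E * E * Suc mkM" using mkl by (intro mult_left_mono) auto
 show ?thesis
 proof (cases ro)
  case None
  have X: "T * cost_cover E p mk kc + 90 + 80 * n + 10 * mk' + 2 \<le> X1" if "mk' \<le> mkM" for mk'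
  proof -
   have "(p div 2 + 1) * (150 * kc + 10) + 160 \<le> (p div 2 + 1) * (150 * kcM + 10) + 160" using kcl by (intro add_mono mult_left_mono) auto
   then have "T * cost_cover E p mk kc \<le> T * cost_cover E p mkM kcM"
    by (intro mult_left_mono[OF add_right_mono[OF mult_mono[OF mk8]]]) auto
   then show ?thesis unfolding X1_def using that by linarith
  qed
  show ?thesis
  proof (rule wp_body0[OF gh _ kc mk a])
   show "mode0 h" using Inv None by simp
   fix h' mk' assume h': "Inv g s (Some 0) h'" "sc h' 16 = sc h 16 + 1" "mpar n E \<delta> mk' h'"
    "ct h' \<le> ct h + T * cost_cover E p mk kc + 90 + 80 * n + 10 * mk'"
   show "Q h'"
   proof (rule Q[of g s "Some 0"])
    show "InvC g s (Some 0) h'" unfolding InvC_def using h' c None by (intro conjI exI[of _ "Suc c"] exI[of _ mk']) auto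
    show "ct h' + 2 + cbound g s ro \<le> ct h + cbound g s (Some 0)" using h'(4) X[OF mkl'[OF h'(3,2)]] None by simp
   qed (rule h'(2))
  qed
 next
  case (Some R)
  have X: "T * cost_pack E p mk + 220 + 20 * p + 15 * kc' + 120 * n + 10 * mk' + 2 \<le> X2" if "mk' \<le> mkM" "kc' \<le> kcM" for mk' kc'
  proof -
   have "T * cost_pack E p mk \<le> T * cost_pack E p mkM"
    by (intro mult_left_mono[OF add_right_mono[OF mult_right_mono[OF mk8]]]) auto
   then show ?thesis unfolding X2_def using that by linarith
  qed
  have m1: "mode1 R h" using Inv Some by simp
  show ?thesis
  proof (rule wp_body1[OF gh m1 kc mk a], goal_cases)
   case (1 h' g' s' ro' kc' mk')
   show ?case
   proof (rule Q[OF _ 1(4)])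
    note b = bound_next[OF Inv[unfolded Some] 1(1,2)]
    show "InvC g' s' ro' h'" unfolding InvC_def using 1 c Some b(1) by (intro conjI exI[of _ "Suc c"] exI[of _ mk']) auto
    have "ghead g' s' h'" using 1(1) by (cases ro') auto
    then have "kc' \<le> kcM" using ghead_bounds(3) 1(3) by blast
    then show "ct h' + 2 + cbound g s ro \<le> ct h + cbound g' s' ro'" using 1(6) X[OF mkl'[OF 1(5,4)]] b(2) Some by fastforce
   qed
  next
   case (2 h' mk')
   show ?case
    using 2(6) X[OF mkl'[OF 2(5,4)], of 0] bound_lt(2)[OF Inv] Some by (intro Q'[OF 2(1,2,3,4)]) simp
  qed
 qed
qed

end

subsection \<open>Gaussian sketches\<close>

abbreviation "stdn \<equiv> density lborel (\<lambda>x. ennreal (std_normal_density x))"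

interpretation tape: sequence_space stdn
proof -
 interpret prob_space stdn by (rule prob_space_normal_density) simp
 show "sequence_space stdn" by unfold_locales
qed

lemma tape_eq: "random_tape = tape.S"
 by (simp add: random_tape_def)

lemma prob_space_tape: "prob_space tape.S"
 by unfold_locales

lemma coord_measurable[measurable]: "(\<lambda>rnd. rnd (i :: nat)) \<in> borel_measurable tape.S"
proof -
 have "(\<lambda>rnd. rnd i) \<in> measurable tape.S stdn" by (rule measurable_component_singleton) simp
 then show ?thesis by (simp cong: measurable_cong_sets)
qed

lemma space_tape[simp]: "space tape.S = UNIV"
 by (simp add: space_PiM)

lemma coord_distr: "distr tape.S stdn (\<lambda>rnd. rnd (i :: nat)) = stdn"
 by (rule tape.PiM_component) simp

lemma coord_distributed: "distributed tape.S lborel (\<lambda>rnd. rnd (i :: nat)) std_normal_density"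
proof -
 have "distr tape.S lborel (\<lambda>rnd. rnd i) = distr tape.S stdn (\<lambda>rnd. rnd i)" by (rule distr_cong) auto
 then show ?thesis unfolding distributed_def coord_distr by simp
qed

lemma coord_indep: "prob_space.indep_vars tape.S (\<lambda>_. borel) (\<lambda>i rnd. rnd i) (UNIV :: nat set)"
proof -
 have d: "distr tape.S borel (\<lambda>rnd. rnd (i :: nat)) = distr tape.S stdn (\<lambda>rnd. rnd i)" for i by (rule distr_cong) auto
 have s: "sets (\<Pi>\<^sub>M i\<in>UNIV :: nat set. (borel :: real measure)) = sets tape.S" by (rule sets_PiM_cong) auto
 have "distr tape.S (\<Pi>\<^sub>M i\<in>UNIV :: nat set. borel) (\<lambda>x. x) = tape.S" by (rule distr_id2) (rule s)
 moreover have "(\<Pi>\<^sub>M i\<in>UNIV. distr tape.S borel (\<lambda>rnd. rnd (i :: nat))) = tape.S" by (simp only: d coord_distr)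
 ultimately have "distr tape.S (\<Pi>\<^sub>M i\<in>UNIV :: nat set. borel) (\<lambda>x. \<lambda>i\<in>UNIV. x i) = (\<Pi>\<^sub>M i\<in>UNIV. distr tape.S borel (\<lambda>rnd. rnd i))" by (simp add: restrict_UNIV)
 then show ?thesis
  by (subst prob_space.indep_vars_iff_distr_eq_PiM'[OF prob_space_tape]) auto
qed

text \<open>Zero coefficients are dropped first, since a degenerate normal variable has no
  density.\<close>

lemma lin_normal:
 assumes "\<exists>l<N. c l \<noteq> 0"
 shows "distributed tape.S lborel (\<lambda>rnd. \<Sum>l<N. c l * rnd l) (normal_density 0 (sqrt (\<Sum>l<N. (c l)\<^sup>2)))"
proof -
 let ?I = "{l. l < N \<and> c l \<noteq> 0}"
 have ind: "tape.P.indep_vars (\<lambda>_. borel) (\<lambda>i rnd. c i * rnd i) ?I"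
  by (rule tape.P.indep_vars_compose2[OF tape.P.indep_vars_subset[OF coord_indep]]) auto
 have nd: "distributed tape.S lborel (\<lambda>rnd. c i * rnd i) (normal_density 0 \<bar>c i\<bar>)" if "i \<in> ?I" for i
  using tape.P.normal_density_affine[OF coord_distributed[of i], of "c i" 0] that by simp
 have "distributed tape.S lborel (\<lambda>rnd. \<Sum>l\<in>?I. c l * rnd l) (normal_density (\<Sum>l\<in>?I. 0) (sqrt (\<Sum>l\<in>?I. \<bar>c l\<bar>\<^sup>2)))"
  by (rule tape.P.sum_indep_normal[OF _ _ ind _ nd]) (use assms in auto)
 moreover have "(\<Sum>l\<in>?I. c l * rnd l) = (\<Sum>l<N. c l * rnd l)" for rnd :: "nat \<Rightarrow> real"
  by (rule sum.mono_neutral_left) auto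
 moreover have "(\<Sum>l\<in>?I. \<bar>c l\<bar>\<^sup>2) = (\<Sum>l<N. (c l)\<^sup>2)"
  by (simp, rule sum.mono_neutral_left) auto
 ultimately show ?thesis by simp
qed

text \<open>The factor \<open>exp (s * x^2)\<close> merely changes the variance of the Gaussian
  density to \<open>\<tau>^2 = 1 / (1 - 2 s)\<close>; the normalising constants leave the factor
  \<tau>.\<close>

lemma normal_mgf_sq:
 assumes s: "s < (1 / 2 :: real)"
 shows "(\<integral>\<^sup>+x. ennreal (std_normal_density x) * ennreal (exp (s * x\<^sup>2)) \<partial>lborel) = ennreal (1 / sqrt (1 - 2 * s))"
proof -
 define \<tau> where "\<tau> = 1 / sqrt (1 - 2 * s)"
 have t: "0 < \<tau>" using s by (simp add: \<tau>_def)
 have t2: "1 / \<tau>\<^sup>2 = 1 - 2 * s" using s by (simp add: \<tau>_def power_divide)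
 have "ennreal (std_normal_density x) * ennreal (exp (s * x\<^sup>2)) = ennreal \<tau> * ennreal (normal_density 0 \<tau> x)" for x
 proof -
  have "- x\<^sup>2 / 2 + s * x\<^sup>2 = - x\<^sup>2 * (1 / \<tau>\<^sup>2) / 2" unfolding t2 by (simp add: algebra_simps diff_divide_distrib)
  also have "\<dots> = - x\<^sup>2 / (2 * \<tau>\<^sup>2)" by simp
  finally have "exp (- x\<^sup>2 / 2) * exp (s * x\<^sup>2) = exp (- x\<^sup>2 / (2 * \<tau>\<^sup>2))" by (simp add: exp_add[symmetric])
  moreover have "\<tau> * (1 / sqrt (2 * pi * \<tau>\<^sup>2)) = 1 / sqrt (2 * pi)" using t by (simp add: real_sqrt_mult)
  moreover have "std_normal_density x * exp (s * x\<^sup>2) = 1 / sqrt (2 * pi) * (exp (- x\<^sup>2 / 2) * exp (s * x\<^sup>2))"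
   unfolding normal_density_def by simp
  moreover have "\<tau> * normal_density 0 \<tau> x = \<tau> * (1 / sqrt (2 * pi * \<tau>\<^sup>2)) * exp (- x\<^sup>2 / (2 * \<tau>\<^sup>2))"
   unfolding normal_density_def by simp
  ultimately have "std_normal_density x * exp (s * x\<^sup>2) = \<tau> * normal_density 0 \<tau> x" by (simp only:)
  then show ?thesis using t by (simp add: ennreal_mult'[symmetric])
 qed
 then have "(\<integral>\<^sup>+x. ennreal (std_normal_density x) * ennreal (exp (s * x\<^sup>2)) \<partial>lborel) = (\<integral>\<^sup>+x. ennreal \<tau> * ennreal (normal_density 0 \<tau> x) \<partial>lborel)"
  by simp
 also have "\<dots> = ennreal \<tau> * (\<integral>\<^sup>+x. ennreal (normal_density 0 \<tau> x) \<partial>lborel)" by (rule nn_integral_cmult) simp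
 also have "(\<integral>\<^sup>+x. ennreal (normal_density 0 \<tau> x) \<partial>lborel) = 1"
  using prob_space.emeasure_space_1[OF prob_space_normal_density[OF t, of 0]] by (simp add: emeasure_density)
 finally show ?thesis by (simp add: \<tau>_def)
qed

definition lin :: "rseq \<Rightarrow> nat \<Rightarrow> nat \<Rightarrow> rseq \<Rightarrow> real" where
 "lin c N k rnd = (\<Sum>l<N. c l * rnd (k * N + l))"

lemma lin_measurable[measurable]: "lin c N k \<in> borel_measurable tape.S"
 unfolding lin_def[abs_def] by measurable

text \<open>\<open>comb_seq\<close> cuts off the first block of the tape, and the shifted rest has
  the same distribution; so the integral factorises and the induction proceeds by one block.\<close>

lemma mgf_lin:
 assumes c: "(\<Sum>l<N. (c l)\<^sup>2) = 1" and s: "s < 1 / 2"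
 shows "(\<integral>\<^sup>+rnd. ennreal (exp (s * (\<Sum>k<m. (lin c N k rnd)\<^sup>2))) \<partial>tape.S) = ennreal ((1 / sqrt (1 - 2 * s)) ^ m)"
proof (induction m)
 case 0
 show ?case by (simp add: tape.P.emeasure_space_1[simplified])
next
 case (Suc m)
 let ?f = "\<lambda>m rnd. ennreal (exp (s * (\<Sum>k<m. (lin c N k rnd)\<^sup>2)))"
 have nz: "\<exists>l<N. c l \<noteq> 0"
 proof (rule ccontr)
  assume "\<not> ?thesis"
  then have "(\<Sum>l<N. (c l)\<^sup>2) = 0" by (intro sum.neutral) auto
  then show False using c by simp
 qed
 have one: "(\<integral>\<^sup>+rnd. ennreal (exp (s * (lin c N 0 rnd)\<^sup>2)) \<partial>tape.S) = ennreal (1 / sqrt (1 - 2 * s))"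
 proof -
  have "distributed tape.S lborel (lin c N 0) std_normal_density" using lin_normal[OF nz] c by (simp add: lin_def[abs_def])
  then have "(\<integral>\<^sup>+rnd. ennreal (exp (s * (lin c N 0 rnd)\<^sup>2)) \<partial>tape.S) = (\<integral>\<^sup>+x. ennreal (std_normal_density x) * ennreal (exp (s * x\<^sup>2)) \<partial>lborel)"
   by (rule distributed_nn_integral[symmetric]) simp
  then show ?thesis using normal_mgf_sq[OF s] by simp
 qed
 have sp: "?f (Suc m) (comb_seq N rnd rnd') = ennreal (exp (s * (lin c N 0 rnd)\<^sup>2)) * ?f m rnd'" for rnd rnd'
 proof -
  have a: "lin c N 0 (comb_seq N rnd rnd') = lin c N 0 rnd" unfolding lin_def by (intro sum.cong) (auto simp: comb_seq_less)
  have "lin c N (Suc k) (comb_seq N rnd rnd') = lin c N k rnd'" for k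
  proof -
   have "Suc k * N + l = (k * N + l) + N" for l by simp
   then show ?thesis unfolding lin_def by (simp only: comb_seq_add)
  qed
  then show ?thesis unfolding sum.lessThan_Suc_shift a by (simp add: exp_add distrib_left ennreal_mult')
 qed
 have mf[measurable]: "?f k \<in> borel_measurable tape.S" for k by measurable
 have "(\<integral>\<^sup>+rnd. ?f (Suc m) rnd \<partial>tape.S) = (\<integral>\<^sup>+rnd. ?f (Suc m) rnd \<partial>distr (tape.S \<Otimes>\<^sub>M tape.S) tape.S (\<lambda>(rnd, rnd'). comb_seq N rnd rnd'))"
  by (simp only: tape.PiM_comb_seq)
 also have "\<dots> = (\<integral>\<^sup>+x. ?f (Suc m) (case x of (rnd, rnd') \<Rightarrow> comb_seq N rnd rnd') \<partial>(tape.S \<Otimes>\<^sub>M tape.S))"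
  by (rule nn_integral_distr[OF measurable_comb_seq]) (simp add: mf)
 also have "\<dots> = (\<integral>\<^sup>+x. (case x of (rnd, rnd') \<Rightarrow> ennreal (exp (s * (lin c N 0 rnd)\<^sup>2)) * ?f m rnd') \<partial>(tape.S \<Otimes>\<^sub>M tape.S))"
  using sp by (intro nn_integral_cong) auto
 also have "\<dots> = (\<integral>\<^sup>+rnd. (\<integral>\<^sup>+rnd'. ennreal (exp (s * (lin c N 0 rnd)\<^sup>2)) * ?f m rnd' \<partial>tape.S) \<partial>tape.S)"
  by (subst tape.nn_integral_fst[symmetric]) auto
 also have "\<dots> = ennreal (1 / sqrt (1 - 2 * s)) * ennreal ((1 / sqrt (1 - 2 * s)) ^ m)"
  using Suc.IH by (simp add: nn_integral_cmult nn_integral_multc one)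
 finally show ?case using s by (simp add: ennreal_mult'[symmetric])
qed

lemma one_plus_le_exp:
 assumes "0 \<le> e" "e \<le> (1::real)" shows "1 + e \<le> exp (e - e\<^sup>2 / 4)"
proof -
 have "0 \<le> e * (1 - e / 4)" using assms by (intro mult_nonneg_nonneg) auto
 then have y: "0 \<le> e - e\<^sup>2 / 4" by (simp add: power2_eq_square algebra_simps)
 have "(1/2 :: real) \<le> (3/4)\<^sup>2" by (simp add: power2_eq_square)
 also have "\<dots> \<le> (1 - e / 4)\<^sup>2" using assms by (intro power_mono) auto
 finally have "e\<^sup>2 * (1/2) \<le> e\<^sup>2 * (1 - e / 4)\<^sup>2" by (intro mult_left_mono) auto
 also have "\<dots> = (e - e\<^sup>2 / 4)\<^sup>2" by (simp add: power2_eq_square algebra_simps)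
 finally have "1 + e \<le> 1 + (e - e\<^sup>2 / 4) + (e - e\<^sup>2 / 4)\<^sup>2 / 2" by simp
 also have "\<dots> \<le> exp (e - e\<^sup>2 / 4)" by (rule exp_lower_Taylor_quadratic[OF y])
 finally show ?thesis .
qed

lemma one_minus_le_exp:
 assumes "0 \<le> e" "e < (1::real)" shows "1 - e \<le> exp (- e - e\<^sup>2 / 4)"
proof -
 let ?f = "\<lambda>x::real. ln (1 - x) + x + x\<^sup>2 / 2"
 have "?f e \<le> ?f 0"
 proof (rule DERIV_nonpos_imp_nonincreasing[OF assms(1)])
  fix x assume x: "0 \<le> x" "x \<le> e"
  have "- 1 / (1 - x) + 1 + x = - x\<^sup>2 / (1 - x)" using x assms by (simp add: field_simps power2_eq_square)
  moreover have "- x\<^sup>2 / (1 - x) \<le> 0" using x assms by (intro divide_nonpos_nonneg) auto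
  moreover have "(?f has_real_derivative - 1 / (1 - x) + 1 + x) (at x)"
   using x assms by (auto intro!: derivative_eq_intros simp: power2_eq_square)
  ultimately show "\<exists>y. (?f has_real_derivative y) (at x) \<and> y \<le> 0" by metis
 qed
 then have "ln (1 - e) \<le> - e - e\<^sup>2 / 2" by simp
 also have "\<dots> \<le> - e - e\<^sup>2 / 4" by simp
 finally show ?thesis using assms by (metis diff_gt_0_iff_gt exp_le_cancel_iff exp_ln)
qed

text \<open>Exponential Markov inequality. The sign of \<open>s\<close> is left open, so that it
  serves both tails.\<close>

lemma chernoff_step:
 assumes c: "(\<Sum>l<N. (c l)\<^sup>2) = 1" and s: "s < 1 / 2"
  and X: "\<And>rnd. rnd \<in> X \<Longrightarrow> s * a \<le> s * (\<Sum>k<m. (lin c N k rnd)\<^sup>2)" and Xm: "X \<in> sets tape.S"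
 shows "measure tape.S X \<le> (1 / sqrt (1 - 2 * s)) ^ m * exp (- (s * a))"
proof -
 have "emeasure tape.S X = (\<integral>\<^sup>+rnd. indicator X rnd \<partial>tape.S)" using Xm by simp
 also have "\<dots> \<le> (\<integral>\<^sup>+rnd. ennreal (exp (s * (\<Sum>k<m. (lin c N k rnd)\<^sup>2))) * ennreal (exp (- (s * a))) \<partial>tape.S)"
 proof (rule nn_integral_mono)
  fix rnd
  show "indicator X rnd \<le> ennreal (exp (s * (\<Sum>k<m. (lin c N k rnd)\<^sup>2))) * ennreal (exp (- (s * a)))"
   using X[of rnd] by (auto simp: indicator_def ennreal_mult'[symmetric] exp_add[symmetric])
 qed
 also have "\<dots> = ennreal ((1 / sqrt (1 - 2 * s)) ^ m) * ennreal (exp (- (s * a)))"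
  by (subst nn_integral_multc) (simp_all add: mgf_lin[OF c s])
 also have "\<dots> = ennreal ((1 / sqrt (1 - 2 * s)) ^ m * exp (- (s * a)))" using s by (simp add: ennreal_mult'[symmetric])
 finally show ?thesis using s by (simp add: tape.P.emeasure_eq_measure)
qed

lemma sqrt_pow_le:
 assumes "0 < u" "u \<le> exp v" shows "sqrt u ^ m \<le> exp (v * real m / 2)"
proof -
 have "sqrt u \<le> sqrt (exp v)" using assms by simp
 also have "\<dots> = exp (v / 2)" by (simp add: real_sqrt_unique power2_eq_square exp_add[symmetric])
 finally have "sqrt u ^ m \<le> exp (v / 2) ^ m" using assms by (intro power_mono) auto
 also have "\<dots> = exp (v * real m / 2)" by (simp add: exp_of_nat_mult[symmetric] mult.commute)
 finally show ?thesis .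
qed

lemma chi_square_tail:
 assumes c: "(\<Sum>l<N. (c l)\<^sup>2) = 1" and e: "0 < e" "e \<le> 1 / 2"
 shows "measure tape.S {rnd. \<not> ((1 - e) * real m \<le> (\<Sum>k<m. (lin c N k rnd)\<^sup>2) \<and> (\<Sum>k<m. (lin c N k rnd)\<^sup>2) \<le> (1 + e) * real m)} \<le> 2 * exp (- (real m * e\<^sup>2 / 8))"
proof -
 let ?S = "\<lambda>rnd. \<Sum>k<m. (lin c N k rnd)\<^sup>2"
 let ?U = "{rnd \<in> space tape.S. (1 + e) * real m < ?S rnd}" and ?L = "{rnd \<in> space tape.S. ?S rnd < (1 - e) * real m}"
 have m: "?U \<in> sets tape.S" "?L \<in> sets tape.S" by measurable
 have U: "measure tape.S ?U \<le> exp (- (real m * e\<^sup>2 / 8))"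
 proof -
  \<comment> \<open>The optimal choice: it makes \<open>1 - 2 * t = 1 / (1 + e)\<close>. The lower
    tail uses the same formula with \<open>- e\<close> in place of \<open>e\<close>.\<close>
  define t where "t = e / (2 * (1 + e))"
  have t: "0 < t" "t < 1 / 2" using e by (simp_all add: t_def field_simps)
  have "1 - 2 * t = 1 / (1 + e)" using e by (simp add: t_def field_simps)
  then have q: "1 / sqrt (1 - 2 * t) = sqrt (1 + e)" by (simp add: real_sqrt_divide)
  have "measure tape.S ?U \<le> (1 / sqrt (1 - 2 * t)) ^ m * exp (- (t * ((1 + e) * real m)))"
   by (rule chernoff_step[OF c t(2) _ m(1)]) (use t in \<open>auto intro: mult_left_mono less_imp_le\<close>)
  also have "\<dots> \<le> exp ((e - e\<^sup>2 / 4) * real m / 2) * exp (- (t * ((1 + e) * real m)))"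
   unfolding q by (intro mult_right_mono sqrt_pow_le one_plus_le_exp) (use e in auto)
  also have "t * ((1 + e) * real m) = e * real m / 2" using e by (simp add: t_def field_simps)
  also have "exp ((e - e\<^sup>2 / 4) * real m / 2) * exp (- (e * real m / 2)) = exp (- (real m * e\<^sup>2 / 8))"
   by (simp add: exp_add[symmetric] field_simps)
  finally show ?thesis .
 qed
 have L: "measure tape.S ?L \<le> exp (- (real m * e\<^sup>2 / 8))"
 proof -
  define t where "t = - (e / (2 * (1 - e)))"
  have t: "t < 0" "t < 1 / 2" using e by (simp_all add: t_def field_simps)
  have "1 - 2 * t = 1 / (1 - e)" using e by (simp add: t_def field_simps)
  then have q: "1 / sqrt (1 - 2 * t) = sqrt (1 - e)" by (simp add: real_sqrt_divide)
  have "measure tape.S ?L \<le> (1 / sqrt (1 - 2 * t)) ^ m * exp (- (t * ((1 - e) * real m)))"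
   by (rule chernoff_step[OF c t(2) _ m(2)]) (use t in \<open>auto intro: mult_left_mono_neg less_imp_le\<close>)
  also have "\<dots> \<le> exp ((- e - e\<^sup>2 / 4) * real m / 2) * exp (- (t * ((1 - e) * real m)))"
   unfolding q by (intro mult_right_mono sqrt_pow_le one_minus_le_exp) (use e in auto)
  also have "- (t * ((1 - e) * real m)) = e * real m / 2" using e by (simp add: t_def field_simps)
  also have "exp ((- e - e\<^sup>2 / 4) * real m / 2) * exp (e * real m / 2) = exp (- (real m * e\<^sup>2 / 8))"
   by (simp add: exp_add[symmetric] field_simps)
  finally show ?thesis .
 qed
 have "{rnd. \<not> ((1 - e) * real m \<le> ?S rnd \<and> ?S rnd \<le> (1 + e) * real m)} = ?L \<union> ?U" by auto
 then have "measure tape.S {rnd. \<not> ((1 - e) * real m \<le> ?S rnd \<and> ?S rnd \<le> (1 + e) * real m)} \<le> measure tape.S ?L + measure tape.S ?U"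
  using measure_Un_le[OF m(2,1)] by simp
 then show ?thesis using U L by simp
qed

section \<open>Variance and failure probability of a sketch\<close>

definition coef :: "real mat \<Rightarrow> real mat \<Rightarrow> real \<Rightarrow> rseq \<Rightarrow> real vec \<Rightarrow> nat \<Rightarrow> real" where
 "coef A Z b u a l = (let y = Z\<^sup>T *\<^sub>v a in
   if l < dim_col A then y $ l * b else sqrt (u (l - dim_col A)) * (row A (l - dim_col A) \<bullet> y))"

lemma sum_split_add:
 fixes f :: "nat \<Rightarrow> real"
 shows "(\<Sum>l<d + n. f l) = (\<Sum>l<d. f l) + (\<Sum>i<n. f (d + i))"
 by (induction n) (simp_all add: add.assoc)

context
 fixes A Z :: "real mat" and n d :: nat and a :: "real vec"
 assumes A: "A \<in> carrier_mat n d" and Z: "Z \<in> carrier_mat d d" and a: "a \<in> carrier_vec d"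
begin

lemma samp_lin: "samp A Z b u \<xi> a = (\<Sum>l<d + n. coef A Z b u a l * \<xi> l)"
proof -
 let ?y = "Z\<^sup>T *\<^sub>v a" and ?v = "start_vec A b u \<xi>"
 have v: "?v \<in> carrier_vec d" using A by (simp add: start_vec_def)
 have y: "?y \<in> carrier_vec d" using Z a by simp
 have dd: "dim_col A = d" "dim_row A = n" using A by auto
 have "samp A Z b u \<xi> a = ?y \<bullet> ?v"
  unfolding samp_def using transpose_vec_mult_scalar[OF Z v a] a v y Z by (metis comm_scalar_prod mult_mat_vec_carrier)
 also have "\<dots> = (\<Sum>j<d. ?y $ j * ((\<Sum>i<n. A $$ (i, j) * (\<xi> (d + i) * sqrt (u i))) + \<xi> j * b))"
  unfolding scalar_prod_def using dd by (auto simp: start_vec_def Atf_def atLeast0LessThan intro!: sum.cong)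
 also have "\<dots> = (\<Sum>j<d. ?y $ j * b * \<xi> j) + (\<Sum>j<d. \<Sum>i<n. ?y $ j * (A $$ (i, j) * (\<xi> (d + i) * sqrt (u i))))"
  by (simp add: distrib_left sum.distrib sum_distrib_left mult_ac)
 also have "(\<Sum>j<d. \<Sum>i<n. ?y $ j * (A $$ (i, j) * (\<xi> (d + i) * sqrt (u i)))) = (\<Sum>i<n. sqrt (u i) * (row A i \<bullet> ?y) * \<xi> (d + i))"
 proof (subst sum.swap, rule sum.cong[OF refl])
  fix i assume "i \<in> {..<n}"
  then have "row A i \<bullet> y = (\<Sum>j<d. A $$ (i, j) * y $ j)" if "y \<in> carrier_vec d" for y
   unfolding scalar_prod_def using A that dd by (auto simp: atLeast0LessThan intro!: sum.cong)
  from this[OF y] have "row A i \<bullet> ?y = (\<Sum>j<d. A $$ (i, j) * ?y $ j)" .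
  then show "(\<Sum>j<d. ?y $ j * (A $$ (i, j) * (\<xi> (d + i) * sqrt (u i)))) = sqrt (u i) * (row A i \<bullet> ?y) * \<xi> (d + i)"
   by (simp add: sum_distrib_left sum_distrib_right mult_ac)
 qed
 finally show ?thesis unfolding sum_split_add by (simp add: coef_def Let_def dd)
qed

lemma sum_coef_sq:
 assumes u: "\<And>i. i < n \<Longrightarrow> 0 \<le> u i"
 shows "(\<Sum>l<d + n. (coef A Z b u a l)\<^sup>2) = Qv A Z b u a"
proof -
 let ?y = "Z\<^sup>T *\<^sub>v a"
 have y: "?y \<in> carrier_vec d" using Z a by simp
 have dd: "dim_col A = d" "dim_row A = n" using A by auto
 have C: "covm A b u \<in> carrier_mat d d" using A by (simp add: covm_def dd)
 have "Qv A Z b u a = a \<bullet> (Z *\<^sub>v (covm A b u *\<^sub>v ?y))"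
  unfolding Qv_def qf_def using Z C a by (simp add: assoc_mult_mat_vec[of _ d d _ d])
 also have "\<dots> = ?y \<bullet> (covm A b u *\<^sub>v ?y)"
  using transpose_vec_mult_scalar[OF Z mult_mat_vec_carrier[OF C y] a] a Z C y by (metis comm_scalar_prod mult_mat_vec_carrier)
 also have "\<dots> = qf (covm A b u) ?y" by (simp add: qf_def)
 also have "\<dots> = b\<^sup>2 * (?y \<bullet> ?y) + (\<Sum>i<n. u i * (row A i \<bullet> ?y)\<^sup>2)"
 proof -
  have "qf (b\<^sup>2 \<cdot>\<^sub>m 1\<^sub>m d) ?y = b\<^sup>2 * (?y \<bullet> ?y)"
  proof -
   have "(c \<cdot>\<^sub>m X) *\<^sub>v v = c \<cdot>\<^sub>v (X *\<^sub>v v)" if "X \<in> carrier_mat d d" "v \<in> carrier_vec d" for c :: real and X v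
    using that by (intro eq_vecI) auto
   from this[OF one_carrier_mat y] have "(b\<^sup>2 \<cdot>\<^sub>m 1\<^sub>m d) *\<^sub>v ?y = b\<^sup>2 \<cdot>\<^sub>v ?y" using y by simp
   then show ?thesis using y by (simp add: qf_def)
  qed
  moreover have "qf (covm A b u) ?y = qf (b\<^sup>2 \<cdot>\<^sub>m 1\<^sub>m d) ?y + qf (gram A u) ?y"
   unfolding covm_def dd by (rule qf_add) (use A y in auto)
  ultimately show ?thesis unfolding qf_gram[OF A y] by simp
 qed
 also have "\<dots> = (\<Sum>l<d + n. (coef A Z b u a l)\<^sup>2)"
 proof -
  have "b\<^sup>2 * (y \<bullet> y) = (\<Sum>j<d. (y $ j * b)\<^sup>2)" if "y \<in> carrier_vec d" for y
   using that by (auto simp: scalar_prod_def atLeast0LessThan sum_distrib_left power2_eq_square mult_ac intro!: sum.cong)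
  moreover have "(\<Sum>i<n. u i * (row A i \<bullet> y)\<^sup>2) = (\<Sum>i<n. (sqrt (u i) * (row A i \<bullet> y))\<^sup>2)" for y
   using u by (intro sum.cong) (auto simp: power_mult_distrib)
  ultimately show ?thesis unfolding sum_split_add using y by (simp add: coef_def Let_def dd)
 qed
 finally show ?thesis ..
qed

lemma estim_lin: "estim A Z b u m \<xi> a = (\<Sum>k<m. (lin (coef A Z b u a) (d + n) k \<xi>)\<^sup>2) / real m"
 unfolding estim_def samp_lin lin_def using A by (simp add: add.commute)

text \<open>A sample is a fixed linear form of its tape block with variance \<open>Qv\<close>, and
  dividing by the variance reduces the claim to \<open>chi_square_tail\<close>. If the variance is
  0, the estimate vanishes identically and is exact.\<close>

lemma estim_fail:
 fixes b :: real
 assumes u: "\<And>i. i < n \<Longrightarrow> 0 \<le> u i" and e: "0 < e" "e \<le> 1 / 2" and m: "0 < m"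
 defines "X \<equiv> {\<xi>. \<not> ((1 - e) * Qv A Z b u a \<le> estim A Z b u m \<xi> a \<and> estim A Z b u m \<xi> a \<le> (1 + e) * Qv A Z b u a)}"
 shows "X \<in> sets tape.S" "measure tape.S X \<le> 2 * exp (- (real m * e\<^sup>2 / 8))"
proof -
 let ?c = "coef A Z b u a" and ?N = "d + n"
 define q where "q = Qv A Z b u a"
 have q: "(\<Sum>l<?N. (?c l)\<^sup>2) = q" unfolding q_def by (rule sum_coef_sq[OF u])
 have q0: "0 \<le> q" unfolding q[symmetric] by (intro sum_nonneg) auto
 have "X = {\<xi> \<in> space tape.S. \<not> ((1 - e) * q \<le> (\<Sum>k<m. (lin ?c ?N k \<xi>)\<^sup>2) / real m \<and> (\<Sum>k<m. (lin ?c ?N k \<xi>)\<^sup>2) / real m \<le> (1 + e) * q)}"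
  unfolding X_def estim_lin q_def by simp
 also have "\<dots> \<in> sets tape.S" by measurable
 finally show "X \<in> sets tape.S" .
 show "measure tape.S X \<le> 2 * exp (- (real m * e\<^sup>2 / 8))"
 proof (cases "q = 0")
  case True
  then have "?c l = 0" if "l < ?N" for l using q that sum_nonneg_eq_0_iff[of "{..<?N}" "\<lambda>l. (?c l)\<^sup>2"] by auto
  then have "lin ?c ?N k \<xi> = 0" for k \<xi> unfolding lin_def by simp
  then have "X = {}" unfolding X_def estim_lin using True by (auto simp: q_def)
  then show ?thesis by simp
 next
  case False
  then have qp: "0 < q" using q0 by simp
  define c where "c l = ?c l / sqrt q" for l
  have c: "(\<Sum>l<?N. (c l)\<^sup>2) = 1" unfolding c_def power_divide sum_divide_distrib[symmetric] q using qp by simp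
  have "lin c ?N k \<xi> = lin ?c ?N k \<xi> / sqrt q" for k \<xi> unfolding lin_def c_def by (simp add: sum_divide_distrib)
  then have "(\<Sum>k<m. (lin ?c ?N k \<xi>)\<^sup>2) = q * (\<Sum>k<m. (lin c ?N k \<xi>)\<^sup>2)" for \<xi>
   using qp by (simp add: power_divide sum_divide_distrib[symmetric])
  then have "X = {rnd. \<not> ((1 - e) * real m \<le> (\<Sum>k<m. (lin c ?N k rnd)\<^sup>2) \<and> (\<Sum>k<m. (lin c ?N k rnd)\<^sup>2) \<le> (1 + e) * real m)}"
  proof -
   have "(1 - e) * q \<le> q * t / real m \<longleftrightarrow> (1 - e) * real m \<le> t" "q * t / real m \<le> (1 + e) * q \<longleftrightarrow> t \<le> (1 + e) * real m" for t
    using m mult_le_cancel_left_pos[OF qp, of "(1 - e) * real m" t] mult_le_cancel_left_pos[OF qp, of t "(1 + e) * real m"]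
    by (simp_all only: pos_le_divide_eq pos_divide_le_eq of_nat_0_less_iff mult_ac)
   then show ?thesis unfolding X_def estim_lin q_def[symmetric] \<open>\<And>\<xi>. (\<Sum>k<m. (lin ?c ?N k \<xi>)\<^sup>2) = q * (\<Sum>k<m. (lin c ?N k \<xi>)\<^sup>2)\<close> by simp
  qed
  then show ?thesis using chi_square_tail[OF c e] by simp
 qed
qed

end

lemma accurate_fail:
 assumes A: "A \<in> carrier_mat n d" and Z: "Z \<in> carrier_mat d d" and u: "\<And>i. i < n \<Longrightarrow> 0 \<le> u i" and e: "0 < e" "e \<le> 1 / 2" and m: "0 < m"
 shows "{\<xi>. \<not> accurate A e Z b u m \<xi>} \<in> sets tape.S" "measure tape.S {\<xi>. \<not> accurate A e Z b u m \<xi>} \<le> real (n + d) * (2 * exp (- (real m * e\<^sup>2 / 8)))"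
proof -
 let ?X = "\<lambda>a. {\<xi>. \<not> ((1 - e) * Qv A Z b u a \<le> estim A Z b u m \<xi> a \<and> estim A Z b u m \<xi> a \<le> (1 + e) * Qv A Z b u a)}"
 let ?V = "row A ` {..<n} \<union> unit_vec d ` {..<d}"
 have V: "a \<in> carrier_vec d" if "a \<in> ?V" for a using that A by (auto intro: row_carrier_vec)
 have eq: "{\<xi>. \<not> accurate A e Z b u m \<xi>} = (\<Union>a\<in>?V. ?X a)" unfolding accurate_def using A by auto
 have fin: "finite ?V" by simp
 show "{\<xi>. \<not> accurate A e Z b u m \<xi>} \<in> sets tape.S" unfolding eq
  by (intro sets.finite_UN fin estim_fail(1)[OF A Z V u e m])
 have "measure tape.S {\<xi>. \<not> accurate A e Z b u m \<xi>} \<le> (\<Sum>a\<in>?V. measure tape.S (?X a))" unfolding eq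
  by (rule measure_UNION_le[OF fin]) (rule estim_fail(1)[OF A Z V u e m])
 also have "\<dots> \<le> (\<Sum>a\<in>?V. 2 * exp (- (real m * e\<^sup>2 / 8)))" by (rule sum_mono) (rule estim_fail(2)[OF A Z V u e m])
 also have "\<dots> = real (card ?V) * (2 * exp (- (real m * e\<^sup>2 / 8)))" by simp
 also have "\<dots> \<le> real (n + d) * (2 * exp (- (real m * e\<^sup>2 / 8)))"
 proof (rule mult_right_mono)
  have "card ?V \<le> card (row A ` {..<n}) + card ((unit_vec d :: nat \<Rightarrow> real vec) ` {..<d})" by (rule card_Un_le)
  also have "\<dots> \<le> n + d" using card_image_le[of "{..<n}" "row A"] card_image_le[of "{..<d}" "unit_vec d :: nat \<Rightarrow> real vec"] by simp
  finally show "real (card ?V) \<le> real (n + d)" by simp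
 qed simp
 finally show "measure tape.S {\<xi>. \<not> accurate A e Z b u m \<xi>} \<le> real (n + d) * (2 * exp (- (real m * e\<^sup>2 / 8)))" .
qed

subsection \<open>Measurability and independence of trajectories\<close>

text \<open>Measurability of a random state is stated component by component; each memory cell is a
  random variable of its own.\<close>

definition smeas :: "'a measure \<Rightarrow> ('a \<Rightarrow> state) \<Rightarrow> bool" where
 "smeas M F \<longleftrightarrow> (\<lambda>x. pc (F x)) \<in> measurable M (count_space UNIV) \<and> (\<lambda>x. draws (F x)) \<in> measurable M (count_space UNIV)
   \<and> (\<lambda>x. clock (F x)) \<in> measurable M (count_space UNIV) \<and> (\<forall>a. (\<lambda>x. nmem (F x) a) \<in> measurable M (count_space UNIV))
   \<and> (\<forall>a. (\<lambda>x. rmem (F x) a) \<in> borel_measurable M)"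

lemma smeasD:
 assumes "smeas M F"
 shows "(\<lambda>x. pc (F x)) \<in> measurable M (count_space UNIV)" "(\<lambda>x. draws (F x)) \<in> measurable M (count_space UNIV)"
  "(\<lambda>x. clock (F x)) \<in> measurable M (count_space UNIV)" "(\<lambda>x. nmem (F x) a) \<in> measurable M (count_space UNIV)"
  "(\<lambda>x. rmem (F x) a) \<in> borel_measurable M"
 using assms by (auto simp: smeas_def)

lemma smeas_const: "smeas M (\<lambda>_. s)"
 by (simp add: smeas_def)

lemma rmem_write_vec:
 "write_vec mem a v j = (if a \<le> j \<and> j < a + dim_vec v then vec_index v (j - a) else mem j)"
 by (simp add: write_vec_def)

lemma mat_vec_measurable:
 assumes "\<And>a. (\<lambda>x. mem x a) \<in> borel_measurable M" and a: "f \<in> measurable M (count_space UNIV)" and b: "g \<in> measurable M (count_space UNIV)"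
  and X: "dim_col X = k"
 shows "(\<lambda>x. write_vec (mem x) (f x) (X *\<^sub>v read_vec (mem x) (g x) k) j) \<in> borel_measurable M"
proof (rule measurable_compose_countable[OF _ a], rule measurable_compose_countable[OF _ b])
 fix i l
 have "write_vec (mem x) i (X *\<^sub>v read_vec (mem x) l k) j =
   (if i \<le> j \<and> j < i + dim_row X then \<Sum>c<k. X $$ (j - i, c) * mem x (l + c) else mem x j)" for x
  using X by (auto simp: rmem_write_vec read_vec_def scalar_prod_def atLeast0LessThan intro!: sum.cong)
 then show "(\<lambda>x. write_vec (mem x) i (X *\<^sub>v read_vec (mem x) l k) j) \<in> borel_measurable M"
  using assms(1) by simp
qed

lemma smeas_exec:
 assumes F: "smeas M F" and W: "\<And>i. (\<lambda>x. W x i) \<in> borel_measurable M"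
 shows "smeas M (\<lambda>x. exec A (W x) i (F x))"
proof -
 note D[measurable] = smeasD[OF F]
 note W[measurable]
 have c: "(\<lambda>x. h (nmem (F x) a)) \<in> measurable M N" if "\<And>y. h y \<in> space N" for h a and N :: "'b measure"
  by (rule measurable_compose[OF D(4)]) (use that in auto)
 show ?thesis
 proof (cases i)
  case (NLoad a b)
  have "(\<lambda>x. nmem (F x) (nmem (F x) b)) \<in> measurable M (count_space UNIV)" by (rule measurable_compose_countable[OF D(4) D(4)])
  then show ?thesis using NLoad F by (auto simp: smeas_def)
 next
  case (NStore a b)
  have "(\<lambda>x. if j = nmem (F x) a then nmem (F x) b else nmem (F x) j) \<in> measurable M (count_space UNIV)" for j by measurable
  then show ?thesis using NStore F by (auto simp: smeas_def fun_upd_def)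
 next
  case (RLoad a b)
  have "(\<lambda>x. rmem (F x) (nmem (F x) b)) \<in> borel_measurable M" by (rule measurable_compose_countable[OF D(5) D(4)])
  then show ?thesis using RLoad F by (auto simp: smeas_def)
 next
  case (RStore a b)
  have "(\<lambda>x. if j = nmem (F x) a then rmem (F x) b else rmem (F x) j) \<in> borel_measurable M" for j by measurable
  then show ?thesis using RStore F by (auto simp: smeas_def fun_upd_def)
 next
  case (Entry a b c)
  have "(\<lambda>x. if nmem (F x) b < dim_row A \<and> nmem (F x) c < dim_col A then A $$ (nmem (F x) b, nmem (F x) c) else 0) \<in> borel_measurable M"
   by (rule measurable_compose_countable[OF _ D(4)[of b]], rule measurable_compose_countable[OF _ D(4)[of c]]) simp
  then show ?thesis using Entry F by (auto simp: smeas_def)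
 next
  case (MatVec a b)
  have "(\<lambda>x. write_vec (rmem (F x)) (nmem (F x) a) (A *\<^sub>v read_vec (rmem (F x)) (nmem (F x) b) (dim_col A)) j) \<in> borel_measurable M" for j
   by (rule mat_vec_measurable) (use D in auto)
  then show ?thesis using MatVec F by (auto simp: smeas_def)
 next
  case (MatTVec a b)
  have "(\<lambda>x. write_vec (rmem (F x)) (nmem (F x) a) (A\<^sup>T *\<^sub>v read_vec (rmem (F x)) (nmem (F x) b) (dim_row A)) j) \<in> borel_measurable M" for j
   by (rule mat_vec_measurable) (use D in auto)
  then show ?thesis using MatTVec F by (auto simp: smeas_def)
 next
  case (Gauss a)
  have "(\<lambda>x. W x (draws (F x))) \<in> borel_measurable M" by (rule measurable_compose_countable[OF W D(2)])
  moreover have "(\<lambda>x. Suc (draws (F x))) \<in> measurable M (count_space UNIV)" by measurable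
  ultimately show ?thesis using Gauss F by (auto simp: smeas_def)
 next
  case (JumpNLess a b l)
  have "(\<lambda>x. if nmem (F x) a < nmem (F x) b then l else pc (F x)) \<in> measurable M (count_space UNIV)"
   by (rule measurable_compose_countable[OF _ D(4)[of a]], rule measurable_compose_countable[OF _ D(4)[of b]]) (use D in simp)
  then show ?thesis using JumpNLess F by (auto simp: smeas_def if_distrib[of pc] if_distrib[of draws] if_distrib[of clock] if_distrib[of nmem] if_distrib[of rmem] cong: if_cong)
 next
  case (JumpRLess a b l)
  have "(\<lambda>x. if rmem (F x) a < rmem (F x) b then l else pc (F x)) \<in> measurable M (count_space UNIV)" by measurable
  then show ?thesis using JumpRLess F by (auto simp: smeas_def if_distrib[of pc] if_distrib[of draws] if_distrib[of clock] if_distrib[of nmem] if_distrib[of rmem] cong: if_cong)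
 qed (use F in \<open>auto simp: smeas_def\<close>)
qed

lemma smeas_adv:
 assumes "smeas M F" shows "smeas M (\<lambda>x. F x\<lparr>pc := l, clock := clock (F x) + c\<rparr>)"
proof -
 note [measurable] = smeasD[OF assms]
 have "(\<lambda>x. clock (F x) + c) \<in> measurable M (count_space UNIV)" by measurable
 then show ?thesis using assms by (auto simp: smeas_def)
qed

text \<open>Jumps select the next instruction among countably many alternatives; it suffices that
  each alternative is measurable and that the selector is a measurable natural number.\<close>

lemma smeas_compose:
 assumes "\<And>l. smeas M (G l)" "f \<in> measurable M (count_space (UNIV :: nat set))"
 shows "smeas M (\<lambda>x. G (f x) x)"
 unfolding smeas_def
 by (intro conjI allI) (rule measurable_compose_countable[OF smeasD(1)[OF assms(1)] assms(2)] measurable_compose_countable[OF smeasD(2)[OF assms(1)] assms(2)]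
  measurable_compose_countable[OF smeasD(3)[OF assms(1)] assms(2)] measurable_compose_countable[OF smeasD(4)[OF assms(1)] assms(2)]
  measurable_compose_countable[OF smeasD(5)[OF assms(1)] assms(2)])+

lemma smeas_step:
 assumes F: "smeas M F" and W: "\<And>i. (\<lambda>x. W x i) \<in> borel_measurable M"
 shows "smeas M (\<lambda>x. step P A T (W x) (F x))"
proof -
 let ?G = "\<lambda>l x. if length P \<le> l then F x else exec A (W x) (P ! l) (F x\<lparr>pc := Suc l, clock := clock (F x) + cost T (P ! l)\<rparr>)"
 have "smeas M (?G l)" for l
  using F smeas_exec[OF smeas_adv[OF F] W] by (cases "length P \<le> l") auto
 then have "smeas M (\<lambda>x. ?G (pc (F x)) x)" by (rule smeas_compose) (rule smeasD(1)[OF F])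
 then show ?thesis by (simp add: step_def halted_def)
qed

lemma draws_exec: "draws s \<le> draws (exec A rnd i s)"
 by (cases i) auto

lemma draws_step: "draws s \<le> draws (step P A T rnd s)"
 unfolding step_def using draws_exec[of "s\<lparr>pc := Suc (pc s), clock := clock s + cost T (P ! pc s)\<rparr>" A rnd "P ! pc s"] by auto

lemma exec_cong:
 assumes "\<And>i. i < D \<Longrightarrow> rnd i = rnd' i" "draws (exec A rnd i s) \<le> D"
 shows "exec A rnd i s = exec A rnd' i s"
 using assms by (cases i) auto

section \<open>Independence of the unread tape\<close>

locale trajectory =
 fixes P :: program and A :: "real mat" and T :: nat and s0 :: state
begin

definition st :: "nat \<Rightarrow> rseq \<Rightarrow> state" where
 "st k rnd = (step P A T rnd ^^ k) s0"

lemma st_Suc: "st (Suc k) rnd = step P A T rnd (st k rnd)"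
 by (simp add: st_def)

lemma smeas_st: "smeas tape.S (st k)"
proof (induction k)
 case 0
 then show ?case by (simp add: st_def smeas_const)
next
 case (Suc k)
 then show ?case unfolding st_Suc[abs_def] by (rule smeas_step) (rule coord_measurable)
qed

lemma draws_mono: "k \<le> l \<Longrightarrow> draws (st k rnd) \<le> draws (st l rnd)"
proof (induction l)
 case (Suc l)
 then show ?case using draws_step[of "st l rnd" P A T rnd] by (cases "k = Suc l") (auto simp: st_Suc)
qed simp

lemma st_cong:
 assumes "\<And>i. i < D \<Longrightarrow> rnd i = rnd' i" "draws (st k rnd) \<le> D"
 shows "st k rnd = st k rnd'"
 using assms(2)
proof (induction k)
 case 0
 show ?case by (simp add: st_def)
next
 case (Suc k)
 have "draws (st k rnd) \<le> D" using Suc.prems draws_mono[of k "Suc k" rnd] by simp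
 then have IH: "st k rnd = st k rnd'" by (rule Suc.IH)
 show ?case unfolding st_Suc IH[symmetric] step_def
  using Suc.prems[unfolded st_Suc step_def] exec_cong[of D rnd rnd', OF assms(1)] by (auto split: if_splits)
qed

text \<open>\<open>B\<close> sees the state at the first time that \<open>H\<close> holds and the
  tape from the current read position on, that is, exactly the entries the next sketch can
  consume.\<close>

definition first_bad :: "(state \<Rightarrow> bool) \<Rightarrow> (state \<Rightarrow> rseq \<Rightarrow> bool) \<Rightarrow> rseq set" where
 "first_bad H B = {rnd. \<exists>k. H (st k rnd) \<and> (\<forall>k'<k. \<not> H (st k' rnd)) \<and> B (st k rnd) (\<lambda>l. rnd (draws (st k rnd) + l))}"

text \<open>
 The state in which \<open>H\<close> holds for the first time is independent of the part of the tape
 that has not been read.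
\<close>

lemma first_bad:
 assumes H: "\<And>k. {rnd. H (st k rnd)} \<in> sets tape.S"
  and B: "\<And>k. {x. B (st k (fst x)) (snd x)} \<in> sets (tape.S \<Otimes>\<^sub>M tape.S)"
  and b: "\<And>s. measure tape.S {\<xi>. B s \<xi>} \<le> b" and b0: "0 \<le> b"
 shows "first_bad H B \<in> sets tape.S" "measure tape.S (first_bad H B) \<le> b"
proof -
 \<comment> \<open>The hitting time \<open>k\<close> and the number \<open>D\<close> of draws made
   so far split the event into countably many disjoint pieces on which the read position is
   constant.\<close>
 define F where "F = (\<lambda>(k, D). {rnd. H (st k rnd) \<and> (\<forall>k'<k. \<not> H (st k' rnd)) \<and> draws (st k rnd) = D})"
 define G where "G = (\<lambda>(k, D). {rnd. rnd \<in> F (k, D) \<and> B (st k rnd) (\<lambda>l. rnd (D + l))})"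
 have Fs: "F x \<in> sets tape.S" for x
 proof -
  obtain k D where x: "x = (k, D)" by fastforce
  have [measurable]: "Measurable.pred tape.S (\<lambda>rnd. H (st k rnd))" for k using H by (simp add: pred_def)
  note [measurable] = smeasD(2)[OF smeas_st]
  have "{rnd \<in> space tape.S. H (st k rnd) \<and> (\<forall>k'\<in>{..<k}. \<not> H (st k' rnd)) \<and> draws (st k rnd) = D} \<in> sets tape.S" by measurable
  then show ?thesis unfolding F_def x by (simp add: Ball_def)
 qed
 have sh: "(\<lambda>rnd l. rnd (D + l)) \<in> measurable tape.S tape.S" for D :: nat
  by (rule measurable_PiM_single') (auto intro: measurable_component_singleton)
 have Gs: "G x \<in> sets tape.S" for x
 proof -
  obtain k D where x: "x = (k, D)" by fastforce
  have "(\<lambda>rnd. (rnd, \<lambda>l. rnd (D + l))) \<in> measurable tape.S (tape.S \<Otimes>\<^sub>M tape.S)" using sh by simp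
  from measurable_sets[OF this B[of k]] have "{rnd. B (st k rnd) (\<lambda>l. rnd (D + l))} \<in> sets tape.S" by (simp add: vimage_def)
  then have "F (k, D) \<inter> {rnd. B (st k rnd) (\<lambda>l. rnd (D + l))} \<in> sets tape.S" using Fs by blast
  then show ?thesis unfolding G_def x by (simp add: Int_def)
 qed
 have Gb: "emeasure tape.S (G x) \<le> ennreal b * emeasure tape.S (F x)" for x
 proof -
  obtain k D where x: "x = (k, D)" by fastforce
  define X where "X = {x. fst x \<in> F (k, D) \<and> B (st k (fst x)) (snd x)}"
  have X: "X \<in> sets (tape.S \<Otimes>\<^sub>M tape.S)"
  proof -
   have "X = (F (k, D) \<times> space tape.S) \<inter> {x. B (st k (fst x)) (snd x)}" unfolding X_def by auto
   also have "\<dots> \<in> sets (tape.S \<Otimes>\<^sub>M tape.S)" using Fs B sets.top[of tape.S] by (intro sets.Int pair_measureI) auto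
   finally show ?thesis .
  qed
  \<comment> \<open>Whether \<open>F (k, D)\<close> occurs, and the state at time \<open>k\<close>
    on it, are determined by the first \<open>D\<close> entries. After cutting the tape at
    \<open>D\<close> they depend only on the first component of the product, while the entries
    passed to \<open>B\<close> form the second.\<close>
  have cF: "comb_seq D rnd rnd' \<in> F (k, D) \<longleftrightarrow> rnd \<in> F (k, D)" and cs: "rnd \<in> F (k, D) \<Longrightarrow> st k (comb_seq D rnd rnd') = st k rnd" for rnd rnd'
  proof -
   have 1: "st l (comb_seq D rnd rnd') = st l rnd" if "draws (st l rnd) \<le> D" for l
    by (rule st_cong[symmetric, OF _ that]) (simp add: comb_seq_less)
   have 2: "st l (comb_seq D rnd rnd') = st l rnd" if "draws (st l (comb_seq D rnd rnd')) \<le> D" for l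
    by (rule st_cong[OF _ that]) (simp add: comb_seq_less)
   show "rnd \<in> F (k, D) \<Longrightarrow> st k (comb_seq D rnd rnd') = st k rnd" using 1[of k] unfolding F_def by simp
   show "comb_seq D rnd rnd' \<in> F (k, D) \<longleftrightarrow> rnd \<in> F (k, D)"
   proof
    assume a: "comb_seq D rnd rnd' \<in> F (k, D)"
    then have "st l (comb_seq D rnd rnd') = st l rnd" if "l \<le> k" for l
     using draws_mono[OF that, of "comb_seq D rnd rnd'"] 2[of l] unfolding F_def by simp
    then show "rnd \<in> F (k, D)" using a unfolding F_def by auto
   next
    assume a: "rnd \<in> F (k, D)"
    then have "st l (comb_seq D rnd rnd') = st l rnd" if "l \<le> k" for l
     using draws_mono[OF that, of "rnd"] 1[of l] unfolding F_def by simp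
    then show "comb_seq D rnd rnd' \<in> F (k, D)" using a unfolding F_def by auto
   qed
  qed
  have cb: "(\<lambda>l. comb_seq D rnd rnd' (D + l)) = rnd'" for rnd rnd' :: "nat \<Rightarrow> real"
   using comb_seq_add[of D rnd rnd'] by (auto simp: add.commute)
  have "emeasure tape.S (G x) = emeasure (distr (tape.S \<Otimes>\<^sub>M tape.S) tape.S (\<lambda>(rnd, rnd'). comb_seq D rnd rnd')) (G x)"
   by (simp only: tape.PiM_comb_seq)
  also have "\<dots> = emeasure (tape.S \<Otimes>\<^sub>M tape.S) ((\<lambda>(rnd, rnd'). comb_seq D rnd rnd') -` G x \<inter> space (tape.S \<Otimes>\<^sub>M tape.S))"
   by (rule emeasure_distr[OF measurable_comb_seq Gs])
  also have "(\<lambda>(rnd, rnd'). comb_seq D rnd rnd') -` G x \<inter> space (tape.S \<Otimes>\<^sub>M tape.S) = X"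
   unfolding X_def G_def x by (auto simp: space_pair_measure cF cs cb)
  also have "emeasure (tape.S \<Otimes>\<^sub>M tape.S) X = (\<integral>\<^sup>+rnd. emeasure tape.S (Pair rnd -` X) \<partial>tape.S)"
   by (rule tape.emeasure_pair_measure_alt[OF X])
  also have "\<dots> \<le> (\<integral>\<^sup>+rnd. ennreal b * indicator (F (k, D)) rnd \<partial>tape.S)"
  proof (rule nn_integral_mono)
   fix rnd
   show "emeasure tape.S (Pair rnd -` X) \<le> ennreal b * indicator (F (k, D)) rnd"
   proof (cases "rnd \<in> F (k, D)")
    case True
    then have "Pair rnd -` X = {\<xi>. B (st k rnd) \<xi>}" unfolding X_def by auto
    then show ?thesis using True b[of "st k rnd"] b0 by (simp add: tape.P.emeasure_eq_measure ennreal_leI)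
   next
    case False
    then have "Pair rnd -` X = {}" unfolding X_def by auto
    then show ?thesis by simp
   qed
  qed
  also have "\<dots> = ennreal b * emeasure tape.S (F x)" using Fs unfolding x by (simp add: nn_integral_cmult)
  finally show ?thesis .
 qed
 have eq: "first_bad H B = (\<Union>x. G x)" unfolding first_bad_def G_def F_def by auto
 show "first_bad H B \<in> sets tape.S" unfolding eq by (rule sets.countable_UN) (use Gs in auto)
 have disjF: "disjoint_family F"
  unfolding disjoint_family_on_def
 proof (intro ballI impI)
  fix x y :: "nat \<times> nat" assume ne: "x \<noteq> y"
  obtain k D l D' where xy: "x = (k, D)" "y = (l, D')" by fastforce
  show "F x \<inter> F y = {}"
  proof (rule ccontr)
   assume "F x \<inter> F y \<noteq> {}"
   then obtain rnd where w: "rnd \<in> F (k, D)" "rnd \<in> F (l, D')" unfolding xy by blast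
   then have "k = l" unfolding F_def by (cases k l rule: linorder_cases) auto
   then show False using w ne xy unfolding F_def by auto
  qed
 qed
 have disjG: "disjoint_family G" using disjF unfolding disjoint_family_on_def G_def by fastforce
 have "emeasure tape.S (first_bad H B) = (\<integral>\<^sup>+x. emeasure tape.S (G x) \<partial>count_space UNIV)"
  unfolding eq by (rule emeasure_UN_countable) (use Gs disjG in auto)
 also have "\<dots> \<le> (\<integral>\<^sup>+x. ennreal b * emeasure tape.S (F x) \<partial>count_space UNIV)" by (rule nn_integral_mono) (rule Gb)
 also have "\<dots> = ennreal b * (\<integral>\<^sup>+x. emeasure tape.S (F x) \<partial>count_space UNIV)" by (rule nn_integral_cmult) simp
 also have "(\<integral>\<^sup>+x. emeasure tape.S (F x) \<partial>count_space UNIV) = emeasure tape.S (\<Union>x. F x)"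
  by (rule emeasure_UN_countable[symmetric]) (use Fs disjF in auto)
 also have "ennreal b * emeasure tape.S (\<Union>x. F x) \<le> ennreal b * 1" by (intro mult_left_mono tape.P.emeasure_le_1) simp
 finally show "measure tape.S (first_bad H B) \<le> b" using b0 by (simp add: tape.P.emeasure_eq_measure)
qed

end

section \<open>Measurability of the estimates and of success\<close>

definition mmeas :: "'a measure \<Rightarrow> nat \<Rightarrow> ('a \<Rightarrow> real mat) \<Rightarrow> bool" where
 "mmeas M d F \<longleftrightarrow> (\<forall>x. F x \<in> carrier_mat d d) \<and> (\<forall>i<d. \<forall>j<d. (\<lambda>x. F x $$ (i, j)) \<in> borel_measurable M)"

lemma mmeasD:
 assumes "mmeas M d F"
 shows "F x \<in> carrier_mat d d" "i < d \<Longrightarrow> j < d \<Longrightarrow> (\<lambda>x. F x $$ (i, j)) \<in> borel_measurable M"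
 using assms by (auto simp: mmeas_def)

lemma mmeas_const: "X \<in> carrier_mat d d \<Longrightarrow> mmeas M d (\<lambda>_. X)"
 by (simp add: mmeas_def)

lemma mmeas_add:
 assumes "mmeas M d F" "mmeas M d G" shows "mmeas M d (\<lambda>x. F x + G x)"
 using assms carrier_matD[OF mmeasD(1)[OF assms(2)]] unfolding mmeas_def by (auto intro!: borel_measurable_add)

lemma mmeas_diff:
 assumes "mmeas M d F" "mmeas M d G" shows "mmeas M d (\<lambda>x. F x - G x)"
 using assms carrier_matD[OF mmeasD(1)[OF assms(2)]] unfolding mmeas_def by (auto intro!: borel_measurable_diff minus_carrier_mat)

lemma mmeas_smult:
 assumes "c \<in> borel_measurable M" "mmeas M d G" shows "mmeas M d (\<lambda>x. c x \<cdot>\<^sub>m G x)"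
 using assms carrier_matD[OF mmeasD(1)[OF assms(2)]] unfolding mmeas_def by (auto intro!: borel_measurable_times)

lemma mmeas_mult:
 assumes F: "mmeas M d F" and G: "mmeas M d G" shows "mmeas M d (\<lambda>x. F x * G x)"
 unfolding mmeas_def
proof (intro conjI allI impI)
 show "F x * G x \<in> carrier_mat d d" for x using mmeasD(1)[OF F] mmeasD(1)[OF G] by (rule mult_carrier_mat)
 fix i j assume ij: "i < d" "j < d"
 have "(F x * G x) $$ (i, j) = (\<Sum>k<d. F x $$ (i, k) * G x $$ (k, j))" for x
  using carrier_matD[OF mmeasD(1)[OF F]] carrier_matD[OF mmeasD(1)[OF G]] ij
  by (auto simp: scalar_prod_def atLeast0LessThan)
 moreover have "(\<lambda>x. \<Sum>k<d. F x $$ (i, k) * G x $$ (k, j)) \<in> borel_measurable M"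
  by (intro borel_measurable_sum borel_measurable_times mmeasD(2)[OF F] mmeasD(2)[OF G]) (use ij in auto)
 ultimately show "(\<lambda>x. (F x * G x) $$ (i, j)) \<in> borel_measurable M" by simp
qed

lemma mmeas_pow: "mmeas M d F \<Longrightarrow> mmeas M d (\<lambda>x. F x ^\<^sub>m k)"
proof (induction k)
 case 0
 then have "dim_row (F x) = d" for x using mmeasD(1)[of M d F x] by simp
 then show ?case by (simp add: mmeas_const)
next
 case (Suc k)
 then show ?case by (simp add: mmeas_mult)
qed

lemma mmeas_transpose: "mmeas M d F \<Longrightarrow> mmeas M d (\<lambda>x. transpose_mat (F x))"
 unfolding mmeas_def by (auto simp: carrier_matD[of _ d d])

lemma cheb_measurable: "a \<in> borel_measurable M \<Longrightarrow> (\<lambda>x. cheb (a x) k) \<in> borel_measurable M"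
 by (induction k rule: induct_nat_012) auto

lemma mmeas_chebM:
 assumes a: "a \<in> borel_measurable M" and b: "b \<in> borel_measurable M" and N: "mmeas M d N"
 shows "mmeas M d (\<lambda>x. chebM (a x) (b x) (N x) k)"
proof -
 have dr: "dim_row (N x) = d" for x using mmeasD(1)[OF N, of x] by simp
 show ?thesis
 proof (induction k rule: induct_nat_012)
  case 0
  show ?case by (simp add: dr mmeas_const)
 next
  case 1
  show ?case by (simp add: dr mmeas_const mmeas_smult[OF b])
 next
  case (ge2 k)
  have c: "(\<lambda>x. 2 * b x * cheb (a x) (Suc k)) \<in> borel_measurable M"
   by (intro borel_measurable_times cheb_measurable a b) simp
  show ?case unfolding chebM.simps dr
   by (intro mmeas_add mmeas_diff mmeas_smult mmeas_mult mmeas_const ge2 N a b c borel_measurable_const one_carrier_mat)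
 qed
qed

lemma mmeas_gram:
 assumes A: "A \<in> carrier_mat n d" and u: "\<And>i. (\<lambda>x. u x i) \<in> borel_measurable M"
 shows "mmeas M d (\<lambda>x. gram A (u x))"
 unfolding mmeas_def using A u by (auto simp: gram_index[OF A])

lemma mmeas_opM:
 assumes A: "A \<in> carrier_mat n d" and m[measurable]: "a \<in> borel_measurable M" "b \<in> borel_measurable M" "md \<in> borel_measurable M"
  and u: "\<And>i. (\<lambda>x. u x i) \<in> borel_measurable M"
 shows "mmeas M d (\<lambda>x. opM A (a x) (b x) kc (md x) (u x))"
proof -
 note g = mmeas_gram[OF A, of u, OF u]
 have dd: "dim_col A = d" using A by simp
 have c: "mmeas M d (\<lambda>x. chebM (a x) (b x) (1\<^sub>m d + gram A (u x)) kc)"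
  by (intro mmeas_chebM m mmeas_add g mmeas_const) simp
 have o: "opM A (a x) (b x) kc (md x) (u x) = (if md x < 1 / 2 then chebM (a x) (b x) (1\<^sub>m d + gram A (u x)) kc else gram A (u x))" for x
  by (simp add: opM_def dd)
 show ?thesis unfolding mmeas_def o
 proof (intro conjI allI impI)
  show "(if md x < 1 / 2 then chebM (a x) (b x) (1\<^sub>m d + gram A (u x)) kc else gram A (u x)) \<in> carrier_mat d d" for x
   using mmeasD(1)[OF c] mmeasD(1)[OF g] by auto
  fix i j assume ij: "i < d" "j < d"
  note [measurable] = mmeasD(2)[OF c ij] mmeasD(2)[OF g ij]
  have "(\<lambda>x. if md x < 1 / 2 then chebM (a x) (b x) (1\<^sub>m d + gram A (u x)) kc $$ (i, j) else gram A (u x) $$ (i, j)) \<in> borel_measurable M"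
   by measurable
  then show "(\<lambda>x. (if md x < 1 / 2 then chebM (a x) (b x) (1\<^sub>m d + gram A (u x)) kc else gram A (u x)) $$ (i, j)) \<in> borel_measurable M"
   by (simp add: if_distrib[of "\<lambda>X. X $$ (i, j)"])
 qed
qed

lemma qf_measurable:
 assumes F: "mmeas M d F" and v: "v \<in> carrier_vec d"
 shows "(\<lambda>x. qf (F x) v) \<in> borel_measurable M"
 unfolding qf_sum[OF mmeasD(1)[OF F] v]
 by (intro borel_measurable_sum borel_measurable_times mmeasD(2)[OF F] borel_measurable_const) auto

lemma Qv_measurable:
 assumes A: "A \<in> carrier_mat n d" and Z: "mmeas M d Z" and b: "b \<in> borel_measurable M" and u: "\<And>i. (\<lambda>x. u x i) \<in> borel_measurable M"
  and v: "v \<in> carrier_vec d"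
 shows "(\<lambda>x. Qv A (Z x) (b x) (u x) v) \<in> borel_measurable M"
proof -
 have dd: "dim_col A = d" using A by simp
 show ?thesis unfolding Qv_def covm_def dd
  by (intro qf_measurable[OF _ v] mmeas_mult mmeas_add mmeas_smult mmeas_transpose Z mmeas_const mmeas_gram[OF A] u one_carrier_mat)
    (use b in measurable)
qed

lemma estim_measurable:
 assumes A: "A \<in> carrier_mat n d" and Z: "mmeas M d Z" and b: "b \<in> borel_measurable M" and u: "\<And>i. (\<lambda>x. u x i) \<in> borel_measurable M"
  and xi: "\<And>i. (\<lambda>x. \<xi> x i) \<in> borel_measurable M" and v: "v \<in> carrier_vec d"
 shows "(\<lambda>x. estim A (Z x) (b x) (u x) m (\<xi> x) v) \<in> borel_measurable M"
proof -
 note [measurable] = b u xi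
 have dd: "dim_col A = d" using A by simp
 have s: "(\<lambda>x. samp A (Z x) (b x) (u x) (\<lambda>l. \<xi> x (k + l)) v) \<in> borel_measurable M" for k
 proof -
  have sv: "(\<lambda>x. Atf A (\<lambda>i. \<xi> x (k + (d + i)) * sqrt (u x i)) j + \<xi> x (k + j) * b x) \<in> borel_measurable M" for j
   unfolding Atf_def by measurable
  have *: "samp A (Z x) (b x) (u x) (\<lambda>l. \<xi> x (k + l)) v =
    (\<Sum>i<d. v $ i * (\<Sum>j<d. Z x $$ (i, j) * (Atf A (\<lambda>i. \<xi> x (k + (d + i)) * sqrt (u x i)) j + \<xi> x (k + j) * b x)))" for x
   using carrier_matD[OF mmeasD(1)[OF Z]] v unfolding samp_def start_vec_def dd
   by (auto simp: scalar_prod_def atLeast0LessThan intro!: sum.cong)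
  show ?thesis unfolding *
   using sv mmeasD(2)[OF Z] by (intro borel_measurable_sum borel_measurable_times borel_measurable_const) auto
 qed
 show ?thesis unfolding estim_def by (intro borel_measurable_divide borel_measurable_sum borel_measurable_power s borel_measurable_const)
qed

lemma accurate_measurable:
 assumes A: "A \<in> carrier_mat n d" and Z: "mmeas M d Z" and b: "b \<in> borel_measurable M" and u: "\<And>i. (\<lambda>x. u x i) \<in> borel_measurable M"
  and xi: "\<And>i. (\<lambda>x. \<xi> x i) \<in> borel_measurable M"
 shows "Measurable.pred M (\<lambda>x. accurate A e (Z x) (b x) (u x) m (\<xi> x))"
proof -
 let ?V = "row A ` {..<dim_row A} \<union> unit_vec (dim_col A) ` {..<dim_col A}"
 have fin: "finite ?V" by simp
 have V: "v \<in> carrier_vec d" if "v \<in> ?V" for v using that A by (auto intro: row_carrier_vec)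
 show ?thesis unfolding accurate_def
 proof (rule pred_intros_finite(3)[OF fin])
  fix v assume "v \<in> ?V"
  note v = V[OF this]
  note [measurable] = estim_measurable[OF A Z b u xi v, where m = m] Qv_measurable[OF A Z b u v]
  show "Measurable.pred M (\<lambda>x. (1 - e) * Qv A (Z x) (b x) (u x) v \<le> estim A (Z x) (b x) (u x) m (\<xi> x) v \<and>
   estim A (Z x) (b x) (u x) m (\<xi> x) v \<le> (1 + e) * Qv A (Z x) (b x) (u x) v)" by measurable
 qed
qed

lemma rat_seq: "\<exists>r :: nat \<Rightarrow> rat. (\<lambda>k. of_rat (r k) :: real) \<longlonglongrightarrow> a"
proof -
 have "\<exists>q :: rat. a < of_rat q \<and> of_rat q < a + 1 / real (Suc k)" for k by (rule of_rat_dense) simp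
 then have "\<forall>k. \<exists>q :: rat. a < of_rat q \<and> of_rat q < a + 1 / real (Suc k)" by blast
 from choice[OF this] obtain r :: "nat \<Rightarrow> rat" where r: "\<forall>k. a < of_rat (r k) \<and> of_rat (r k) < a + 1 / real (Suc k)" ..
 have "(\<lambda>k. a + 1 / real (Suc k)) \<longlonglongrightarrow> a + 0" by (intro tendsto_add tendsto_const LIMSEQ_inverse_real_of_nat[unfolded inverse_eq_divide])
 then have lim: "(\<lambda>k. a + 1 / real (Suc k)) \<longlonglongrightarrow> a" by simp
 have "(\<lambda>k. of_rat (r k) :: real) \<longlonglongrightarrow> a"
 proof (rule tendsto_sandwich[OF _ _ tendsto_const lim])
  show "\<forall>\<^sub>F k in sequentially. a \<le> of_rat (r k)" by (rule always_eventually) (metis r less_imp_le)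
  show "\<forall>\<^sub>F k in sequentially. of_rat (r k) \<le> a + 1 / real (Suc k)" by (rule always_eventually) (metis r less_imp_le)
 qed
 then show ?thesis by blast
qed

definition rvec :: "nat \<Rightarrow> rat list \<Rightarrow> real vec" where
 "rvec d l = vec d (\<lambda>i. of_rat (l ! i))"

lemma rvec_carrier[simp]: "rvec d l \<in> carrier_vec d"
 by (simp add: rvec_def)

lemma rvec_dense:
 assumes "(v :: real vec) \<in> carrier_vec d"
 obtains l where "\<And>i. i < d \<Longrightarrow> (\<lambda>k. (rvec d (l k)) $ i) \<longlonglongrightarrow> v $ i"
proof -
 have "\<forall>i. \<exists>r :: nat \<Rightarrow> rat. (\<lambda>k. of_rat (r k) :: real) \<longlonglongrightarrow> v $ i" using rat_seq by blast
 from choice[OF this] obtain r where r: "\<forall>i. (\<lambda>k. of_rat (r i k :: rat) :: real) \<longlonglongrightarrow> v $ i" ..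
 have "(\<lambda>k. (rvec d (map (\<lambda>i. r i k) [0..<d])) $ i) \<longlonglongrightarrow> v $ i" if "i < d" for i
  using r that by (simp add: rvec_def)
 then show ?thesis using that[of "\<lambda>k. map (\<lambda>i. r i k) [0..<d]"] by blast
qed

lemma qf_tendsto:
 assumes M: "M \<in> carrier_mat d d" and v: "v \<in> carrier_vec d" and l: "\<And>k. w k \<in> carrier_vec d"
  and lim: "\<And>i. i < d \<Longrightarrow> (\<lambda>k. (w k) $ i) \<longlonglongrightarrow> v $ i"
 shows "(\<lambda>k. qf M (w k)) \<longlonglongrightarrow> qf M v"
 unfolding qf_sum[OF M v] qf_sum[OF M l] by (intro tendsto_intros lim) auto

text \<open>Conditions on countably many rational vectors replace the spectrum, so that success
  becomes measurable; density and continuity extend them to all vectors. The uniform constant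
  \<open>N\<close> replaces positivity, because a form that is positive on all rational vectors may
  still vanish at an irrational one.\<close>

lemma pos_def_cond_iff:
 assumes M: "M \<in> carrier_mat d d" "M\<^sup>T = M" and d: "0 < d"
 shows "pos_def M \<and> cond_num M \<le> c \<longleftrightarrow>
  (\<exists>N :: nat. \<forall>l. qf (1\<^sub>m d) (rvec d l) \<le> real N * qf M (rvec d l)) \<and>
  (\<forall>l l'. qf M (rvec d l) * qf (1\<^sub>m d) (rvec d l') \<le> c * qf M (rvec d l') * qf (1\<^sub>m d) (rvec d l))" (is "?L \<longleftrightarrow> ?R")
proof
 assume L: ?L
 then obtain m where m: "0 < m" "1 \<le> cond_num M"
  "\<And>v. v \<in> carrier_vec d \<Longrightarrow> m * (v \<bullet> v) \<le> qf M v" "\<And>v. v \<in> carrier_vec d \<Longrightarrow> qf M v \<le> m * cond_num M * (v \<bullet> v)"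
  using cond_num_witness[OF M(1) _ d] by blast
 obtain N :: nat where N: "1 / m \<le> real N" using real_arch_simple by blast
 have nn: "0 \<le> v \<bullet> v" for v :: "real vec" by (rule scalar_prod_self_nonneg)
 have q0: "0 \<le> qf M v" if "v \<in> carrier_vec d" for v using m(3)[OF that] m(1) nn[of v] mult_nonneg_nonneg[of m "v \<bullet> v"] by linarith
 have 1: "v \<bullet> v \<le> real N * qf M v" if v: "v \<in> carrier_vec d" for v
 proof -
  have "v \<bullet> v = 1 / m * (m * (v \<bullet> v))" using m by simp
  also have "\<dots> \<le> real N * qf M v" using N m(1,3) v nn by (intro mult_mono) auto
  finally show ?thesis .
 qed
 have 2: "qf M u * (v \<bullet> v) \<le> c * qf M v * (u \<bullet> u)" if u: "u \<in> carrier_vec d" and v: "v \<in> carrier_vec d" for u v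
 proof -
  have "qf M u * (v \<bullet> v) \<le> m * cond_num M * (u \<bullet> u) * (v \<bullet> v)" using m(4)[OF u] nn by (intro mult_right_mono) auto
  also have "\<dots> = cond_num M * (u \<bullet> u) * (m * (v \<bullet> v))" by simp
  also have "\<dots> \<le> cond_num M * (u \<bullet> u) * qf M v" using m(2) m(3)[OF v] nn[of u] by (intro mult_left_mono) auto
  also have "\<dots> \<le> c * (u \<bullet> u) * qf M v" using L q0[OF v] nn[of u] by (intro mult_right_mono) auto
  finally show ?thesis by (simp add: mult_ac)
 qed
 show ?R using 1 2 by (auto simp: qf_def intro!: exI[of _ N])
next
 assume R: ?R
 then obtain N :: nat where N: "\<And>l. qf (1\<^sub>m d) (rvec d l) \<le> real N * qf M (rvec d l)" by blast
 have one: "(1\<^sub>m d :: real mat) \<in> carrier_mat d d" by simp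
 have 1: "qf (1\<^sub>m d) v \<le> real N * qf M v" if v: "v \<in> carrier_vec d" for v
 proof -
  obtain l where l: "\<And>i. i < d \<Longrightarrow> (\<lambda>k. (rvec d (l k)) $ i) \<longlonglongrightarrow> v $ i" using rvec_dense[OF v] by blast
  have "(\<lambda>k. qf (1\<^sub>m d) (rvec d (l k))) \<longlonglongrightarrow> qf (1\<^sub>m d) v" by (rule qf_tendsto[OF one v _ l]) auto
  moreover have "(\<lambda>k. real N * qf M (rvec d (l k))) \<longlonglongrightarrow> real N * qf M v" by (intro tendsto_mult tendsto_const qf_tendsto[OF M(1) v _ l]) auto
  ultimately show ?thesis by (rule LIMSEQ_le) (use N in auto)
 qed
 have 2: "qf M u * qf (1\<^sub>m d) v \<le> c * qf M v * qf (1\<^sub>m d) u" if u: "u \<in> carrier_vec d" and v: "v \<in> carrier_vec d" for u v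
 proof -
  obtain l where l: "\<And>i. i < d \<Longrightarrow> (\<lambda>k. (rvec d (l k)) $ i) \<longlonglongrightarrow> v $ i" using rvec_dense[OF v] by blast
  obtain l' where l': "\<And>i. i < d \<Longrightarrow> (\<lambda>k. (rvec d (l' k)) $ i) \<longlonglongrightarrow> u $ i" using rvec_dense[OF u] by blast
  have "(\<lambda>k. qf M (rvec d (l' k)) * qf (1\<^sub>m d) (rvec d (l k))) \<longlonglongrightarrow> qf M u * qf (1\<^sub>m d) v"
   by (intro tendsto_mult qf_tendsto[OF M(1) u _ l'] qf_tendsto[OF one v _ l]) auto
  moreover have "(\<lambda>k. c * qf M (rvec d (l k)) * qf (1\<^sub>m d) (rvec d (l' k))) \<longlonglongrightarrow> c * qf M v * qf (1\<^sub>m d) u"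
   by (intro tendsto_mult tendsto_const qf_tendsto[OF M(1) v _ l] qf_tendsto[OF one u _ l']) auto
  ultimately show ?thesis by (rule LIMSEQ_le) (use R in auto)
 qed
 obtain U f where U: "orth d U" "M = fc U f" using spectral_fc[OF M] by blast
 \<comment> \<open>An eigenvector of the smallest eigenvalue turns the cross-multiplied inequality
   into the upper bound \<open>c * f i0\<close>.\<close>
 obtain i0 where i0: "i0 < d" "\<And>i. i < d \<Longrightarrow> f i0 \<le> f i"
 proof -
  have "finite (f ` {..<d})" "f ` {..<d} \<noteq> {}" using d by auto
  then have "Min (f ` {..<d}) \<in> f ` {..<d}" by (rule Min_in)
  then obtain i0 where "i0 < d" "f i0 = Min (f ` {..<d})" by auto
  then show ?thesis using that[of i0] by simp
 qed
 have c0: "col U i0 \<in> carrier_vec d" "col U i0 \<bullet> col U i0 = 1" using col_orth[OF U(1) i0(1)] by auto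
 have qc: "qf M (col U i0) = f i0" unfolding U(2) by (rule qf_col[OF U(1) i0(1)])
 have o: "qf (1\<^sub>m d) v = v \<bullet> v" if "v \<in> carrier_vec d" for v :: "real vec" using that by (simp add: qf_def)
 have "1 \<le> real N * f i0" using 1[OF c0(1)] qc c0 by (simp add: o)
 then have f0: "0 < f i0" using mult_nonneg_nonpos[of "real N" "f i0"] by linarith
 have lo: "f i0 * (v \<bullet> v) \<le> qf M v" if "v \<in> carrier_vec d" for v unfolding U(2) by (rule qf_fc_ge[OF U(1) that i0(2)])
 have up: "qf M v \<le> (c * f i0) * (v \<bullet> v)" if "v \<in> carrier_vec d" for v using 2[OF that c0(1)] qc c0 by (simp add: o that)
 show ?L using cond_num_le[OF M d f0 lo up] f0 by simp
qed

lemma good_scaling_measurable: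
 assumes A: "A \<in> carrier_mat n d" and d: "0 < d" and w: "\<And>i. (\<lambda>x. w x i) \<in> borel_measurable M"
 shows "Measurable.pred M (\<lambda>x. good_scaling \<epsilon> A (vec n (w x)))"
proof -
 note [measurable] = w
 have g: "mmeas M d (\<lambda>x. gram A (w x))" by (rule mmeas_gram[OF A w])
 note [measurable] = qf_measurable[OF g rvec_carrier]
 have eq: "good_scaling \<epsilon> A (vec n (w x)) \<longleftrightarrow> (\<forall>i\<in>{..<n}. 0 \<le> w x i) \<and>
  (\<exists>N :: nat. \<forall>l. qf (1\<^sub>m d) (rvec d l) \<le> real N * qf (gram A (w x)) (rvec d l)) \<and>
  (\<forall>l l'. qf (gram A (w x)) (rvec d l) * qf (1\<^sub>m d) (rvec d l') \<le> (1 + \<epsilon>) * opt_inner_cond A * qf (gram A (w x)) (rvec d l') * qf (1\<^sub>m d) (rvec d l))" for x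
 proof -
  have dd: "dim_row A = n" using A by simp
  have "scaled_gram A (mat_diag n (vec_index (vec n (w x)))) = gram A (w x)"
   using gram_cong[OF A, of "vec_index (vec n (w x))" "w x"] A by (simp add: gram_def)
  then show ?thesis
   unfolding good_scaling_def Let_def dd pos_def_cond_iff[OF gram_carrier[OF A] gram_sym[OF A] d, symmetric] by auto
 qed
 show ?thesis unfolding eq by measurable
qed

section \<open>The machine program and its runs\<close>

definition prologue :: program where
 "prologue = [NConst 2 0, NConst 3 1, NConst 6 nregs] @ map (\<lambda>j. NAdd (7 + j) (6 + j) 0) [0..<narrs - 1]"

definition Lhead :: "nat \<Rightarrow> nat" where
 "Lhead E = length prologue + csize (init0 E)"

text \<open>Until the last instruction cell 0 holds \<open>n\<close>, from which the prologue has
  built the array addresses by repeated addition. At the end it must hold the output address, which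
  is that of array 0.\<close>

definition prog :: "nat \<Rightarrow> program" where
 "prog E = prologue @ comp (length prologue) (init0 E) @ comp (Lhead E) (Wh (TR 15 1) body) @ [NConst 0 nregs]"

lemma prologue_length: "length prologue = narrs + 2"
 by (simp add: prologue_def narrs_def)

lemma wf_init0: "wf (init0 E)"
 by (simp add: init0_def setk_def setm_def VFill_def VSum_def For_def nregs_def narrs_def)

lemma wf_body: "wf body"
 by (simp add: body_def sketch_def sk1_def opP_def opC_def VCheb_def VAcc_def postC_def postP_def postT_def setk_def setm_def VFill_def VSum_def
  VSc_def VBin_def VRt_def VGau_def VThr_def For_def nregs_def narrs_def)

lemma code_at_prog:
 "code_at (prog E) 0 prologue" "code_at (prog E) (length prologue) (comp (length prologue) (init0 E))"
 "code_at (prog E) (Lhead E) (comp (Lhead E) (Wh (TR 15 1) body))"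
 "code_at (prog E) (Lhead E + csize body + 3) [NConst 0 nregs]"
proof -
 have "code_at (prog E) 0 (prog E)" by (simp add: code_at_def)
 then have "code_at (prog E) 0 (prologue @ comp (length prologue) (init0 E) @ comp (Lhead E) (Wh (TR 15 1) body) @ [NConst 0 nregs])"
  by (subst (asm) (2) prog_def)
 then show "code_at (prog E) 0 prologue" "code_at (prog E) (length prologue) (comp (length prologue) (init0 E))"
  "code_at (prog E) (Lhead E) (comp (Lhead E) (Wh (TR 15 1) body))" "code_at (prog E) (Lhead E + csize body + 3) [NConst 0 nregs]"
  unfolding code_at_append by (simp_all del: comp.simps add: Lhead_def add.assoc)
qed

lemma length_prog: "length (prog E) = Lhead E + csize body + 4"
 by (simp add: prog_def Lhead_def)

lemma code_at_Cons: "code_at P p (i # is) \<longleftrightarrow> code_at P p [i] \<and> code_at P (Suc p) is"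
 using code_at_append[of P p "[i]" "is"] by simp

lemma step_code:
 assumes "code_at P p [i]" "pc s = p"
 shows "step P A T rnd s = exec A rnd i (s\<lparr>pc := Suc p, clock := clock s + cost T i\<rparr>)"
 using code_at_single[OF assms(1)] assms(2) by (simp add: step_def halted_def)

context prog_context
begin

definition s_start :: "real \<Rightarrow> nat \<Rightarrow> nat \<Rightarrow> nat \<Rightarrow> state" where
 "s_start \<delta> p c j = \<lparr>pc = p, nmem = (\<lambda>a. if a = 0 then n else if a = 1 then d else if a = 3 then 1 else if 6 \<le> a \<and> a < 6 + j then nregs + (a - 6) * n else 0),
   rmem = (\<lambda>_. 0)(0 := \<delta>), draws = 0, clock = c\<rparr>"

lemma prologue_steps:
 fixes E :: nat
 defines "P \<equiv> prog E"
 shows "j \<le> narrs - 1 \<Longrightarrow> (step P A T rnd ^^ (3 + j)) (init A \<delta>) = s_start \<delta> (3 + j) (3 + j) (Suc j)"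
  and "i \<le> 3 + j \<Longrightarrow> j \<le> narrs - 1 \<Longrightarrow> pc ((step P A T rnd ^^ i) (init A \<delta>)) = i"
proof -
 have c: "code_at P 0 prologue" unfolding P_def by (rule code_at_prog)
 then have c012: "code_at P 0 [NConst 2 0]" "code_at P (Suc 0) [NConst 3 1]" "code_at P (Suc (Suc 0)) [NConst 6 nregs]"
  and c3: "code_at P 3 (map (\<lambda>j. NAdd (7 + j) (6 + j) 0) [0..<narrs - 1])"
  unfolding prologue_def by (simp_all add: code_at_Cons[of P _ _ "_ # _"] code_at_Cons[of P _ _ "map _ _"] numeral_3_eq_3)
 have cj: "code_at P (3 + j) [NAdd (7 + j) (6 + j) 0]" if "j < narrs - 1" for j
 proof -
  have "[0..<narrs - 1] = [0..<j] @ j # [Suc j..<narrs - 1]"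
   using upt_add_eq_append[of 0 j "narrs - 1 - j"] upt_conv_Cons[of j "narrs - 1"] that by simp
  then have "map (\<lambda>j. NAdd (7 + j) (6 + j) 0) [0..<narrs - 1] = map (\<lambda>j. NAdd (7 + j) (6 + j) 0) [0..<j] @ [NAdd (7 + j) (6 + j) 0] @ map (\<lambda>j. NAdd (7 + j) (6 + j) 0) [Suc j..<narrs - 1]"
   by simp
  with c3 show ?thesis by (simp only: code_at_append) simp
 qed
 have 1: "step P A T rnd (init A \<delta>) = s_start \<delta> 1 1 0\<lparr>nmem := (\<lambda>_. 0)(0 := n, 1 := d)\<rparr>"
  using step_code[OF c012(1), of "init A \<delta>" A T rnd] by (auto simp: init_def s_start_def dim)
 have 2: "step P A T rnd (step P A T rnd (init A \<delta>)) = s_start \<delta> 2 2 0"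
  unfolding 1 by (subst step_code[OF c012(2)]) (auto simp: s_start_def)
 have 3: "step P A T rnd (step P A T rnd (step P A T rnd (init A \<delta>))) = s_start \<delta> 3 3 1"
  unfolding 2 by (subst step_code[OF c012(3)]) (auto simp: s_start_def)
 have main: "(step P A T rnd ^^ (3 + j)) (init A \<delta>) = s_start \<delta> (3 + j) (3 + j) (Suc j)" if "j \<le> narrs - 1" for j
  using that
 proof (induction j)
  case 0
  then show ?case using 3 by (simp add: numeral_3_eq_3)
 next
  case (Suc j)
  have "(step P A T rnd ^^ (3 + Suc j)) (init A \<delta>) = step P A T rnd (s_start \<delta> (3 + j) (3 + j) (Suc j))"
  proof -
   have "3 + Suc j = Suc (3 + j)" by simp
   then show ?thesis using Suc by (simp only: funpow.simps o_apply)
  qed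
  also have "\<dots> = s_start \<delta> (3 + Suc j) (3 + Suc j) (Suc (Suc j))"
   using Suc.prems by (subst step_code[OF cj]) (auto simp: s_start_def fun_eq_iff)
  finally show ?case .
 qed
 then show "j \<le> narrs - 1 \<Longrightarrow> (step P A T rnd ^^ (3 + j)) (init A \<delta>) = s_start \<delta> (3 + j) (3 + j) (Suc j)" .
 assume i: "i \<le> 3 + j" "j \<le> narrs - 1"
 consider "i = 0" | "i = 1" | "i = 2" | l where "i = 3 + l" "l \<le> narrs - 1"
 proof -
  have "i = 0 \<or> i = 1 \<or> i = 2 \<or> (i = 3 + (i - 3) \<and> i - 3 \<le> narrs - 1)" using i by linarith
  then show ?thesis using that by blast
 qed
 then show "pc ((step P A T rnd ^^ i) (init A \<delta>)) = i"
 proof cases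
  case 1 then show ?thesis by (simp add: init_def)
 next
  case 2 then show ?thesis using 1 by (simp add: s_start_def)
 next
  case 3 then show ?thesis using 2 by (simp add: s_start_def numeral_2_eq_2)
 next
  case (4 l) then show ?thesis using main[of l] by (simp add: s_start_def)
 qed
qed

definition h_of :: "state \<Rightarrow> hst" where
 "h_of s = \<lparr>sc = rmem s, vc = (\<lambda>j i. rmem s (nregs + j * n + i)), ix = 0, dr = draws s, ct = 0\<rparr>"

lemma run_init:
 fixes E :: nat
 defines "P \<equiv> prog E"
 obtains s1 where "pc s1 = length prologue" "clock s1 = length prologue" "sim A s1 (h_of s1)" "sc (h_of s1) 0 = \<delta>"
  "(step P A T rnd ^^ length prologue) (init A \<delta>) = s1" "\<And>i. i < length prologue \<Longrightarrow> pc ((step P A T rnd ^^ i) (init A \<delta>)) = i"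
proof -
 let ?s = "s_start \<delta> (narrs + 2) (narrs + 2) narrs"
 have l: "length prologue = 3 + (narrs - 1)" "Suc (narrs - 1) = narrs" by (simp_all add: prologue_length narrs_def)
 have s: "(step P A T rnd ^^ length prologue) (init A \<delta>) = ?s"
  unfolding l(1) P_def using prologue_steps(1)[of "narrs - 1" E \<delta>] by (simp add: narrs_def)
 show ?thesis
 proof (rule that[of ?s, OF _ _ _ _ s])
  show "sim A ?s (h_of ?s)" by (auto simp: sim_def h_of_def s_start_def dim)
  show "pc ((step P A T rnd ^^ i) (init A \<delta>)) = i" if "i < length prologue" for i
   unfolding P_def by (rule prologue_steps(2)[of i "narrs - 1"]) (use that l in auto)
 qed (auto simp: s_start_def h_of_def prologue_length)
qed

text \<open>Besides the simulation it records that the loop head is not visited strictly in between.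
  This identifies the visit with sketch counter \<open>j\<close> as the first one with that
  counter.\<close>

lemma run_body:
 fixes E :: nat
 defines "P \<equiv> prog E"
 assumes s: "pc s = Lhead E" "sim A s h" "sc h 15 < sc h 1" and w: "WP body Q h"
 obtains k h' where "0 < k" "pc ((step P A T rnd ^^ k) s) = Lhead E" "sim A ((step P A T rnd ^^ k) s) h'" "Q h'"
  "clock ((step P A T rnd ^^ k) s) + ct h \<le> clock s + ct h' + 2" "\<And>i. 0 < i \<Longrightarrow> i < k \<Longrightarrow> pc ((step P A T rnd ^^ i) s) \<noteq> Lhead E"
proof -
 let ?L = "Lhead E" and ?st = "step P A T rnd"
 obtain h' where h': "big A T rnd body h h'" "Q h'" using w unfolding wp_def by blast
 have "code_at P ?L (jmp (TR 15 1) (?L + 2) # JumpNLess 2 3 (?L + csize body + 3) # comp (?L + 2) body @ [JumpNLess 2 3 ?L])"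
  using code_at_prog(3)[of E] unfolding P_def by simp
 then have c1: "code_at P ?L [jmp (TR 15 1) (?L + 2)]" and c2: "code_at P (?L + 2) (comp (?L + 2) body)" and c3: "code_at P (?L + 2 + csize body) [JumpNLess 2 3 ?L]"
  by (simp_all add: code_at_Cons[of P _ _ "_ # _"] code_at_Cons[of P _ _ "_ @ _"] code_at_append)
 define s1 where "s1 = ?st s"
 have s1: "pc s1 = ?L + 2" "sim A s1 h" "clock s1 = clock s + 1"
  unfolding s1_def using step_code[OF c1 s(1), of A T rnd] s(2,3) by (auto simp: sim_def nregs_def)
 obtain s2 where s2: "reach P A T rnd (?L + 2) (?L + 2 + csize body) s1 s2" "sim A s2 h'" "pc s2 = ?L + 2 + csize body" "clock s2 + ct h \<le> clock s1 + ct h'"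
  using comp_correct[OF h'(1) wf_body c2 s1(2,1) dim(1)] by blast
 obtain k where k: "(?st ^^ k) s1 = s2" "\<And>i. i < k \<Longrightarrow> ?L + 2 \<le> pc ((?st ^^ i) s1)" using s2(1) unfolding reach_def by blast
 have s3: "pc (?st s2) = ?L" "sim A (?st s2) h'" "clock (?st s2) = clock s2 + 1"
  using step_code[OF c3 s2(3), of A T rnd] s2(2) by (auto simp: sim_def)
 have sh: "(?st ^^ Suc i) s = (?st ^^ i) s1" for i unfolding s1_def by (simp add: funpow_swap1)
 have e: "(?st ^^ Suc (Suc k)) s = ?st s2" using sh[of "Suc k"] k(1) by simp
 show ?thesis
 proof (rule that[of "Suc (Suc k)" h'])
  fix i assume i: "0 < i" "i < Suc (Suc k)"
  then obtain j where j: "i = Suc j" "j \<le> k" by (cases i) auto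
  show "pc ((?st ^^ i) s) \<noteq> ?L" unfolding j(1) sh using j(2) k(1) k(2)[of j] s2(3) by (cases "j = k") auto
 qed (use e s3 s2 s1 h' in simp_all)
qed

lemma run_exit:
 fixes E :: nat
 defines "P \<equiv> prog E"
 assumes s: "pc s = Lhead E" "sim A s h" "\<not> sc h 15 < sc h 1"
 shows "halted P ((step P A T rnd ^^ 3) s)" "clock ((step P A T rnd ^^ 3) s) = clock s + 3"
  "read_vec (rmem ((step P A T rnd ^^ 3) s)) (nmem ((step P A T rnd ^^ 3) s) 0) n = vec n (vc h 0)"
proof -
 let ?L = "Lhead E" and ?st = "step P A T rnd"
 have "code_at P ?L (jmp (TR 15 1) (?L + 2) # JumpNLess 2 3 (?L + csize body + 3) # comp (?L + 2) body @ [JumpNLess 2 3 ?L])"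
  using code_at_prog(3)[of E] unfolding P_def by simp
 then have c1: "code_at P ?L [jmp (TR 15 1) (?L + 2)]" and c2: "code_at P (Suc ?L) [JumpNLess 2 3 (?L + csize body + 3)]"
  by (simp_all add: code_at_Cons[of P _ _ "_ # _"] code_at_Cons[of P _ _ "_ @ _"] code_at_append)
 note c3 = code_at_prog(4)[of E, folded P_def]
 define s1 where "s1 = ?st s"
 have s1: "pc s1 = Suc ?L" "sim A s1 h" "clock s1 = clock s + 1"
  unfolding s1_def using step_code[OF c1 s(1), of A T rnd] s(2,3) by (auto simp: sim_def nregs_def)
 define s2 where "s2 = ?st s1"
 have s2: "pc s2 = ?L + csize body + 3" "sim A s2 h" "clock s2 = clock s + 2"
  unfolding s2_def using step_code[OF c2 s1(1), of A T rnd] s1 by (auto simp: sim_def)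
 have e: "(?st ^^ 3) s = ?st s2" unfolding s2_def s1_def by (simp add: numeral_3_eq_3)
 have s3: "?st s2 = exec A rnd (NConst 0 nregs) (s2\<lparr>pc := Suc (?L + csize body + 3), clock := clock s2 + cost T (NConst 0 nregs)\<rparr>)"
  by (rule step_code[OF c3 s2(1)])
 show "halted P ((?st ^^ 3) s)" "clock ((?st ^^ 3) s) = clock s + 3" unfolding e s3 unfolding halted_def P_def length_prog using s2 by simp_all
 have "rmem s2 (nregs + i) = vc h 0 i" if "i < n" for i
 proof -
  have "\<forall>j<narrs. \<forall>i<n. rmem s2 (nregs + j * n + i) = vc h j i" using s2(2) by (simp add: sim_def dim)
  from this[rule_format, of 0 i] show ?thesis using that by (simp add: narrs_def)
 qed
 then show "read_vec (rmem ((?st ^^ 3) s)) (nmem ((?st ^^ 3) s) 0) n = vec n (vc h 0)"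
  unfolding e s3 by (auto simp: read_vec_def)
qed

end

section \<open>Failure events and the run of the main loop\<close>

definition hd_at :: "nat \<Rightarrow> nat \<Rightarrow> state \<Rightarrow> bool" where
 "hd_at E j s \<longleftrightarrow> pc s = Lhead E \<and> rmem s 16 = real j"

definition u_of :: "nat \<Rightarrow> state \<Rightarrow> nat \<Rightarrow> real" where
 "u_of n s = (\<lambda>i. rmem s (nregs + n + i))"

text \<open>The side conditions on the registers hold at the loop head of every run without an
  earlier failure. Building them into the event makes its probability small for every fixed state,
  as the independence lemma demands.\<close>

definition bad_at :: "real mat \<Rightarrow> nat \<Rightarrow> real \<Rightarrow> nat \<Rightarrow> state \<Rightarrow> rseq \<Rightarrow> bool" where
 "bad_at A E \<delta> j s \<xi> \<longleftrightarrow> (\<exists>kc pw m mk. rmem s 12 = real kc \<and> rmem s 13 = real pw \<and> rmem s 14 = real m \<and> m = 8 * E * E * Suc mk \<and>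
   4 * ((real j + 1) * (real j + 2) * real (dim_row A)) / \<delta> \<le> 2 ^ mk \<and> (\<forall>i\<in>{..<dim_row A}. 0 \<le> u_of (dim_row A) s i) \<and>
   \<not> accurate A (1 / real E) (opM A (rmem s 10) (rmem s 11) kc (rmem s 8) (u_of (dim_row A) s) ^\<^sub>m pw) (rmem s 9) (u_of (dim_row A) s) m \<xi>)"

abbreviation "failure_at A T E \<delta> j \<equiv> trajectory.first_bad (prog E) A T (init A \<delta>) (hd_at E j) (bad_at A E \<delta> j)"

lemma accurate_cong:
 assumes A: "A \<in> carrier_mat n d" and u: "\<And>i. i < n \<Longrightarrow> u i = u' i"
 shows "accurate A e (opM A a b kc md u ^\<^sub>m pw) c u m \<xi> = accurate A e (opM A a b kc md u' ^\<^sub>m pw) c u' m \<xi>"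
proof -
 have g: "gram A u = gram A u'" by (rule gram_cong[OF A u])
 have o: "opM A a b kc md u = opM A a b kc md u'" by (simp add: opM_def g)
 have "start_vec A c u \<zeta> = start_vec A c u' \<zeta>" for \<zeta>
  unfolding start_vec_def Atf_def using A u by (intro arg_cong2[of _ _ _ _ vec] ext arg_cong2[of _ _ _ _ "(+)"] sum.cong) auto
 then have "estim A Z c u m \<xi> v = estim A Z c u' m \<xi> v" for Z v unfolding estim_def samp_def by simp
 moreover have "Qv A Z c u v = Qv A Z c u' v" for Z v unfolding Qv_def covm_def g ..
 ultimately show ?thesis unfolding accurate_def o by simp
qed

context scaling_program
begin

lemma Inv_u_nonneg:
 assumes "Inv g s ro h" "i < n" shows "0 \<le> vc h 1 i"
proof (cases ro)
 case None
 then have "ghead g s h" "mode0 h" using assms(1) by auto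
 then show ?thesis using assms(2) unfolding ghead_def coverinv_def mode0_def by auto
next
 case (Some R)
 then have gh: "ghead g s h" and m1: "mode1 R h" using assms(1) by auto
 obtain kc where kc: "kpar n E p kc h" using gh unfolding ghead_def by blast
 have k1: "1 \<le> sc h 7" by (rule kap1[OF gh])
 have z: "0 \<le> sc h 21" unfolding kparD(6)[OF kc] using k1 by (intro divide_nonneg_nonneg mult_nonneg_nonneg zero_le_power) auto
 have pk: "packinv (vc h 4) (sc h 21) R (vc h 3)" using m1 unfolding mode1_def by blast
 obtain cnt :: "nat \<Rightarrow> nat" where "\<forall>i<n. vc h 3 i = (if vc h 4 i = 0 then 0 else sc h 21 * (1 + e / real p) ^ cnt i)"
  using pk unfolding packinv_def by (elim exE conjE) (rule that)
 then have "0 \<le> vc h 3 i" using assms(2) z e by simp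
 moreover obtain U f where "RRok (sc h 7) (Pm U f) (vc h 4)" using m1 unfolding mode1_def by blast
 then have "0 \<le> vc h 4 i" using RRok_row assms(2) unfolding RRrow_def by blast
 ultimately show ?thesis using m1 assms(2) unfolding mode1_def by simp
qed

lemma Inv_cregs: "Inv g s ro h \<Longrightarrow> cregs n E p \<delta> h \<and> sc h 15 = 0"
 by (cases ro) (auto simp: ghead_def)

end

context scaling_counters
begin

abbreviation "stp \<equiv> step (prog E) A T rnd"
abbreviation "st q \<equiv> (stp ^^ q) (init A \<delta>)"

lemma not_bad_acc:
 assumes s: "sim A s h" and I: "Inv g r ro h" and mk: "mpar n E \<delta> mk h" and c: "sc h 16 = real c"
  and nb: "\<not> bad_at A E \<delta> c s (\<lambda>l. rnd (draws s + l))"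
 shows "acc h"
 unfolding acc_def
proof (intro allI impI)
 fix kc pw m assume r: "sc h 12 = real kc" "sc h 13 = real pw" "sc h 14 = real m"
 have rm: "rmem s i = sc h i" if "i < 50" for i using s that by (simp add: sim_def nregs_def)
 have u: "u_of n s i = vc h 1 i" if "i < n" for i
 proof -
  have "\<forall>j<narrs. \<forall>i<n. rmem s (nregs + j * n + i) = vc h j i" using s by (simp add: sim_def dim)
  from this[rule_format, of 1 i] show ?thesis using that by (simp add: narrs_def u_of_def)
 qed
 have dr: "draws s = dr h" using s by (simp add: sim_def)
 have m: "m = 8 * E * E * Suc mk"
 proof -
  have "real m = real (8 * E * E * Suc mk)" using mk r(3) unfolding mpar_def Let_def by (simp add: algebra_simps)
  then show ?thesis by (simp only: of_nat_eq_iff)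
 qed
 have x: "4 * ((real c + 1) * (real c + 2) * real n) / \<delta> \<le> 2 ^ mk" using mk c unfolding mpar_def Let_def by simp
 have u0: "0 \<le> u_of n s i" if "i < n" for i using Inv_u_nonneg[OF I that] u[OF that] by simp
 have "accurate A (1 / real E) (opM A (rmem s 10) (rmem s 11) kc (rmem s 8) (u_of n s) ^\<^sub>m pw) (rmem s 9) (u_of n s) m (\<lambda>l. rnd (draws s + l))"
 proof (rule ccontr)
  assume na: "\<not> ?thesis"
  have "bad_at A E \<delta> c s (\<lambda>l. rnd (draws s + l))" unfolding bad_at_def dim
  proof (intro exI conjI)
   show "rmem s 12 = real kc" "rmem s 13 = real pw" "rmem s 14 = real m" by (simp_all add: rm r)
   show "\<forall>i\<in>{..<n}. 0 \<le> u_of n s i" using u0 by simp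
  qed (rule m x na)+
  then show False using nb by simp
 qed
 then have "accurate A e (opM A (sc h 10) (sc h 11) kc (sc h 8) (u_of n s) ^\<^sub>m pw) (sc h 9) (u_of n s) m (\<lambda>l. rnd (dr h + l))"
  by (simp add: rm e_def dr)
 then show "accurate A e (opM A (sc h 10) (sc h 11) kc (sc h 8) (vc h 1) ^\<^sub>m pw) (sc h 9) (vc h 1) m (\<lambda>l. rnd (dr h + l))"
  using accurate_cong[OF A, of "u_of n s" "vc h 1"] u by blast
qed

text \<open>The induction is on the number of sketches left. By \<open>first\<close>, earlier visits
  of the loop head had smaller counters, so the present one is the first with counter
  \<open>c\<close>, and excluding the failure event yields accuracy of the next sketch.\<close>

lemma run_loop:
 assumes nb: "\<And>j. rnd \<notin> failure_at A T E \<delta> j"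
 assumes s: "pc (st q) = Lhead E" "sim A (st q) h" "InvC g r ro h" "sc h 16 = real c" "c \<le> Nmax"
  and first: "\<And>q'. q' < q \<Longrightarrow> pc (st q') = Lhead E \<Longrightarrow> \<exists>c'<c. rmem (st q') 16 = real c'"
  and cl: "clock (st q) \<le> C0 + cbound g r ro"
 shows "\<exists>q. halted (prog E) (st q) \<and> clock (st q) \<le> C0 + Cmax + 3 \<and> good_scaling \<epsilon> A (read_vec (rmem (st q)) (nmem (st q) 0) n)"
 using s first cl
proof (induction "Nmax - c" arbitrary: q h g r ro c rule: less_induct)
 case less
 note s = less.prems(1-5) and first = less.prems(6) and cl = less.prems(7)
 interpret tr: trajectory "prog E" A T "init A \<delta>" .
 have Inv: "Inv g r ro h" and mpar: "\<exists>mk. mpar n E \<delta> mk h" using s(3) unfolding InvC_def by auto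
 then obtain mk where mk: "mpar n E \<delta> mk h" by blast
 have hd: "hd_at E c (st q)" unfolding hd_at_def using s(1,2,4) by (simp add: sim_def nregs_def)
 have nf: "\<not> hd_at E c (st q')" if "q' < q" for q'
 proof
  assume "hd_at E c (st q')"
  then obtain c' where "c' < c" "rmem (st q') 16 = real c'" "rmem (st q') 16 = real c" using first[OF \<open>q' < q\<close>] unfolding hd_at_def by auto
  then show False by simp
 qed
 have "\<not> bad_at A E \<delta> c (st q) (\<lambda>l. rnd (draws (st q) + l))"
  using nb[of c] hd nf unfolding tr.first_bad_def tr.st_def by blast
 then have acc: "acc h" by (rule not_bad_acc[OF s(2) Inv mk s(4)])
 have c1: "sc h 15 < sc h 1" using Inv_cregs[OF Inv] unfolding cregs_def by simp
 define Q where "Q h' \<longleftrightarrow> sc h' 16 = real c + 1 \<and> ((\<exists>g' r' ro'. InvC g' r' ro' h' \<and> ct h' + 2 + cbound g r ro \<le> ct h + cbound g' r' ro') \<or>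
   (cregs n E p \<delta> h' \<and> sc h' 15 = 1 \<and> good_scaling \<epsilon> A (vec n (vc h' 0)) \<and> ct h' + 2 + cbound g r ro \<le> ct h + Cmax))" for h'
 have "WP body Q h" by (rule wp_body[OF s(3) acc]) (use s(4) in \<open>auto simp: Q_def\<close>)
 from run_body[OF s(1,2) c1 this] obtain l h' where l: "0 < l" "pc ((stp ^^ l) (st q)) = Lhead E" "sim A ((stp ^^ l) (st q)) h'" "Q h'"
  "clock ((stp ^^ l) (st q)) + ct h \<le> clock (st q) + ct h' + 2" "\<And>i. 0 < i \<Longrightarrow> i < l \<Longrightarrow> pc ((stp ^^ i) (st q)) \<noteq> Lhead E"
  by metis
 have add: "(stp ^^ i) (st q) = st (i + q)" for i by (simp add: funpow_add)
 note l = l[unfolded add]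
 have c': "sc h' 16 = real (Suc c)" using l(4) unfolding Q_def by simp
 consider (cont) g' r' ro' where "InvC g' r' ro' h'" "ct h' + 2 + cbound g r ro \<le> ct h + cbound g' r' ro'"
  | (fin) "cregs n E p \<delta> h'" "sc h' 15 = 1" "good_scaling \<epsilon> A (vec n (vc h' 0))" "ct h' + 2 + cbound g r ro \<le> ct h + Cmax"
  using l(4) unfolding Q_def by blast
 then show ?case
 proof cases
  case cont
  obtain c'' where "sc h' 16 = real c''" "c'' \<le> bound g' r' ro'" using cont(1) unfolding InvC_def by blast
  then have "Suc c < Nmax" using bound_lt(1)[of g' r' ro' h'] cont(1) c' unfolding InvC_def by auto
  show ?thesis
  proof (rule less.hyps[OF _ l(2,3) cont(1) c'])
   show "Nmax - Suc c < Nmax - c" "Suc c \<le> Nmax" using \<open>Suc c < Nmax\<close> by auto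
   show "\<exists>c'<Suc c. rmem (st q') 16 = real c'" if q': "q' < l + q" "pc (st q') = Lhead E" for q'
   proof (cases "q' < q")
    case True
    then show ?thesis using first[OF True q'(2)] less_Suc_eq by auto
   next
    case False
    then obtain i where i: "q' = i + q" by (metis add.commute le_Suc_ex not_less)
    have "i = 0" using l(6)[of i] q' i by auto
    then show ?thesis using i hd unfolding hd_at_def by auto
   qed
   show "clock (st (l + q)) \<le> C0 + cbound g' r' ro'" using l(5) cl cont(2) by simp
  qed
 next
  case fin
  have ex: "\<not> sc h' 15 < sc h' 1" using fin(1,2) unfolding cregs_def by simp
  note x = run_exit[OF l(2,3) ex]
  have "(stp ^^ 3) (st (l + q)) = st (3 + (l + q))" by (simp only: funpow_add o_apply)
  note x = x[unfolded this]
  show ?thesis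
  proof (intro exI[of _ "3 + (l + q)"] conjI)
   show "clock (st (3 + (l + q))) \<le> C0 + Cmax + 3" using x(2) l(5) cl fin(4) by simp
   show "good_scaling \<epsilon> A (read_vec (rmem (st (3 + (l + q)))) (nmem (st (3 + (l + q))) 0) n)" unfolding x(3) by (rule fin(3))
  qed (rule x(1))
 qed
qed

end

subsection \<open>Running time\<close>

lemma ln_half:
 assumes "0 < b" "b \<le> (1 / 2 :: real)" shows "b / 2 \<le> ln (1 + b)"
proof -
 have "b * b \<le> b * (1 / 2)" using assms by (intro mult_left_mono) auto
 then have "b / 2 \<le> b - b\<^sup>2" by (simp add: power2_eq_square)
 also have "\<dots> \<le> ln (1 + b)" by (rule ln_one_plus_pos_lower_bound) (use assms in auto)
 finally show ?thesis .
qed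

lemma pow_ge:
 assumes "0 < b" "b \<le> (1 / 2 :: real)" "0 < X" "2 * ln X \<le> b * real k" shows "X \<le> (1 + b) ^ k"
proof -
 have "real k * (b / 2) \<le> real k * ln (1 + b)" using ln_half[OF assms(1,2)] by (intro mult_left_mono) auto
 then have "ln X \<le> ln ((1 + b) ^ k)" using assms by (simp add: ln_realpow mult.commute)
 then show ?thesis using assms by (subst (asm) ln_le_cancel_iff) auto
qed

lemma pow_le:
 assumes "0 < b" "b \<le> (1 / 2 :: real)" "(1 + b) ^ k \<le> X" shows "b * real k \<le> 2 * ln X"
proof -
 have "0 < (1 + b) ^ k" using assms by simp
 then have "ln ((1 + b) ^ k) \<le> ln X" using assms(3) by (subst ln_le_cancel_iff) auto
 moreover have "real k * (b / 2) \<le> real k * ln (1 + b)" using ln_half[OF assms(1,2)] by (intro mult_left_mono) auto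
 ultimately show ?thesis using assms by (simp add: ln_realpow mult.commute)
qed

lemma nat_above:
 assumes "0 \<le> (x::real)" obtains k :: nat where "x \<le> real k" "real k \<le> x + 1"
 using that[of "nat \<lceil>x\<rceil>"] assms by linarith

lemma ln_le_self: "0 < x \<Longrightarrow> ln x \<le> (x :: real)"
 using ln_le_minus_one[of x] by simp

text \<open>\<open>E\<close> counts as a constant here, while the powers of \<kappa> and of the
  logarithm \<open>L\<close> are tracked.\<close>

locale budget =
 fixes E :: nat and e \<kappa> L \<delta> :: real and n p T :: nat
 assumes E: "100 \<le> E" and e: "e = 1 / real E" and \<kappa>: "1 \<le> \<kappa>" and \<delta>: "0 < \<delta>" "\<delta> < 1" and n: "1 \<le> n"
  and L: "L = max 1 (log 2 (real n * \<kappa> / \<delta>))" and p: "2 \<le> p" "real p \<le> 6 * real E * L" and T: "n \<le> T"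
begin

abbreviation "R \<equiv> real E"

definition "r = sqrt \<kappa>"

lemma r: "1 \<le> r" "r * r = \<kappa>"
 using \<kappa> by (simp_all add: r_def)

lemma L1: "1 \<le> L" and L_ln: "ln (real n) \<le> L" "ln \<kappa> \<le> L" "log 2 (real n / \<delta>) \<le> L" "log 2 \<kappa> \<le> L"
proof -
 show "1 \<le> L" by (simp add: L)
 have n1: "1 \<le> real n" using n by simp
 have d1: "1 \<le> 1 / \<delta>" using \<delta> by simp
 have le: "log 2 x \<le> L" if "0 < x" "x \<le> real n * \<kappa> / \<delta>" for x
 proof -
  have "log 2 x \<le> log 2 (real n * \<kappa> / \<delta>)" using that by (subst log_le_cancel_iff) auto
  then show ?thesis by (simp add: L)
 qed
 have ll: "ln x \<le> log 2 x" if "1 \<le> x" for x :: real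
 proof -
  have "ln x * ln 2 \<le> ln x * 1" using that ln_le_minus_one[of "2::real"] by (intro mult_left_mono) auto
  then show ?thesis by (simp add: log_def le_divide_eq)
 qed
 have a: "real n * 1 * 1 \<le> real n * \<kappa> * (1 / \<delta>)" using n1 \<kappa> d1 \<delta> by (intro mult_mono) auto
 have b: "1 * \<kappa> * 1 \<le> real n * \<kappa> * (1 / \<delta>)" using n1 \<kappa> d1 \<delta> by (intro mult_mono) auto
 have c: "real n * 1 * (1 / \<delta>) \<le> real n * \<kappa> * (1 / \<delta>)" using n1 \<kappa> d1 \<delta> by (intro mult_mono) auto
 show "ln (real n) \<le> L" using le[of "real n"] ll[of "real n"] n1 a by simp
 show "log 2 \<kappa> \<le> L" using le[of \<kappa>] \<kappa> b by simp
 then show "ln \<kappa> \<le> L" using ll[of \<kappa>] \<kappa> by simp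
 show "log 2 (real n / \<delta>) \<le> L" using le[of "real n / \<delta>"] n1 \<delta> c by simp
qed

lemma E100: "100 \<le> R"
 using E by simp

lemma e0: "0 < e" "e \<le> 1 / 2"
 using E100 by (simp_all add: e field_simps)

lemma pow1: "1 \<le> L ^ i" "i \<le> j \<Longrightarrow> L ^ i \<le> L ^ j"
 using L1 by (auto intro: one_le_power power_increasing)

lemma ex_Gm: "\<exists>Gm. (\<forall>g. (1 + e) ^ g \<le> (1 + e) * \<kappa> \<longrightarrow> g \<le> Gm) \<and> real (Gm + 1) \<le> 8 * R * L"
proof -
 obtain Gm where G: "2 * R * (1 + L) \<le> real Gm" "real Gm \<le> 2 * R * (1 + L) + 1"
  using nat_above[of "2 * R * (1 + L)"] L1 E100 by auto
 have "g \<le> Gm" if "(1 + e) ^ g \<le> (1 + e) * \<kappa>" for g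
 proof -
  have "e * real g \<le> 2 * ln ((1 + e) * \<kappa>)" by (rule pow_le[OF e0 that])
  also have "ln ((1 + e) * \<kappa>) = ln (1 + e) + ln \<kappa>" using e0 \<kappa> by (simp add: ln_mult)
  also have "ln (1 + e) \<le> 1" using ln_add_one_self_le_self[of e] e0 by simp
  finally have "e * real g \<le> 2 * (1 + L)" using L_ln(2) by simp
  then have "real g \<le> 2 * R * (1 + L)" using E100 by (simp add: e divide_le_eq mult_ac)
  then show ?thesis using G(1) by linarith
 qed
 moreover have "real (Gm + 1) \<le> 8 * R * L"
 proof -
  have "R * 1 \<le> R * L" using L1 by (intro mult_left_mono) auto
  then have "R \<le> R * L" by simp
  moreover have "2 * R * (1 + L) = 2 * R + 2 * (R * L)" by (simp add: algebra_simps)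
  ultimately show ?thesis using G(2) E100 unfolding of_nat_add of_nat_1 by linarith
 qed
 ultimately show ?thesis by blast
qed

text \<open>Steps of length \<open>1 / (2 E p \<kappa>)\<close> have to cover total length
  \<open>E\<close>, and \<open>p\<close> is at most of order \<open>E L\<close>.\<close>

lemma ex_S: "\<exists>S. 2 * R * R * real p * ((1 + e) * \<kappa>) \<le> real S \<and> real (S + 1) \<le> 26 * R ^ 3 * \<kappa> * L"
proof -
 have x: "0 \<le> 2 * R * R * real p * ((1 + e) * \<kappa>)" using e0 \<kappa> by (intro mult_nonneg_nonneg) auto
 obtain S where S: "2 * R * R * real p * ((1 + e) * \<kappa>) \<le> real S" "real S \<le> 2 * R * R * real p * ((1 + e) * \<kappa>) + 1"
  using nat_above[OF x] by blast
 have "2 * R * R * real p * ((1 + e) * \<kappa>) \<le> 2 * R * R * (6 * R * L) * (2 * \<kappa>)"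
  using p e0 \<kappa> by (intro mult_mono mult_right_mono) auto
 also have "\<dots> = 24 * (R ^ 3 * \<kappa> * L)" by (simp add: power3_eq_cube)
 finally have "real (S + 1) \<le> 24 * (R ^ 3 * \<kappa> * L) + 2" using S(2) unfolding of_nat_add of_nat_1 by linarith
 moreover have "1 * 1 * 1 \<le> R ^ 3 * \<kappa> * L" using E100 \<kappa> L1 by (intro mult_mono one_le_power) auto
 ultimately show ?thesis using S(1) by (intro exI[of _ S]) simp
qed

text \<open>The inverse of the initial scale contains a power with exponent \<open>p + 1\<close>, so
  its logarithm is of order \<open>L^2\<close>; the growth rate \<open>e^2 / p\<close> per round
  contributes the third factor \<open>L\<close>.\<close>

lemma ex_Rm: "\<exists>Rm. R \<le> 1 / (4 * ((4 * ((1 + e) * \<kappa> * R)) ^ Suc p * real n * real n)) * (1 + e / real p * e) ^ Rm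
  \<and> real (Rm + 1) \<le> 1000 * R ^ 5 * L ^ 3"
proof -
 let ?H = "4 * ((4 * ((1 + e) * \<kappa> * R)) ^ Suc p * real n * real n)"
 have n0: "0 < real n" using n by simp
 define h where "h = 4 * ((1 + e) * \<kappa> * R)"
 have h: "0 < h" "h \<le> 8 * R * \<kappa>"
 proof -
  show "0 < h" unfolding h_def using e0 \<kappa> E100 by simp
  have "h \<le> 4 * (2 * \<kappa> * R)" unfolding h_def using e0 \<kappa> E100 by (intro mult_left_mono mult_right_mono) auto
  then show "h \<le> 8 * R * \<kappa>" by (simp add: mult_ac)
 qed
 have lnh: "ln h \<le> 8 * R + L"
 proof -
  have "0 < \<kappa> * R" using E100 \<kappa> by (intro mult_pos_pos) auto
  then have "ln h \<le> ln (8 * R * \<kappa>)" using h by (subst ln_le_cancel_iff) (auto simp: mult_ac)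
  also have "\<dots> = ln (8 * R) + ln \<kappa>" using E100 \<kappa> by (subst ln_mult) auto
  finally show ?thesis using ln_le_self[of "8 * R"] L_ln(2) E100 by simp
 qed
 have "0 < 4 * (h ^ Suc p * real n * real n)" using h n0 by (intro mult_pos_pos zero_less_power) auto
 then have H0: "0 < ?H" by (simp only: h_def)
 have lnH: "ln (R * ?H) \<le> 80 * (R ^ 2 * L ^ 2)"
 proof -
  have "R * ?H = (4 * R) * (h ^ Suc p * (real n * real n))" by (simp add: h_def)
  then have "ln (R * ?H) = ln (4 * R) + (ln (h ^ Suc p) + ln (real n * real n))"
   using E100 h n0 by (simp only: ln_mult_pos zero_less_power mult_pos_pos)
  also have "ln (h ^ Suc p) = real (Suc p) * ln h" using h by (intro ln_realpow)
  also have "ln (real n * real n) = 2 * ln (real n)" using n0 by (simp add: ln_mult)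
  finally have 1: "ln (R * ?H) = ln (4 * R) + (real (Suc p) * ln h + 2 * ln (real n))" .
  have EL: "100 * 1 \<le> R * L" using E100 L1 by (intro mult_mono) auto
  have RL: "R \<le> R * L" "L \<le> R * L" using mult_left_mono[OF L1, of R] mult_right_mono[of 1 R L] E100 L1 by simp_all
  have "real (Suc p) * ln h \<le> (7 * (R * L)) * (9 * (R * L))"
  proof (rule mult_mono)
   show "real (Suc p) \<le> 7 * (R * L)" using p EL by simp
   show "ln h \<le> 9 * (R * L)" using lnh RL by linarith
   show "0 \<le> ln h"
   proof -
    have "4 * (1 * 1 * 1) \<le> h" unfolding h_def using e0 \<kappa> E100 by (intro mult_left_mono mult_mono) auto
    then show ?thesis by simp
   qed
  qed (use EL in simp)
  moreover have "ln (4 * R) \<le> 4 * (R * L)" "2 * ln (real n) \<le> 2 * (R * L)"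
   using RL ln_le_self[of "4 * R"] E100 L_ln(1) by linarith+
  moreover have "R * L * 1 \<le> R * L * (R * L)" using EL by (intro mult_left_mono) auto
  moreover define w where "w = real (Suc p) * ln h"
  moreover have "80 * (R ^ 2 * L ^ 2) = 80 * (R * L * (R * L))" by (simp add: power2_eq_square)
  moreover have "7 * (R * L) * (9 * (R * L)) = 63 * (R * L * (R * L))" by simp
  ultimately show ?thesis unfolding 1 w_def[symmetric] using EL by linarith
 qed
 define b where "b = e / real p * e"
 have p2: "2 \<le> real p" using p by simp
 have b: "0 < b" "b \<le> 1 / 2" and b1: "1 / b = real p * R ^ 2"
 proof -
  show "0 < b" unfolding b_def using e0 p2 by simp
  have "e / real p * e \<le> 1 / 2 * 1"
   using e0 p2 by (intro mult_mono) (auto simp: divide_le_eq)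
  then show "b \<le> 1 / 2" by (simp add: b_def)
  show "1 / b = real p * R ^ 2" unfolding b_def e using E100 p2 by (simp add: power2_eq_square)
 qed
 have "0 \<le> 2 * (80 * (R ^ 2 * L ^ 2)) * (1 / b)" using b by simp
 then obtain Rm where R: "2 * (80 * (R ^ 2 * L ^ 2)) * (1 / b) \<le> real Rm" "real Rm \<le> 2 * (80 * (R ^ 2 * L ^ 2)) * (1 / b) + 1"
  using nat_above by blast
 have "R * ?H \<le> (1 + b) ^ Rm"
 proof (rule pow_ge[OF b])
  have "2 * ln (R * ?H) \<le> 2 * (80 * (R ^ 2 * L ^ 2))" using lnH by linarith
  also have "\<dots> \<le> b * real Rm" using R(1) b by (simp add: field_simps)
  finally show "2 * ln (R * ?H) \<le> b * real Rm" .
 qed (use H0 E100 in simp)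
 then have "R \<le> 1 / ?H * (1 + e / real p * e) ^ Rm" using H0 unfolding b_def[symmetric] by (simp only: le_divide_eq times_divide_eq_left mult_1 if_True)
 moreover have "real (Rm + 1) \<le> 1000 * R ^ 5 * L ^ 3"
 proof -
  have "160 * (R ^ 2 * L ^ 2) * (real p * R ^ 2) \<le> 160 * (R ^ 2 * L ^ 2) * (6 * R * L * R ^ 2)"
   using p by (intro mult_left_mono mult_right_mono) auto
  also have "\<dots> = 960 * (R ^ 5 * L ^ 3)" by (simp add: eval_nat_numeral)
  finally have "160 * (R ^ 2 * L ^ 2) * (real p * R ^ 2) \<le> 960 * (R ^ 5 * L ^ 3)" .
  moreover have "2 * (80 * (R ^ 2 * L ^ 2)) * (real p * R ^ 2) = 160 * (R ^ 2 * L ^ 2) * (real p * R ^ 2)" by simp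
  ultimately have "real (Rm + 1) \<le> 960 * (R ^ 5 * L ^ 3) + 2" using R(2) unfolding b1 of_nat_add of_nat_1 by linarith
  moreover have "1 * 1 \<le> R ^ 5 * L ^ 3" using E100 L1 by (intro mult_mono one_le_power) auto
  ultimately show ?thesis by simp
 qed
 ultimately show ?thesis by blast
qed

text \<open>The Chebyshev values grow at least at rate \<open>b = 1 / (2 E r)\<close> with
  \<open>r\<close> the root of \<kappa>, and the logarithm of the target is bounded by a multiple of
  \<open>L\<close>.\<close>

lemma ex_kcM: "\<exists>kcM. 1 \<le> kcM \<and> (\<forall>\<kappa>'. 1 \<le> \<kappa>' \<longrightarrow> \<kappa>' \<le> (1 + e) * \<kappa> \<longrightarrow>
  4 * ((real p + 2) * R) \<le> cheb (cs0 E \<kappa>') kcM) \<and> real kcM \<le> 262 * R ^ 3 * r * L"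
proof -
 define b where "b = 1 / (2 * R * r)"
 have Er: "100 * 1 \<le> R * r" using E100 r by (intro mult_mono) auto
 have b: "0 < b" "b \<le> 1 / 2" using Er E100 r by (auto simp: b_def divide_le_eq)
 define X where "X = 8 * ((real p + 2) * R)"
 have EL: "100 * 1 \<le> R * L" using E100 L1 by (intro mult_mono) auto
 have X0: "0 < X" unfolding X_def using E100 by simp
 have lnX: "ln X \<le> 65 * R ^ 2 * L"
 proof -
  have "X \<le> 8 * ((7 * (R * L)) * R)" unfolding X_def using p EL E100 by (intro mult_left_mono mult_right_mono) auto
  then have "X \<le> 56 * R ^ 2 * L" by (simp add: power2_eq_square mult_ac)
  then have "ln X \<le> 56 * R ^ 2 * L" using ln_le_self[OF X0] by simp
  moreover have "0 \<le> R ^ 2 * L" using L1 by simp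
  ultimately show ?thesis by simp
 qed
 have "0 \<le> 2 * (65 * R ^ 2 * L) * (2 * R * r)" using L1 r by simp
 then obtain k0 where k0: "2 * (65 * R ^ 2 * L) * (2 * R * r) \<le> real k0" "real k0 \<le> 2 * (65 * R ^ 2 * L) * (2 * R * r) + 1"
  using nat_above by blast
 define kcM where "kcM = Suc k0"
 have k: "4 * ((real p + 2) * R) \<le> cheb (cs0 E \<kappa>') kcM" if k': "1 \<le> \<kappa>'" "\<kappa>' \<le> (1 + e) * \<kappa>" for \<kappa>'
 proof -
  let ?hi = "4 * (\<kappa>' * R)"
  have hi: "400 \<le> ?hi" using mult_mono[OF k'(1) E100] k'(1) by simp
  have "\<kappa>' \<le> 2 * \<kappa>" using k'(2) e0 \<kappa> mult_right_mono[of "1 + e" 2 \<kappa>] by linarith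
  then have hi2: "?hi \<le> 8 * R * (r * r)" using mult_right_mono[of \<kappa>' "2 * \<kappa>" "R"] r(2) by (simp add: mult_ac)
  define d' where "d' = 2 / (?hi - 1)"
  have s0: "(?hi + 1) / (?hi - 1) = 1 + d'" unfolding d'_def using hi by (simp add: field_simps)
  have "b\<^sup>2 \<le> 2 * d'"
  proof -
   have "b\<^sup>2 = 1 / (4 * (R * R) * (r * r))" by (simp add: b_def power2_eq_square)
   also have "\<dots> \<le> 4 / (8 * R * (r * r))"
   proof -
    have "8 * R * (r * r) \<le> 4 * (4 * (R * R) * (r * r))"
    proof -
     have "R * (r * r) * 1 \<le> R * (r * r) * R" using E100 r(1) by (intro mult_left_mono mult_nonneg_nonneg) auto
     moreover have "4 * (4 * (R * R) * (r * r)) = 16 * (R * (r * r) * R)" "8 * R * (r * r) = 8 * (R * (r * r) * 1)" by simp_all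
     moreover have "0 \<le> R * (r * r) * 1" using E100 r(1) by (intro mult_nonneg_nonneg) auto
     ultimately show ?thesis by linarith
    qed
    moreover have "0 < r * r" "0 < R" using r(1) E100 by auto
    ultimately show ?thesis by (simp add: divide_le_eq le_divide_eq)
   qed
   also have "\<dots> \<le> 4 / (?hi - 1)" by (rule divide_left_mono[OF _ _ mult_pos_pos]) (use hi hi2 in linarith)+
   finally show ?thesis by (simp add: d'_def)
  qed
  then have "b \<le> sqrt (2 * d')" using b by (intro real_le_rsqrt) auto
  then have "(1 + b) ^ kcM \<le> (1 + sqrt (2 * d')) ^ kcM" using b by (intro power_mono) auto
  also have "\<dots> \<le> 2 * cheb (1 + d') kcM" using cheb_growth[of d' kcM] hi unfolding d'_def by simp
  finally have "(1 + b) ^ kcM \<le> 2 * cheb (1 + d') kcM" .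
  moreover have "X \<le> (1 + b) ^ kcM"
  proof (rule pow_ge[OF b X0])
   have "2 * ln X \<le> 2 * (65 * R ^ 2 * L)" using lnX by linarith
   also have "\<dots> \<le> b * real k0" unfolding b_def using k0(1) Er by (simp add: le_divide_eq mult_ac)
   also have "\<dots> \<le> b * real kcM" using b by (simp add: kcM_def)
   finally show "2 * ln X \<le> b * real kcM" .
  qed
  ultimately show ?thesis unfolding s0 X_def by simp
 qed
 have "real kcM \<le> 262 * R ^ 3 * r * L"
 proof -
  have "1 * 1 * 1 \<le> R ^ 3 * r * L" using E100 r L1 by (intro mult_mono one_le_power) auto
  moreover have "2 * (65 * R ^ 2 * L) * (2 * R * r) = 260 * (R ^ 3 * r * L)" by (simp add: eval_nat_numeral)
  ultimately show ?thesis using k0(2) unfolding kcM_def of_nat_Suc by linarith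
 qed
 then show ?thesis using k by (intro exI[of _ kcM]) (simp add: kcM_def)
qed

text \<open>The number of sketches is polynomial in \<kappa> and \<open>L\<close>, so the logarithm
  that fixes the sample size is of order \<open>L\<close>.\<close>

lemma ex_mkM:
 assumes "real N \<le> 216000 * R ^ 9 * \<kappa> * L ^ 5"
 shows "\<exists>mkM. 4 * ((real N + 1) * (real N + 2) * real n) / \<delta> \<le> 2 ^ mkM \<and> real mkM \<le> (2 * log 2 (216003 * R ^ 9) + 30) * L"
proof -
 define q where "q = 216003 * R ^ 9"
 have q1: "1 \<le> q" unfolding q_def using E100 one_le_power[of "R" 9] by linarith
 have nd: "0 < real n / \<delta>" using n \<delta> by simp
 have qkL: "0 < q * \<kappa> * L ^ 5" using q1 \<kappa> L1 by (intro mult_pos_pos) auto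
 have N2: "real N + 2 \<le> q * \<kappa> * L ^ 5"
 proof -
  have "1 * 1 * 1 \<le> R ^ 9 * \<kappa> * L ^ 5" using E100 \<kappa> L1 by (intro mult_mono one_le_power) auto
  then show ?thesis using assms unfolding q_def by simp
 qed
 have x: "4 * ((real N + 1) * (real N + 2) * real n) / \<delta> \<le> 4 * ((q * \<kappa> * L ^ 5) * (q * \<kappa> * L ^ 5)) * (real n / \<delta>)"
 proof -
  have "(real N + 1) * (real N + 2) \<le> (q * \<kappa> * L ^ 5) * (q * \<kappa> * L ^ 5)" using N2 qkL by (intro mult_mono) auto
  then have "4 * ((real N + 1) * (real N + 2)) * (real n / \<delta>) \<le> 4 * ((q * \<kappa> * L ^ 5) * (q * \<kappa> * L ^ 5)) * (real n / \<delta>)"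
   using nd by (intro mult_right_mono mult_left_mono) auto
  then show ?thesis by simp
 qed
 define Z where "Z = 4 * ((q * \<kappa> * L ^ 5) * (q * \<kappa> * L ^ 5)) * (real n / \<delta>)"
 have Z0: "0 < Z" unfolding Z_def by (rule mult_pos_pos[OF mult_pos_pos[OF _ mult_pos_pos[OF qkL qkL]] nd]) simp
 have lq: "log 2 (q * \<kappa> * L ^ 5) \<le> log 2 q + 11 * L"
 proof -
  have "log 2 (q * \<kappa> * L ^ 5) = log 2 q + log 2 \<kappa> + log 2 (L ^ 5)" using q1 \<kappa> L1 by (simp add: log_mult)
  also have "log 2 (L ^ 5) = 5 * log 2 L" using L1 by (simp add: log_nat_power)
  also have "log 2 L \<le> 2 * L"
  proof -
   have "exp (1 / 2) \<le> 1 + 1 / 2 + (1 / 2 :: real)\<^sup>2" by (rule exp_bound) auto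
   also have "\<dots> \<le> 2" by (simp add: power2_eq_square)
   finally have "1 / 2 \<le> ln (2 :: real)" by (subst ln_ge_iff) auto
   then have "ln L / ln 2 \<le> ln L / (1 / 2)" using L1 by (intro divide_left_mono) auto
   then show ?thesis using ln_le_self[of L] L1 by (simp add: log_def)
  qed
  finally show ?thesis using L_ln(4) by simp
 qed
 have "log 2 Z = 2 + 2 * log 2 (q * \<kappa> * L ^ 5) + log 2 (real n / \<delta>)"
 proof -
  have "log 2 4 = (2 :: real)" using log_pow_cancel[of 2 2] by simp
  have *: "log 2 (4 * (y * y) * z) = log 2 4 + 2 * log 2 y + log 2 z" if "0 < y" "0 < z" for y z :: real
   using that by (simp add: log_mult)
  show ?thesis unfolding Z_def *[OF qkL nd] using \<open>log 2 4 = 2\<close> by simp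
 qed
 then have lZ: "log 2 Z \<le> 2 + 2 * log 2 q + 23 * L" using lq L_ln(3) by simp
 have lq0: "0 \<le> log 2 q" using q1 by simp
 obtain m where m: "2 + 2 * log 2 q + 23 * L \<le> real m" "real m \<le> 2 + 2 * log 2 q + 23 * L + 1"
  using nat_above[of "2 + 2 * log 2 q + 23 * L"] lq0 L1 by auto
 have "Z = 2 powr log 2 Z" using Z0 by simp
 also have "\<dots> \<le> 2 powr real m" using lZ m(1) by (intro powr_mono) auto
 also have "\<dots> = 2 ^ m" by (simp add: powr_realpow)
 finally have "Z \<le> 2 ^ m" .
 moreover have "real m \<le> (2 * log 2 q + 30) * L"
 proof -
  have "log 2 q * 1 \<le> log 2 q * L" using lq0 L1 by (intro mult_left_mono) auto
  then show ?thesis using m(2) L1 by (simp add: algebra_simps)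
 qed
 ultimately show ?thesis using x unfolding Z_def q_def by (intro exI[of _ m]) auto
qed

definition "cm = 2 * log 2 (216003 * R ^ 9) + 30"
definition "A1 = 8872368 * cm * R ^ 6"
definition "B1 = (15984 * cm + 3930) * R ^ 3"
text \<open>It depends on \<open>E\<close> alone, as the constant of the theorem has to be fixed
  before the matrix and \<delta>.\<close>

definition "Ctot = 208 * R ^ 4 * (A1 + 1000 * R ^ 5 * B1) + B1 + 3"

lemma cpos: "30 \<le> cm" "0 \<le> A1" "0 \<le> B1"
proof -
 have "1 \<le> 216003 * R ^ 9" using E100 one_le_power[of "R" 9] by linarith
 then have "0 \<le> log 2 (216003 * R ^ 9)" using zero_le_log_cancel_iff[of 2 "216003 * R ^ 9"] E100 by simp
 then show c: "30 \<le> cm" unfolding cm_def by simp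
 then show "0 \<le> A1" "0 \<le> B1" unfolding A1_def B1_def by simp_all
qed

context
 fixes mkM kcM :: nat
 assumes mk: "real mkM \<le> cm * L" and kc: "1 \<le> kcM" "real kcM \<le> 262 * R ^ 3 * r * L"
begin

lemma T1: "1 \<le> real T"
 using n T by auto

lemma mk1: "real (Suc mkM) \<le> 2 * cm * L"
 using mult_mono[of 1 cm 1 L] cpos(1) L1 mk by simp

lemma V_le: "real (E * E * Suc mkM * p) \<le> 12 * cm * R ^ 3 * L ^ 2"
proof -
 have "R ^ 2 * (real (Suc mkM) * real p) \<le> R ^ 2 * ((2 * cm * L) * (6 * R * L))"
  using mk1 p(2) cpos(1) L1 by (intro mult_left_mono mult_mono) auto
 then show ?thesis by (simp only: of_nat_mult) (simp add: power2_eq_square power3_eq_cube mult_ac)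
qed

text \<open>The number of samples contributes \<open>L\<close>, the power of the operator
  \<open>L\<close>, and the degree \<open>r * L\<close>.\<close>

lemma X1_le: "real (T * cost_cover E p mkM kcM + 92 + 80 * n + 10 * mkM) \<le> real T * (A1 * (r * L ^ 3))"
 (is "real ?X \<le> _")
proof -
 define U where "U = E * E * Suc mkM * (p * kcM)"
 have pk: "1 * 1 \<le> p * kcM" using p kc by (intro mult_mono) auto
 have E1: "1 * 1 \<le> E * E" using E by (intro mult_mono) auto
 have U: "Suc mkM \<le> U" unfolding U_def using mult_mono[OF mult_mono[OF E1 le_refl[of "Suc mkM"]] pk] by simp
 have "(p div 2 + 1) * (150 * kcM + 10) \<le> p * (160 * kcM)" using p kc by (intro mult_mono) auto
 then have "(p div 2 + 1) * (150 * kcM + 10) + 160 \<le> 320 * (p * kcM)" using pk by linarith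
 then have "8 * E * E * Suc mkM * ((p div 2 + 1) * (150 * kcM + 10) + 160) \<le> 8 * E * E * Suc mkM * (320 * (p * kcM))" by (rule mult_left_mono) simp
 also have "\<dots> = 2560 * U" unfolding U_def by simp
 finally have "cost_cover E p mkM kcM \<le> 2640 * U" using U by linarith
 from mult_le_mono2[OF this, of T] have "?X \<le> T * (2640 * U) + 92 + 80 * n + 10 * mkM" by linarith
 moreover have "1 * U \<le> T * U" "n * 1 \<le> T * U" using n T U by (intro mult_mono; simp)+
 ultimately have "?X \<le> 2822 * (T * U)" using U by linarith
 then have "real ?X \<le> real (2822 * (T * U))" by (rule of_nat_mono)
 also have "\<dots> = 2822 * (real T * (real (E * E * Suc mkM * p) * real kcM))" by (simp only: U_def of_nat_mult of_nat_numeral mult.assoc)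
 also have "\<dots> \<le> 2822 * (real T * ((12 * cm * R ^ 3 * L ^ 2) * (262 * R ^ 3 * r * L)))"
  using V_le kc(2) cpos(1) L1 by (intro mult_left_mono mult_mono) auto
 also have "\<dots> = real T * (A1 * (r * L ^ 3))" by (simp add: A1_def eval_nat_numeral)
 finally show ?thesis .
qed

lemma X2_le: "real (T * cost_pack E p mkM + 222 + 20 * p + 15 * kcM + 120 * n + 10 * mkM)
  \<le> real T * (B1 * (r * L ^ 2))" (is "real ?X \<le> _")
proof -
 define V where "V = E * E * Suc mkM * p"
 have E1: "1 * 1 \<le> E * E" using E by (intro mult_mono) auto
 have V: "Suc mkM \<le> V" "p \<le> V" unfolding V_def using mult_mono[OF mult_mono[OF E1 le_refl[of "Suc mkM"]] p(1)] mult_mono[OF mult_mono[OF E1, of 1 "Suc mkM"] le_refl[of p]]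
  by simp_all
 have "(p div 2 - 1) * 30 + 160 \<le> 110 * p" using p by linarith
 then have "8 * E * E * Suc mkM * ((p div 2 - 1) * 30 + 160) \<le> 8 * E * E * Suc mkM * (110 * p)" by (rule mult_left_mono) simp
 also have "\<dots> = 880 * V" unfolding V_def by simp
 finally have "cost_pack E p mkM \<le> 960 * V" using V by linarith
 from mult_le_mono2[OF this, of T] have "?X \<le> T * (960 * V) + 222 + 20 * p + 15 * kcM + 120 * n + 10 * mkM" by linarith
 moreover have "1 * V \<le> T * V" "n * 1 \<le> T * V" "1 * kcM \<le> T * kcM" using n T V by (intro mult_mono; simp)+
 ultimately have "?X \<le> 1332 * (T * V) + 15 * (T * kcM)" using V by linarith
 then have "real ?X \<le> real (1332 * (T * V) + 15 * (T * kcM))" by (rule of_nat_mono)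
 also have "\<dots> = 1332 * (real T * real V) + 15 * (real T * real kcM)" by simp
 also have "\<dots> \<le> 1332 * (real T * (12 * cm * R ^ 3 * (r * L ^ 2))) + 15 * (real T * (262 * R ^ 3 * (r * L ^ 2)))"
 proof (intro add_mono mult_left_mono)
  have "12 * cm * R ^ 3 * L ^ 2 \<le> 12 * cm * R ^ 3 * (r * L ^ 2)"
   using cpos(1) mult_right_mono[OF r(1), of "L ^ 2"] by (intro mult_left_mono) auto
  then show "real V \<le> 12 * cm * R ^ 3 * (r * L ^ 2)" using V_le unfolding V_def by linarith
  have "262 * R ^ 3 * (r * L) \<le> 262 * R ^ 3 * (r * L ^ 2)" using r pow1(2)[of 1 2] by (intro mult_left_mono) auto
  then show "real kcM \<le> 262 * R ^ 3 * (r * L ^ 2)" using kc(2) by (simp add: mult.assoc)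
 qed auto
 also have "\<dots> = real T * (B1 * (r * L ^ 2))" by (simp add: B1_def algebra_simps)
 finally show ?thesis .
qed

text \<open>Guesses contribute \<open>L\<close> and covering steps \<open>\<kappa> * L\<close>. Per
  step the covering sketch costs \<open>r * L^3\<close> and the packing rounds \<open>L^3\<close>
  times \<open>r * L^2\<close>, where \<open>r\<close> stems from the possible degree search. The
  product is of order \<open>\<kappa> * r * L^7\<close>.\<close>

lemma total_le:
 fixes Gm S Rm X1 X2 :: nat
 assumes G: "real (Gm + 1) \<le> 8 * R * L" and S: "real (S + 1) \<le> 26 * R ^ 3 * \<kappa> * L" and R: "real (Rm + 1) \<le> 1000 * R ^ 5 * L ^ 3"
  and X1: "real X1 \<le> real T * (A1 * (r * L ^ 3))" and X2: "real X2 \<le> real T * (B1 * (r * L ^ 2))"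
 shows "real (X2 + (Gm + 1) * (S + 1) * (X1 + Rm * X2) + 3) \<le> Ctot * (real T * \<kappa> powr (3 / 2) * L ^ 7)"
proof -
 have k32: "\<kappa> powr (3 / 2) = \<kappa> * r"
 proof -
  have "\<kappa> powr (3 / 2) = \<kappa> powr 1 * \<kappa> powr (1 / 2)" by (simp only: powr_add[symmetric]) simp
  then show ?thesis using \<kappa> by (simp add: r_def powr_half_sqrt)
 qed
 have "real Rm * real X2 \<le> (1000 * R ^ 5 * L ^ 3) * (real T * (B1 * (r * L ^ 2)))" using R X2 L1 by (intro mult_mono) auto
 also have "\<dots> = real T * (1000 * R ^ 5 * B1 * (r * L ^ 5))" by (simp add: eval_nat_numeral)
 finally have 1: "real Rm * real X2 \<le> real T * (1000 * R ^ 5 * B1 * (r * L ^ 5))" .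
 have "A1 * (r * L ^ 3) \<le> A1 * (r * L ^ 5)" using cpos r pow1(2)[of 3 5] by (intro mult_left_mono) auto
 then have "real T * (A1 * (r * L ^ 3)) \<le> real T * (A1 * (r * L ^ 5))" by (rule mult_left_mono) simp
 then have 2: "real (X1 + Rm * X2) \<le> real T * ((A1 + 1000 * R ^ 5 * B1) * (r * L ^ 5))"
 proof -
  have "real (X1 + Rm * X2) \<le> real T * (A1 * (r * L ^ 5)) + real T * (1000 * R ^ 5 * B1 * (r * L ^ 5))"
   using 1 X1 \<open>real T * (A1 * (r * L ^ 3)) \<le> real T * (A1 * (r * L ^ 5))\<close> unfolding of_nat_add of_nat_mult by linarith
  then show ?thesis by (simp only: distrib_left distrib_right)
 qed
 have "real (Gm + 1) * real (S + 1) \<le> (8 * R * L) * (26 * R ^ 3 * \<kappa> * L)" using G S L1 by (intro mult_mono) auto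
 also have "\<dots> = 208 * R ^ 4 * \<kappa> * L ^ 2" by (simp add: eval_nat_numeral)
 finally have "real (Gm + 1) * real (S + 1) * real (X1 + Rm * X2) \<le> (208 * R ^ 4 * \<kappa> * L ^ 2) * (real T * ((A1 + 1000 * R ^ 5 * B1) * (r * L ^ 5)))"
  by (rule mult_mono[OF _ 2]) (use \<kappa> in auto)
 also have "\<dots> = 208 * R ^ 4 * (A1 + 1000 * R ^ 5 * B1) * (real T * (\<kappa> * r) * L ^ 7)" by (simp add: eval_nat_numeral)
 finally have 3: "real ((Gm + 1) * (S + 1) * (X1 + Rm * X2)) \<le> 208 * R ^ 4 * (A1 + 1000 * R ^ 5 * B1) * (real T * (\<kappa> * r) * L ^ 7)"
  by (simp only: of_nat_mult)
 have "1 * (r * L ^ 2) \<le> \<kappa> * (r * L ^ 7)" using \<kappa> r pow1(2)[of 2 7] L1 by (intro mult_mono) auto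
 then have "real T * (B1 * (r * L ^ 2)) \<le> real T * (B1 * (\<kappa> * (r * L ^ 7)))" using cpos by (intro mult_left_mono) auto
 then have 4: "real X2 \<le> B1 * (real T * (\<kappa> * r) * L ^ 7)" using X2 by (simp add: mult_ac)
 have "1 * (1 * 1) * 1 \<le> real T * (\<kappa> * r) * L ^ 7" using T1 \<kappa> r pow1(1)[of 7] by (intro mult_mono) auto
 then show ?thesis using 3 4 unfolding k32 Ctot_def by (simp add: algebra_simps)
qed

end

end

section \<open>Failure probability and measurability of success\<close>

lemma rmem_fst_measurable:
 assumes "smeas M F" shows "(\<lambda>x. rmem (F (fst x)) a) \<in> borel_measurable (M \<Otimes>\<^sub>M N)"
 by (rule measurable_compose[OF measurable_fst smeasD(5)[OF assms]])

context
 fixes A :: "real mat" and n d E :: nat and \<delta> :: real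
 assumes A: "A \<in> carrier_mat n d" and dn: "d \<le> n" and E: "2 \<le> E" and \<delta>: "0 < \<delta>" and n0: "1 \<le> n"
begin

lemma hd_at_measurable:
 assumes "smeas M F" "space M = UNIV" shows "{x. hd_at E j (F x)} \<in> sets M"
proof -
 note [measurable] = smeasD[OF assms(1)]
 have "{x \<in> space M. pc (F x) = Lhead E \<and> rmem (F x) 16 = real j} \<in> sets M" by measurable
 then show ?thesis by (simp add: hd_at_def assms(2))
qed

lemma bad_at_measurable:
 assumes F: "smeas tape.S F"
 shows "{x. bad_at A E \<delta> j (F (fst x)) (snd x)} \<in> sets (tape.S \<Otimes>\<^sub>M tape.S)"
proof -
 let ?M = "tape.S \<Otimes>\<^sub>M tape.S"
 note r = rmem_fst_measurable[OF F, of _ tape.S]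
 note [measurable] = r
 have dd: "dim_row A = n" using A by simp
 have u: "(\<lambda>x. u_of n (F (fst x)) i) \<in> borel_measurable ?M" for i unfolding u_of_def by (rule r)
 note [measurable] = u
 have xi: "(\<lambda>x. snd x i) \<in> borel_measurable ?M" for i :: nat by (rule measurable_compose[OF measurable_snd coord_measurable])
 have acc[measurable]: "Measurable.pred ?M (\<lambda>x. accurate A (1 / real E) (opM A (rmem (F (fst x)) 10) (rmem (F (fst x)) 11) kc (rmem (F (fst x)) 8) (u_of n (F (fst x))) ^\<^sub>m pw)
  (rmem (F (fst x)) 9) (u_of n (F (fst x))) m (snd x))" for kc pw m
  by (intro accurate_measurable[OF A] mmeas_pow mmeas_opM[OF A] r u xi)
 have "{x \<in> space ?M. bad_at A E \<delta> j (F (fst x)) (snd x)} \<in> sets ?M" unfolding bad_at_def dd by measurable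
 then show ?thesis by (simp add: space_pair_measure)
qed

text \<open>The registers determine the operator and the sample size, so the event lies inside a
  single accuracy failure. Its bound \<open>4 n / 2^mk\<close> meets the claim by the condition on
  \<open>mk\<close>.\<close>

lemma bad_at_prob: "measure tape.S {\<xi>. bad_at A E \<delta> j s \<xi>} \<le> \<delta> / ((real j + 1) * (real j + 2))"
proof (cases "\<exists>\<xi>. bad_at A E \<delta> j s \<xi>")
 case False
 then have "{\<xi>. bad_at A E \<delta> j s \<xi>} = {}" by blast
 then show ?thesis using \<delta> by simp
next
 case True
 have dd: "dim_row A = n" using A by simp
 from True obtain kc pw m mk where P: "rmem s 12 = real kc" "rmem s 13 = real pw" "rmem s 14 = real m" "m = 8 * E * E * Suc mk"
   "4 * ((real j + 1) * (real j + 2) * real n) / \<delta> \<le> 2 ^ mk" "\<And>i. i < n \<Longrightarrow> 0 \<le> u_of n s i"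
  unfolding bad_at_def dd by blast
 let ?Z = "opM A (rmem s 10) (rmem s 11) kc (rmem s 8) (u_of n s) ^\<^sub>m pw" and ?e = "1 / real E"
 let ?X = "{\<xi>. \<not> accurate A ?e ?Z (rmem s 9) (u_of n s) m \<xi>}"
 have "opM A (rmem s 10) (rmem s 11) kc (rmem s 8) (u_of n s) \<in> carrier_mat d d" using A by (simp add: opM_def)
 then have Z: "?Z \<in> carrier_mat d d" by (rule pow_carrier_mat)
 have e: "0 < ?e" "?e \<le> 1 / 2" using E by (simp_all add: field_simps)
 have m: "0 < m" using P(4) E by simp
 note af = accurate_fail[OF A Z P(6) e m, where b = "rmem s 9"]
 have "{\<xi>. bad_at A E \<delta> j s \<xi>} \<subseteq> ?X" unfolding bad_at_def dd using P(1-3) by auto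
 then have "measure tape.S {\<xi>. bad_at A E \<delta> j s \<xi>} \<le> measure tape.S ?X" by (rule tape.P.finite_measure_mono[OF _ af(1)])
 also have "\<dots> \<le> real (n + d) * (2 * exp (- (real m * ?e\<^sup>2 / 8)))" by (rule af(2))
 also have "real m * ?e\<^sup>2 / 8 = real (Suc mk)" unfolding P(4) using E by (simp add: power2_eq_square field_simps)
 also have "real (n + d) * (2 * exp (- real (Suc mk))) \<le> (2 * real n) * (2 * (1 / 2 ^ mk))"
 proof (intro mult_mono)
  have "exp (- real (Suc mk)) \<le> exp (- real mk)" by simp
  also have "\<dots> = exp (- 1) ^ mk" by (simp add: exp_of_nat_mult[symmetric])
  also have "\<dots> \<le> (1 / 2) ^ mk"
  proof (intro power_mono)
   have "2 \<le> exp (1 :: real)" using exp_ge_add_one_self[of 1] by simp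
   then show "exp (- 1) \<le> (1 / 2 :: real)" by (simp add: exp_minus divide_simps)
  qed simp
  finally show "exp (- real (Suc mk)) \<le> 1 / 2 ^ mk" by (simp add: power_divide)
 qed (use dn in auto)
 also have "\<dots> = 4 * real n / 2 ^ mk" by simp
 also have "\<dots> \<le> \<delta> / ((real j + 1) * (real j + 2))"
  using P(5) \<delta> by (simp add: divide_simps mult_ac add_pos_pos split: if_splits)
 finally show ?thesis .
qed

text \<open>The union runs over all sketch numbers at once; the individual bounds telescope to
  \<delta>.\<close>

lemma all_bad_prob:
 fixes P :: program and T :: nat and s0 :: state
 defines "B \<equiv> \<Union>j. trajectory.first_bad P A T s0 (hd_at E j) (bad_at A E \<delta> j)"
 shows "B \<in> sets tape.S" "measure tape.S B \<le> \<delta>"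
proof -
 interpret tr: trajectory P A T s0 .
 let ?F = "\<lambda>j. tr.first_bad (hd_at E j) (bad_at A E \<delta> j)" and ?b = "\<lambda>j. \<delta> / ((real j + 1) * (real j + 2))"
 have F: "?F j \<in> sets tape.S" "measure tape.S (?F j) \<le> ?b j" for j
 proof -
  have 1: "{rnd. hd_at E j (tr.st k rnd)} \<in> sets tape.S" for k by (rule hd_at_measurable[OF tr.smeas_st]) simp
  have 2: "{x. bad_at A E \<delta> j (tr.st k (fst x)) (snd x)} \<in> sets (tape.S \<Otimes>\<^sub>M tape.S)" for k by (rule bad_at_measurable[OF tr.smeas_st])
  show "?F j \<in> sets tape.S" "measure tape.S (?F j) \<le> ?b j"
   by (rule tr.first_bad[OF 1 2 bad_at_prob]; use \<delta> in simp)+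
 qed
 show "B \<in> sets tape.S" unfolding B_def using F(1) by auto
 have su: "?b sums \<delta>"
 proof -
  have "(\<lambda>j. 1 / real (Suc j)) \<longlonglongrightarrow> 0" using LIMSEQ_inverse_real_of_nat by (simp add: inverse_eq_divide)
  then have "(\<lambda>j. 1 / real (Suc j) - 1 / real (Suc (Suc j))) sums (1 / real (Suc 0) - 0)" by (rule telescope_sums')
  then have "(\<lambda>j. \<delta> * (1 / real (Suc j) - 1 / real (Suc (Suc j)))) sums (\<delta> * 1)" by (intro sums_mult) simp
  moreover have "\<delta> * (1 / real (Suc j) - 1 / real (Suc (Suc j))) = ?b j" for j by (simp add: divide_simps) (simp add: algebra_simps)
  ultimately show ?thesis by simp
 qed
 have sm: "summable (\<lambda>j. measure tape.S (?F j))"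
  by (rule summable_comparison_test'[OF sums_summable[OF su], of 0]) (use F(2) in simp)
 have "measure tape.S B \<le> (\<Sum>j. measure tape.S (?F j))"
  unfolding B_def by (rule tape.P.finite_measure_subadditive_countably[OF _ sm]) (use F(1) in auto)
 also have "\<dots> \<le> (\<Sum>j. ?b j)" by (rule suminf_le[OF F(2) sm sums_summable[OF su]])
 also have "\<dots> = \<delta>" using su by (rule sums_unique[symmetric])
 finally show "measure tape.S B \<le> \<delta>" .
qed

lemma success_measurable:
 fixes P :: program and T :: nat and c :: real
 assumes d: "0 < d"
 shows "{rnd. \<exists>t w. computes P A \<delta> T rnd t w \<and> real t \<le> c \<and> good_scaling \<epsilon> A w} \<in> sets tape.S"
proof -
 interpret tr: trajectory P A T "init A \<delta>" .
 have dd: "dim_row A = n" using A by simp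
 have "{rnd \<in> space tape.S. \<exists>k. length P \<le> pc (tr.st k rnd) \<and> real (clock (tr.st k rnd)) \<le> c \<and>
   good_scaling \<epsilon> A (vec n (\<lambda>i. rmem (tr.st k rnd) (nmem (tr.st k rnd) 0 + i)))} \<in> sets tape.S"
 proof -
  note [measurable] = smeasD[OF tr.smeas_st]
  have [measurable]: "Measurable.pred tape.S (\<lambda>rnd. good_scaling \<epsilon> A (vec n (\<lambda>i. rmem (tr.st k rnd) (nmem (tr.st k rnd) 0 + i))))" for k
  proof (rule good_scaling_measurable[OF A d])
   show "(\<lambda>rnd. rmem (tr.st k rnd) (nmem (tr.st k rnd) 0 + i)) \<in> borel_measurable tape.S" for i
    by (rule measurable_compose_countable[OF smeasD(5)[OF tr.smeas_st] smeasD(4)[OF tr.smeas_st]])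
  qed
  show ?thesis by measurable
 qed
 also have "{rnd \<in> space tape.S. \<exists>k. length P \<le> pc (tr.st k rnd) \<and> real (clock (tr.st k rnd)) \<le> c \<and>
   good_scaling \<epsilon> A (vec n (\<lambda>i. rmem (tr.st k rnd) (nmem (tr.st k rnd) 0 + i)))} = {rnd. \<exists>t w. computes P A \<delta> T rnd t w \<and> real t \<le> c \<and> good_scaling \<epsilon> A w}"
  unfolding computes_def Let_def halted_def tr.st_def dd read_vec_def by auto
 finally show ?thesis .
qed

end

section \<open>Assembling the run and the bounds\<close>

lemma least_exponent_unique:
 fixes a x :: real
 assumes a: "1 < a" and i: "x \<le> a ^ 2 ^ Suc i" "0 < i \<Longrightarrow> a ^ 2 ^ i < x" and j: "x \<le> a ^ 2 ^ Suc j" "0 < j \<Longrightarrow> a ^ 2 ^ j < x"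
 shows "i = j"
proof -
 have *: False if "i < j" "x \<le> a ^ 2 ^ Suc i" "0 < j \<Longrightarrow> a ^ 2 ^ j < x" for i j
 proof -
  have "a ^ 2 ^ Suc i \<le> a ^ 2 ^ j" using that(1) a by (intro power_increasing) (auto simp del: power_Suc simp: Suc_le_eq)
  then show False using that by simp
 qed
 show ?thesis using *[of i j] *[of j i] i j by (metis linorder_neqE_nat)
qed

context scaling_counters
begin

lemma run_start:
 assumes j: "0 < k \<Longrightarrow> (1 + e) ^ 2 ^ k < real n"
 obtains q h where "pc (st q) = Lhead E" "sim A (st q) h" "InvC 0 0 None h" "sc h 16 = real 0"
  "\<And>q'. q' < q \<Longrightarrow> pc (st q') \<noteq> Lhead E" "clock (st q) \<le> X2"
proof -
 obtain s1 where s1: "pc s1 = length prologue" "clock s1 = length prologue" "sim A s1 (h_of s1)" "sc (h_of s1) 0 = \<delta>"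
  "st (length prologue) = s1" "\<And>i. i < length prologue \<Longrightarrow> pc (st i) = i"
  using run_init[of \<delta> E] by blast
 define Q where "Q h \<longleftrightarrow> InvC 0 0 None h \<and> sc h 16 = real 0 \<and> (\<exists>kc mk. kpar n E p kc h \<and> mpar n E \<delta> mk h \<and> ct h \<le> 200 + 20 * p + 15 * kc + 40 * n + 10 * mk)" for h
 have "WP (init0 E) Q (h_of s1)"
 proof (rule wp_init0[OF _ s1(4)])
  show "1 \<le> E" using E by simp
  fix h' p' j' kc mk
  assume a: "cregs n E p' \<delta> h'" "p' = 2 ^ Suc j'" "real n \<le> (1 + 1 / real E) ^ p'" "0 < j' \<Longrightarrow> (1 + 1 / real E) ^ 2 ^ j' < real n"
   "sc h' 7 = 1" "kpar n E p' kc h'" "sc h' 8 = 0" "sc h' 9 = 1" "sc h' 13 = real p' / 2 + 1" "sc h' 15 = 0" "sc h' 16 = 0" "sc h' 17 = 0"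
   "mpar n E \<delta> mk h'" "\<And>i. i < n \<Longrightarrow> vc h' 0 i = 0" "\<And>i. i < n \<Longrightarrow> vc h' 1 i = 0" "dr h' = dr (h_of s1)"
   "ct h' \<le> ct (h_of s1) + 200 + 20 * p' + 15 * kc + 40 * n + 10 * mk"
  \<comment> \<open>The locale fixes \<open>p\<close> before the run; uniqueness of the exponent
    identifies it with the one that \<open>init0\<close> computes.\<close>
  have "j' = k"
  proof (rule least_exponent_unique[of "1 + e" "real n"])
   show "1 < 1 + e" using e by simp
   show "real n \<le> (1 + e) ^ 2 ^ Suc j'" using a(2,3) by (simp add: e_def)
   show "(1 + e) ^ 2 ^ j' < real n" if "0 < j'" using a(4) that by (simp add: e_def)
   show "real n \<le> (1 + e) ^ 2 ^ Suc k" using np p by simp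
   show "0 < k \<Longrightarrow> (1 + e) ^ 2 ^ k < real n" by (rule j)
  qed
  then have pp: "p' = p" using a(2) p by simp
  note a = a[unfolded pp]
  have k1: "1 \<le> opt_inner_cond A" using opt_inner_cond_witness(1)[OF A rk _ e(1)] d0 by simp
  have "ghead 0 0 h'" unfolding ghead_def
  proof (intro conjI)
   have "1 * 1 \<le> kmax" using k1 e by (intro mult_mono) auto
   then show "sc h' 7 \<le> kmax" using a(5) by simp
   show "coverinv (sc h' 7) (vc h' 0) (sc h' 17)" unfolding a(12) by (rule coverinv_init) (rule a(14))
   show "\<exists>kc. kpar n E p kc h'" using a(6) by blast
  qed (use a E in auto)
  moreover have "mode0 h'" unfolding mode0_def using a phalf(1) by simp
  ultimately have "InvC 0 0 None h'" unfolding InvC_def using a(11,13) by (intro conjI exI[of _ 0] exI[of _ mk]) auto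
  then show "Q h'" unfolding Q_def using a(6,11,13,17) by (auto simp: h_of_def)
 qed
 then obtain h where h: "big A T rnd (init0 E) (h_of s1) h" "Q h" unfolding wp_def by blast
 obtain s2 where s2: "reach (prog E) A T rnd (length prologue) (length prologue + csize (init0 E)) s1 s2" "sim A s2 h"
  "pc s2 = length prologue + csize (init0 E)" "clock s2 + ct (h_of s1) \<le> clock s1 + ct h"
  using comp_correct[OF h(1) wf_init0 code_at_prog(2) s1(3,1) dim(1)] by blast
 obtain q where q: "(stp ^^ q) s1 = s2" "\<And>i. i < q \<Longrightarrow> pc ((stp ^^ i) s1) < length prologue + csize (init0 E)" using s2(1) unfolding reach_def by blast
 have add: "st (i + length prologue) = (stp ^^ i) s1" for i unfolding s1(5)[symmetric] by (simp add: funpow_add)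
 from h(2) obtain kc mk where hq: "InvC 0 0 None h" "sc h 16 = real 0" "kpar n E p kc h" "mpar n E \<delta> mk h" "ct h \<le> 200 + 20 * p + 15 * kc + 40 * n + 10 * mk"
  unfolding Q_def by blast
 have g: "ghead 0 0 h" using hq(1) unfolding InvC_def by simp
 have "kc \<le> kcM" by (rule ghead_bounds(3)[OF g hq(3)])
 moreover have "mk \<le> mkM" by (rule mk_le[OF hq(4,2)]) simp
 ultimately have c: "clock s2 \<le> X2" using s2(4) s1(2) hq(5) unfolding X2_def by (simp add: prologue_length narrs_def)
 show ?thesis
 proof (rule that[of "q + length prologue" h])
  fix q' assume q': "q' < q + length prologue"
  show "pc (st q') \<noteq> Lhead E"
  proof (cases "q' < length prologue")
   case True
   then show ?thesis using s1(6)[OF True] unfolding Lhead_def by simp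
  next
   case False
   then obtain i where i: "q' = i + length prologue" by (metis add.commute le_Suc_ex not_less)
   show ?thesis using q(2)[of i] q' unfolding i add Lhead_def by simp
  qed
 qed (use q s2 add hq c in \<open>simp_all add: Lhead_def\<close>)
qed

lemma run_all:
 assumes nb: "\<And>j. rnd \<notin> failure_at A T E \<delta> j"
  and j: "0 < k \<Longrightarrow> (1 + e) ^ 2 ^ k < real n"
 shows "\<exists>t w. computes (prog E) A \<delta> T rnd t w \<and> t \<le> X2 + Cmax + 3 \<and> good_scaling \<epsilon> A w"
proof -
 obtain q h where q: "pc (st q) = Lhead E" "sim A (st q) h" "InvC 0 0 None h" "sc h 16 = real 0"
  "\<And>q'. q' < q \<Longrightarrow> pc (st q') \<noteq> Lhead E" "clock (st q) \<le> X2"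
  using run_start[OF j] by metis
 have "\<exists>q. halted (prog E) (st q) \<and> clock (st q) \<le> X2 + Cmax + 3 \<and> good_scaling \<epsilon> A (read_vec (rmem (st q)) (nmem (st q) 0) n)"
  by (rule run_loop[OF nb q(1-4)]) (use q(5,6) in auto)
 then obtain q where "halted (prog E) (st q)" "clock (st q) \<le> X2 + Cmax + 3" "good_scaling \<epsilon> A (read_vec (rmem (st q)) (nmem (st q) 0) n)" by blast
 then show ?thesis unfolding computes_def Let_def dim by blast
qed

end

theorem theorem5p1:
 fixes \<epsilon> :: real
 assumes "0 < \<epsilon>"
 shows "\<exists>(P :: program) (C :: real).
  \<forall>(\<delta> :: real) (n :: nat) (d :: nat) (A :: real mat) (T :: nat).
   0 < \<delta> \<and> \<delta> < 1 \<and> 1 \<le> d \<and> d \<le> n \<and> A \<in> carrier_mat n d \<and> vec_space.rank n A = d \<and> n \<le> T \<longrightarrow>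
   measure random_tape {\<omega> \<in> space random_tape.
    \<exists>t w. computes P A \<delta> T \<omega> t w \<and> real t \<le> C * time_bound \<delta> A T \<and> good_scaling \<epsilon> A w}
   \<ge> 1 - \<delta>"
proof -
 obtain E0 :: nat where E0: "50 / \<epsilon> \<le> real E0" using real_arch_simple by blast
 \<comment> \<open>The factor 50 is the loss in \<open>coverinv_final\<close>, and the minimum 100
   gives the bound \<open>e \<le> 1 / 100\<close> behind all numeric estimates.\<close>
 define E where "E = max 100 E0"
 have E: "100 \<le> E" by (simp add: E_def)
 have "50 / \<epsilon> \<le> real E" using E0 by (simp add: E_def)
 then have eps: "50 * (1 / real E) \<le> \<epsilon>" using assms E by (simp add: field_simps)
 show ?thesis
 proof (intro exI[of _ "prog E"] exI[of _ "budget.Ctot E"] allI impI, elim conjE)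
  fix \<delta> :: real and n d :: nat and A :: "real mat" and T :: nat
  assume \<delta>: "0 < \<delta>" "\<delta> < 1" and d: "1 \<le> d" "d \<le> n" and A: "A \<in> carrier_mat n d" and rk: "vec_space.rank n A = d" and T: "n \<le> T"
  define e where "e = 1 / real E"
  have e0: "0 < e" "e \<le> 1 / 2" using E by (auto simp: e_def field_simps)
  define \<kappa> where "\<kappa> = opt_inner_cond A"
  have \<kappa>: "1 \<le> \<kappa>" unfolding \<kappa>_def using opt_inner_cond_witness(1)[OF A rk _ e0(1)] d by simp
  define L where "L = max 1 (log 2 (real n * \<kappa> / \<delta>))"
  have n: "1 \<le> n" using d by simp
  have L1: "1 \<le> L" by (simp add: L_def)
  obtain j where j: "real n \<le> (1 + e) ^ 2 ^ Suc j" and jj: "0 < j \<Longrightarrow> (1 + e) ^ 2 ^ j < real n"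
   using ex_double_exponent[of "1 + e" "real n"] e0 by auto
  define p :: nat where "p = 2 ^ Suc j"
  have p2: "2 \<le> p" unfolding p_def by simp
  have EL: "100 * 1 \<le> real E * L" using E L1 by (intro mult_mono) auto
  have lnn: "ln (real n) \<le> L"
  proof -
   \<comment> \<open>The bound on \<open>p\<close> that \<open>budget\<close> assumes rests on
     \<open>ln n \<le> L\<close>, which is read off an instance with exponent 2.\<close>
   interpret B: budget E e \<kappa> L \<delta> n 2 T
    by unfold_locales (use E e_def \<kappa> \<delta> n L_def T EL in auto)
   show ?thesis by (rule B.L_ln(1))
  qed
  have pL: "real p \<le> 6 * real E * L"
  proof (cases "j = 0")
   case True
   then have "real p = 2" "6 * real E * L = 6 * (real E * L)" by (simp_all add: p_def)
   then show ?thesis using EL by linarith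
  next
   case False
   then have "e * real (2 ^ j) \<le> 2 * ln (real n)" using jj by (intro pow_le[OF e0]) simp
   then have "real (2 ^ j) \<le> 2 * ln (real n) * real E" using E by (simp add: e_def field_simps)
   also have "\<dots> \<le> 2 * L * real E" using lnn by (intro mult_right_mono) auto
   finally have "real p \<le> 4 * (real E * L)" unfolding p_def by simp
   moreover have "6 * real E * L = 6 * (real E * L)" by simp
   ultimately show ?thesis using EL by linarith
  qed
  interpret B: budget E e \<kappa> L \<delta> n p T
   by unfold_locales (use E e_def \<kappa> \<delta> n L_def T p2 pL in auto)
  obtain Gm where Gm: "\<And>g. (1 + e) ^ g \<le> (1 + e) * \<kappa> \<Longrightarrow> g \<le> Gm" "real (Gm + 1) \<le> 8 * real E * L" using B.ex_Gm by blast
  obtain S where S: "2 * real E * real E * real p * ((1 + e) * \<kappa>) \<le> real S" "real (S + 1) \<le> 26 * real E ^ 3 * \<kappa> * L" using B.ex_S by blast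
  obtain Rm where Rm: "real E \<le> 1 / (4 * ((4 * ((1 + e) * \<kappa> * real E)) ^ Suc p * real n * real n)) * (1 + e / real p * e) ^ Rm"
   "real (Rm + 1) \<le> 1000 * real E ^ 5 * L ^ 3" using B.ex_Rm by blast
  obtain kcM where kcM: "1 \<le> kcM" "\<And>\<kappa>'. 1 \<le> \<kappa>' \<Longrightarrow> \<kappa>' \<le> (1 + e) * \<kappa> \<Longrightarrow>
   tol E p \<le> cheb (cs0 E \<kappa>') kcM" "real kcM \<le> 262 * real E ^ 3 * B.r * L"
   using B.ex_kcM by blast
  define N where "N = (Gm + 1) * (S + 1) * (Rm + 1)"
  have "real N \<le> 216000 * real E ^ 9 * \<kappa> * L ^ 5"
  proof -
   have "real N = real (Gm + 1) * real (S + 1) * real (Rm + 1)" unfolding N_def by (simp only: of_nat_mult)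
   also have "\<dots> \<le> (8 * real E * L) * (26 * real E ^ 3 * \<kappa> * L) * (1000 * real E ^ 5 * L ^ 3)"
    using Gm(2) S(2) Rm(2) L1 \<kappa> by (intro mult_mono mult_nonneg_nonneg) auto
   also have "\<dots> = 208000 * (real E ^ 9 * \<kappa> * L ^ 5)" by (simp add: eval_nat_numeral)
   also have "\<dots> \<le> 216000 * (real E ^ 9 * \<kappa> * L ^ 5)" using \<kappa> L1 by (intro mult_right_mono mult_nonneg_nonneg) auto
   finally show ?thesis by simp
  qed
  from B.ex_mkM[OF this] obtain mkM where mkM: "4 * ((real N + 1) * (real N + 2) * real n) / \<delta> \<le> 2 ^ mkM" "real mkM \<le> B.cm * L"
   unfolding B.cm_def by blast
  let ?B = "\<Union>j. failure_at A T E \<delta> j"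
  let ?G = "{\<omega>. \<exists>t w. computes (prog E) A \<delta> T \<omega> t w \<and> real t \<le> budget.Ctot E * time_bound \<delta> A T \<and> good_scaling \<epsilon> A w}"
  have tb: "time_bound \<delta> A T = real T * \<kappa> powr (3 / 2) * L ^ 7"
   using A by (simp add: time_bound_def \<kappa>_def L_def)
  \<comment> \<open>On a fixed tape the run is deterministic; randomness enters only through the
    exclusion of the failure events.\<close>
  have "\<omega> \<in> ?G" if nb: "\<omega> \<notin> ?B" for \<omega>
  proof -
   interpret C: scaling_counters A n d T \<omega> E p j e \<delta> \<epsilon> Gm S Rm kcM mkM
    by unfold_locales (use A d T rk E e_def p_def j eps Gm(1) S(1) Rm(1) kcM(1,2) mkM(1) \<delta>(1) in \<open>auto simp: \<kappa>_def N_def\<close>)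
   obtain t w where tw: "computes (prog E) A \<delta> T \<omega> t w" "t \<le> C.X2 + C.Cmax + 3" "good_scaling \<epsilon> A w"
    using C.run_all[of, OF _ jj] nb by blast
   have X1: "real C.X1 \<le> real T * (B.A1 * (B.r * L ^ 3))" unfolding C.X1_def by (rule B.X1_le[OF mkM(2) kcM(1,3)])
   have X2: "real C.X2 \<le> real T * (B.B1 * (B.r * L ^ 2))" unfolding C.X2_def by (rule B.X2_le[OF mkM(2) kcM(1,3)])
   have "real t \<le> real (C.X2 + C.Cmax + 3)" using tw(2) by (rule of_nat_mono)
   also have "\<dots> \<le> B.Ctot * (real T * \<kappa> powr (3 / 2) * L ^ 7)"
    unfolding C.Cmax_def by (rule B.total_le[OF mkM(2) kcM(1,3) Gm(2) S(2) Rm(2) X1 X2])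
   finally show ?thesis using tw unfolding tb by blast
  qed
  then have sub: "- ?B \<subseteq> ?G" by blast
  have E2: "2 \<le> E" using E by simp
  note bad = all_bad_prob[OF A d(2) E2 \<delta>(1) n, where P = "prog E" and T = T and ?s0.0 = "init A \<delta>"]
  \<comment> \<open>\<open>measure\<close> assigns 0 to nonmeasurable sets, so the success event has
    to be measurable for a lower bound to make sense.\<close>
  have Gs: "?G \<in> sets tape.S" by (rule success_measurable[OF A d(2) E2 \<delta>(1) n]) (use d in simp)
  have "1 - \<delta> \<le> 1 - measure tape.S ?B" using bad(2) by simp
  also have "\<dots> = measure tape.S (space tape.S - ?B)" by (rule tape.P.prob_compl[OF bad(1), symmetric])
  also have "\<dots> \<le> measure tape.S ?G" by (rule tape.P.finite_measure_mono[OF _ Gs]) (use sub in auto)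
  finally show "1 - \<delta> \<le> measure random_tape {\<omega> \<in> space random_tape.
    \<exists>t w. computes (prog E) A \<delta> T \<omega> t w \<and> real t \<le> budget.Ctot E * time_bound \<delta> A T \<and> good_scaling \<epsilon> A w}"
   by (simp add: tape_eq)
 qed
qed

end
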